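(* Let $N$ be a positive integer, let $\Gamma$ be a discrete group and let $\Lambda$ be a normal subgroup of $\Gamma$ such that the short exact sequence $1\to\Lambda\to\Gamma\to\Gamma/\Lambda\to 1$ is split. Then there is an isomorphism of compact quantum groups $$H_{N}^{+}(\Gamma, \Lambda) \cong \widehat{\Lambda}\:\sharp\: H_{N}^{+}(\Gamma/\Lambda).$$
   Context: A CQG-algebra is a Hopf $*$-algebra spanned by the coefficients of its finite-dimensional unitary corepresentations; it is written $\mathcal{O}(\mathbb{G})$ and said to correspond to the compact quantum group $\mathbb{G}$; isomorphism of compact quantum groups means Hopf $*$-algebra isomorphism of CQG-algebras. For a discrete group $\Lambda$, $\mathcal{O}(\widehat{\Lambda})=\mathbb{C}[\Lambda]$ with $\Delta(g)=g\otimes g$, $g^*=g^{-1}$. For a discrete group $\Gamma$, $\mathcal{O}(H_{N}^{+}(\Gamma))$ is the universal unital $*$-algebra generated by elements $a_{ij}(g)$, $1\leqslant i,j\leqslant N$, $g\in\Gamma$, with $a_{ij}(g)^*=a_{ij}(g^{-1})$ and relations $$a_{ij}(g)a_{ik}(h)=\delta_{jk}a_{ij}(gh),\quad a_{ji}(g)a_{ki}(h)=\delta_{jk}a_{ji}(gh),\quad \sum_{k=1}^{N}a_{ik}(e)=1=\sum_{k=1}^{N}a_{kj}(e),$$ a CQG-algebra with $\Delta(a_{ij}(g))=\sum_{k}a_{ik}(g)\otimes a_{kj}(g)$. For a subgroup $\Lambda<\Gamma$, $\mathcal{O}(H_{N}^{+}(\Gamma,\Lambda))$ is the quotient of $\mathcal{O}(H_{N}^{+}(\Gamma))$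 by the Hopf $*$-ideal generated by the relations $\sum_{k}a_{ik}(g)=\sum_{k}a_{jk}(g)$ for all $1\leqslant i,j\leqslant N$ and $g\in\Lambda$. Smash product: let $\rho:\Gamma/\Lambda\to\Gamma$ be a group homomorphism with $\pi\circ\rho=\mathrm{id}$, where $\pi:\Gamma\to\Gamma/\Lambda$ is the quotient map. $\widehat{\Lambda}\:\sharp\: H_{N}^{+}(\Gamma/\Lambda)$ is the compact quantum group whose CQG-algebra is the vector space $\mathcal{O}(\widehat{\Lambda})\otimes\mathcal{O}(H_{N}^{+}(\Gamma/\Lambda))$ with the unique (associative, with unit $1\otimes 1$) multiplication such that $$(\lambda\otimes a_{ij}(g))(\mu\otimes a_{i'j'}(h))=\lambda\rho(g)\mu\rho(g)^{-1}\otimes a_{ij}(g)a_{i'j'}(h)$$ and the unique comultiplication (algebra homomorphism) such that $$\Delta(\lambda\otimes a_{ij}(g))=\sum_{k=1}^{N}\lambda\otimes a_{ik}(g)\otimes\lambda\otimes a_{kj}(g),$$ for $\lambda,\mu\in\Lambda$, $g,h\in\Gamma/\Lambda$, $1\leqslant i,j,i',j'\leqslant N$; the involution is the one extending those of the subalgebras $\mathcal{O}(\widehat{\Lambda})\otimes 1$ and $1\otimes\mathcal{O}(H_{N}^{+}(\Gamma/\Lambda))$. *)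

theory Defs
  imports Complex_Main "HOL-Algebra.Module" "HOL-Algebra.QuotRing"
begin

section \<open>Complex vector spaces and unital *-algebras\<close>

definition complex_alg :: "(complex, complex) module" where
  "complex_alg = \<lparr>carrier = UNIV, mult = (*), one = 1, zero = 0, add = (+), smult = (*)\<rparr>"

definition linear_maps ::
    "(complex, 'a, 'm) module_scheme \<Rightarrow> (complex, 'b, 'n) module_scheme \<Rightarrow> ('a \<Rightarrow> 'b) set" where
  "linear_maps V W = {f \<in> carrier V \<rightarrow> carrier W.
     (\<forall>x\<in>carrier V. \<forall>y\<in>carrier V. f (x \<oplus>\<^bsub>V\<^esub> y) = f x \<oplus>\<^bsub>W\<^esub> f y) \<and>
     (\<forall>c. \<forall>x\<in>carrier V. f (c \<odot>\<^bsub>V\<^esub> x) = c \<odot>\<^bsub>W\<^esub> f x)}"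

definition lin_span :: "(complex, 'a, 'm) module_scheme \<Rightarrow> 'a set \<Rightarrow> 'a set" where
  "lin_span V X = \<Inter>{H. submodule H complex_alg V \<and> X \<subseteq> H}"

record 'a star_alg = "(complex, 'a) module" +
  star :: "'a \<Rightarrow> 'a"

locale star_algebra = module complex_alg A + A?: ring A
  for A :: "('a, 'm) star_alg_scheme" (structure) +
  assumes smult_mult_left:
      "\<And>c x y. \<lbrakk>x \<in> carrier A; y \<in> carrier A\<rbrakk> \<Longrightarrow> (c \<odot> x) \<otimes> y = c \<odot> (x \<otimes> y)"
    and smult_mult_right:
      "\<And>c x y. \<lbrakk>x \<in> carrier A; y \<in> carrier A\<rbrakk> \<Longrightarrow> x \<otimes> (c \<odot> y) = c \<odot> (x \<otimes> y)"
    and star_closed: "\<And>x. x \<in> carrier A \<Longrightarrow> star A x \<in> carrier A"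
    and star_star: "\<And>x. x \<in> carrier A \<Longrightarrow> star A (star A x) = x"
    and star_add:
      "\<And>x y. \<lbrakk>x \<in> carrier A; y \<in> carrier A\<rbrakk> \<Longrightarrow> star A (x \<oplus> y) = star A x \<oplus> star A y"
    and star_smult: "\<And>c x. x \<in> carrier A \<Longrightarrow> star A (c \<odot> x) = cnj c \<odot> star A x"
    and star_mult:
      "\<And>x y. \<lbrakk>x \<in> carrier A; y \<in> carrier A\<rbrakk> \<Longrightarrow> star A (x \<otimes> y) = star A y \<otimes> star A x"

definition alg_hom ::
    "(complex, 'a, 'm) module_scheme \<Rightarrow> (complex, 'b, 'n) module_scheme \<Rightarrow> ('a \<Rightarrow> 'b) set" where
  "alg_hom A B = ring_hom A B \<inter> linear_maps A B"

definition star_hom ::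
    "('a, 'm) star_alg_scheme \<Rightarrow> ('b, 'n) star_alg_scheme \<Rightarrow> ('a \<Rightarrow> 'b) set" where
  "star_hom A B = {f \<in> alg_hom A B. \<forall>x\<in>carrier A. f (star A x) = star B (f x)}"

definition star_ideal :: "'a set \<Rightarrow> ('a, 'm) star_alg_scheme \<Rightarrow> bool" where
  "star_ideal I A \<longleftrightarrow> ideal I A \<and> star A ` I \<subseteq> I"

definition gen_star_ideal :: "('a, 'm) star_alg_scheme \<Rightarrow> 'a set \<Rightarrow> 'a set" where
  "gen_star_ideal A X = \<Inter>{I. star_ideal I A \<and> X \<subseteq> I}"

text \<open>The ring part is that of \<^const>\<open>FactRing\<close>.\<close>

definition star_quot :: "('a, 'm) star_alg_scheme \<Rightarrow> 'a set \<Rightarrow> 'a set star_alg" where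
  "star_quot A I = \<lparr>carrier = a_rcosets\<^bsub>A\<^esub> I, mult = rcoset_mult A I,
     one = I +>\<^bsub>A\<^esub> \<one>\<^bsub>A\<^esub>, zero = I, add = set_add A,
     smult = (\<lambda>c X. \<Union>x\<in>X. I +>\<^bsub>A\<^esub> (c \<odot>\<^bsub>A\<^esub> x)),
     star = (\<lambda>X. \<Union>x\<in>X. I +>\<^bsub>A\<^esub> star A x)\<rparr>"


section \<open>Formal linear combinations and monoid algebras\<close>

definition free_space :: "'x set \<Rightarrow> (complex, 'x \<Rightarrow> complex) module" where
  "free_space X = \<lparr>carrier = {f. finite {x. f x \<noteq> 0} \<and> {x. f x \<noteq> 0} \<subseteq> X},
     mult = undefined, one = undefined, zero = (\<lambda>x. 0),
     add = (\<lambda>f g x. f x + g x), smult = (\<lambda>c f x. c * f x)\<rparr>"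

definition ket :: "'x \<Rightarrow> 'x \<Rightarrow> complex" where
  "ket x = (\<lambda>y. if y = x then 1 else 0)"

text \<open>The algebra \<open>\<complex>[M]\<close> with \<open>(ket x)\<^sup>* = ket (\<sigma> x)\<close>, where \<open>\<sigma>\<close> is an
  involutive anti-automorphism of the monoid \<open>M\<close>.\<close>

definition monoid_algebra ::
    "('x, 'm) monoid_scheme \<Rightarrow> ('x \<Rightarrow> 'x) \<Rightarrow> ('x \<Rightarrow> complex) star_alg" where
  "monoid_algebra M \<sigma> = \<lparr>carrier = carrier (free_space (carrier M)),
     mult = (\<lambda>f g x. \<Sum>(y, z)\<in>{(y, z). f y \<noteq> 0 \<and> g z \<noteq> 0 \<and> y \<otimes>\<^bsub>M\<^esub> z = x}. f y * g z),
     one = ket \<one>\<^bsub>M\<^esub>, zero = zero (free_space (carrier M)),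
     add = add (free_space (carrier M)), smult = smult (free_space (carrier M)),
     star = (\<lambda>f x. if x \<in> carrier M then cnj (f (\<sigma> x)) else 0)\<rparr>"

text \<open>The free unital *-algebra on \<open>X\<close>: noncommutative polynomials in the letters
  \<open>(x, False)\<close>, standing for \<open>x\<close>, and \<open>(x, True)\<close>, standing for \<open>x\<^sup>*\<close>.\<close>

definition free_star_alg :: "'x set \<Rightarrow> (('x \<times> bool) list \<Rightarrow> complex) star_alg" where
  "free_star_alg X = monoid_algebra
     \<lparr>carrier = lists (X \<times> UNIV), mult = (@), one = []\<rparr>
     (\<lambda>w. rev (map (\<lambda>(x, s). (x, \<not> s)) w))"


section \<open>Algebraic tensor products\<close>

type_synonym ('a, 'b) tensor = "('a \<times> 'b \<Rightarrow> complex) set"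

definition tensor_null ::
    "(complex, 'a, 'm) module_scheme \<Rightarrow> (complex, 'b, 'n) module_scheme \<Rightarrow> ('a \<times> 'b \<Rightarrow> complex) set" where
  "tensor_null V W = (let F = free_space (carrier V \<times> carrier W) in lin_span F
     ({ket (x \<oplus>\<^bsub>V\<^esub> x', y) \<ominus>\<^bsub>F\<^esub> (ket (x, y) \<oplus>\<^bsub>F\<^esub> ket (x', y)) | x x' y.
         x \<in> carrier V \<and> x' \<in> carrier V \<and> y \<in> carrier W}
    \<union> {ket (x, y \<oplus>\<^bsub>W\<^esub> y') \<ominus>\<^bsub>F\<^esub> (ket (x, y) \<oplus>\<^bsub>F\<^esub> ket (x, y')) | x y y'.
         x \<in> carrier V \<and> y \<in> carrier W \<and> y' \<in> carrier W}
    \<union> {ket (c \<odot>\<^bsub>V\<^esub> x, y) \<ominus>\<^bsub>F\<^esub> c \<odot>\<^bsub>F\<^esub> ket (x, y) | c x y.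
         x \<in> carrier V \<and> y \<in> carrier W}
    \<union> {ket (x, c \<odot>\<^bsub>W\<^esub> y) \<ominus>\<^bsub>F\<^esub> c \<odot>\<^bsub>F\<^esub> ket (x, y) | c x y.
         x \<in> carrier V \<and> y \<in> carrier W}))"

definition pure ::
    "(complex, 'a, 'm) module_scheme \<Rightarrow> (complex, 'b, 'n) module_scheme \<Rightarrow> 'a \<Rightarrow> 'b \<Rightarrow> ('a, 'b) tensor" where
  "pure V W x y = tensor_null V W +>\<^bsub>free_space (carrier V \<times> carrier W)\<^esub> ket (x, y)"

text \<open>Only the vector space structure is meaningful here.\<close>

definition tensor_space ::
    "(complex, 'a, 'm) module_scheme \<Rightarrow> (complex, 'b, 'n) module_scheme \<Rightarrow> (complex, ('a, 'b) tensor) module" where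
  "tensor_space V W = (let F = free_space (carrier V \<times> carrier W); K = tensor_null V W in
     \<lparr>carrier = a_rcosets\<^bsub>F\<^esub> K, mult = undefined, one = undefined, zero = K, add = set_add F,
      smult = (\<lambda>c X. \<Union>p\<in>X. K +>\<^bsub>F\<^esub> (c \<odot>\<^bsub>F\<^esub> p))\<rparr>)"

text \<open>\<open>tensor_lift W b\<close> is the linear map into \<open>W\<close> with \<open>pure x y \<mapsto> b x y\<close>, for bilinear \<open>b\<close>: a tensor
  is a coset of formal sums, on all of which the linear extension of \<open>b\<close> takes the same value.\<close>

definition tensor_lift ::
    "(complex, 'c, 'm) module_scheme \<Rightarrow> ('a \<Rightarrow> 'b \<Rightarrow> 'c) \<Rightarrow> ('a, 'b) tensor \<Rightarrow> 'c" where
  "tensor_lift W b t =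
     the_elem ((\<lambda>p. \<Oplus>\<^bsub>W\<^esub>z\<in>{z. p z \<noteq> 0}. p z \<odot>\<^bsub>W\<^esub> b (fst z) (snd z)) ` t)"

definition tensor_map ::
    "(complex, 'c, 'm) module_scheme \<Rightarrow> (complex, 'd, 'n) module_scheme
      \<Rightarrow> ('a \<Rightarrow> 'c) \<Rightarrow> ('b \<Rightarrow> 'd) \<Rightarrow> ('a, 'b) tensor \<Rightarrow> ('c, 'd) tensor" where
  "tensor_map C D f g = tensor_lift (tensor_space C D) (\<lambda>x y. pure C D (f x) (g y))"

text \<open>The product is \<open>(x \<otimes> y)(x' \<otimes> y') = xx' \<otimes> yy'\<close> and the involution, which is conjugate
  linear, is \<open>(x \<otimes> y)\<^sup>* = x\<^sup>* \<otimes> y\<^sup>*\<close>.\<close>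

definition tensor_alg ::
    "('a, 'm) star_alg_scheme \<Rightarrow> ('b, 'n) star_alg_scheme \<Rightarrow> ('a, 'b) tensor star_alg" where
  "tensor_alg A B = (let T = tensor_space A B in
     \<lparr>carrier = carrier T,
      mult = (\<lambda>t u. tensor_lift T (\<lambda>x y. tensor_lift T
                (\<lambda>x' y'. pure A B (x \<otimes>\<^bsub>A\<^esub> x') (y \<otimes>\<^bsub>B\<^esub> y')) u) t),
      one = pure A B \<one>\<^bsub>A\<^esub> \<one>\<^bsub>B\<^esub>, zero = zero T, add = add T, smult = smult T,
      star = (\<lambda>t. the_elem ((\<lambda>p. \<Oplus>\<^bsub>T\<^esub>z\<in>{z. p z \<noteq> 0}.
                cnj (p z) \<odot>\<^bsub>T\<^esub> pure A B (star A (fst z)) (star B (snd z))) ` t))\<rparr>)"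

definition tensor_assoc ::
    "(complex, 'a, 'm) module_scheme \<Rightarrow> (complex, 'b, 'n) module_scheme \<Rightarrow> (complex, 'c, 'k) module_scheme
      \<Rightarrow> (('a, 'b) tensor, 'c) tensor \<Rightarrow> ('a, ('b, 'c) tensor) tensor" where
  "tensor_assoc A B C = (let BC = tensor_space B C; T = tensor_space A BC in
     tensor_lift T (\<lambda>t z. tensor_lift T (\<lambda>x y. pure A BC x (pure B C y z)) t))"


section \<open>Hopf *-algebras and CQG-algebras\<close>

record 'a hopf_star_alg = "'a star_alg" +
  comult :: "'a \<Rightarrow> ('a, 'a) tensor"

definition is_counit :: "('a, 'm) hopf_star_alg_scheme \<Rightarrow> ('a \<Rightarrow> complex) \<Rightarrow> bool" where
  "is_counit A \<epsilon> \<longleftrightarrow> \<epsilon> \<in> alg_hom A complex_alg \<and>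
     (\<forall>x\<in>carrier A. tensor_lift A (\<lambda>y z. \<epsilon> y \<odot>\<^bsub>A\<^esub> z) (comult A x) = x \<and>
                    tensor_lift A (\<lambda>y z. \<epsilon> z \<odot>\<^bsub>A\<^esub> y) (comult A x) = x)"

definition is_antipode :: "('a, 'm) hopf_star_alg_scheme \<Rightarrow> ('a \<Rightarrow> complex) \<Rightarrow> ('a \<Rightarrow> 'a) \<Rightarrow> bool" where
  "is_antipode A \<epsilon> S \<longleftrightarrow> S \<in> linear_maps A A \<and>
     (\<forall>x\<in>carrier A. tensor_lift A (\<lambda>y z. S y \<otimes>\<^bsub>A\<^esub> z) (comult A x) = \<epsilon> x \<odot>\<^bsub>A\<^esub> \<one>\<^bsub>A\<^esub> \<and>
                    tensor_lift A (\<lambda>y z. y \<otimes>\<^bsub>A\<^esub> S z) (comult A x) = \<epsilon> x \<odot>\<^bsub>A\<^esub> \<one>\<^bsub>A\<^esub>)"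

definition hopf_star_algebra :: "('a, 'm) hopf_star_alg_scheme \<Rightarrow> bool" where
  "hopf_star_algebra A \<longleftrightarrow> star_algebra A \<and> comult A \<in> star_hom A (tensor_alg A A) \<and>
     (\<forall>x\<in>carrier A.
        tensor_assoc A A A (tensor_map (tensor_alg A A) A (comult A) (\<lambda>y. y) (comult A x)) =
        tensor_map A (tensor_alg A A) (\<lambda>y. y) (comult A) (comult A x)) \<and>
     (\<exists>\<epsilon> S. is_counit A \<epsilon> \<and> is_antipode A \<epsilon> S)"

text \<open>A unitary corepresentation on \<open>\<complex>\<^sup>n\<close>, given by its matrix of coefficients.\<close>

definition unitary_corep :: "('a, 'm) hopf_star_alg_scheme \<Rightarrow> nat \<Rightarrow> (nat \<Rightarrow> nat \<Rightarrow> 'a) \<Rightarrow> bool" where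
  "unitary_corep A n u \<longleftrightarrow> (\<forall>i<n. \<forall>j<n. u i j \<in> carrier A \<and>
     comult A (u i j) = (\<Oplus>\<^bsub>tensor_alg A A\<^esub>k\<in>{..<n}. pure A A (u i k) (u k j)) \<and>
     (\<Oplus>\<^bsub>A\<^esub>k\<in>{..<n}. u i k \<otimes>\<^bsub>A\<^esub> star A (u j k)) = (if i = j then \<one>\<^bsub>A\<^esub> else \<zero>\<^bsub>A\<^esub>) \<and>
     (\<Oplus>\<^bsub>A\<^esub>k\<in>{..<n}. star A (u k i) \<otimes>\<^bsub>A\<^esub> u k j) = (if i = j then \<one>\<^bsub>A\<^esub> else \<zero>\<^bsub>A\<^esub>))"

definition cqg_algebra :: "('a, 'm) hopf_star_alg_scheme \<Rightarrow> bool" where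
  "cqg_algebra A \<longleftrightarrow> hopf_star_algebra A \<and>
     carrier A = lin_span A {u i j | n u i j. unitary_corep A n u \<and> i < n \<and> j < n}"

text \<open>Counits and antipodes are preserved automatically.\<close>

definition hopf_star_iso ::
    "('a, 'm) hopf_star_alg_scheme \<Rightarrow> ('b, 'n) hopf_star_alg_scheme \<Rightarrow> ('a \<Rightarrow> 'b) set" where
  "hopf_star_iso A B = {f \<in> star_hom A B. bij_betw f (carrier A) (carrier B) \<and>
     (\<forall>x\<in>carrier A. comult B (f x) = tensor_map B B f f (comult A x))}"

text \<open>Isomorphism of the compact quantum groups with CQG-algebras \<open>A\<close> and \<open>B\<close>.\<close>

definition cqg_isomorphic :: "('a, 'm) hopf_star_alg_scheme \<Rightarrow> ('b, 'n) hopf_star_alg_scheme \<Rightarrow> bool" where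
  "cqg_isomorphic A B \<longleftrightarrow> cqg_algebra A \<and> cqg_algebra B \<and> hopf_star_iso A B \<noteq> {}"

text \<open>The counit and the antipode being unique, the existential quantifiers just name them.\<close>

definition hopf_star_ideal :: "'a set \<Rightarrow> ('a, 'm) hopf_star_alg_scheme \<Rightarrow> bool" where
  "hopf_star_ideal I A \<longleftrightarrow> star_ideal I A \<and>
     comult A ` I \<subseteq> lin_span (tensor_alg A A)
       {pure A A x y | x y. x \<in> I \<and> y \<in> carrier A \<or> x \<in> carrier A \<and> y \<in> I} \<and>
     (\<exists>\<epsilon> S. is_counit A \<epsilon> \<and> is_antipode A \<epsilon> S \<and> \<epsilon> ` I \<subseteq> {0} \<and> S ` I \<subseteq> I)"

definition gen_hopf_star_ideal :: "('a, 'm) hopf_star_alg_scheme \<Rightarrow> 'a set \<Rightarrow> 'a set" where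
  "gen_hopf_star_ideal A X = \<Inter>{I. hopf_star_ideal I A \<and> X \<subseteq> I}"

text \<open>The comultiplication of \<open>A / I\<close> is induced by \<open>(\<pi> \<otimes> \<pi>) \<circ> \<Delta>\<close>, with \<open>\<pi>\<close> the quotient map.\<close>

definition hopf_quot :: "('a, 'm) hopf_star_alg_scheme \<Rightarrow> 'a set \<Rightarrow> 'a set hopf_star_alg" where
  "hopf_quot A I = (let Q = star_quot A I; \<pi> = (\<lambda>x. I +>\<^bsub>A\<^esub> x) in
     star_alg.extend Q (hopf_star_alg.fields
       (\<lambda>X. the_elem ((\<lambda>x. tensor_map Q Q \<pi> \<pi> (comult A x)) ` X))))"


section \<open>The quantum groups of the theorem\<close>

text \<open>The *-algebra \<open>\<complex>[\<Lambda>]\<close> of the dual of \<open>\<Lambda>\<close>.\<close>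

definition group_alg :: "('g, 'm) monoid_scheme \<Rightarrow> ('g \<Rightarrow> complex) star_alg" where
  "group_alg G = monoid_algebra G (\<lambda>x. inv\<^bsub>G\<^esub> x)"

type_synonym 'g hn_poly = "((nat \<times> nat \<times> 'g) \<times> bool) list \<Rightarrow> complex"

definition hn_free :: "nat \<Rightarrow> ('g, 'm) monoid_scheme \<Rightarrow> 'g hn_poly star_alg" where
  "hn_free N G = free_star_alg ({1..N} \<times> {1..N} \<times> carrier G)"

definition hn_var :: "nat \<Rightarrow> nat \<Rightarrow> 'g \<Rightarrow> 'g hn_poly" where
  "hn_var i j g = ket [((i, j, g), False)]"

definition hn_relators :: "nat \<Rightarrow> ('g, 'm) monoid_scheme \<Rightarrow> 'g hn_poly set" where
  "hn_relators N G = (let F = hn_free N G; x = hn_var in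
     {star F (x i j g) \<ominus>\<^bsub>F\<^esub> x i j (inv\<^bsub>G\<^esub> g) | i j g.
        i \<in> {1..N} \<and> j \<in> {1..N} \<and> g \<in> carrier G}
   \<union> {x i j g \<otimes>\<^bsub>F\<^esub> x i k h \<ominus>\<^bsub>F\<^esub> (if j = k then x i j (g \<otimes>\<^bsub>G\<^esub> h) else \<zero>\<^bsub>F\<^esub>) | i j k g h.
        i \<in> {1..N} \<and> j \<in> {1..N} \<and> k \<in> {1..N} \<and> g \<in> carrier G \<and> h \<in> carrier G}
   \<union> {x j i g \<otimes>\<^bsub>F\<^esub> x k i h \<ominus>\<^bsub>F\<^esub> (if j = k then x j i (g \<otimes>\<^bsub>G\<^esub> h) else \<zero>\<^bsub>F\<^esub>) | i j k g h.
        i \<in> {1..N} \<and> j \<in> {1..N} \<and> k \<in> {1..N} \<and> g \<in> carrier G \<and> h \<in> carrier G}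
   \<union> {(\<Oplus>\<^bsub>F\<^esub>k\<in>{1..N}. x i k \<one>\<^bsub>G\<^esub>) \<ominus>\<^bsub>F\<^esub> \<one>\<^bsub>F\<^esub> | i. i \<in> {1..N}}
   \<union> {(\<Oplus>\<^bsub>F\<^esub>k\<in>{1..N}. x k j \<one>\<^bsub>G\<^esub>) \<ominus>\<^bsub>F\<^esub> \<one>\<^bsub>F\<^esub> | j. j \<in> {1..N}})"

definition hn_ideal :: "nat \<Rightarrow> ('g, 'm) monoid_scheme \<Rightarrow> 'g hn_poly set" where
  "hn_ideal N G = gen_star_ideal (hn_free N G) (hn_relators N G)"

definition hn_star_alg :: "nat \<Rightarrow> ('g, 'm) monoid_scheme \<Rightarrow> 'g hn_poly set star_alg" where
  "hn_star_alg N G = star_quot (hn_free N G) (hn_ideal N G)"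

definition hn_gen :: "nat \<Rightarrow> ('g, 'm) monoid_scheme \<Rightarrow> nat \<Rightarrow> nat \<Rightarrow> 'g \<Rightarrow> 'g hn_poly set" where
  "hn_gen N G i j g = hn_ideal N G +>\<^bsub>hn_free N G\<^esub> hn_var i j g"

text \<open>\<open>O_HN N G\<close> is \<open>\<O>(H\<^sub>N\<^sup>+(G))\<close>. As usual, \<open>\<rightarrow>\<^sub>E\<close> serves to make functions on carriers unique.\<close>

definition O_HN :: "nat \<Rightarrow> ('g, 'm) monoid_scheme \<Rightarrow> 'g hn_poly set hopf_star_alg" where
  "O_HN N G = (let A = hn_star_alg N G; a = hn_gen N G in
     star_alg.extend A (hopf_star_alg.fields
       (THE \<Delta>. \<Delta> \<in> carrier A \<rightarrow>\<^sub>E carrier (tensor_alg A A) \<and> \<Delta> \<in> star_hom A (tensor_alg A A) \<and>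
          (\<forall>i\<in>{1..N}. \<forall>j\<in>{1..N}. \<forall>g\<in>carrier G.
             \<Delta> (a i j g) = (\<Oplus>\<^bsub>tensor_alg A A\<^esub>k\<in>{1..N}. pure A A (a i k g) (a k j g))))))"

definition O_HN_sub ::
    "nat \<Rightarrow> ('g, 'm) monoid_scheme \<Rightarrow> 'g set \<Rightarrow> 'g hn_poly set set hopf_star_alg" where
  "O_HN_sub N G \<Lambda> = (let A = O_HN N G; a = hn_gen N G in
     hopf_quot A (gen_hopf_star_ideal A
       {(\<Oplus>\<^bsub>A\<^esub>k\<in>{1..N}. a i k g) \<ominus>\<^bsub>A\<^esub> (\<Oplus>\<^bsub>A\<^esub>k\<in>{1..N}. a j k g) | i j g.
          i \<in> {1..N} \<and> j \<in> {1..N} \<and> g \<in> \<Lambda>}))"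


subsection \<open>The smash product\<close>

type_synonym 'g smash_elem = "('g \<Rightarrow> complex, 'g set hn_poly set) tensor"

definition smash_space ::
    "nat \<Rightarrow> ('g, 'm) monoid_scheme \<Rightarrow> 'g set \<Rightarrow> (complex, 'g smash_elem) module" where
  "smash_space N G \<Lambda> = tensor_space (group_alg (G\<lparr>carrier := \<Lambda>\<rparr>)) (O_HN N (G Mod \<Lambda>))"

definition smash_pure ::
    "nat \<Rightarrow> ('g, 'm) monoid_scheme \<Rightarrow> 'g set \<Rightarrow> ('g \<Rightarrow> complex) \<Rightarrow> 'g set hn_poly set \<Rightarrow> 'g smash_elem" where
  "smash_pure N G \<Lambda> = pure (group_alg (G\<lparr>carrier := \<Lambda>\<rparr>)) (O_HN N (G Mod \<Lambda>))"

text \<open>Besides being associative with unit \<open>1 \<otimes> 1\<close> and satisfying the defining formula on generators,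
  the multiplication \<open>m\<close> has \<open>\<complex>[\<Lambda>] \<otimes> 1\<close> and \<open>1 \<otimes> \<O>(H\<^sub>N\<^sup>+(\<Gamma>/\<Lambda>))\<close> as subalgebras, isomorphic to the
  two tensor factors, and \<open>x \<otimes> y = (x \<otimes> 1)(1 \<otimes> y)\<close>. The formula by itself only determines products of
  elements that are linear in the \<open>a\<^sub>i\<^sub>j(g)\<close>; together with these conventions it determines \<open>m\<close>.\<close>

definition smash_mult ::
    "nat \<Rightarrow> ('g, 'm) monoid_scheme \<Rightarrow> 'g set \<Rightarrow> ('g set \<Rightarrow> 'g)
      \<Rightarrow> ('g smash_elem \<Rightarrow> 'g smash_elem \<Rightarrow> 'g smash_elem) \<Rightarrow> bool" where
  "smash_mult N G \<Lambda> \<rho> m \<longleftrightarrow>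
    (let T = smash_space N G \<Lambda>; L = group_alg (G\<lparr>carrier := \<Lambda>\<rparr>); H = O_HN N (G Mod \<Lambda>);
         p = smash_pure N G \<Lambda>; a = hn_gen N (G Mod \<Lambda>) in
     m \<in> carrier T \<rightarrow>\<^sub>E carrier T \<rightarrow>\<^sub>E carrier T \<and>
     (\<forall>s\<in>carrier T. (\<lambda>t. m s t) \<in> linear_maps T T \<and> (\<lambda>t. m t s) \<in> linear_maps T T) \<and>
     (\<forall>s\<in>carrier T. \<forall>t\<in>carrier T. \<forall>u\<in>carrier T. m (m s t) u = m s (m t u)) \<and>
     (\<forall>t\<in>carrier T. m (p \<one>\<^bsub>L\<^esub> \<one>\<^bsub>H\<^esub>) t = t \<and> m t (p \<one>\<^bsub>L\<^esub> \<one>\<^bsub>H\<^esub>) = t) \<and>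
     (\<forall>x\<in>carrier L. \<forall>x'\<in>carrier L. m (p x \<one>\<^bsub>H\<^esub>) (p x' \<one>\<^bsub>H\<^esub>) = p (x \<otimes>\<^bsub>L\<^esub> x') \<one>\<^bsub>H\<^esub>) \<and>
     (\<forall>y\<in>carrier H. \<forall>y'\<in>carrier H. m (p \<one>\<^bsub>L\<^esub> y) (p \<one>\<^bsub>L\<^esub> y') = p \<one>\<^bsub>L\<^esub> (y \<otimes>\<^bsub>H\<^esub> y')) \<and>
     (\<forall>x\<in>carrier L. \<forall>y\<in>carrier H. m (p x \<one>\<^bsub>H\<^esub>) (p \<one>\<^bsub>L\<^esub> y) = p x y) \<and>
     (\<forall>l\<in>\<Lambda>. \<forall>l'\<in>\<Lambda>. \<forall>g\<in>carrier (G Mod \<Lambda>). \<forall>h\<in>carrier (G Mod \<Lambda>).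
      \<forall>i\<in>{1..N}. \<forall>j\<in>{1..N}. \<forall>i'\<in>{1..N}. \<forall>j'\<in>{1..N}.
        m (p (ket l) (a i j g)) (p (ket l') (a i' j' h)) =
        p (ket (l \<otimes>\<^bsub>G\<^esub> \<rho> g \<otimes>\<^bsub>G\<^esub> l' \<otimes>\<^bsub>G\<^esub> inv\<^bsub>G\<^esub> (\<rho> g))) (a i j g \<otimes>\<^bsub>H\<^esub> a i' j' h)))"

text \<open>The complex algebra underlying the smash product, still without an involution.\<close>

definition smash_alg ::
    "nat \<Rightarrow> ('g, 'm) monoid_scheme \<Rightarrow> 'g set \<Rightarrow> ('g set \<Rightarrow> 'g) \<Rightarrow> (complex, 'g smash_elem) module" where
  "smash_alg N G \<Lambda> \<rho> = (smash_space N G \<Lambda>)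
     \<lparr>mult := (THE m. smash_mult N G \<Lambda> \<rho> m),
      one := smash_pure N G \<Lambda> \<one>\<^bsub>group_alg (G\<lparr>carrier := \<Lambda>\<rparr>)\<^esub> \<one>\<^bsub>O_HN N (G Mod \<Lambda>)\<^esub>\<rparr>"

definition smash_star ::
    "nat \<Rightarrow> ('g, 'm) monoid_scheme \<Rightarrow> 'g set \<Rightarrow> ('g set \<Rightarrow> 'g) \<Rightarrow> ('g smash_elem \<Rightarrow> 'g smash_elem) \<Rightarrow> bool" where
  "smash_star N G \<Lambda> \<rho> s \<longleftrightarrow>
    (let S = smash_alg N G \<Lambda> \<rho>; L = group_alg (G\<lparr>carrier := \<Lambda>\<rparr>); H = O_HN N (G Mod \<Lambda>);
         p = smash_pure N G \<Lambda> in
     s \<in> carrier S \<rightarrow>\<^sub>E carrier S \<and>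
     star_algebra (module.extend S (star_alg.fields s)) \<and>
     (\<forall>x\<in>carrier L. s (p x \<one>\<^bsub>H\<^esub>) = p (star L x) \<one>\<^bsub>H\<^esub>) \<and>
     (\<forall>y\<in>carrier H. s (p \<one>\<^bsub>L\<^esub> y) = p \<one>\<^bsub>L\<^esub> (star H y)))"

definition smash_star_alg ::
    "nat \<Rightarrow> ('g, 'm) monoid_scheme \<Rightarrow> 'g set \<Rightarrow> ('g set \<Rightarrow> 'g) \<Rightarrow> 'g smash_elem star_alg" where
  "smash_star_alg N G \<Lambda> \<rho> =
     module.extend (smash_alg N G \<Lambda> \<rho>) (star_alg.fields (THE s. smash_star N G \<Lambda> \<rho> s))"

definition O_smash ::
    "nat \<Rightarrow> ('g, 'm) monoid_scheme \<Rightarrow> 'g set \<Rightarrow> ('g set \<Rightarrow> 'g) \<Rightarrow> 'g smash_elem hopf_star_alg" where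
  "O_smash N G \<Lambda> \<rho> =
    (let S = smash_star_alg N G \<Lambda> \<rho>; p = smash_pure N G \<Lambda>; a = hn_gen N (G Mod \<Lambda>) in
     star_alg.extend S (hopf_star_alg.fields
       (THE \<Delta>. \<Delta> \<in> carrier S \<rightarrow>\<^sub>E carrier (tensor_alg S S) \<and> \<Delta> \<in> alg_hom S (tensor_alg S S) \<and>
          (\<forall>l\<in>\<Lambda>. \<forall>g\<in>carrier (G Mod \<Lambda>). \<forall>i\<in>{1..N}. \<forall>j\<in>{1..N}.
             \<Delta> (p (ket l) (a i j g)) =
             (\<Oplus>\<^bsub>tensor_alg S S\<^esub>k\<in>{1..N}. pure S S (p (ket l) (a i k g)) (p (ket l) (a k j g)))))))"

end

theory Submission
  imports Defs
begin

text \<open>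
  Write \<open>q\<^sub>i\<^sub>j(g)\<close> for the generators of \<open>\<O>(H\<^sub>N\<^sup>+(\<Gamma>, \<Lambda>))\<close> and \<open>\<nu>\<close> for the quotient map \<open>\<Gamma> \<rightarrow> \<Gamma>/\<Lambda>\<close>.
  For \<open>l \<in> \<Lambda>\<close> the row sums \<open>u\<^sub>l = \<Sum>\<^sub>k q\<^sub>i\<^sub>k(l)\<close> do not depend on \<open>i\<close>, and
  \<open>u\<^sub>l q\<^sub>i\<^sub>j(g) = q\<^sub>i\<^sub>j(lg)\<close>, \<open>q\<^sub>i\<^sub>j(g) u\<^sub>l = q\<^sub>i\<^sub>j(gl)\<close>. Hence \<open>l \<mapsto> u\<^sub>l\<close> and \<open>a\<^sub>i\<^sub>j(x) \<mapsto> q\<^sub>i\<^sub>j(\<rho>(x))\<close> extend to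
  *-homomorphisms \<open>U\<close> and \<open>\<theta>\<close>, and \<open>\<Psi>(x \<otimes> y) = U(x) \<theta>(y)\<close> defines a surjective linear map on
  \<open>\<complex>[\<Lambda>] \<otimes> \<O>(H\<^sub>N\<^sup>+(\<Gamma>/\<Lambda>))\<close>. It is injective because composing it with the *-homomorphism
  \<open>q\<^sub>i\<^sub>j(g) \<mapsto> g \<otimes> a\<^sub>i\<^sub>j(\<nu>(g))\<close> into \<open>\<complex>[\<Gamma>] \<otimes> \<O>(H\<^sub>N\<^sup>+(\<Gamma>/\<Lambda>))\<close> and with \<open>g \<mapsto> g \<rho>(\<nu>(g))\<inverse>\<close> on the first
  factor gives the identity; grading arguments are avoided by testing this on all
  \<open>l \<rho>(x) \<otimes> 1\<close> at once. The product, involution and comultiplication of the smash product exist because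
  they can be transported along \<open>\<Psi>\<close>, and they are unique because the algebras are generated by
  the elements on which they are prescribed.

  The Hopf *-algebra axioms are linear, so that it suffices to check them on coefficients of unitary
  corepresentations, where they are immediate; the latter span as soon as they generate.
\<close>

section \<open>Complex vector spaces\<close>

text \<open>Three obstacles shape the argument. The product, involution and comultiplication of the
  smash product are definite descriptions, so nothing can be computed with them before existence and
  uniqueness are settled; a direct construction would have to extend the action of the quotient
  group on \<open>\<complex>[\<Lambda>]\<close> consistently to all words in the generators, whereas
  the quotient algebra already has a product to transport. Next, the defining ideal is an
  intersection of Hopf ideals, which is not visibly a Hopf ideal itself. It is identified with the
  generated *-ideal; stability under the antipode is then a statement on column sums, although the
  relations only speak of row sums. Finally, \<open>g \<mapsto> g \<rho>(\<nu>(g))\<inverse>\<close>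
  is not multiplicative, so the left inverse of \<Psi> is merely linear and checking it on
  generators proves nothing. Left multiplication by \<open>l \<rho>(x) \<otimes> 1\<close> repairs
  this: the image of \<open>a\<^sub>i\<^sub>j(g)\<close> changes the group component
  \<open>l \<rho>(x)\<close> into \<open>l \<rho>(x g)\<close>, so a claim made for all l and x
  survives induction on words.\<close>

abbreviation cvec :: "(complex, 'a, 'm) module_scheme \<Rightarrow> bool" where
  "cvec V \<equiv> module complex_alg V"

lemma complex_alg_sel [simp]:
  "carrier complex_alg = UNIV" "mult complex_alg = (*)" "one complex_alg = 1"
  "zero complex_alg = 0" "add complex_alg = (+)" "smult complex_alg = (*)"
  by (simp_all add: complex_alg_def)

lemma cring_complex_alg: "cring complex_alg"
proof (rule cringI)
  show "abelian_group complex_alg"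
    proof (rule abelian_groupI)
    fix x :: complex
    show "\<exists>y\<in>carrier complex_alg. y \<oplus>\<^bsub>complex_alg\<^esub> x = \<zero>\<^bsub>complex_alg\<^esub>"
      by (rule bexI[of _ "- x"]) simp_all
  qed simp_all
  show "comm_monoid complex_alg"
    by (rule comm_monoidI) (auto simp: algebra_simps)
qed (auto simp: algebra_simps)

lemma cvec_add_closed [simp]:
    "\<lbrakk>cvec V; x \<in> carrier V; y \<in> carrier V\<rbrakk> \<Longrightarrow> x \<oplus>\<^bsub>V\<^esub> y \<in> carrier V"
  and cvec_zero_closed [simp]: "cvec V \<Longrightarrow> \<zero>\<^bsub>V\<^esub> \<in> carrier V"
  and cvec_neg_closed [simp]: "\<lbrakk>cvec V; x \<in> carrier V\<rbrakk> \<Longrightarrow> \<ominus>\<^bsub>V\<^esub> x \<in> carrier V"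
  and cvec_l_zero [simp]: "\<lbrakk>cvec V; x \<in> carrier V\<rbrakk> \<Longrightarrow> \<zero>\<^bsub>V\<^esub> \<oplus>\<^bsub>V\<^esub> x = x"
  and cvec_r_zero [simp]: "\<lbrakk>cvec V; x \<in> carrier V\<rbrakk> \<Longrightarrow> x \<oplus>\<^bsub>V\<^esub> \<zero>\<^bsub>V\<^esub> = x"
  and cvec_l_neg [simp]: "\<lbrakk>cvec V; x \<in> carrier V\<rbrakk> \<Longrightarrow> \<ominus>\<^bsub>V\<^esub> x \<oplus>\<^bsub>V\<^esub> x = \<zero>\<^bsub>V\<^esub>"
  and cvec_r_neg [simp]: "\<lbrakk>cvec V; x \<in> carrier V\<rbrakk> \<Longrightarrow> x \<oplus>\<^bsub>V\<^esub> \<ominus>\<^bsub>V\<^esub> x = \<zero>\<^bsub>V\<^esub>"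
  and cvec_add_assoc: "\<lbrakk>cvec V; x \<in> carrier V; y \<in> carrier V; z \<in> carrier V\<rbrakk>
    \<Longrightarrow> (x \<oplus>\<^bsub>V\<^esub> y) \<oplus>\<^bsub>V\<^esub> z = x \<oplus>\<^bsub>V\<^esub> (y \<oplus>\<^bsub>V\<^esub> z)"
  and cvec_add_comm: "\<lbrakk>cvec V; x \<in> carrier V; y \<in> carrier V\<rbrakk> \<Longrightarrow> x \<oplus>\<^bsub>V\<^esub> y = y \<oplus>\<^bsub>V\<^esub> x"
  and cvec_add_lcomm: "\<lbrakk>cvec V; x \<in> carrier V; y \<in> carrier V; z \<in> carrier V\<rbrakk>
    \<Longrightarrow> x \<oplus>\<^bsub>V\<^esub> (y \<oplus>\<^bsub>V\<^esub> z) = y \<oplus>\<^bsub>V\<^esub> (x \<oplus>\<^bsub>V\<^esub> z)"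
proof -
  assume "cvec V"
  then interpret abelian_group V by (simp add: module_def)
  show "x \<in> carrier V \<Longrightarrow> y \<in> carrier V \<Longrightarrow> x \<oplus>\<^bsub>V\<^esub> y \<in> carrier V"
    and "\<zero>\<^bsub>V\<^esub> \<in> carrier V"
    and "x \<in> carrier V \<Longrightarrow> \<ominus>\<^bsub>V\<^esub> x \<in> carrier V"
    and "x \<in> carrier V \<Longrightarrow> \<zero>\<^bsub>V\<^esub> \<oplus>\<^bsub>V\<^esub> x = x"
    and "x \<in> carrier V \<Longrightarrow> x \<oplus>\<^bsub>V\<^esub> \<zero>\<^bsub>V\<^esub> = x"
    and "x \<in> carrier V \<Longrightarrow> \<ominus>\<^bsub>V\<^esub> x \<oplus>\<^bsub>V\<^esub> x = \<zero>\<^bsub>V\<^esub>"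
    and "x \<in> carrier V \<Longrightarrow> x \<oplus>\<^bsub>V\<^esub> \<ominus>\<^bsub>V\<^esub> x = \<zero>\<^bsub>V\<^esub>"
    by (simp_all add: l_neg r_neg)
  show "x \<in> carrier V \<Longrightarrow> y \<in> carrier V \<Longrightarrow> z \<in> carrier V \<Longrightarrow>
      (x \<oplus>\<^bsub>V\<^esub> y) \<oplus>\<^bsub>V\<^esub> z = x \<oplus>\<^bsub>V\<^esub> (y \<oplus>\<^bsub>V\<^esub> z)"
    and "x \<in> carrier V \<Longrightarrow> y \<in> carrier V \<Longrightarrow> x \<oplus>\<^bsub>V\<^esub> y = y \<oplus>\<^bsub>V\<^esub> x"
    and "x \<in> carrier V \<Longrightarrow> y \<in> carrier V \<Longrightarrow> z \<in> carrier V \<Longrightarrow>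
      x \<oplus>\<^bsub>V\<^esub> (y \<oplus>\<^bsub>V\<^esub> z) = y \<oplus>\<^bsub>V\<^esub> (x \<oplus>\<^bsub>V\<^esub> z)"
    by (rule a_assoc a_comm a_lcomm; assumption)+
qed

lemmas cvec_ac = cvec_add_assoc cvec_add_comm cvec_add_lcomm

lemma cvec_smult_closed [simp]: "\<lbrakk>cvec V; x \<in> carrier V\<rbrakk> \<Longrightarrow> c \<odot>\<^bsub>V\<^esub> x \<in> carrier V"
  and cvec_smult_add_left: "\<lbrakk>cvec V; x \<in> carrier V\<rbrakk>
    \<Longrightarrow> (c + d) \<odot>\<^bsub>V\<^esub> x = c \<odot>\<^bsub>V\<^esub> x \<oplus>\<^bsub>V\<^esub> d \<odot>\<^bsub>V\<^esub> x"
  and cvec_smult_add: "\<lbrakk>cvec V; x \<in> carrier V; y \<in> carrier V\<rbrakk>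
    \<Longrightarrow> c \<odot>\<^bsub>V\<^esub> (x \<oplus>\<^bsub>V\<^esub> y) = c \<odot>\<^bsub>V\<^esub> x \<oplus>\<^bsub>V\<^esub> c \<odot>\<^bsub>V\<^esub> y"
  and cvec_smult_smult: "\<lbrakk>cvec V; x \<in> carrier V\<rbrakk> \<Longrightarrow> c \<odot>\<^bsub>V\<^esub> (d \<odot>\<^bsub>V\<^esub> x) = (c * d) \<odot>\<^bsub>V\<^esub> x"
  and cvec_smult_one [simp]: "\<lbrakk>cvec V; x \<in> carrier V\<rbrakk> \<Longrightarrow> 1 \<odot>\<^bsub>V\<^esub> x = x"
  and cvec_smult_zero_left [simp]: "\<lbrakk>cvec V; x \<in> carrier V\<rbrakk> \<Longrightarrow> 0 \<odot>\<^bsub>V\<^esub> x = \<zero>\<^bsub>V\<^esub>"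
  and cvec_smult_zero [simp]: "cvec V \<Longrightarrow> c \<odot>\<^bsub>V\<^esub> \<zero>\<^bsub>V\<^esub> = \<zero>\<^bsub>V\<^esub>"
  using module.smult_closed[of complex_alg V c x] module.smult_l_distr[of complex_alg V c d x]
    module.smult_r_distr[of complex_alg V c x y] module.smult_assoc1[of complex_alg V c d x]
    module.smult_one[of complex_alg V x] module.smult_l_null[of complex_alg V x]
    module.smult_r_null[of complex_alg V c]
  by simp_all

lemma cvec_neg: assumes "cvec V" "x \<in> carrier V" shows "\<ominus>\<^bsub>V\<^esub> x = (-1) \<odot>\<^bsub>V\<^esub> x"
proof -
  interpret abelian_group V using assms(1) by (simp add: module_def)
  have "(-1) \<odot>\<^bsub>V\<^esub> x \<oplus>\<^bsub>V\<^esub> x = \<zero>\<^bsub>V\<^esub>"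
    using cvec_smult_add_left[of V x "-1" 1] assms by simp
  then show ?thesis using minus_equality assms by simp
qed

lemma cvec_minus:
  "\<lbrakk>cvec V; x \<in> carrier V; y \<in> carrier V\<rbrakk> \<Longrightarrow> x \<ominus>\<^bsub>V\<^esub> y = x \<oplus>\<^bsub>V\<^esub> (-1) \<odot>\<^bsub>V\<^esub> y"
  by (simp add: a_minus_def cvec_neg)

lemma cvec_minus_closed [simp]:
  "\<lbrakk>cvec V; x \<in> carrier V; y \<in> carrier V\<rbrakk> \<Longrightarrow> x \<ominus>\<^bsub>V\<^esub> y \<in> carrier V"
  by (simp add: cvec_minus)

lemma cvec_minus_eq_zero_iff:
  assumes "cvec V" "x \<in> carrier V" "y \<in> carrier V"
  shows "x \<ominus>\<^bsub>V\<^esub> y = \<zero>\<^bsub>V\<^esub> \<longleftrightarrow> x = y"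
proof -
  interpret abelian_group V using assms(1) by (simp add: module_def)
  show ?thesis using assms 
    by (metis a_minus_def assms(2,3) minus_equality minus_minus a_inv_closed r_neg a_comm)
qed

lemma cvec_abelian_group: "cvec V \<Longrightarrow> abelian_group V"
  by (simp add: module_def)

lemma cvec_abelian_monoid: "cvec V \<Longrightarrow> abelian_monoid V"
  by (simp add: module_def abelian_group_def)

section \<open>Finite sums in a vector space\<close>

lemma cvec_finsum_closed [simp]:
  "\<lbrakk>cvec V; \<And>i. i \<in> I \<Longrightarrow> f i \<in> carrier V\<rbrakk> \<Longrightarrow> finsum V f I \<in> carrier V"
  by (rule abelian_monoid.finsum_closed[OF cvec_abelian_monoid]) auto

lemma cvec_finsum_empty [simp]: "cvec V \<Longrightarrow> finsum V f {} = \<zero>\<^bsub>V\<^esub>"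
  using abelian_monoid.finsum_empty[OF cvec_abelian_monoid] .

lemma cvec_finsum_insert:
  "\<lbrakk>cvec V; finite I; i \<notin> I; f i \<in> carrier V; \<And>i. i \<in> I \<Longrightarrow> f i \<in> carrier V\<rbrakk>
    \<Longrightarrow> finsum V f (insert i I) = f i \<oplus>\<^bsub>V\<^esub> finsum V f I"
  by (rule abelian_monoid.finsum_insert[OF cvec_abelian_monoid]) auto

lemma cvec_finsum_cong:
  "\<lbrakk>cvec V; \<And>i. i \<in> I \<Longrightarrow> f i = g i; \<And>i. i \<in> I \<Longrightarrow> g i \<in> carrier V\<rbrakk>
    \<Longrightarrow> finsum V f I = finsum V g I"
  by (rule abelian_monoid.finsum_cong'[OF cvec_abelian_monoid]) auto

lemma cvec_finsum_add:
  "\<lbrakk>cvec V; \<And>i. i \<in> I \<Longrightarrow> f i \<in> carrier V; \<And>i. i \<in> I \<Longrightarrow> g i \<in> carrier V\<rbrakk>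
    \<Longrightarrow> (\<Oplus>\<^bsub>V\<^esub>i\<in>I. f i \<oplus>\<^bsub>V\<^esub> g i) = finsum V f I \<oplus>\<^bsub>V\<^esub> finsum V g I"
  by (rule abelian_monoid.finsum_addf[OF cvec_abelian_monoid]) auto

lemma cvec_finsum_zero: "\<lbrakk>cvec V; \<And>i. i \<in> I \<Longrightarrow> f i = \<zero>\<^bsub>V\<^esub>\<rbrakk> \<Longrightarrow> finsum V f I = \<zero>\<^bsub>V\<^esub>"
  by (metis abelian_monoid.finsum_zero cvec_abelian_monoid cvec_finsum_cong cvec_zero_closed)

lemma cvec_finsum_delta:
  assumes "cvec V" "finite I" "j \<in> I" "x \<in> carrier V" "\<And>i. i \<in> I \<Longrightarrow> f i = (if i = j then x else \<zero>\<^bsub>V\<^esub>)"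
  shows "finsum V f I = x"
proof -
  have "finsum V f I = finsum V f (insert j (I - {j}))" using assms(3) by (simp add: insert_absorb)
  also have "\<dots> = f j \<oplus>\<^bsub>V\<^esub> finsum V f (I - {j})"
    using assms by (intro cvec_finsum_insert) auto
  also have "finsum V f (I - {j}) = \<zero>\<^bsub>V\<^esub>" using assms by (intro cvec_finsum_zero) auto
  finally show ?thesis using assms by simp
qed

lemma cvec_finsum_mono_neutral:
  "\<lbrakk>cvec V; finite J; I \<subseteq> J; \<And>i. i \<in> J - I \<Longrightarrow> f i = \<zero>\<^bsub>V\<^esub>; \<And>i. i \<in> J \<Longrightarrow> f i \<in> carrier V\<rbrakk>
    \<Longrightarrow> finsum V f I = finsum V f J"
proof -
  assume *: "cvec V" "finite J" "I \<subseteq> J" "\<And>i. i \<in> J - I \<Longrightarrow> f i = \<zero>\<^bsub>V\<^esub>" "\<And>i. i \<in> J \<Longrightarrow> f i \<in> carrier V"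
  then interpret abelian_monoid V by (simp add: cvec_abelian_monoid)
  show ?thesis by (rule add.finprod_mono_neutral_cong_left) (use * in auto)
qed

lemma cvec_finsum_reindex:
  "\<lbrakk>cvec V; inj_on h I; \<And>i. i \<in> I \<Longrightarrow> f (h i) \<in> carrier V\<rbrakk>
    \<Longrightarrow> finsum V f (h ` I) = (\<Oplus>\<^bsub>V\<^esub>i\<in>I. f (h i))"
  by (rule abelian_monoid.finsum_reindex[OF cvec_abelian_monoid]) auto

text \<open>The axioms pass along any surjection that respects the operations, and nothing is
  assumed of \<open>W\<close> beforehand. With a projection this treats quotients; with the identity
  it treats records that merely share their operations.\<close>

lemma cvec_image:
  assumes V: "cvec V"
    and surj: "f ` carrier V = carrier W"
    and add: "\<And>x y. \<lbrakk>x \<in> carrier V; y \<in> carrier V\<rbrakk> \<Longrightarrow> f (x \<oplus>\<^bsub>V\<^esub> y) = f x \<oplus>\<^bsub>W\<^esub> f y"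
    and smult: "\<And>c x. x \<in> carrier V \<Longrightarrow> f (c \<odot>\<^bsub>V\<^esub> x) = c \<odot>\<^bsub>W\<^esub> f x"
    and zero: "f \<zero>\<^bsub>V\<^esub> = \<zero>\<^bsub>W\<^esub>"
  shows "cvec W"
proof (rule moduleI)
  show "cring complex_alg" by (rule cring_complex_alg)
  have im: "\<exists>x'\<in>carrier V. x = f x'" if "x \<in> carrier W" for x using that surj by auto
  have cl: "f x \<in> carrier W" if "x \<in> carrier V" for x using that surj by auto
  note hom = add[symmetric] smult[symmetric] zero[symmetric]
  show "abelian_group W"
  proof (rule abelian_groupI)
    fix x y z
    assume "x \<in> carrier W"
    then obtain x' where x: "x = f x'" "x' \<in> carrier V" using im by blast
    show "\<zero>\<^bsub>W\<^esub> \<oplus>\<^bsub>W\<^esub> x = x" using x V by (simp add: hom)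
    have "f (\<ominus>\<^bsub>V\<^esub> x') \<oplus>\<^bsub>W\<^esub> x = \<zero>\<^bsub>W\<^esub>" using x V by (simp add: hom)
    then show "\<exists>y\<in>carrier W. y \<oplus>\<^bsub>W\<^esub> x = \<zero>\<^bsub>W\<^esub>" using cl x V by (meson cvec_neg_closed)
    assume "y \<in> carrier W"
    then obtain y' where y: "y = f y'" "y' \<in> carrier V" using im by blast
    show "x \<oplus>\<^bsub>W\<^esub> y \<in> carrier W" using x y V cl by (simp add: hom)
    show "x \<oplus>\<^bsub>W\<^esub> y = y \<oplus>\<^bsub>W\<^esub> x" using x y V by (simp add: hom cvec_add_comm)
    assume "z \<in> carrier W"
    then obtain z' where z: "z = f z'" "z' \<in> carrier V" using im by blast
    show "x \<oplus>\<^bsub>W\<^esub> y \<oplus>\<^bsub>W\<^esub> z = x \<oplus>\<^bsub>W\<^esub> (y \<oplus>\<^bsub>W\<^esub> z)" using x y z V by (simp add: hom cvec_add_assoc)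
  next
    show "\<zero>\<^bsub>W\<^esub> \<in> carrier W" using V cl by (simp add: hom)
  qed
  fix a b :: complex and x y
  assume "x \<in> carrier W"
  then obtain x' where x: "x = f x'" "x' \<in> carrier V" using im by blast
  show "a \<odot>\<^bsub>W\<^esub> x \<in> carrier W" using x V cl by (simp add: hom)
  show "(a \<oplus>\<^bsub>complex_alg\<^esub> b) \<odot>\<^bsub>W\<^esub> x = a \<odot>\<^bsub>W\<^esub> x \<oplus>\<^bsub>W\<^esub> b \<odot>\<^bsub>W\<^esub> x"
    using x V by (simp add: hom cvec_smult_add_left)
  show "(a \<otimes>\<^bsub>complex_alg\<^esub> b) \<odot>\<^bsub>W\<^esub> x = a \<odot>\<^bsub>W\<^esub> (b \<odot>\<^bsub>W\<^esub> x)"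
    using x V by (simp add: hom cvec_smult_smult)
  show "\<one>\<^bsub>complex_alg\<^esub> \<odot>\<^bsub>W\<^esub> x = x" using x V by (simp add: hom)
  assume "y \<in> carrier W"
  then obtain y' where y: "y = f y'" "y' \<in> carrier V" using im by blast
  show "a \<odot>\<^bsub>W\<^esub> (x \<oplus>\<^bsub>W\<^esub> y) = a \<odot>\<^bsub>W\<^esub> x \<oplus>\<^bsub>W\<^esub> a \<odot>\<^bsub>W\<^esub> y"
    using x y V by (simp add: hom cvec_smult_add)
qed

subsection \<open>Linear maps and spans\<close>

lemma linear_mapsI:
  assumes "\<And>x. x \<in> carrier V \<Longrightarrow> f x \<in> carrier W"
    and "\<And>x y. \<lbrakk>x \<in> carrier V; y \<in> carrier V\<rbrakk> \<Longrightarrow> f (x \<oplus>\<^bsub>V\<^esub> y) = f x \<oplus>\<^bsub>W\<^esub> f y"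
    and "\<And>c x. x \<in> carrier V \<Longrightarrow> f (c \<odot>\<^bsub>V\<^esub> x) = c \<odot>\<^bsub>W\<^esub> f x"
  shows "f \<in> linear_maps V W"
  using assms by (auto simp: linear_maps_def)

lemma linear_maps_closed: "\<lbrakk>f \<in> linear_maps V W; x \<in> carrier V\<rbrakk> \<Longrightarrow> f x \<in> carrier W"
  and linear_maps_add: "\<lbrakk>f \<in> linear_maps V W; x \<in> carrier V; y \<in> carrier V\<rbrakk>
    \<Longrightarrow> f (x \<oplus>\<^bsub>V\<^esub> y) = f x \<oplus>\<^bsub>W\<^esub> f y"
  and linear_maps_smult: "\<lbrakk>f \<in> linear_maps V W; x \<in> carrier V\<rbrakk> \<Longrightarrow> f (c \<odot>\<^bsub>V\<^esub> x) = c \<odot>\<^bsub>W\<^esub> f x"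
  by (auto simp: linear_maps_def)

lemma linear_maps_zero:
  "\<lbrakk>f \<in> linear_maps V W; cvec V; cvec W\<rbrakk> \<Longrightarrow> f \<zero>\<^bsub>V\<^esub> = \<zero>\<^bsub>W\<^esub>"
  using linear_maps_smult[of f V W "\<zero>\<^bsub>V\<^esub>" 0] linear_maps_closed[of f V W "\<zero>\<^bsub>V\<^esub>"] by simp

lemma linear_maps_minus:
  "\<lbrakk>f \<in> linear_maps V W; cvec V; cvec W; x \<in> carrier V; y \<in> carrier V\<rbrakk>
    \<Longrightarrow> f (x \<ominus>\<^bsub>V\<^esub> y) = f x \<ominus>\<^bsub>W\<^esub> f y"
  by (simp add: cvec_minus linear_maps_add linear_maps_smult linear_maps_closed)

lemma linear_maps_finsum:
  assumes "f \<in> linear_maps V W" "cvec V" "cvec W" "\<And>i. i \<in> I \<Longrightarrow> g i \<in> carrier V"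
  shows "f (finsum V g I) = (\<Oplus>\<^bsub>W\<^esub>i\<in>I. f (g i))"
proof (cases "finite I")
  case True
  then show ?thesis using assms(4)
  proof (induction I)
    case empty
    then show ?case using assms by (simp add: linear_maps_zero)
  next
    case (insert i I)
    then show ?case using assms(1-3)
      by (simp add: cvec_finsum_insert linear_maps_add linear_maps_closed)
  qed
next
  case False
  then show ?thesis using assms
    by (simp add: abelian_monoid.finsum_infinite[OF cvec_abelian_monoid] linear_maps_zero)
qed

lemma linear_maps_comp:
  "\<lbrakk>f \<in> linear_maps U V; g \<in> linear_maps V W\<rbrakk> \<Longrightarrow> (\<lambda>x. g (f x)) \<in> linear_maps U W"
  by (rule linear_mapsI) (simp_all add: linear_maps_closed linear_maps_add linear_maps_smult)

lemma linear_maps_id: "(\<lambda>x. x) \<in> linear_maps V V"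
  by (auto simp: linear_maps_def)

text \<open>Closure under negatives comes from scaling by -1. What remains is a list of closure
  conditions that is easily checked for intersections and for sets cut out by a property.\<close>

lemma submodule_iff:
  assumes "cvec V"
  shows "submodule H complex_alg V \<longleftrightarrow> H \<subseteq> carrier V \<and> \<zero>\<^bsub>V\<^esub> \<in> H \<and>
    (\<forall>x\<in>H. \<forall>y\<in>H. x \<oplus>\<^bsub>V\<^esub> y \<in> H) \<and> (\<forall>c. \<forall>x\<in>H. c \<odot>\<^bsub>V\<^esub> x \<in> H)" (is "_ \<longleftrightarrow> ?R")
proof
  interpret module complex_alg V by fact
  assume sub: "submodule H complex_alg V"
  then have "\<zero>\<^bsub>V\<^esub> \<in> H" using subgroup.one_closed[OF submodule.axioms(1)[OF sub]] by simp
  then show ?R using submoduleE[OF sub] by auto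
next
  interpret module complex_alg V by fact
  assume R: ?R
  show "submodule H complex_alg V"
  proof (rule submoduleI)
    fix a assume "a \<in> H"
    then show "\<ominus>\<^bsub>V\<^esub> a \<in> H" using R assms cvec_neg[of V a] by auto
  qed (use R in auto)
qed

lemma lin_span_submodule:
  assumes "cvec V" "X \<subseteq> carrier V" shows "submodule (lin_span V X) complex_alg V"
proof -
  \<comment> \<open>The carrier belongs to the family being intersected, which keeps the span inside
    the carrier.\<close>
  have "submodule (carrier V) complex_alg V" using assms by (simp add: submodule_iff)
  then show ?thesis unfolding submodule_iff[OF assms(1)] lin_span_def
    using assms by (auto simp: submodule_iff)
qed

lemma lin_span_superset: "X \<subseteq> lin_span V X"
  by (auto simp: lin_span_def)

lemma lin_span_least: "\<lbrakk>submodule H complex_alg V; X \<subseteq> H\<rbrakk> \<Longrightarrow> lin_span V X \<subseteq> H"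
  by (auto simp: lin_span_def)

text \<open>The elements of the carrier with property \<open>P\<close> form a submodule containing
  \<open>X\<close>, hence the span. Membership in the carrier is carried along because the module
  laws are only available there.\<close>

lemma lin_span_induct [consumes 3, case_names base zero add smult]:
  assumes "x \<in> lin_span V X" "cvec V" "X \<subseteq> carrier V"
    and "\<And>x. x \<in> X \<Longrightarrow> P x" "P \<zero>\<^bsub>V\<^esub>"
    and "\<And>x y. \<lbrakk>x \<in> carrier V; y \<in> carrier V; P x; P y\<rbrakk> \<Longrightarrow> P (x \<oplus>\<^bsub>V\<^esub> y)"
    and "\<And>c x. \<lbrakk>x \<in> carrier V; P x\<rbrakk> \<Longrightarrow> P (c \<odot>\<^bsub>V\<^esub> x)"
  shows "P x"
proof -
  have "lin_span V X \<subseteq> {x \<in> carrier V. P x}"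
    by (rule lin_span_least) (use assms in \<open>auto simp: submodule_iff\<close>)
  then show ?thesis using assms(1) by auto
qed

lemma linear_maps_eq_on_span:
  assumes "x \<in> lin_span V X" "cvec V" "X \<subseteq> carrier V" "cvec W"
    and "f \<in> linear_maps V W" "g \<in> linear_maps V W" "\<And>x. x \<in> X \<Longrightarrow> f x = g x"
  shows "f x = g x"
  using assms(1-3)
  by (induction rule: lin_span_induct)
    (use assms in \<open>auto simp: linear_maps_zero linear_maps_add linear_maps_smult\<close>)

subsection \<open>Cosets\<close>

lemma submodule_abelian_subgroup:
  assumes "cvec V" "submodule K complex_alg V" shows "abelian_subgroup K V"
  using assms by (intro abelian_subgroupI3)
    (auto simp: module_def submodule_def additive_subgroup_def)

lemma coset_eq_iff:
  assumes "cvec V" "submodule K complex_alg V" "x \<in> carrier V" "y \<in> carrier V"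
  shows "K +>\<^bsub>V\<^esub> x = K +>\<^bsub>V\<^esub> y \<longleftrightarrow> x \<ominus>\<^bsub>V\<^esub> y \<in> K"
proof -
  interpret abelian_subgroup K V by (rule submodule_abelian_subgroup[OF assms(1,2)])
  have "x \<in> K +>\<^bsub>V\<^esub> y \<longleftrightarrow> x \<ominus>\<^bsub>V\<^esub> y \<in> K"
    using a_rcos_module[OF assms(4,3)] by (simp add: a_minus_def)
  moreover have "x \<in> K +>\<^bsub>V\<^esub> y \<longleftrightarrow> K +>\<^bsub>V\<^esub> x = K +>\<^bsub>V\<^esub> y"
    using a_rcos_self[OF assms(3)] a_repr_independence'[OF _ assms(4)] by metis
  ultimately show ?thesis by simp
qed

lemma coset_memD:
  assumes "cvec V" "submodule K complex_alg V" "x \<in> carrier V" "z \<in> K +>\<^bsub>V\<^esub> x"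
  shows "z \<in> carrier V" "z \<ominus>\<^bsub>V\<^esub> x \<in> K" "K +>\<^bsub>V\<^esub> z = K +>\<^bsub>V\<^esub> x"
proof -
  interpret abelian_subgroup K V by (rule submodule_abelian_subgroup[OF assms(1,2)])
  show z: "z \<in> carrier V" using a_elemrcos_carrier[OF assms(3,4)] .
  show "K +>\<^bsub>V\<^esub> z = K +>\<^bsub>V\<^esub> x" using a_repr_independence'[OF assms(4,3)] by simp
  then show "z \<ominus>\<^bsub>V\<^esub> x \<in> K" using coset_eq_iff[OF assms(1,2) z assms(3)] by simp
qed

lemma coset_self:
  "\<lbrakk>cvec V; submodule K complex_alg V; x \<in> carrier V\<rbrakk> \<Longrightarrow> x \<in> K +>\<^bsub>V\<^esub> x"
  by (rule abelian_subgroup.a_rcos_self[OF submodule_abelian_subgroup])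

text \<open>Operations on cosets are encoded as unions, or as \<open>the_elem\<close> of an image,
  over all representatives. Such an expression collapses to one value as soon as the value does not
  depend on the representative.\<close>

lemma coset_Union:
  assumes "cvec V" "submodule K complex_alg V" "x \<in> carrier V"
    and "\<And>z. z \<in> carrier V \<Longrightarrow> z \<ominus>\<^bsub>V\<^esub> x \<in> K \<Longrightarrow> F z = F x"
  shows "(\<Union>z\<in>K +>\<^bsub>V\<^esub> x. F z) = F x"
  using coset_memD[OF assms(1-3)] coset_self[OF assms(1-3)] assms(4) by blast

lemma coset_the_elem:
  assumes "cvec V" "submodule K complex_alg V" "x \<in> carrier V"
    and "\<And>z. z \<in> carrier V \<Longrightarrow> z \<ominus>\<^bsub>V\<^esub> x \<in> K \<Longrightarrow> f z = f x"
  shows "the_elem (f ` (K +>\<^bsub>V\<^esub> x)) = f x"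
proof -
  have "f ` (K +>\<^bsub>V\<^esub> x) = {f x}"
    using coset_memD[OF assms(1-3)] coset_self[OF assms(1-3)] assms(4) by blast
  then show ?thesis by simp
qed

text \<open>A linear map that vanishes on \<open>K\<close> is constant on cosets; this is the form
  in which every induced map on a quotient is evaluated.\<close>

lemma coset_the_elem_linear:
  assumes "cvec V" "submodule K complex_alg V" "x \<in> carrier V" "cvec W"
    and "f \<in> linear_maps V W" "\<And>z. z \<in> K \<Longrightarrow> f z = \<zero>\<^bsub>W\<^esub>"
  shows "the_elem (f ` (K +>\<^bsub>V\<^esub> x)) = f x"
proof (rule coset_the_elem[OF assms(1-3)])
  fix z assume z: "z \<in> carrier V" "z \<ominus>\<^bsub>V\<^esub> x \<in> K"
  then have "f z \<ominus>\<^bsub>W\<^esub> f x = \<zero>\<^bsub>W\<^esub>" using assms linear_maps_minus[of f V W z x] by simp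
  then show "f z = f x"
    using cvec_minus_eq_zero_iff[OF assms(4)] assms z by (auto simp: linear_maps_closed)
qed

lemma coset_add:
  assumes "cvec V" "submodule K complex_alg V" "x \<in> carrier V" "y \<in> carrier V"
  shows "(K +>\<^bsub>V\<^esub> x) <+>\<^bsub>V\<^esub> (K +>\<^bsub>V\<^esub> y) = K +>\<^bsub>V\<^esub> (x \<oplus>\<^bsub>V\<^esub> y)"
  by (rule abelian_subgroup.a_rcos_sum[OF submodule_abelian_subgroup]) fact+

lemma coset_smult:
  assumes "cvec V" "submodule K complex_alg V" "x \<in> carrier V"
  shows "(\<Union>z\<in>K +>\<^bsub>V\<^esub> x. K +>\<^bsub>V\<^esub> (c \<odot>\<^bsub>V\<^esub> z)) = K +>\<^bsub>V\<^esub> (c \<odot>\<^bsub>V\<^esub> x)"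
proof (rule coset_Union[OF assms])
  fix z assume z: "z \<in> carrier V" "z \<ominus>\<^bsub>V\<^esub> x \<in> K"
  have "c \<odot>\<^bsub>V\<^esub> z \<ominus>\<^bsub>V\<^esub> c \<odot>\<^bsub>V\<^esub> x = c \<odot>\<^bsub>V\<^esub> (z \<ominus>\<^bsub>V\<^esub> x)"
    using assms z by (simp add: cvec_minus cvec_smult_add cvec_smult_smult)
  also have "\<dots> \<in> K" using z assms by (simp add: submodule_iff)
  finally show "K +>\<^bsub>V\<^esub> (c \<odot>\<^bsub>V\<^esub> z) = K +>\<^bsub>V\<^esub> (c \<odot>\<^bsub>V\<^esub> x)" using assms z by (simp add: coset_eq_iff)
qed

lemma coset_zero: 
  assumes "cvec V" "submodule K complex_alg V" shows "K +>\<^bsub>V\<^esub> \<zero>\<^bsub>V\<^esub> = K"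
  using assms abelian_group.a_coset_add_zero[OF cvec_abelian_group] by (auto simp: submodule_iff)

lemma a_rcosets_image: "a_rcosets\<^bsub>V\<^esub> K = (\<lambda>x. K +>\<^bsub>V\<^esub> x) ` carrier V"
  by (auto simp: A_RCOSETS_def' a_r_coset_def')

subsection \<open>Linear extension from a basis\<close>

lemma free_space_sel [simp]:
  "zero (free_space X) = (\<lambda>x. 0)" "add (free_space X) = (\<lambda>f g x. f x + g x)"
  "smult (free_space X) = (\<lambda>c f x. c * f x)"
  by (simp_all add: free_space_def)

lemma free_space_carrier:
  "f \<in> carrier (free_space X) \<longleftrightarrow> finite {x. f x \<noteq> 0} \<and> {x. f x \<noteq> 0} \<subseteq> X"
  by (simp add: free_space_def)

lemma free_space_cvec [simp]: "cvec (free_space X)"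
proof (rule moduleI)
  show "cring complex_alg" by (rule cring_complex_alg)
  have add: "(\<lambda>x. f x + g x) \<in> carrier (free_space X)"
    if "f \<in> carrier (free_space X)" "g \<in> carrier (free_space X)" for f g
  proof -
    have "{x. f x + g x \<noteq> 0} \<subseteq> {x. f x \<noteq> 0} \<union> {x. g x \<noteq> 0}" by auto
    then show ?thesis using that unfolding free_space_carrier
      by (meson finite_UnI finite_subset le_sup_iff order_trans)
  qed
  have smult: "(\<lambda>x. c * f x) \<in> carrier (free_space X)" if "f \<in> carrier (free_space X)" for f c
  proof -
    have "{x. c * f x \<noteq> 0} \<subseteq> {x. f x \<noteq> 0}" by auto
    then show ?thesis using that unfolding free_space_carrier
      by (meson finite_subset order_trans)
  qed
  show "abelian_group (free_space X)"
  proof (rule abelian_groupI)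
    fix f assume f: "f \<in> carrier (free_space X)"
    show "\<exists>g\<in>carrier (free_space X). g \<oplus>\<^bsub>free_space X\<^esub> f = \<zero>\<^bsub>free_space X\<^esub>"
      by (rule bexI[of _ "\<lambda>x. -1 * f x"]) (use smult[OF f, of "-1"] in auto)
  qed (auto simp: add algebra_simps, simp add: free_space_carrier)
  show "\<And>a x. \<lbrakk>a \<in> carrier complex_alg; x \<in> carrier (free_space X)\<rbrakk>
       \<Longrightarrow> a \<odot>\<^bsub>free_space X\<^esub> x \<in> carrier (free_space X)"
    by (simp add: smult)
qed (auto simp: algebra_simps)

lemma ket_self [simp]: "ket x x = 1" by (simp add: ket_def)

lemma ket_support [simp]: "{y. ket x y \<noteq> 0} = {x}"
  by (auto simp: ket_def)

lemma ket_closed [simp]: "ket x \<in> carrier (free_space X) \<longleftrightarrow> x \<in> X"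
  by (simp add: free_space_carrier)

lemma free_space_induct [consumes 1, case_names ket zero add smult]:
  assumes "p \<in> carrier (free_space X)"
    and ket: "\<And>x. x \<in> X \<Longrightarrow> P (ket x)" and zero: "P (\<lambda>x. 0)"
    and add: "\<And>p q. \<lbrakk>p \<in> carrier (free_space X); q \<in> carrier (free_space X); P p; P q\<rbrakk>
      \<Longrightarrow> P (\<lambda>x. p x + q x)"
    and smult: "\<And>c p. \<lbrakk>p \<in> carrier (free_space X); P p\<rbrakk> \<Longrightarrow> P (\<lambda>x. c * p x)"
  shows "P p"
proof -
  \<comment> \<open>The induction runs over a finite set that contains the support, with
    \<open>p\<close> arbitrary, so that one coefficient can be erased at a time.\<close>
  have "p \<in> carrier (free_space X) \<Longrightarrow> P p" if "finite S" "{x. p x \<noteq> 0} \<subseteq> S" for S p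
    using that
  proof (induction S arbitrary: p)
    case empty
    then have "p = (\<lambda>x. 0)" by auto
    then show ?case using zero by simp
  next
    case (insert s S)
    show ?case
    proof (cases "p s = 0")
      case True
      then have "{x. p x \<noteq> 0} \<subseteq> S" using insert by auto
      then show ?thesis using insert by blast
    next
      case False
      then have s: "s \<in> X" using insert.prems by (auto simp: free_space_carrier)
      \<comment> \<open>Erasing the coefficient at \<open>s\<close> leaves a function supported in
        \<open>S\<close>; the erased part is a multiple of \<open>ket s\<close>.\<close>
      define q where "q = p(s := 0)"
      have q: "q \<in> carrier (free_space X)" "{x. q x \<noteq> 0} \<subseteq> S"
        using insert.prems(1,2) by (auto simp: q_def free_space_carrier elim: finite_subset[rotated])
      have k: "(\<lambda>x. p s * ket s x) \<in> carrier (free_space X)"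
        using cvec_smult_closed[of "free_space X" "ket s" "p s"] s by simp
      have "P (\<lambda>x. q x + p s * ket s x)"
        by (rule add[OF q(1) k insert.IH[OF q]]) (use smult ket s in simp)
      moreover have "(\<lambda>x. q x + p s * ket s x) = p" by (auto simp: q_def ket_def)
      ultimately show ?thesis by simp
    qed
  qed
  then show ?thesis using assms(1) by (auto simp: free_space_carrier)
qed

text \<open>This is the sum that occurs inside \<open>tensor_lift\<close>, detached from cosets so
  that linearity can be proved on formal sums first. It also serves for maps out of monoid
  algebras.\<close>

definition lin_ext :: "(complex, 'c, 'm) module_scheme \<Rightarrow> ('x \<Rightarrow> 'c) \<Rightarrow> ('x \<Rightarrow> complex) \<Rightarrow> 'c" where
  "lin_ext W b p = (\<Oplus>\<^bsub>W\<^esub>z\<in>{z. p z \<noteq> 0}. p z \<odot>\<^bsub>W\<^esub> b z)"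

lemma lin_ext_superset:
  assumes "cvec W" "finite S" "{z. p z \<noteq> 0} \<subseteq> S" "\<And>z. z \<in> S \<Longrightarrow> b z \<in> carrier W"
  shows "lin_ext W b p = (\<Oplus>\<^bsub>W\<^esub>z\<in>S. p z \<odot>\<^bsub>W\<^esub> b z)"
  unfolding lin_ext_def by (rule cvec_finsum_mono_neutral) (use assms in auto)

lemma lin_ext_linear:
  assumes W: "cvec W" and b: "\<And>x. x \<in> X \<Longrightarrow> b x \<in> carrier W"
  shows "lin_ext W b \<in> linear_maps (free_space X) W"
proof (rule linear_mapsI)
  fix p assume p: "p \<in> carrier (free_space X)"
  then show "lin_ext W b p \<in> carrier W"
    using W b by (auto simp: lin_ext_def free_space_carrier intro!: cvec_finsum_closed)
  fix q assume q: "q \<in> carrier (free_space X)"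
  \<comment> \<open>Cancellation may make the support of \<open>p + q\<close> smaller than the union
    of the supports, so all three sums are taken over this common finite set.\<close>
  define S where "S = {z. p z \<noteq> 0} \<union> {z. q z \<noteq> 0}"
  have S: "finite S" "\<And>z. z \<in> S \<Longrightarrow> b z \<in> carrier W"
    using p q b by (auto simp: S_def free_space_carrier)
  have 1: "lin_ext W b p = (\<Oplus>\<^bsub>W\<^esub>z\<in>S. p z \<odot>\<^bsub>W\<^esub> b z)"
    by (rule lin_ext_superset) (use W S in \<open>auto simp: S_def\<close>)
  have 2: "lin_ext W b q = (\<Oplus>\<^bsub>W\<^esub>z\<in>S. q z \<odot>\<^bsub>W\<^esub> b z)"
    by (rule lin_ext_superset) (use W S in \<open>auto simp: S_def\<close>)
  have "lin_ext W b (\<lambda>x. p x + q x) = (\<Oplus>\<^bsub>W\<^esub>z\<in>S. (p z + q z) \<odot>\<^bsub>W\<^esub> b z)"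
    by (rule lin_ext_superset) (use W S in \<open>auto simp: S_def\<close>)
  also have "\<dots> = (\<Oplus>\<^bsub>W\<^esub>z\<in>S. p z \<odot>\<^bsub>W\<^esub> b z \<oplus>\<^bsub>W\<^esub> q z \<odot>\<^bsub>W\<^esub> b z)"
    by (rule cvec_finsum_cong) (use W S in \<open>auto simp: cvec_smult_add_left\<close>)
  also have "\<dots> = lin_ext W b p \<oplus>\<^bsub>W\<^esub> lin_ext W b q"
    unfolding 1 2 by (rule cvec_finsum_add) (use W S in auto)
  finally show "lin_ext W b (p \<oplus>\<^bsub>free_space X\<^esub> q) = lin_ext W b p \<oplus>\<^bsub>W\<^esub> lin_ext W b q" by simp
next
  fix c p assume p: "p \<in> carrier (free_space X)"
  define S where "S = {z. p z \<noteq> 0}"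
  have S: "finite S" "\<And>z. z \<in> S \<Longrightarrow> b z \<in> carrier W"
    using p b by (auto simp: S_def free_space_carrier)
  have "lin_ext W b (\<lambda>x. c * p x) = (\<Oplus>\<^bsub>W\<^esub>z\<in>S. (c * p z) \<odot>\<^bsub>W\<^esub> b z)"
    by (rule lin_ext_superset) (use W S in \<open>auto simp: S_def\<close>)
  also have "\<dots> = (\<Oplus>\<^bsub>W\<^esub>z\<in>S. c \<odot>\<^bsub>W\<^esub> (p z \<odot>\<^bsub>W\<^esub> b z))"
    by (rule cvec_finsum_cong) (use W S in \<open>auto simp: cvec_smult_smult\<close>)
  also have "\<dots> = c \<odot>\<^bsub>W\<^esub> lin_ext W b p"
    unfolding lin_ext_def S_def[symmetric]
    by (rule module.finsum_smult_ldistr[symmetric]) (use W S in auto)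
  finally show "lin_ext W b (c \<odot>\<^bsub>free_space X\<^esub> p) = c \<odot>\<^bsub>W\<^esub> lin_ext W b p" by simp
qed

lemma lin_ext_ket: "\<lbrakk>cvec W; b x \<in> carrier W\<rbrakk> \<Longrightarrow> lin_ext W b (ket x) = b x"
  unfolding lin_ext_def ket_support
  using cvec_finsum_insert[of W "{}" x "\<lambda>z. ket x z \<odot>\<^bsub>W\<^esub> b z"] by simp

section \<open>Tensor products of vector spaces\<close>

definition bilinear ::
    "(complex, 'a, 'm) module_scheme \<Rightarrow> (complex, 'b, 'n) module_scheme \<Rightarrow>
      (complex, 'c, 'k) module_scheme \<Rightarrow> ('a \<Rightarrow> 'b \<Rightarrow> 'c) \<Rightarrow> bool" where
  "bilinear V W U b \<longleftrightarrow> (\<forall>x\<in>carrier V. b x \<in> linear_maps W U) \<and>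
     (\<forall>y\<in>carrier W. (\<lambda>x. b x y) \<in> linear_maps V U)"

lemma bilinearI:
  assumes "\<And>x y. \<lbrakk>x \<in> carrier V; y \<in> carrier W\<rbrakk> \<Longrightarrow> b x y \<in> carrier U"
    and "\<And>x x' y. \<lbrakk>x \<in> carrier V; x' \<in> carrier V; y \<in> carrier W\<rbrakk>
      \<Longrightarrow> b (x \<oplus>\<^bsub>V\<^esub> x') y = b x y \<oplus>\<^bsub>U\<^esub> b x' y"
    and "\<And>x y y'. \<lbrakk>x \<in> carrier V; y \<in> carrier W; y' \<in> carrier W\<rbrakk>
      \<Longrightarrow> b x (y \<oplus>\<^bsub>W\<^esub> y') = b x y \<oplus>\<^bsub>U\<^esub> b x y'"
    and "\<And>c x y. \<lbrakk>x \<in> carrier V; y \<in> carrier W\<rbrakk> \<Longrightarrow> b (c \<odot>\<^bsub>V\<^esub> x) y = c \<odot>\<^bsub>U\<^esub> b x y"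
    and "\<And>c x y. \<lbrakk>x \<in> carrier V; y \<in> carrier W\<rbrakk> \<Longrightarrow> b x (c \<odot>\<^bsub>W\<^esub> y) = c \<odot>\<^bsub>U\<^esub> b x y"
  shows "bilinear V W U b"
  using assms by (auto simp: bilinear_def linear_maps_def)

lemma bilinear_closed:
    "\<lbrakk>bilinear V W U b; x \<in> carrier V; y \<in> carrier W\<rbrakk> \<Longrightarrow> b x y \<in> carrier U"
  and bilinear_add_left: "\<lbrakk>bilinear V W U b; x \<in> carrier V; x' \<in> carrier V; y \<in> carrier W\<rbrakk>
      \<Longrightarrow> b (x \<oplus>\<^bsub>V\<^esub> x') y = b x y \<oplus>\<^bsub>U\<^esub> b x' y"
  and bilinear_add_right: "\<lbrakk>bilinear V W U b; x \<in> carrier V; y \<in> carrier W; y' \<in> carrier W\<rbrakk>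
      \<Longrightarrow> b x (y \<oplus>\<^bsub>W\<^esub> y') = b x y \<oplus>\<^bsub>U\<^esub> b x y'"
  and bilinear_smult_left: "\<lbrakk>bilinear V W U b; x \<in> carrier V; y \<in> carrier W\<rbrakk>
      \<Longrightarrow> b (c \<odot>\<^bsub>V\<^esub> x) y = c \<odot>\<^bsub>U\<^esub> b x y"
  and bilinear_smult_right: "\<lbrakk>bilinear V W U b; x \<in> carrier V; y \<in> carrier W\<rbrakk>
      \<Longrightarrow> b x (c \<odot>\<^bsub>W\<^esub> y) = c \<odot>\<^bsub>U\<^esub> b x y"
  by (auto simp: bilinear_def linear_maps_def)

lemma bilinear_linear_left:
    "\<lbrakk>bilinear V W U b; y \<in> carrier W\<rbrakk> \<Longrightarrow> (\<lambda>x. b x y) \<in> linear_maps V U"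
  and bilinear_linear_right: "\<lbrakk>bilinear V W U b; x \<in> carrier V\<rbrakk> \<Longrightarrow> b x \<in> linear_maps W U"
  by (auto simp: bilinear_def)

lemma bilinear_comp:
  assumes "bilinear V W U b" "f \<in> linear_maps V' V" "g \<in> linear_maps W' W" "h \<in> linear_maps U U'"
  shows "bilinear V' W' U' (\<lambda>x y. h (b (f x) (g y)))"
  using assms
  by (intro bilinearI) (simp_all add: linear_maps_closed linear_maps_add linear_maps_smult
    bilinear_closed bilinear_add_left bilinear_add_right bilinear_smult_left bilinear_smult_right)

text \<open>The spanning set inside \<open>tensor_null\<close> receives a name of its own, so that
  span induction and membership facts can refer to it.\<close>

definition tensor_rel ::
    "(complex, 'a, 'm) module_scheme \<Rightarrow> (complex, 'b, 'n) module_scheme \<Rightarrow> ('a \<times> 'b \<Rightarrow> complex) set" where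
  "tensor_rel V W = (let F = free_space (carrier V \<times> carrier W) in
     ({ket (x \<oplus>\<^bsub>V\<^esub> x', y) \<ominus>\<^bsub>F\<^esub> (ket (x, y) \<oplus>\<^bsub>F\<^esub> ket (x', y)) | x x' y.
         x \<in> carrier V \<and> x' \<in> carrier V \<and> y \<in> carrier W}
    \<union> {ket (x, y \<oplus>\<^bsub>W\<^esub> y') \<ominus>\<^bsub>F\<^esub> (ket (x, y) \<oplus>\<^bsub>F\<^esub> ket (x, y')) | x y y'.
         x \<in> carrier V \<and> y \<in> carrier W \<and> y' \<in> carrier W}
    \<union> {ket (c \<odot>\<^bsub>V\<^esub> x, y) \<ominus>\<^bsub>F\<^esub> c \<odot>\<^bsub>F\<^esub> ket (x, y) | c x y.
         x \<in> carrier V \<and> y \<in> carrier W}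
    \<union> {ket (x, c \<odot>\<^bsub>W\<^esub> y) \<ominus>\<^bsub>F\<^esub> c \<odot>\<^bsub>F\<^esub> ket (x, y) | c x y.
         x \<in> carrier V \<and> y \<in> carrier W}))"

lemma tensor_null_eq:
  "tensor_null V W = lin_span (free_space (carrier V \<times> carrier W)) (tensor_rel V W)"
  by (simp only: tensor_null_def tensor_rel_def Let_def)

context
  fixes V :: "(complex, 'a, 'm) module_scheme" and W :: "(complex, 'b, 'n) module_scheme"
  assumes V [simp]: "cvec V" and W [simp]: "cvec W"
begin

private abbreviation (input) "F \<equiv> free_space (carrier V \<times> carrier W)"
private abbreviation (input) "K \<equiv> tensor_null V W"
private abbreviation (input) "T \<equiv> tensor_space V W"

lemma free_space_pair_closed:
  "\<lbrakk>x \<in> carrier V; y \<in> carrier W\<rbrakk> \<Longrightarrow> c \<odot>\<^bsub>F\<^esub> ket (x, y) \<in> carrier F"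
  "\<lbrakk>p \<in> carrier F; q \<in> carrier F\<rbrakk> \<Longrightarrow> p \<oplus>\<^bsub>F\<^esub> q \<in> carrier F"
  "\<lbrakk>p \<in> carrier F; q \<in> carrier F\<rbrakk> \<Longrightarrow> p \<ominus>\<^bsub>F\<^esub> q \<in> carrier F"
  by (rule cvec_smult_closed cvec_add_closed cvec_minus_closed; simp)+

lemma tensor_rel_subset: "tensor_rel V W \<subseteq> carrier F"
  unfolding tensor_rel_def Let_def
  by (auto simp del: free_space_sel intro!: free_space_pair_closed)

lemma tensor_relI:
  "\<lbrakk>x \<in> carrier V; x' \<in> carrier V; y \<in> carrier W\<rbrakk> \<Longrightarrow>
    ket (x \<oplus>\<^bsub>V\<^esub> x', y) \<ominus>\<^bsub>F\<^esub> (ket (x, y) \<oplus>\<^bsub>F\<^esub> ket (x', y)) \<in> tensor_rel V W"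
  "\<lbrakk>x \<in> carrier V; y \<in> carrier W; y' \<in> carrier W\<rbrakk> \<Longrightarrow>
    ket (x, y \<oplus>\<^bsub>W\<^esub> y') \<ominus>\<^bsub>F\<^esub> (ket (x, y) \<oplus>\<^bsub>F\<^esub> ket (x, y')) \<in> tensor_rel V W"
  "\<lbrakk>x \<in> carrier V; y \<in> carrier W\<rbrakk> \<Longrightarrow>
    ket (c \<odot>\<^bsub>V\<^esub> x, y) \<ominus>\<^bsub>F\<^esub> c \<odot>\<^bsub>F\<^esub> ket (x, y) \<in> tensor_rel V W"
  "\<lbrakk>x \<in> carrier V; y \<in> carrier W\<rbrakk> \<Longrightarrow>
    ket (x, c \<odot>\<^bsub>W\<^esub> y) \<ominus>\<^bsub>F\<^esub> c \<odot>\<^bsub>F\<^esub> ket (x, y) \<in> tensor_rel V W"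
  unfolding tensor_rel_def Let_def Un_iff mem_Collect_eq by metis+

lemma tensor_null_submodule: "submodule K complex_alg F"
  unfolding tensor_null_eq by (rule lin_span_submodule) (simp_all add: tensor_rel_subset)

lemma tensor_space_sel [simp]:
  "zero T = K" "add T = set_add F" "smult T = (\<lambda>c X. \<Union>p\<in>X. K +>\<^bsub>F\<^esub> (c \<odot>\<^bsub>F\<^esub> p))"
  "carrier T = (\<lambda>p. K +>\<^bsub>F\<^esub> p) ` carrier F"
  by (simp_all add: tensor_space_def Let_def a_rcosets_image)

lemma tensor_proj_linear: "(\<lambda>p. K +>\<^bsub>F\<^esub> p) \<in> linear_maps F T"
  using coset_add[OF free_space_cvec tensor_null_submodule]
    coset_smult[OF free_space_cvec tensor_null_submodule]
  by (intro linear_mapsI) (simp_all del: free_space_sel)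

lemma tensor_space_cvec [simp]: "cvec T"
proof (rule cvec_image[of F])
  show "(\<lambda>p. K +>\<^bsub>F\<^esub> p) \<zero>\<^bsub>F\<^esub> = \<zero>\<^bsub>T\<^esub>"
    using coset_zero[OF free_space_cvec tensor_null_submodule] by simp
qed (use tensor_proj_linear in \<open>simp_all add: linear_maps_add linear_maps_smult del: free_space_sel tensor_space_sel(1-3)\<close>)

lemma pure_closed [simp]: "\<lbrakk>x \<in> carrier V; y \<in> carrier W\<rbrakk> \<Longrightarrow> pure V W x y \<in> carrier T"
  by (simp add: pure_def)

lemma tensor_proj_eq:
  assumes "p \<ominus>\<^bsub>F\<^esub> q \<in> tensor_rel V W" "p \<in> carrier F" "q \<in> carrier F"
  shows "K +>\<^bsub>F\<^esub> p = K +>\<^bsub>F\<^esub> q"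
proof -
  have "p \<ominus>\<^bsub>F\<^esub> q \<in> K" unfolding tensor_null_eq
    by (rule subsetD[OF lin_span_superset assms(1)])
  then show ?thesis using coset_eq_iff[OF free_space_cvec tensor_null_submodule assms(2,3)] by simp
qed

lemma pure_bilinear: "bilinear V W T (pure V W)"
proof (rule bilinearI)
  note lin = linear_maps_add[OF tensor_proj_linear, symmetric] linear_maps_smult[OF tensor_proj_linear, symmetric]
  fix x x' y y' c assume x: "x \<in> carrier V" and y: "y \<in> carrier W"
  show "pure V W x y \<in> carrier T" using x y by (rule pure_closed)
  show "pure V W (c \<odot>\<^bsub>V\<^esub> x) y = c \<odot>\<^bsub>T\<^esub> pure V W x y"
  proof -
    have "K +>\<^bsub>F\<^esub> ket (c \<odot>\<^bsub>V\<^esub> x, y) = K +>\<^bsub>F\<^esub> (c \<odot>\<^bsub>F\<^esub> ket (x, y))"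
    proof (rule tensor_proj_eq)
      show "ket (c \<odot>\<^bsub>V\<^esub> x, y) \<ominus>\<^bsub>F\<^esub> c \<odot>\<^bsub>F\<^esub> ket (x, y) \<in> tensor_rel V W"
        using x y by (intro tensor_relI)
    qed (use x y in \<open>simp_all add: free_space_pair_closed del: free_space_sel\<close>)
    then show ?thesis unfolding pure_def using x y by (simp add: lin del: free_space_sel tensor_space_sel)
  qed
  show "pure V W x (c \<odot>\<^bsub>W\<^esub> y) = c \<odot>\<^bsub>T\<^esub> pure V W x y"
  proof -
    have "K +>\<^bsub>F\<^esub> ket (x, c \<odot>\<^bsub>W\<^esub> y) = K +>\<^bsub>F\<^esub> (c \<odot>\<^bsub>F\<^esub> ket (x, y))"
    proof (rule tensor_proj_eq)
      show "ket (x, c \<odot>\<^bsub>W\<^esub> y) \<ominus>\<^bsub>F\<^esub> c \<odot>\<^bsub>F\<^esub> ket (x, y) \<in> tensor_rel V W"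
        using x y by (intro tensor_relI)
    qed (use x y in \<open>simp_all add: free_space_pair_closed del: free_space_sel\<close>)
    then show ?thesis unfolding pure_def using x y by (simp add: lin del: free_space_sel tensor_space_sel)
  qed
  show "pure V W (x \<oplus>\<^bsub>V\<^esub> x') y = pure V W x y \<oplus>\<^bsub>T\<^esub> pure V W x' y" if x': "x' \<in> carrier V"
  proof -
    have "K +>\<^bsub>F\<^esub> ket (x \<oplus>\<^bsub>V\<^esub> x', y) = K +>\<^bsub>F\<^esub> (ket (x, y) \<oplus>\<^bsub>F\<^esub> ket (x', y))"
    proof (rule tensor_proj_eq)
      show "ket (x \<oplus>\<^bsub>V\<^esub> x', y) \<ominus>\<^bsub>F\<^esub> (ket (x, y) \<oplus>\<^bsub>F\<^esub> ket (x', y)) \<in> tensor_rel V W"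
        using x x' y by (intro tensor_relI)
    qed (use x x' y in \<open>simp_all add: free_space_pair_closed del: free_space_sel\<close>)
    then show ?thesis unfolding pure_def using x x' y by (simp add: lin del: free_space_sel tensor_space_sel)
  qed
  show "pure V W x (y \<oplus>\<^bsub>W\<^esub> y') = pure V W x y \<oplus>\<^bsub>T\<^esub> pure V W x y'" if y': "y' \<in> carrier W"
  proof -
    have "K +>\<^bsub>F\<^esub> ket (x, y \<oplus>\<^bsub>W\<^esub> y') = K +>\<^bsub>F\<^esub> (ket (x, y) \<oplus>\<^bsub>F\<^esub> ket (x, y'))"
    proof (rule tensor_proj_eq)
      show "ket (x, y \<oplus>\<^bsub>W\<^esub> y') \<ominus>\<^bsub>F\<^esub> (ket (x, y) \<oplus>\<^bsub>F\<^esub> ket (x, y')) \<in> tensor_rel V W"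
        using x y y' by (intro tensor_relI)
    qed (use x y y' in \<open>simp_all add: free_space_pair_closed del: free_space_sel\<close>)
    then show ?thesis unfolding pure_def using x y y' by (simp add: lin del: free_space_sel tensor_space_sel)
  qed
qed

lemma pure_zero_left: "y \<in> carrier W \<Longrightarrow> pure V W \<zero>\<^bsub>V\<^esub> y = \<zero>\<^bsub>T\<^esub>"
  using linear_maps_zero[OF bilinear_linear_left[OF pure_bilinear]]
  by (simp del: tensor_space_sel)

lemma pure_zero_right: "x \<in> carrier V \<Longrightarrow> pure V W x \<zero>\<^bsub>W\<^esub> = \<zero>\<^bsub>T\<^esub>"
  using linear_maps_zero[OF bilinear_linear_right[OF pure_bilinear]]
  by (simp del: tensor_space_sel)

text \<open>Neither a scalar case nor a zero case is required of the user: a multiple of a pure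
  tensor is pure, and so is zero.\<close>

lemma tensor_induct [consumes 1, case_names pure add]:
  assumes t: "t \<in> carrier T"
    and pure: "\<And>x y. \<lbrakk>x \<in> carrier V; y \<in> carrier W\<rbrakk> \<Longrightarrow> P (pure V W x y)"
    and add: "\<And>s t. \<lbrakk>s \<in> carrier T; t \<in> carrier T; P s; P t\<rbrakk> \<Longrightarrow> P (s \<oplus>\<^bsub>T\<^esub> t)"
  shows "P t"
proof -
  \<comment> \<open>The scalar \<open>c\<close> is part of the claim: in the scaling case of the
    induction over formal sums it absorbs the new factor, for which \<open>P\<close> offers no
    rule.\<close>
  have "P (c \<odot>\<^bsub>T\<^esub> (K +>\<^bsub>F\<^esub> p))" if "p \<in> carrier F" for p c
    using that
  proof (induction arbitrary: c rule: free_space_induct)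
    case (ket z)
    obtain x y where z: "z = (x, y)" "x \<in> carrier V" "y \<in> carrier W" using ket by auto
    then have "c \<odot>\<^bsub>T\<^esub> (K +>\<^bsub>F\<^esub> ket z) = pure V W (c \<odot>\<^bsub>V\<^esub> x) y"
      using bilinear_smult_left[OF pure_bilinear, of x y c] by (simp add: pure_def)
    then show ?case using pure[of "c \<odot>\<^bsub>V\<^esub> x" y] z by simp
  next
    case zero
    have "c \<odot>\<^bsub>T\<^esub> (K +>\<^bsub>F\<^esub> \<zero>\<^bsub>F\<^esub>) = \<zero>\<^bsub>T\<^esub>"
      using linear_maps_zero[OF tensor_proj_linear] by (simp del: tensor_space_sel free_space_sel)
    also have "\<dots> = pure V W \<zero>\<^bsub>V\<^esub> \<zero>\<^bsub>W\<^esub>" by (rule pure_zero_left[symmetric]) simp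
    finally show ?case using pure[of "\<zero>\<^bsub>V\<^esub>" "\<zero>\<^bsub>W\<^esub>"] by (simp del: tensor_space_sel)
  next
    case (add p q)
    have "c \<odot>\<^bsub>T\<^esub> (K +>\<^bsub>F\<^esub> (p \<oplus>\<^bsub>F\<^esub> q)) = c \<odot>\<^bsub>T\<^esub> (K +>\<^bsub>F\<^esub> p) \<oplus>\<^bsub>T\<^esub> c \<odot>\<^bsub>T\<^esub> (K +>\<^bsub>F\<^esub> q)"
      using linear_maps_closed[OF tensor_proj_linear] add(1,2)
      by (subst linear_maps_add[OF tensor_proj_linear])
        (simp_all add: cvec_smult_add del: tensor_space_sel free_space_sel)
    moreover have "c \<odot>\<^bsub>T\<^esub> (K +>\<^bsub>F\<^esub> p) \<in> carrier T" "c \<odot>\<^bsub>T\<^esub> (K +>\<^bsub>F\<^esub> q) \<in> carrier T"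
      using add(1,2) linear_maps_closed[OF tensor_proj_linear]
      by (simp_all del: tensor_space_sel)
    ultimately show ?case using assms(3) add(3,4) by (simp del: tensor_space_sel)
  next
    case (smult d p)
    have "c \<odot>\<^bsub>T\<^esub> (K +>\<^bsub>F\<^esub> (d \<odot>\<^bsub>F\<^esub> p)) = (c * d) \<odot>\<^bsub>T\<^esub> (K +>\<^bsub>F\<^esub> p)"
      using linear_maps_closed[OF tensor_proj_linear] smult(1)
      by (subst linear_maps_smult[OF tensor_proj_linear])
        (simp_all add: cvec_smult_smult del: tensor_space_sel free_space_sel)
    then show ?case using smult(2) by (simp del: tensor_space_sel)
  qed
  moreover obtain p where "p \<in> carrier F" "t = K +>\<^bsub>F\<^esub> p" using t by auto
  ultimately have "P (1 \<odot>\<^bsub>T\<^esub> t)" by blast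
  then show ?thesis using t by (simp del: tensor_space_sel)
qed

lemma tensor_ext:
  assumes "f \<in> linear_maps T U" "g \<in> linear_maps T U"
    and "\<And>x y. \<lbrakk>x \<in> carrier V; y \<in> carrier W\<rbrakk> \<Longrightarrow> f (pure V W x y) = g (pure V W x y)"
    and "t \<in> carrier T"
  shows "f t = g t"
  using assms(4)
  by (induction rule: tensor_induct)
    (use assms in \<open>simp_all add: linear_maps_add del: tensor_space_sel\<close>)

context
  fixes U :: "(complex, 'c, 'k) module_scheme" and b
  assumes U [simp]: "cvec U" and b: "bilinear V W U b"
begin

text \<open>The universal property of the tensor product: the linear extension of \<open>b\<close>
  to formal sums is constant on cosets of the null space, so \<open>the_elem\<close> returns its
  value.\<close>

lemma tensor_lift_proj:
  assumes p: "p \<in> carrier F"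
  shows "tensor_lift U b (K +>\<^bsub>F\<^esub> p) = lin_ext U (\<lambda>z. b (fst z) (snd z)) p"
proof -
  let ?f = "lin_ext U (\<lambda>z. b (fst z) (snd z))"
  have lin: "?f \<in> linear_maps F U"
    by (rule lin_ext_linear) (use bilinear_closed[OF b] in auto)
  have ket: "?f (ket (x, y)) = b x y" if "x \<in> carrier V" "y \<in> carrier W" for x y
    using lin_ext_ket[of U "\<lambda>z. b (fst z) (snd z)" "(x, y)"] bilinear_closed[OF b] that by simp
  \<comment> \<open>The four kinds of relations correspond to the four identities of bilinearity, so
    each of them is sent to zero.\<close>
  have rel: "?f z = \<zero>\<^bsub>U\<^esub>" if "z \<in> tensor_rel V W" for z
    using that unfolding tensor_rel_def Let_def
    by (auto simp del: free_space_sel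
      simp: linear_maps_minus[OF lin] linear_maps_add[OF lin] linear_maps_smult[OF lin] ket
        free_space_pair_closed cvec_minus_eq_zero_iff bilinear_closed[OF b] bilinear_add_left[OF b]
        bilinear_add_right[OF b] bilinear_smult_left[OF b] bilinear_smult_right[OF b])
  have null: "?f z = \<zero>\<^bsub>U\<^esub>" if "z \<in> K" for z
    using that[unfolded tensor_null_eq] free_space_cvec tensor_rel_subset
    by (induction rule: lin_span_induct)
      (simp_all add: rel linear_maps_add[OF lin] linear_maps_smult[OF lin]
        linear_maps_zero[OF lin] del: free_space_sel)
  have "tensor_lift U b t = the_elem (?f ` t)" for t
    by (simp add: tensor_lift_def lin_ext_def)
  then show ?thesis
    using coset_the_elem_linear[OF free_space_cvec tensor_null_submodule p U lin null] by simp
qed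

lemma tensor_lift_linear: "tensor_lift U b \<in> linear_maps T U"
proof (rule linear_mapsI)
  have lin: "lin_ext U (\<lambda>z. b (fst z) (snd z)) \<in> linear_maps F U"
    by (rule lin_ext_linear) (use bilinear_closed[OF b] in auto)
  note hom = linear_maps_add[OF tensor_proj_linear, symmetric] linear_maps_smult[OF tensor_proj_linear, symmetric]
  fix s t c assume "s \<in> carrier T"
  then obtain p where p: "p \<in> carrier F" "s = K +>\<^bsub>F\<^esub> p" by auto
  show "tensor_lift U b s \<in> carrier U"
    using p linear_maps_closed[OF lin] by (simp add: tensor_lift_proj)
  have cl: "c \<odot>\<^bsub>F\<^esub> p \<in> carrier F" using p by (intro cvec_smult_closed) simp_all
  show "tensor_lift U b (c \<odot>\<^bsub>T\<^esub> s) = c \<odot>\<^bsub>U\<^esub> tensor_lift U b s"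
    unfolding p using p cl
    by (simp add: tensor_lift_proj hom linear_maps_smult[OF lin] del: tensor_space_sel free_space_sel)
  assume "t \<in> carrier T"
  then obtain q where q: "q \<in> carrier F" "t = K +>\<^bsub>F\<^esub> q" by auto
  have cl: "p \<oplus>\<^bsub>F\<^esub> q \<in> carrier F" using p q by (intro cvec_add_closed) simp_all
  show "tensor_lift U b (s \<oplus>\<^bsub>T\<^esub> t) = tensor_lift U b s \<oplus>\<^bsub>U\<^esub> tensor_lift U b t"
    unfolding p q using p q cl
    by (simp add: tensor_lift_proj hom linear_maps_add[OF lin] del: tensor_space_sel free_space_sel)
qed

lemma tensor_lift_pure [simp]:
  assumes "x \<in> carrier V" "y \<in> carrier W" shows "tensor_lift U b (pure V W x y) = b x y"
  unfolding pure_def using assms bilinear_closed[OF b]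
  by (subst tensor_lift_proj) (simp_all add: lin_ext_ket)

end

end

text \<open>From here on tensors are handled through \<open>pure\<close>,
  \<open>tensor_induct\<close> and \<open>tensor_lift\<close>; the description by cosets stays
  hidden from the simplifier.\<close>

declare tensor_space_sel [simp del] free_space_sel [simp del]

section \<open>Unital *-algebras\<close>

lemma star_algebra_cvec [simp]: "star_algebra A \<Longrightarrow> cvec A"
  by (simp add: star_algebra_def)

lemma star_algebra_ring: "star_algebra A \<Longrightarrow> ring A"
  by (simp add: star_algebra_def)

context
  fixes A :: "('a, 'm) star_alg_scheme"
  assumes A: "star_algebra A"
begin

interpretation star_algebra A by fact

lemma alg_mult_closed [simp]: "\<lbrakk>x \<in> carrier A; y \<in> carrier A\<rbrakk> \<Longrightarrow> x \<otimes>\<^bsub>A\<^esub> y \<in> carrier A"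
  and alg_one_closed [simp]: "\<one>\<^bsub>A\<^esub> \<in> carrier A"
  and alg_mult_assoc: "\<lbrakk>x \<in> carrier A; y \<in> carrier A; z \<in> carrier A\<rbrakk>
    \<Longrightarrow> (x \<otimes>\<^bsub>A\<^esub> y) \<otimes>\<^bsub>A\<^esub> z = x \<otimes>\<^bsub>A\<^esub> (y \<otimes>\<^bsub>A\<^esub> z)"
  and alg_l_one [simp]: "x \<in> carrier A \<Longrightarrow> \<one>\<^bsub>A\<^esub> \<otimes>\<^bsub>A\<^esub> x = x"
  and alg_r_one [simp]: "x \<in> carrier A \<Longrightarrow> x \<otimes>\<^bsub>A\<^esub> \<one>\<^bsub>A\<^esub> = x"
  and alg_mult_zero [simp]: "x \<in> carrier A \<Longrightarrow> x \<otimes>\<^bsub>A\<^esub> \<zero>\<^bsub>A\<^esub> = \<zero>\<^bsub>A\<^esub>"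
  and alg_zero_mult [simp]: "x \<in> carrier A \<Longrightarrow> \<zero>\<^bsub>A\<^esub> \<otimes>\<^bsub>A\<^esub> x = \<zero>\<^bsub>A\<^esub>"
  and alg_mult_add: "\<lbrakk>x \<in> carrier A; y \<in> carrier A; z \<in> carrier A\<rbrakk>
    \<Longrightarrow> x \<otimes>\<^bsub>A\<^esub> (y \<oplus>\<^bsub>A\<^esub> z) = x \<otimes>\<^bsub>A\<^esub> y \<oplus>\<^bsub>A\<^esub> x \<otimes>\<^bsub>A\<^esub> z"
  and alg_add_mult: "\<lbrakk>x \<in> carrier A; y \<in> carrier A; z \<in> carrier A\<rbrakk>
    \<Longrightarrow> (x \<oplus>\<^bsub>A\<^esub> y) \<otimes>\<^bsub>A\<^esub> z = x \<otimes>\<^bsub>A\<^esub> z \<oplus>\<^bsub>A\<^esub> y \<otimes>\<^bsub>A\<^esub> z"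
  and alg_smult_mult: "\<lbrakk>x \<in> carrier A; y \<in> carrier A\<rbrakk>
    \<Longrightarrow> (c \<odot>\<^bsub>A\<^esub> x) \<otimes>\<^bsub>A\<^esub> y = c \<odot>\<^bsub>A\<^esub> (x \<otimes>\<^bsub>A\<^esub> y)"
  and alg_mult_smult: "\<lbrakk>x \<in> carrier A; y \<in> carrier A\<rbrakk>
    \<Longrightarrow> x \<otimes>\<^bsub>A\<^esub> (c \<odot>\<^bsub>A\<^esub> y) = c \<odot>\<^bsub>A\<^esub> (x \<otimes>\<^bsub>A\<^esub> y)"
  and alg_star_closed [simp]: "x \<in> carrier A \<Longrightarrow> star A x \<in> carrier A"
  and alg_star_star [simp]: "x \<in> carrier A \<Longrightarrow> star A (star A x) = x"
  and alg_star_add: "\<lbrakk>x \<in> carrier A; y \<in> carrier A\<rbrakk>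
    \<Longrightarrow> star A (x \<oplus>\<^bsub>A\<^esub> y) = star A x \<oplus>\<^bsub>A\<^esub> star A y"
  and alg_star_smult: "x \<in> carrier A \<Longrightarrow> star A (c \<odot>\<^bsub>A\<^esub> x) = cnj c \<odot>\<^bsub>A\<^esub> star A x"
  and alg_star_mult: "\<lbrakk>x \<in> carrier A; y \<in> carrier A\<rbrakk>
    \<Longrightarrow> star A (x \<otimes>\<^bsub>A\<^esub> y) = star A y \<otimes>\<^bsub>A\<^esub> star A x"
  by (simp_all add: A.m_assoc A.l_distr A.r_distr smult_mult_left smult_mult_right
    star_closed star_star star_add star_smult star_mult)

lemma alg_star_one [simp]: "star A \<one>\<^bsub>A\<^esub> = \<one>\<^bsub>A\<^esub>"
  by (metis alg_l_one alg_one_closed alg_star_closed alg_star_mult alg_star_star)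

lemma alg_star_zero [simp]: "star A \<zero>\<^bsub>A\<^esub> = \<zero>\<^bsub>A\<^esub>"
  using alg_star_smult[of "\<zero>\<^bsub>A\<^esub>" 0] A by simp

lemma alg_mult_linear_left: "y \<in> carrier A \<Longrightarrow> (\<lambda>x. x \<otimes>\<^bsub>A\<^esub> y) \<in> linear_maps A A"
  by (rule linear_mapsI) (simp_all add: alg_add_mult alg_smult_mult)

lemma alg_mult_linear_right: "y \<in> carrier A \<Longrightarrow> (\<lambda>x. y \<otimes>\<^bsub>A\<^esub> x) \<in> linear_maps A A"
  by (rule linear_mapsI) (simp_all add: alg_mult_add alg_mult_smult)

lemma alg_mult_finsum:
  "\<lbrakk>y \<in> carrier A; \<And>i. i \<in> I \<Longrightarrow> f i \<in> carrier A\<rbrakk>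
    \<Longrightarrow> y \<otimes>\<^bsub>A\<^esub> finsum A f I = (\<Oplus>\<^bsub>A\<^esub>i\<in>I. y \<otimes>\<^bsub>A\<^esub> f i)"
  by (rule linear_maps_finsum[OF alg_mult_linear_right]) (use A in simp_all)

lemma alg_finsum_mult:
  "\<lbrakk>y \<in> carrier A; \<And>i. i \<in> I \<Longrightarrow> f i \<in> carrier A\<rbrakk>
    \<Longrightarrow> finsum A f I \<otimes>\<^bsub>A\<^esub> y = (\<Oplus>\<^bsub>A\<^esub>i\<in>I. f i \<otimes>\<^bsub>A\<^esub> y)"
  by (rule linear_maps_finsum[OF alg_mult_linear_left]) (use A in simp_all)

lemma alg_star_minus:
  "\<lbrakk>x \<in> carrier A; y \<in> carrier A\<rbrakk> \<Longrightarrow> star A (x \<ominus>\<^bsub>A\<^esub> y) = star A x \<ominus>\<^bsub>A\<^esub> star A y"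
  using A by (simp add: cvec_minus alg_star_add alg_star_smult)

lemma alg_star_finsum:
  assumes "\<And>i. i \<in> I \<Longrightarrow> f i \<in> carrier A"
  shows "star A (finsum A f I) = (\<Oplus>\<^bsub>A\<^esub>i\<in>I. star A (f i))"
proof (cases "finite I")
  case True
  then show ?thesis using assms
    by (induction I) (use A in \<open>simp_all add: cvec_finsum_insert alg_star_add\<close>)
next
  case False
  then show ?thesis using A
    by (simp add: abelian_monoid.finsum_infinite[OF cvec_abelian_monoid])
qed

end

lemma alg_finsum_mult_finsum:
  assumes A: "star_algebra A" and "\<And>i. i \<in> I \<Longrightarrow> f i \<in> carrier A" "\<And>j. j \<in> J \<Longrightarrow> g j \<in> carrier A"
  shows "finsum A f I \<otimes>\<^bsub>A\<^esub> finsum A g J = (\<Oplus>\<^bsub>A\<^esub>i\<in>I. \<Oplus>\<^bsub>A\<^esub>j\<in>J. f i \<otimes>\<^bsub>A\<^esub> g j)"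
proof -
  have "finsum A f I \<otimes>\<^bsub>A\<^esub> finsum A g J = (\<Oplus>\<^bsub>A\<^esub>i\<in>I. f i \<otimes>\<^bsub>A\<^esub> finsum A g J)"
    by (rule alg_finsum_mult) (use assms in simp_all)
  also have "\<dots> = (\<Oplus>\<^bsub>A\<^esub>i\<in>I. \<Oplus>\<^bsub>A\<^esub>j\<in>J. f i \<otimes>\<^bsub>A\<^esub> g j)"
    by (intro cvec_finsum_cong alg_mult_finsum) (use assms in simp_all)
  finally show ?thesis .
qed

lemma star_algebraI:
  assumes "cvec A"
    and "\<And>x y. \<lbrakk>x \<in> carrier A; y \<in> carrier A\<rbrakk> \<Longrightarrow> x \<otimes>\<^bsub>A\<^esub> y \<in> carrier A"
    and "\<one>\<^bsub>A\<^esub> \<in> carrier A"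
    and "\<And>x y z. \<lbrakk>x \<in> carrier A; y \<in> carrier A; z \<in> carrier A\<rbrakk>
      \<Longrightarrow> (x \<otimes>\<^bsub>A\<^esub> y) \<otimes>\<^bsub>A\<^esub> z = x \<otimes>\<^bsub>A\<^esub> (y \<otimes>\<^bsub>A\<^esub> z)"
    and "\<And>x. x \<in> carrier A \<Longrightarrow> \<one>\<^bsub>A\<^esub> \<otimes>\<^bsub>A\<^esub> x = x"
    and "\<And>x. x \<in> carrier A \<Longrightarrow> x \<otimes>\<^bsub>A\<^esub> \<one>\<^bsub>A\<^esub> = x"
    and "\<And>x y z. \<lbrakk>x \<in> carrier A; y \<in> carrier A; z \<in> carrier A\<rbrakk>
      \<Longrightarrow> x \<otimes>\<^bsub>A\<^esub> (y \<oplus>\<^bsub>A\<^esub> z) = x \<otimes>\<^bsub>A\<^esub> y \<oplus>\<^bsub>A\<^esub> x \<otimes>\<^bsub>A\<^esub> z"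
    and "\<And>x y z. \<lbrakk>x \<in> carrier A; y \<in> carrier A; z \<in> carrier A\<rbrakk>
      \<Longrightarrow> (x \<oplus>\<^bsub>A\<^esub> y) \<otimes>\<^bsub>A\<^esub> z = x \<otimes>\<^bsub>A\<^esub> z \<oplus>\<^bsub>A\<^esub> y \<otimes>\<^bsub>A\<^esub> z"
    and "\<And>c x y. \<lbrakk>x \<in> carrier A; y \<in> carrier A\<rbrakk> \<Longrightarrow> (c \<odot>\<^bsub>A\<^esub> x) \<otimes>\<^bsub>A\<^esub> y = c \<odot>\<^bsub>A\<^esub> (x \<otimes>\<^bsub>A\<^esub> y)"
    and "\<And>c x y. \<lbrakk>x \<in> carrier A; y \<in> carrier A\<rbrakk> \<Longrightarrow> x \<otimes>\<^bsub>A\<^esub> (c \<odot>\<^bsub>A\<^esub> y) = c \<odot>\<^bsub>A\<^esub> (x \<otimes>\<^bsub>A\<^esub> y)"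
    and "\<And>x. x \<in> carrier A \<Longrightarrow> star A x \<in> carrier A"
    and "\<And>x. x \<in> carrier A \<Longrightarrow> star A (star A x) = x"
    and "\<And>x y. \<lbrakk>x \<in> carrier A; y \<in> carrier A\<rbrakk> \<Longrightarrow> star A (x \<oplus>\<^bsub>A\<^esub> y) = star A x \<oplus>\<^bsub>A\<^esub> star A y"
    and "\<And>c x. x \<in> carrier A \<Longrightarrow> star A (c \<odot>\<^bsub>A\<^esub> x) = cnj c \<odot>\<^bsub>A\<^esub> star A x"
    and "\<And>x y. \<lbrakk>x \<in> carrier A; y \<in> carrier A\<rbrakk> \<Longrightarrow> star A (x \<otimes>\<^bsub>A\<^esub> y) = star A y \<otimes>\<^bsub>A\<^esub> star A x"
  shows "star_algebra A"
proof (rule star_algebra.intro)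
  show "ring A"
    by (rule ringI[OF cvec_abelian_group[OF assms(1)] monoidI]) (simp_all add: assms)
  show "star_algebra_axioms A"
    by (rule star_algebra_axioms.intro) (use assms in auto)
qed fact

text \<open>The counterpart of \<open>cvec_image\<close> for all operations at once. It yields
  quotients by *-ideals, records with additional fields and, in the end, the smash product as the
  image of a known algebra.\<close>

lemma star_algebra_image:
  assumes A: "star_algebra A"
    and surj: "f ` carrier A = carrier B"
    and add: "\<And>x y. \<lbrakk>x \<in> carrier A; y \<in> carrier A\<rbrakk> \<Longrightarrow> f (x \<oplus>\<^bsub>A\<^esub> y) = f x \<oplus>\<^bsub>B\<^esub> f y"
    and smult: "\<And>c x. x \<in> carrier A \<Longrightarrow> f (c \<odot>\<^bsub>A\<^esub> x) = c \<odot>\<^bsub>B\<^esub> f x"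
    and zero: "f \<zero>\<^bsub>A\<^esub> = \<zero>\<^bsub>B\<^esub>"
    and mult: "\<And>x y. \<lbrakk>x \<in> carrier A; y \<in> carrier A\<rbrakk> \<Longrightarrow> f (x \<otimes>\<^bsub>A\<^esub> y) = f x \<otimes>\<^bsub>B\<^esub> f y"
    and one: "f \<one>\<^bsub>A\<^esub> = \<one>\<^bsub>B\<^esub>"
    and star: "\<And>x. x \<in> carrier A \<Longrightarrow> f (star A x) = star B (f x)"
  shows "star_algebra B"
proof -
  have B: "cvec B" by (rule cvec_image[of A f]) (use assms in auto)
  have im: "\<exists>x'\<in>carrier A. x = f x'" if "x \<in> carrier B" for x using that surj by auto
  have cl: "f x \<in> carrier B" if "x \<in> carrier A" for x using that surj by auto
  note hom = add[symmetric] smult[symmetric] zero[symmetric] mult[symmetric] one[symmetric] star[symmetric]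
  show ?thesis
  proof (rule star_algebraI[OF B])
    show "\<one>\<^bsub>B\<^esub> \<in> carrier B" using A cl by (simp add: hom)
    fix x y z c
    assume "x \<in> carrier B"
    then obtain x' where x: "x = f x'" "x' \<in> carrier A" using im by blast
    show "\<one>\<^bsub>B\<^esub> \<otimes>\<^bsub>B\<^esub> x = x" "x \<otimes>\<^bsub>B\<^esub> \<one>\<^bsub>B\<^esub> = x" "star B x \<in> carrier B" "star B (star B x) = x"
      "star B (c \<odot>\<^bsub>B\<^esub> x) = cnj c \<odot>\<^bsub>B\<^esub> star B x"
      using x A cl by (simp_all add: hom alg_star_smult)
    assume "y \<in> carrier B"
    then obtain y' where y: "y = f y'" "y' \<in> carrier A" using im by blast
    show "x \<otimes>\<^bsub>B\<^esub> y \<in> carrier B" "(c \<odot>\<^bsub>B\<^esub> x) \<otimes>\<^bsub>B\<^esub> y = c \<odot>\<^bsub>B\<^esub> (x \<otimes>\<^bsub>B\<^esub> y)"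
      "x \<otimes>\<^bsub>B\<^esub> (c \<odot>\<^bsub>B\<^esub> y) = c \<odot>\<^bsub>B\<^esub> (x \<otimes>\<^bsub>B\<^esub> y)"
      "star B (x \<oplus>\<^bsub>B\<^esub> y) = star B x \<oplus>\<^bsub>B\<^esub> star B y" "star B (x \<otimes>\<^bsub>B\<^esub> y) = star B y \<otimes>\<^bsub>B\<^esub> star B x"
      using x y A cl
      by (simp_all add: hom alg_smult_mult alg_mult_smult alg_star_add alg_star_mult)
    assume "z \<in> carrier B"
    then obtain z' where z: "z = f z'" "z' \<in> carrier A" using im by blast
    show "(x \<otimes>\<^bsub>B\<^esub> y) \<otimes>\<^bsub>B\<^esub> z = x \<otimes>\<^bsub>B\<^esub> (y \<otimes>\<^bsub>B\<^esub> z)"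
      "x \<otimes>\<^bsub>B\<^esub> (y \<oplus>\<^bsub>B\<^esub> z) = x \<otimes>\<^bsub>B\<^esub> y \<oplus>\<^bsub>B\<^esub> x \<otimes>\<^bsub>B\<^esub> z"
      "(x \<oplus>\<^bsub>B\<^esub> y) \<otimes>\<^bsub>B\<^esub> z = x \<otimes>\<^bsub>B\<^esub> z \<oplus>\<^bsub>B\<^esub> y \<otimes>\<^bsub>B\<^esub> z"
      using x y z A by (simp_all add: hom alg_mult_assoc alg_mult_add alg_add_mult)
  qed
qed

subsection \<open>Homomorphisms\<close>

lemma alg_homI:
  assumes "f \<in> linear_maps A B"
    and "\<And>x y. \<lbrakk>x \<in> carrier A; y \<in> carrier A\<rbrakk> \<Longrightarrow> f (x \<otimes>\<^bsub>A\<^esub> y) = f x \<otimes>\<^bsub>B\<^esub> f y"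
    and "f \<one>\<^bsub>A\<^esub> = \<one>\<^bsub>B\<^esub>"
  shows "f \<in> alg_hom A B"
  using assms by (auto simp: alg_hom_def ring_hom_def linear_maps_def)

lemma alg_hom_linear: "f \<in> alg_hom A B \<Longrightarrow> f \<in> linear_maps A B"
  and alg_hom_mult: "\<lbrakk>f \<in> alg_hom A B; x \<in> carrier A; y \<in> carrier A\<rbrakk>
    \<Longrightarrow> f (x \<otimes>\<^bsub>A\<^esub> y) = f x \<otimes>\<^bsub>B\<^esub> f y"
  and alg_hom_one: "f \<in> alg_hom A B \<Longrightarrow> f \<one>\<^bsub>A\<^esub> = \<one>\<^bsub>B\<^esub>"
  by (auto simp: alg_hom_def ring_hom_def)

lemma star_homI:
  assumes "f \<in> linear_maps A B"
    and "\<And>x y. \<lbrakk>x \<in> carrier A; y \<in> carrier A\<rbrakk> \<Longrightarrow> f (x \<otimes>\<^bsub>A\<^esub> y) = f x \<otimes>\<^bsub>B\<^esub> f y"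
    and "f \<one>\<^bsub>A\<^esub> = \<one>\<^bsub>B\<^esub>"
    and "\<And>x. x \<in> carrier A \<Longrightarrow> f (star A x) = star B (f x)"
  shows "f \<in> star_hom A B"
  using assms by (auto simp: star_hom_def intro: alg_homI)

lemma star_hom_alg_hom: "f \<in> star_hom A B \<Longrightarrow> f \<in> alg_hom A B"
  and star_hom_linear: "f \<in> star_hom A B \<Longrightarrow> f \<in> linear_maps A B"
  and star_hom_closed: "\<lbrakk>f \<in> star_hom A B; x \<in> carrier A\<rbrakk> \<Longrightarrow> f x \<in> carrier B"
  and star_hom_mult: "\<lbrakk>f \<in> star_hom A B; x \<in> carrier A; y \<in> carrier A\<rbrakk>
    \<Longrightarrow> f (x \<otimes>\<^bsub>A\<^esub> y) = f x \<otimes>\<^bsub>B\<^esub> f y"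
  and star_hom_one: "f \<in> star_hom A B \<Longrightarrow> f \<one>\<^bsub>A\<^esub> = \<one>\<^bsub>B\<^esub>"
  and star_hom_star: "\<lbrakk>f \<in> star_hom A B; x \<in> carrier A\<rbrakk> \<Longrightarrow> f (star A x) = star B (f x)"
  and star_hom_add: "\<lbrakk>f \<in> star_hom A B; x \<in> carrier A; y \<in> carrier A\<rbrakk>
    \<Longrightarrow> f (x \<oplus>\<^bsub>A\<^esub> y) = f x \<oplus>\<^bsub>B\<^esub> f y"
  and star_hom_smult: "\<lbrakk>f \<in> star_hom A B; x \<in> carrier A\<rbrakk> \<Longrightarrow> f (c \<odot>\<^bsub>A\<^esub> x) = c \<odot>\<^bsub>B\<^esub> f x"
  by (auto simp: star_hom_def alg_hom_linear alg_hom_mult alg_hom_one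
    dest!: alg_hom_linear intro: linear_maps_closed linear_maps_add linear_maps_smult)

lemma star_hom_comp:
  "\<lbrakk>f \<in> star_hom A B; g \<in> star_hom B C\<rbrakk> \<Longrightarrow> (\<lambda>x. g (f x)) \<in> star_hom A C"
  by (rule star_homI) (simp_all add: star_hom_closed star_hom_mult star_hom_one star_hom_star
    linear_maps_comp[OF star_hom_linear star_hom_linear])

text \<open>A finite sum reads only carrier, addition and zero. This moves sums between records that
  are different objects but agree in these fields, such as \<open>tensor_alg\<close> and
  \<open>tensor_space\<close>.\<close>

lemma finsum_structure_cong:
  assumes "carrier V = carrier W" "add V = add W" "zero V = zero W"
  shows "finsum V f I = finsum W f I"
  using assms by (simp add: finsum_def finprod_def)

subsection \<open>Tensor products\<close>

lemma tensor_map_bilinear: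
  assumes "cvec V'" "cvec W'" "f \<in> linear_maps V V'" "g \<in> linear_maps W W'"
  shows "bilinear V W (tensor_space V' W') (\<lambda>x y. pure V' W' (f x) (g y))"
  using bilinear_comp[OF pure_bilinear assms(3,4) linear_maps_id] assms by simp

lemma tensor_map_linear:
  assumes "cvec V" "cvec W" "cvec V'" "cvec W'" "f \<in> linear_maps V V'" "g \<in> linear_maps W W'"
  shows "tensor_map V' W' f g \<in> linear_maps (tensor_space V W) (tensor_space V' W')"
  unfolding tensor_map_def
  by (rule tensor_lift_linear) (use assms tensor_map_bilinear in auto)

lemma tensor_map_pure:
  assumes "cvec V" "cvec W" "cvec V'" "cvec W'" "f \<in> linear_maps V V'" "g \<in> linear_maps W W'"
    "x \<in> carrier V" "y \<in> carrier W"
  shows "tensor_map V' W' f g (pure V W x y) = pure V' W' (f x) (g y)"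
  unfolding tensor_map_def
  by (rule tensor_lift_pure) (use assms tensor_map_bilinear in auto)

lemma tensor_alg_sel [simp]:
  "carrier (tensor_alg A B) = carrier (tensor_space A B)"
  "one (tensor_alg A B) = pure A B \<one>\<^bsub>A\<^esub> \<one>\<^bsub>B\<^esub>"
  "zero (tensor_alg A B) = zero (tensor_space A B)"
  "add (tensor_alg A B) = add (tensor_space A B)"
  "smult (tensor_alg A B) = smult (tensor_space A B)"
  by (simp_all add: tensor_alg_def Let_def)

lemma linear_maps_tensor_alg [simp]:
  "linear_maps (tensor_alg A B) V = linear_maps (tensor_space A B) V"
  "linear_maps V (tensor_alg A B) = linear_maps V (tensor_space A B)"
  by (simp_all add: linear_maps_def)

lemma finsum_tensor_alg [simp]: "finsum (tensor_alg A B) f I = finsum (tensor_space A B) f I"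
  by (rule finsum_structure_cong) simp_all

context
  fixes A :: "('a, 'm) star_alg_scheme" and B :: "('b, 'n) star_alg_scheme"
  assumes A [simp]: "star_algebra A" and B [simp]: "star_algebra B"
begin

private abbreviation (input) "AB \<equiv> tensor_space A B"

text \<open>The inner lift in the product of \<open>tensor_alg\<close> is the tensor product of two
  left multiplications, so the facts on \<open>tensor_map\<close> apply.\<close>

lemma tensor_mult_left:
  assumes "x \<in> carrier A" "y \<in> carrier B"
  shows "tensor_lift AB (\<lambda>x' y'. pure A B (x \<otimes>\<^bsub>A\<^esub> x') (y \<otimes>\<^bsub>B\<^esub> y')) \<in> linear_maps AB AB"
    and "\<lbrakk>x' \<in> carrier A; y' \<in> carrier B\<rbrakk> \<Longrightarrow>
      tensor_lift AB (\<lambda>x' y'. pure A B (x \<otimes>\<^bsub>A\<^esub> x') (y \<otimes>\<^bsub>B\<^esub> y')) (pure A B x' y') =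
      pure A B (x \<otimes>\<^bsub>A\<^esub> x') (y \<otimes>\<^bsub>B\<^esub> y')"
  using tensor_map_linear[of A B A B "\<lambda>x'. x \<otimes>\<^bsub>A\<^esub> x'" "\<lambda>y'. y \<otimes>\<^bsub>B\<^esub> y'"]
    tensor_map_pure[of A B A B "\<lambda>x'. x \<otimes>\<^bsub>A\<^esub> x'" "\<lambda>y'. y \<otimes>\<^bsub>B\<^esub> y'" x' y'] assms
  by (simp_all add: tensor_map_def alg_mult_linear_right)

text \<open>The outer lift in the product makes sense only if the inner one is bilinear in
  \<open>x\<close> and \<open>y\<close>. For pure \<open>u\<close> this is a tensor product of right
  multiplications; general \<open>u\<close> follows by addition.\<close>

lemma tensor_mult_left_bilinear:
  assumes "u \<in> carrier AB"
  shows "bilinear A B AB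
    (\<lambda>x y. tensor_lift AB (\<lambda>x' y'. pure A B (x \<otimes>\<^bsub>A\<^esub> x') (y \<otimes>\<^bsub>B\<^esub> y')) u)"
  using assms
proof (induction rule: tensor_induct[OF star_algebra_cvec[OF A] star_algebra_cvec[OF B], consumes 1, case_names pure add])
  case (pure x' y')
  then have "bilinear A B AB (\<lambda>x y. pure A B (x \<otimes>\<^bsub>A\<^esub> x') (y \<otimes>\<^bsub>B\<^esub> y'))"
    by (intro tensor_map_bilinear alg_mult_linear_left) simp_all
  then show ?case
    by (simp add: bilinear_def linear_maps_def tensor_mult_left pure cong: conj_cong ball_cong)
next
  case (add s t)
  note b = bilinear_closed[OF add(3)] bilinear_closed[OF add(4)]
  show ?case
    by (rule bilinearI)
      (use add in \<open>simp_all add: linear_maps_add[OF tensor_mult_left(1)] b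
        bilinear_add_left[OF add(3)] bilinear_add_right[OF add(3)] bilinear_smult_left[OF add(3)]
        bilinear_smult_right[OF add(3)] bilinear_add_left[OF add(4)] bilinear_add_right[OF add(4)]
        bilinear_smult_left[OF add(4)] bilinear_smult_right[OF add(4)] cvec_ac cvec_smult_add\<close>)
qed

lemma tensor_mult_def':
  "s \<otimes>\<^bsub>tensor_alg A B\<^esub> t =
    tensor_lift AB (\<lambda>x y. tensor_lift AB (\<lambda>x' y'. pure A B (x \<otimes>\<^bsub>A\<^esub> x') (y \<otimes>\<^bsub>B\<^esub> y')) t) s"
  by (simp add: tensor_alg_def Let_def)

lemma tensor_mult_pure [simp]:
  assumes "x \<in> carrier A" "y \<in> carrier B" "x' \<in> carrier A" "y' \<in> carrier B"
  shows "pure A B x y \<otimes>\<^bsub>tensor_alg A B\<^esub> pure A B x' y' = pure A B (x \<otimes>\<^bsub>A\<^esub> x') (y \<otimes>\<^bsub>B\<^esub> y')"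
  unfolding tensor_mult_def'
  by (subst tensor_lift_pure[OF _ _ _ tensor_mult_left_bilinear])
    (use assms in \<open>simp_all add: tensor_mult_left\<close>)

lemma tensor_mult_bilinear: "bilinear AB AB AB (\<lambda>s t. s \<otimes>\<^bsub>tensor_alg A B\<^esub> t)"
proof -
  have 1: "(\<lambda>s. s \<otimes>\<^bsub>tensor_alg A B\<^esub> t) \<in> linear_maps AB AB" if "t \<in> carrier AB" for t
    unfolding tensor_mult_def' by (rule tensor_lift_linear) (use that tensor_mult_left_bilinear in simp_all)
  have 2: "(\<lambda>t. s \<otimes>\<^bsub>tensor_alg A B\<^esub> t) \<in> linear_maps AB AB" if "s \<in> carrier AB" for s
    using that
  proof (induction rule: tensor_induct[OF star_algebra_cvec[OF A] star_algebra_cvec[OF B], consumes 1, case_names pure add])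
    case (pure x y)
    have "pure A B x y \<otimes>\<^bsub>tensor_alg A B\<^esub> t =
        tensor_lift AB (\<lambda>x' y'. pure A B (x \<otimes>\<^bsub>A\<^esub> x') (y \<otimes>\<^bsub>B\<^esub> y')) t" if "t \<in> carrier AB" for t
      unfolding tensor_mult_def' using that pure
      by (subst tensor_lift_pure[OF _ _ _ tensor_mult_left_bilinear]) simp_all
    then show ?case using tensor_mult_left(1)[OF pure] by (simp add: linear_maps_def Pi_def)
  next
    case (add s t)
    show ?case
      by (rule linear_mapsI)
        (use add in \<open>simp_all add: linear_maps_add[OF 1] linear_maps_closed[OF add(3)]
          linear_maps_closed[OF add(4)] linear_maps_add[OF add(3)] linear_maps_add[OF add(4)]
          linear_maps_smult[OF add(3)] linear_maps_smult[OF add(4)] cvec_ac cvec_smult_add\<close>)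
  qed
  show ?thesis using 1 2 by (auto simp: bilinear_def)
qed

text \<open>The conjugate vector space. The involution is conjugate linear, hence linear into this
  space, and can be treated by \<open>tensor_lift\<close> like every other map.\<close>

definition tensor_conj :: "(complex, ('a, 'b) tensor) module" where
  "tensor_conj = AB\<lparr>smult := (\<lambda>c x. cnj c \<odot>\<^bsub>AB\<^esub> x)\<rparr>"

lemma tensor_conj_sel:
  "carrier tensor_conj = carrier AB" "zero tensor_conj = zero AB" "add tensor_conj = add AB"
  "smult tensor_conj = (\<lambda>c x. cnj c \<odot>\<^bsub>AB\<^esub> x)"
  by (simp_all add: tensor_conj_def)

lemma tensor_conj_cvec: "cvec tensor_conj"
proof (rule moduleI)
  show "cring complex_alg" by (rule cring_complex_alg)
  show "abelian_group tensor_conj"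
  proof (rule abelian_groupI)
    fix x assume "x \<in> carrier tensor_conj"
    then show "\<exists>y\<in>carrier tensor_conj. y \<oplus>\<^bsub>tensor_conj\<^esub> x = \<zero>\<^bsub>tensor_conj\<^esub>"
      unfolding tensor_conj_sel by (intro bexI[of _ "\<ominus>\<^bsub>AB\<^esub> x"]) simp_all
  qed (simp_all add: tensor_conj_sel cvec_ac)
qed (simp_all add: tensor_conj_sel cvec_smult_add_left cvec_smult_add cvec_smult_smult)

lemma tensor_star_bilinear: "bilinear A B tensor_conj (\<lambda>x y. pure A B (star A x) (star B y))"
  by (rule bilinearI) (simp_all add: tensor_conj_sel alg_star_add alg_star_smult
    bilinear_add_left[OF pure_bilinear] bilinear_add_right[OF pure_bilinear]
    bilinear_smult_left[OF pure_bilinear] bilinear_smult_right[OF pure_bilinear])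

lemma tensor_star_def':
  "star (tensor_alg A B) t = tensor_lift tensor_conj (\<lambda>x y. pure A B (star A x) (star B y)) t"
proof -
  have "finsum AB f I = finsum tensor_conj f I" for f :: "'a \<times> 'b \<Rightarrow> _" and I
    by (rule finsum_structure_cong) (simp_all add: tensor_conj_sel)
  then show ?thesis by (simp add: tensor_alg_def Let_def tensor_lift_def tensor_conj_sel)
qed

lemma tensor_star_linear: "star (tensor_alg A B) \<in> linear_maps AB tensor_conj"
proof -
  have "star (tensor_alg A B) = tensor_lift tensor_conj (\<lambda>x y. pure A B (star A x) (star B y))"
    by (rule ext) (rule tensor_star_def')
  then show ?thesis using tensor_lift_linear[OF _ _ tensor_conj_cvec tensor_star_bilinear] by simp
qed

lemma tensor_star_pure [simp]:
  "\<lbrakk>x \<in> carrier A; y \<in> carrier B\<rbrakk> \<Longrightarrow>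
    star (tensor_alg A B) (pure A B x y) = pure A B (star A x) (star B y)"
  unfolding tensor_star_def' by (rule tensor_lift_pure[OF _ _ tensor_conj_cvec tensor_star_bilinear]) simp_all

lemma tensor_alg_cvec: "cvec (tensor_alg A B)"
  by (rule cvec_image[of AB "\<lambda>x. x"]) simp_all

lemma tensor_alg_star_algebra [simp]: "star_algebra (tensor_alg A B)"
proof (rule star_algebraI[OF tensor_alg_cvec])
  note [simp] = bilinear_closed[OF tensor_mult_bilinear] linear_maps_closed[OF tensor_star_linear, unfolded tensor_conj_sel]
  note dist = bilinear_add_left[OF tensor_mult_bilinear] bilinear_add_right[OF tensor_mult_bilinear]
    bilinear_smult_left[OF tensor_mult_bilinear] bilinear_smult_right[OF tensor_mult_bilinear]
    linear_maps_add[OF tensor_star_linear, unfolded tensor_conj_sel]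
    linear_maps_smult[OF tensor_star_linear, unfolded tensor_conj_sel]
  note ind = tensor_induct[OF star_algebra_cvec[OF A] star_algebra_cvec[OF B], consumes 1, case_names pure add]
  fix x y z c
  assume x: "x \<in> carrier (tensor_alg A B)"
  then have x' [simp]: "x \<in> carrier AB" by simp
  show "\<one>\<^bsub>tensor_alg A B\<^esub> \<otimes>\<^bsub>tensor_alg A B\<^esub> x = x"
    using x' by (induction rule: ind) (simp_all add: dist)
  show "x \<otimes>\<^bsub>tensor_alg A B\<^esub> \<one>\<^bsub>tensor_alg A B\<^esub> = x"
    using x' by (induction rule: ind) (simp_all add: dist)
  show "star (tensor_alg A B) x \<in> carrier (tensor_alg A B)" by simp
  show "star (tensor_alg A B) (star (tensor_alg A B) x) = x"
    using x' by (induction rule: ind) (simp_all add: dist)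
  show "star (tensor_alg A B) (c \<odot>\<^bsub>tensor_alg A B\<^esub> x) = cnj c \<odot>\<^bsub>tensor_alg A B\<^esub> star (tensor_alg A B) x"
    by (simp add: dist)
  assume y: "y \<in> carrier (tensor_alg A B)"
  then have y' [simp]: "y \<in> carrier AB" by simp
  show "x \<otimes>\<^bsub>tensor_alg A B\<^esub> y \<in> carrier (tensor_alg A B)" by simp
  show "c \<odot>\<^bsub>tensor_alg A B\<^esub> x \<otimes>\<^bsub>tensor_alg A B\<^esub> y = c \<odot>\<^bsub>tensor_alg A B\<^esub> (x \<otimes>\<^bsub>tensor_alg A B\<^esub> y)"
    "x \<otimes>\<^bsub>tensor_alg A B\<^esub> (c \<odot>\<^bsub>tensor_alg A B\<^esub> y) = c \<odot>\<^bsub>tensor_alg A B\<^esub> (x \<otimes>\<^bsub>tensor_alg A B\<^esub> y)"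
    "star (tensor_alg A B) (x \<oplus>\<^bsub>tensor_alg A B\<^esub> y) =
      star (tensor_alg A B) x \<oplus>\<^bsub>tensor_alg A B\<^esub> star (tensor_alg A B) y"
    by (simp_all add: dist)
  \<comment> \<open>Both sides are additive in each factor, so the factors are reduced to pure
    tensors one after the other: \<open>y\<close> here, then \<open>x\<close>.\<close>
  have "star (tensor_alg A B) (pure A B a b \<otimes>\<^bsub>tensor_alg A B\<^esub> y) =
      star (tensor_alg A B) y \<otimes>\<^bsub>tensor_alg A B\<^esub> star (tensor_alg A B) (pure A B a b)"
    if [simp]: "a \<in> carrier A" "b \<in> carrier B" for a b
    using y' by (induction rule: ind) (simp_all add: dist alg_star_mult)
  with x' show "star (tensor_alg A B) (x \<otimes>\<^bsub>tensor_alg A B\<^esub> y) =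
      star (tensor_alg A B) y \<otimes>\<^bsub>tensor_alg A B\<^esub> star (tensor_alg A B) x"
    by (induction rule: ind) (simp_all add: dist)
  assume z: "z \<in> carrier (tensor_alg A B)"
  then have z' [simp]: "z \<in> carrier AB" by simp
  show "x \<otimes>\<^bsub>tensor_alg A B\<^esub> (y \<oplus>\<^bsub>tensor_alg A B\<^esub> z) =
      x \<otimes>\<^bsub>tensor_alg A B\<^esub> y \<oplus>\<^bsub>tensor_alg A B\<^esub> x \<otimes>\<^bsub>tensor_alg A B\<^esub> z"
    "(x \<oplus>\<^bsub>tensor_alg A B\<^esub> y) \<otimes>\<^bsub>tensor_alg A B\<^esub> z =
      x \<otimes>\<^bsub>tensor_alg A B\<^esub> z \<oplus>\<^bsub>tensor_alg A B\<^esub> y \<otimes>\<^bsub>tensor_alg A B\<^esub> z"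
    by (simp_all add: dist)
  \<comment> \<open>Associativity is additive in three arguments and needs three rounds of the same
    reduction: \<open>z\<close>, then \<open>y\<close>, then \<open>x\<close>.\<close>
  have *: "pure A B a b \<otimes>\<^bsub>tensor_alg A B\<^esub> pure A B a' b' \<otimes>\<^bsub>tensor_alg A B\<^esub> z =
      pure A B a b \<otimes>\<^bsub>tensor_alg A B\<^esub> (pure A B a' b' \<otimes>\<^bsub>tensor_alg A B\<^esub> z)"
    if [simp]: "a \<in> carrier A" "b \<in> carrier B" "a' \<in> carrier A" "b' \<in> carrier B" for a b a' b'
    using z' by (induction rule: ind) (simp_all add: dist alg_mult_assoc del: tensor_mult_pure, simp add: alg_mult_assoc)
  have "pure A B a b \<otimes>\<^bsub>tensor_alg A B\<^esub> y \<otimes>\<^bsub>tensor_alg A B\<^esub> z =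
      pure A B a b \<otimes>\<^bsub>tensor_alg A B\<^esub> (y \<otimes>\<^bsub>tensor_alg A B\<^esub> z)"
    if [simp]: "a \<in> carrier A" "b \<in> carrier B" for a b
    using y' by (induction rule: ind) (simp_all add: dist * del: tensor_mult_pure)
  with x' show "x \<otimes>\<^bsub>tensor_alg A B\<^esub> y \<otimes>\<^bsub>tensor_alg A B\<^esub> z = x \<otimes>\<^bsub>tensor_alg A B\<^esub> (y \<otimes>\<^bsub>tensor_alg A B\<^esub> z)"
    by (induction rule: ind) (simp_all add: dist)
qed simp_all

end

lemma tensor_map_star_hom:
  assumes A: "star_algebra A" "star_algebra A'" "star_algebra B" "star_algebra B'"
    and f: "f \<in> star_hom A A'" and g: "g \<in> star_hom B B'"
  shows "tensor_map A' B' f g \<in> star_hom (tensor_alg A B) (tensor_alg A' B')"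
proof (rule star_homI)
  let ?T = "tensor_alg A B" and ?T' = "tensor_alg A' B'" and ?h = "tensor_map A' B' f g"
  have lin: "?h \<in> linear_maps (tensor_space A B) (tensor_space A' B')"
    by (rule tensor_map_linear) (use assms in \<open>simp_all add: star_hom_linear\<close>)
  then have lin': "?h \<in> linear_maps ?T ?T'" by simp
  then show "?h \<in> linear_maps ?T ?T'" .
  have pure: "?h (pure A B a b) = pure A' B' (f a) (g b)" if "a \<in> carrier A" "b \<in> carrier B" for a b
    by (rule tensor_map_pure) (use assms that in \<open>simp_all add: star_hom_linear\<close>)
  show "?h \<one>\<^bsub>?T\<^esub> = \<one>\<^bsub>?T'\<^esub>" using A f g by (simp add: pure star_hom_one)
  note [simp] = A star_hom_closed[OF f] star_hom_closed[OF g] linear_maps_closed[OF lin]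
  note ind = tensor_induct[OF star_algebra_cvec[OF A(1)] star_algebra_cvec[OF A(3)], consumes 1, case_names pure add]
  note dist = linear_maps_add[OF lin] linear_maps_add[OF lin', simplified]
  note sums = alg_mult_add[of ?T, simplified] alg_add_mult[of ?T, simplified]
    alg_mult_add[of ?T', simplified] alg_add_mult[of ?T', simplified]
    alg_mult_closed[of ?T, simplified] alg_star_closed[of ?T, simplified]
    alg_star_add[of ?T, simplified] alg_star_add[of ?T', simplified]
  fix x assume "x \<in> carrier ?T"
  then have x [simp]: "x \<in> carrier (tensor_space A B)" by simp
  then show "?h (star ?T x) = star ?T' (?h x)"
    by (induction rule: ind)
      (simp_all add: pure star_hom_star[OF f] star_hom_star[OF g] dist sums)
  fix y assume "y \<in> carrier ?T"
  then have y: "y \<in> carrier (tensor_space A B)" by simp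
  have "?h (pure A B a b \<otimes>\<^bsub>?T\<^esub> y) = ?h (pure A B a b) \<otimes>\<^bsub>?T'\<^esub> ?h y"
    if [simp]: "a \<in> carrier A" "b \<in> carrier B" for a b
    using y by (induction rule: ind)
      (simp_all add: pure star_hom_mult[OF f] star_hom_mult[OF g] dist sums)
  with x show "?h (x \<otimes>\<^bsub>?T\<^esub> y) = ?h x \<otimes>\<^bsub>?T'\<^esub> ?h y"
    by (induction rule: ind) (use y in \<open>simp_all add: dist sums\<close>)
qed

subsection \<open>Monoid algebras and free *-algebras\<close>

context
  fixes M :: "('x, 'm) monoid_scheme" and \<sigma> :: "'x \<Rightarrow> 'x"
  assumes M: "monoid M"
begin

interpretation monoid M by fact

private abbreviation (input) "MA \<equiv> monoid_algebra M \<sigma>"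
private abbreviation (input) "FM \<equiv> free_space (carrier M)"

lemma monoid_algebra_sel [simp]:
  "carrier MA = carrier FM" "one MA = ket \<one>\<^bsub>M\<^esub>" "zero MA = zero FM" "add MA = add FM" "smult MA = smult FM"
  by (simp_all add: monoid_algebra_def)

text \<open>Writing the convolution over a rectangle, with \<open>ket\<close> as the indicator of
  \<open>y z = x\<close>, gives an index set that depends neither on \<open>x\<close> nor on the
  exact supports. Linearity in \<open>f\<close> and \<open>g\<close> can then be read off.\<close>

lemma monoid_algebra_mult_eq:
  assumes "finite S" "{y. f y \<noteq> 0} \<subseteq> S" "finite T" "{z. g z \<noteq> 0} \<subseteq> T"
  shows "(f \<otimes>\<^bsub>MA\<^esub> g) x = (\<Sum>y\<in>S. \<Sum>z\<in>T. f y * g z * ket (y \<otimes>\<^bsub>M\<^esub> z) x)"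
proof -
  have "(\<Sum>y\<in>S. \<Sum>z\<in>T. f y * g z * ket (y \<otimes>\<^bsub>M\<^esub> z) x) =
      (\<Sum>(y, z)\<in>S \<times> T. f y * g z * ket (y \<otimes>\<^bsub>M\<^esub> z) x)"
    by (rule sum.cartesian_product)
  also have "\<dots> = (\<Sum>(y, z)\<in>{(y, z). f y \<noteq> 0 \<and> g z \<noteq> 0 \<and> y \<otimes>\<^bsub>M\<^esub> z = x}. f y * g z)"
    by (rule sum.mono_neutral_cong_right) (use assms in \<open>auto simp: ket_def split: if_splits\<close>)
  finally show ?thesis by (simp add: monoid_algebra_def)
qed

lemma free_space_finite_support: "f \<in> carrier (free_space X) \<Longrightarrow> finite {x. f x \<noteq> 0}"
  by (simp add: free_space_carrier)

lemma monoid_algebra_mult_bilinear: "bilinear FM FM FM (\<lambda>f g. f \<otimes>\<^bsub>MA\<^esub> g)"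
proof (rule bilinearI)
  fix f f' g g' c
  assume f: "f \<in> carrier FM" and g: "g \<in> carrier FM"
  define S where "S = {y. f y \<noteq> 0}"
  define T where "T = {y. g y \<noteq> 0}"
  have S: "finite S" "{y. f y \<noteq> 0} \<subseteq> S" "S \<subseteq> carrier M"
    using f by (auto simp: S_def free_space_carrier)
  have T: "finite T" "{y. g y \<noteq> 0} \<subseteq> T" "T \<subseteq> carrier M"
    using g by (auto simp: T_def free_space_carrier)
  \<comment> \<open>The support of a product lies in the product of the two supports, which is
    finite and contained in the monoid.\<close>
  have "{x. (f \<otimes>\<^bsub>MA\<^esub> g) x \<noteq> 0} \<subseteq> (\<lambda>(y, z). y \<otimes>\<^bsub>M\<^esub> z) ` (S \<times> T)"
  proof
    fix x assume "x \<in> {x. (f \<otimes>\<^bsub>MA\<^esub> g) x \<noteq> 0}"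
    then have "(\<Sum>y\<in>S. \<Sum>z\<in>T. f y * g z * ket (y \<otimes>\<^bsub>M\<^esub> z) x) \<noteq> 0"
      using monoid_algebra_mult_eq[OF S(1,2) T(1,2)] by simp
    then obtain y where y: "y \<in> S" "(\<Sum>z\<in>T. f y * g z * ket (y \<otimes>\<^bsub>M\<^esub> z) x) \<noteq> 0"
      by (meson sum.neutral)
    then obtain z where z: "z \<in> T" "f y * g z * ket (y \<otimes>\<^bsub>M\<^esub> z) x \<noteq> 0"
      by (meson sum.neutral)
    then have "x = y \<otimes>\<^bsub>M\<^esub> z" by (auto simp: ket_def split: if_splits)
    then show "x \<in> (\<lambda>(y, z). y \<otimes>\<^bsub>M\<^esub> z) ` (S \<times> T)" using y z by auto
  qed
  moreover have "finite ((\<lambda>(y, z). y \<otimes>\<^bsub>M\<^esub> z) ` (S \<times> T))" using S T by simp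
  moreover have "(\<lambda>(y, z). y \<otimes>\<^bsub>M\<^esub> z) ` (S \<times> T) \<subseteq> carrier M" using S T by auto
  ultimately show "f \<otimes>\<^bsub>MA\<^esub> g \<in> carrier FM"
    unfolding free_space_carrier by (meson finite_subset order_trans)
  have "((c \<odot>\<^bsub>FM\<^esub> f) \<otimes>\<^bsub>MA\<^esub> g) x = (c \<odot>\<^bsub>FM\<^esub> (f \<otimes>\<^bsub>MA\<^esub> g)) x" for x
    unfolding free_space_sel
    by (subst monoid_algebra_mult_eq[OF S(1) _ T(1,2)], use S in force,
      subst monoid_algebra_mult_eq[OF S(1,2) T(1,2)]) (simp add: sum_distrib_left mult_ac)
  then show "(c \<odot>\<^bsub>FM\<^esub> f) \<otimes>\<^bsub>MA\<^esub> g = c \<odot>\<^bsub>FM\<^esub> (f \<otimes>\<^bsub>MA\<^esub> g)" by blast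
  have "(f \<otimes>\<^bsub>MA\<^esub> (c \<odot>\<^bsub>FM\<^esub> g)) x = (c \<odot>\<^bsub>FM\<^esub> (f \<otimes>\<^bsub>MA\<^esub> g)) x" for x
    unfolding free_space_sel
    by (subst monoid_algebra_mult_eq[OF S(1,2) T(1)], use T in force,
      subst monoid_algebra_mult_eq[OF S(1,2) T(1,2)]) (simp add: sum_distrib_left mult_ac)
  then show "f \<otimes>\<^bsub>MA\<^esub> (c \<odot>\<^bsub>FM\<^esub> g) = c \<odot>\<^bsub>FM\<^esub> (f \<otimes>\<^bsub>MA\<^esub> g)" by blast
  show "(f \<oplus>\<^bsub>FM\<^esub> f') \<otimes>\<^bsub>MA\<^esub> g = f \<otimes>\<^bsub>MA\<^esub> g \<oplus>\<^bsub>FM\<^esub> f' \<otimes>\<^bsub>MA\<^esub> g" if f': "f' \<in> carrier FM"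
  proof
    fix x
    define S' where "S' = S \<union> {y. f' y \<noteq> 0}"
    have S': "finite S'" "{y. f y \<noteq> 0} \<subseteq> S'" "{y. f' y \<noteq> 0} \<subseteq> S'" "{y. f y + f' y \<noteq> 0} \<subseteq> S'"
      using S free_space_finite_support[OF f'] by (auto simp: S'_def)
    show "((f \<oplus>\<^bsub>FM\<^esub> f') \<otimes>\<^bsub>MA\<^esub> g) x = (f \<otimes>\<^bsub>MA\<^esub> g \<oplus>\<^bsub>FM\<^esub> f' \<otimes>\<^bsub>MA\<^esub> g) x"
      unfolding free_space_sel monoid_algebra_mult_eq[OF S'(1,2) T(1,2)]
        monoid_algebra_mult_eq[OF S'(1,3) T(1,2)] monoid_algebra_mult_eq[OF S'(1,4) T(1,2)]
      by (simp add: algebra_simps sum.distrib)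
  qed
  show "f \<otimes>\<^bsub>MA\<^esub> (g \<oplus>\<^bsub>FM\<^esub> g') = f \<otimes>\<^bsub>MA\<^esub> g \<oplus>\<^bsub>FM\<^esub> f \<otimes>\<^bsub>MA\<^esub> g'" if g': "g' \<in> carrier FM"
  proof
    fix x
    define T' where "T' = T \<union> {y. g' y \<noteq> 0}"
    have T': "finite T'" "{y. g y \<noteq> 0} \<subseteq> T'" "{y. g' y \<noteq> 0} \<subseteq> T'" "{y. g y + g' y \<noteq> 0} \<subseteq> T'"
      using T free_space_finite_support[OF g'] by (auto simp: T'_def)
    show "(f \<otimes>\<^bsub>MA\<^esub> (g \<oplus>\<^bsub>FM\<^esub> g')) x = (f \<otimes>\<^bsub>MA\<^esub> g \<oplus>\<^bsub>FM\<^esub> f \<otimes>\<^bsub>MA\<^esub> g') x"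
      unfolding free_space_sel monoid_algebra_mult_eq[OF S(1,2) T'(1,2)]
        monoid_algebra_mult_eq[OF S(1,2) T'(1,3)] monoid_algebra_mult_eq[OF S(1,2) T'(1,4)]
      by (simp add: algebra_simps sum.distrib)
  qed
qed

lemma monoid_algebra_mult_ket [simp]: "ket x \<otimes>\<^bsub>MA\<^esub> ket y = ket (x \<otimes>\<^bsub>M\<^esub> y)"
  by (rule ext, subst monoid_algebra_mult_eq[of "{x}" _ "{y}"]) simp_all

lemma monoid_algebra_cvec: "cvec MA"
  by (rule cvec_image[of FM "\<lambda>x. x"]) simp_all

lemma linear_maps_monoid_algebra [simp]: "linear_maps MA V = linear_maps FM V"
  "linear_maps V MA = linear_maps V FM"
  by (simp_all add: linear_maps_def)

lemma monoid_algebra_induct [consumes 1, case_names ket zero add smult]: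
  assumes "p \<in> carrier MA"
    and ket: "\<And>x. x \<in> carrier M \<Longrightarrow> P (ket x)" and zero: "P \<zero>\<^bsub>MA\<^esub>"
    and add: "\<And>p q. \<lbrakk>p \<in> carrier MA; q \<in> carrier MA; P p; P q\<rbrakk> \<Longrightarrow> P (p \<oplus>\<^bsub>MA\<^esub> q)"
    and smult: "\<And>c p. \<lbrakk>p \<in> carrier MA; P p\<rbrakk> \<Longrightarrow> P (c \<odot>\<^bsub>MA\<^esub> p)"
  shows "P p"
  using assms(1) unfolding monoid_algebra_sel
  by (induction rule: free_space_induct)
    (use assms in \<open>simp_all add: free_space_sel\<close>)

lemma monoid_algebra_hom:
  assumes B: "star_algebra B" and h: "\<And>x. x \<in> carrier M \<Longrightarrow> h x \<in> carrier B"
    and mult: "\<And>x y. \<lbrakk>x \<in> carrier M; y \<in> carrier M\<rbrakk> \<Longrightarrow> h (x \<otimes>\<^bsub>M\<^esub> y) = h x \<otimes>\<^bsub>B\<^esub> h y"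
    and one: "h \<one>\<^bsub>M\<^esub> = \<one>\<^bsub>B\<^esub>"
  shows "lin_ext B h \<in> alg_hom MA B"
proof (rule alg_homI)
  have lin: "lin_ext B h \<in> linear_maps FM B" by (rule lin_ext_linear) (use B h in simp_all)
  show "lin_ext B h \<in> linear_maps MA B" using lin by simp
  have ket: "lin_ext B h (ket x) = h x" if "x \<in> carrier M" for x
    using lin_ext_ket[of B h x] B h that by simp
  show "lin_ext B h \<one>\<^bsub>MA\<^esub> = \<one>\<^bsub>B\<^esub>" using ket one by simp
  note [simp] = B linear_maps_closed[OF lin] bilinear_closed[OF monoid_algebra_mult_bilinear]
    linear_maps_zero[OF lin free_space_cvec star_algebra_cvec[OF B]]
    linear_maps_zero[OF bilinear_linear_left[OF monoid_algebra_mult_bilinear] free_space_cvec free_space_cvec]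
    linear_maps_zero[OF bilinear_linear_right[OF monoid_algebra_mult_bilinear] free_space_cvec free_space_cvec]
  note dist = linear_maps_add[OF lin] linear_maps_smult[OF lin]
    bilinear_add_left[OF monoid_algebra_mult_bilinear] bilinear_add_right[OF monoid_algebra_mult_bilinear]
    bilinear_smult_left[OF monoid_algebra_mult_bilinear] bilinear_smult_right[OF monoid_algebra_mult_bilinear]
    alg_mult_add[OF B] alg_add_mult[OF B] alg_smult_mult[OF B] alg_mult_smult[OF B]
  fix p q assume p: "p \<in> carrier MA" and q: "q \<in> carrier MA"
  then have q' [simp]: "q \<in> carrier FM" by simp
  have *: "lin_ext B h (ket x \<otimes>\<^bsub>MA\<^esub> q) = h x \<otimes>\<^bsub>B\<^esub> lin_ext B h q" if [simp]: "x \<in> carrier M" for x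
    using q by (induction rule: monoid_algebra_induct) (simp_all add: ket mult dist h)
  show "lin_ext B h (p \<otimes>\<^bsub>MA\<^esub> q) = lin_ext B h p \<otimes>\<^bsub>B\<^esub> lin_ext B h q"
    using p by (induction rule: monoid_algebra_induct) (simp_all add: ket * dist h)
qed

context
  assumes \<sigma>: "\<And>x. x \<in> carrier M \<Longrightarrow> \<sigma> x \<in> carrier M" "\<And>x. x \<in> carrier M \<Longrightarrow> \<sigma> (\<sigma> x) = x"
    "\<And>x y. \<lbrakk>x \<in> carrier M; y \<in> carrier M\<rbrakk> \<Longrightarrow> \<sigma> (x \<otimes>\<^bsub>M\<^esub> y) = \<sigma> y \<otimes>\<^bsub>M\<^esub> \<sigma> x"
begin

lemma monoid_algebra_star: "star MA f = (\<lambda>x. if x \<in> carrier M then cnj (f (\<sigma> x)) else 0)"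
  by (simp add: monoid_algebra_def)

lemma monoid_algebra_star_ket: "x \<in> carrier M \<Longrightarrow> star MA (ket x) = ket (\<sigma> x)"
  by (rule ext) (use \<sigma>(1,2) in \<open>auto simp: monoid_algebra_star ket_def\<close>)

lemma monoid_algebra_star_algebra: "star_algebra MA"
proof (rule star_algebraI[OF monoid_algebra_cvec])
  note b = bilinear_closed[OF monoid_algebra_mult_bilinear] 
    linear_maps_zero[OF bilinear_linear_left[OF monoid_algebra_mult_bilinear] free_space_cvec free_space_cvec]
    linear_maps_zero[OF bilinear_linear_right[OF monoid_algebra_mult_bilinear] free_space_cvec free_space_cvec]
  have star_closed: "star MA x \<in> carrier FM" if x: "x \<in> carrier FM" for x
  proof -
    \<comment> \<open>Since \<sigma> is involutive, the support of the adjoint is the \<sigma>-image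
      of the original support, hence finite.\<close>
    have "{y. star MA x y \<noteq> 0} \<subseteq> \<sigma> ` {y. x y \<noteq> 0} \<inter> carrier M"
    proof
      fix y assume "y \<in> {y. star MA x y \<noteq> 0}"
      then have y: "y \<in> carrier M" "x (\<sigma> y) \<noteq> 0" by (auto simp: monoid_algebra_star split: if_splits)
      then have "y = \<sigma> (\<sigma> y)" using \<sigma> by simp
      then show "y \<in> \<sigma> ` {y. x y \<noteq> 0} \<inter> carrier M" using y by blast
    qed
    then show ?thesis using x unfolding free_space_carrier
      by (meson finite_Int finite_imageI finite_subset le_inf_iff)
  qed
  have star_add: "star MA (x \<oplus>\<^bsub>FM\<^esub> y) = star MA x \<oplus>\<^bsub>FM\<^esub> star MA y" for x y
    by (rule ext) (simp add: monoid_algebra_star free_space_sel)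
  have star_smult: "star MA (c \<odot>\<^bsub>FM\<^esub> x) = cnj c \<odot>\<^bsub>FM\<^esub> star MA x" for x c
    by (rule ext) (simp add: monoid_algebra_star free_space_sel)
  have star_zero: "star MA \<zero>\<^bsub>FM\<^esub> = \<zero>\<^bsub>FM\<^esub>"
    by (rule ext) (simp add: monoid_algebra_star free_space_sel)
  note [simp] = b star_closed star_zero
  note dist = 
    bilinear_add_left[OF monoid_algebra_mult_bilinear] bilinear_add_right[OF monoid_algebra_mult_bilinear]
    bilinear_smult_left[OF monoid_algebra_mult_bilinear] bilinear_smult_right[OF monoid_algebra_mult_bilinear]
    star_add star_smult
  fix x y z c
  assume x: "x \<in> carrier MA"
  then have x' [simp]: "x \<in> carrier FM" by simp
  show "\<one>\<^bsub>MA\<^esub> \<otimes>\<^bsub>MA\<^esub> x = x" using x by (induction rule: monoid_algebra_induct) (simp_all add: dist)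
  show "x \<otimes>\<^bsub>MA\<^esub> \<one>\<^bsub>MA\<^esub> = x" using x by (induction rule: monoid_algebra_induct) (simp_all add: dist)
  show "star MA x \<in> carrier MA" by simp
  show "star MA (star MA x) = x" 
    using x by (induction rule: monoid_algebra_induct) (simp_all add: dist monoid_algebra_star_ket \<sigma>)
  show "star MA (c \<odot>\<^bsub>MA\<^esub> x) = cnj c \<odot>\<^bsub>MA\<^esub> star MA x" by (simp add: dist)
  assume y: "y \<in> carrier MA"
  then have y' [simp]: "y \<in> carrier FM" by simp
  show "x \<otimes>\<^bsub>MA\<^esub> y \<in> carrier MA" "(c \<odot>\<^bsub>MA\<^esub> x) \<otimes>\<^bsub>MA\<^esub> y = c \<odot>\<^bsub>MA\<^esub> (x \<otimes>\<^bsub>MA\<^esub> y)"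
    "x \<otimes>\<^bsub>MA\<^esub> (c \<odot>\<^bsub>MA\<^esub> y) = c \<odot>\<^bsub>MA\<^esub> (x \<otimes>\<^bsub>MA\<^esub> y)"
    "star MA (x \<oplus>\<^bsub>MA\<^esub> y) = star MA x \<oplus>\<^bsub>MA\<^esub> star MA y"
    by (simp_all add: dist)
  have *: "star MA (ket u \<otimes>\<^bsub>MA\<^esub> y) = star MA y \<otimes>\<^bsub>MA\<^esub> ket (\<sigma> u)" if [simp]: "u \<in> carrier M" for u
    using y by (induction rule: monoid_algebra_induct) (simp_all add: dist monoid_algebra_star_ket \<sigma>)
  show "star MA (x \<otimes>\<^bsub>MA\<^esub> y) = star MA y \<otimes>\<^bsub>MA\<^esub> star MA x"
    using x by (induction rule: monoid_algebra_induct) (simp_all add: dist monoid_algebra_star_ket * \<sigma>)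
  assume z: "z \<in> carrier MA"
  then have z' [simp]: "z \<in> carrier FM" by simp
  show "x \<otimes>\<^bsub>MA\<^esub> (y \<oplus>\<^bsub>MA\<^esub> z) = x \<otimes>\<^bsub>MA\<^esub> y \<oplus>\<^bsub>MA\<^esub> x \<otimes>\<^bsub>MA\<^esub> z"
    "(x \<oplus>\<^bsub>MA\<^esub> y) \<otimes>\<^bsub>MA\<^esub> z = x \<otimes>\<^bsub>MA\<^esub> z \<oplus>\<^bsub>MA\<^esub> y \<otimes>\<^bsub>MA\<^esub> z"
    by (simp_all add: dist)
  have 1: "ket (u \<otimes>\<^bsub>M\<^esub> v) \<otimes>\<^bsub>MA\<^esub> z = ket u \<otimes>\<^bsub>MA\<^esub> (ket v \<otimes>\<^bsub>MA\<^esub> z)"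
    if [simp]: "u \<in> carrier M" "v \<in> carrier M" for u v
    using z by (induction rule: monoid_algebra_induct) (simp_all add: dist m_assoc)
  have 2: "(ket u \<otimes>\<^bsub>MA\<^esub> y) \<otimes>\<^bsub>MA\<^esub> z = ket u \<otimes>\<^bsub>MA\<^esub> (y \<otimes>\<^bsub>MA\<^esub> z)"
    if [simp]: "u \<in> carrier M" for u
    using y by (induction rule: monoid_algebra_induct) (simp_all add: dist 1)
  show "x \<otimes>\<^bsub>MA\<^esub> y \<otimes>\<^bsub>MA\<^esub> z = x \<otimes>\<^bsub>MA\<^esub> (y \<otimes>\<^bsub>MA\<^esub> z)"
    using x by (induction rule: monoid_algebra_induct) (simp_all add: dist 2)
qed simp_all

lemma monoid_algebra_star_hom:
  assumes B: "star_algebra B" and h: "\<And>x. x \<in> carrier M \<Longrightarrow> h x \<in> carrier B"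
    and mult: "\<And>x y. \<lbrakk>x \<in> carrier M; y \<in> carrier M\<rbrakk> \<Longrightarrow> h (x \<otimes>\<^bsub>M\<^esub> y) = h x \<otimes>\<^bsub>B\<^esub> h y"
    and one: "h \<one>\<^bsub>M\<^esub> = \<one>\<^bsub>B\<^esub>"
    and star: "\<And>x. x \<in> carrier M \<Longrightarrow> h (\<sigma> x) = star B (h x)"
  shows "lin_ext B h \<in> star_hom MA B"
proof -
  have hom: "lin_ext B h \<in> alg_hom MA B" by (rule monoid_algebra_hom) (use assms in auto)
  note lin = alg_hom_linear[OF hom]
  note MA = monoid_algebra_star_algebra
  have ket: "lin_ext B h (ket x) = h x" if "x \<in> carrier M" for x
    using lin_ext_ket[of B h x] B h that by simp
  note [simp] = linear_maps_closed[OF lin] linear_maps_zero[OF lin]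
  have "lin_ext B h (star MA x) = star B (lin_ext B h x)" if "x \<in> carrier MA" for x
    using that
    by (induction rule: monoid_algebra_induct)
      (use B MA in \<open>simp_all add: monoid_algebra_star_ket ket star \<sigma> linear_maps_add[OF lin] linear_maps_smult[OF lin]
        alg_star_add alg_star_smult h del: monoid_algebra_sel\<close>)
  then show ?thesis using hom by (simp add: star_hom_def)
qed

end

end

section \<open>Free unital *-algebras\<close>

context
  fixes X :: "'x set"
begin

abbreviation (input) word_monoid :: "('x \<times> bool) list monoid" where
  "word_monoid \<equiv> \<lparr>carrier = lists (X \<times> UNIV), mult = (@), one = []\<rparr>"

abbreviation word_star :: "('x \<times> bool) list \<Rightarrow> ('x \<times> bool) list" where
  "word_star \<equiv> \<lambda>w. rev (map (\<lambda>(x, s). (x, \<not> s)) w)"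

lemma word_monoid: "monoid word_monoid"
  by (rule monoidI) auto

lemma word_star:
  "w \<in> lists (X \<times> UNIV) \<Longrightarrow> word_star w \<in> lists (X \<times> UNIV)"
  "word_star (word_star w) = w" "word_star (v @ w) = word_star w @ word_star v"
  by (fastforce simp: in_lists_conv_set rev_map case_prod_unfold comp_def)+

lemma free_star_alg_star_algebra [simp]: "star_algebra (free_star_alg X)"
  unfolding free_star_alg_def
  by (rule monoid_algebra_star_algebra[OF word_monoid]) (use word_star in auto)

lemma free_star_alg_sel:
  "carrier (free_star_alg X) = carrier (free_space (lists (X \<times> UNIV)))" "\<one>\<^bsub>free_star_alg X\<^esub> = ket []"
  "ket v \<otimes>\<^bsub>free_star_alg X\<^esub> ket w = ket (v @ w)"
  unfolding free_star_alg_def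
  using monoid_algebra_sel(1,2)[OF word_monoid, where \<sigma> = word_star] monoid_algebra_mult_ket[OF word_monoid] by simp_all

lemma free_star_alg_letter [simp]: "x \<in> X \<Longrightarrow> ket [(x, s)] \<in> carrier (free_star_alg X)"
  by (simp add: free_star_alg_sel)

lemma free_star_alg_star_letter: "x \<in> X \<Longrightarrow> star (free_star_alg X) (ket [(x, s)]) = ket [(x, \<not> s)]"
  unfolding free_star_alg_def
  by (subst monoid_algebra_star_ket[OF word_monoid]) (use word_star in auto)

text \<open>Words are built from the left, one letter or adjoint letter at a time. Zero is obtained
  as 0 times the unit and has no case of its own.\<close>

lemma free_star_alg_induct [consumes 1, case_names one letter add smult]:
  assumes "p \<in> carrier (free_star_alg X)"
    and one: "P \<one>\<^bsub>free_star_alg X\<^esub>"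
    and letter: "\<And>x s p. \<lbrakk>x \<in> X; p \<in> carrier (free_star_alg X); P p\<rbrakk>
      \<Longrightarrow> P (ket [(x, s)] \<otimes>\<^bsub>free_star_alg X\<^esub> p)"
    and add: "\<And>p q. \<lbrakk>p \<in> carrier (free_star_alg X); q \<in> carrier (free_star_alg X); P p; P q\<rbrakk>
      \<Longrightarrow> P (p \<oplus>\<^bsub>free_star_alg X\<^esub> q)"
    and smult: "\<And>c p. \<lbrakk>p \<in> carrier (free_star_alg X); P p\<rbrakk> \<Longrightarrow> P (c \<odot>\<^bsub>free_star_alg X\<^esub> p)"
  shows "P p"
proof -
  have ket: "P (ket w)" if "w \<in> lists (X \<times> UNIV)" for w
    using that
  proof (induction w)
    case Nil
    then show ?case using one by (simp add: free_star_alg_sel)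
  next
    case (Cons l w)
    then show ?case using letter[of "fst l" "ket w" "snd l"]
      by (auto simp: free_star_alg_sel)
  qed
  have "P (0 \<odot>\<^bsub>free_star_alg X\<^esub> \<one>\<^bsub>free_star_alg X\<^esub>)" using one by (intro smult) simp_all
  then have zero: "P \<zero>\<^bsub>free_star_alg X\<^esub>" by simp
  show ?thesis
    by (rule monoid_algebra_induct[OF word_monoid, where \<sigma> = word_star, folded free_star_alg_def])
      (use assms(1) ket zero add smult in simp_all)
qed

fun word_eval :: "('b, 'n) star_alg_scheme \<Rightarrow> ('x \<Rightarrow> 'b) \<Rightarrow> ('x \<times> bool) list \<Rightarrow> 'b" where
  "word_eval B \<phi> [] = \<one>\<^bsub>B\<^esub>"
| "word_eval B \<phi> ((x, s) # w) = (if s then star B (\<phi> x) else \<phi> x) \<otimes>\<^bsub>B\<^esub> word_eval B \<phi> w"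

text \<open>Evaluation of words is multiplicative and turns the reversal with exchanged adjoints
  into the involution of \<open>B\<close>; its linear extension is therefore a
  *-homomorphism.\<close>

lemma free_star_alg_universal:
  assumes B: "star_algebra B" and \<phi>: "\<And>x. x \<in> X \<Longrightarrow> \<phi> x \<in> carrier B"
  obtains f where "f \<in> star_hom (free_star_alg X) B" "\<And>x. x \<in> X \<Longrightarrow> f (ket [(x, False)]) = \<phi> x"
proof -
  let ?h = "word_eval B \<phi>"
  have closed: "?h w \<in> carrier B" if "w \<in> lists (X \<times> UNIV)" for w
    using that by (induction w) (use B \<phi> in auto)
  have app: "?h (v @ w) = ?h v \<otimes>\<^bsub>B\<^esub> ?h w" if "v \<in> lists (X \<times> UNIV)" "w \<in> lists (X \<times> UNIV)" for v w
    using that(1)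
  proof (induction v)
    case (Cons l v)
    then have "l \<in> X \<times> UNIV" "v \<in> lists (X \<times> UNIV)" by auto
    then show ?case using Cons.IH closed[of v] closed[of w] that(2) B \<phi>
      by (cases l) (auto simp: alg_mult_assoc)
  qed (use B closed that(2) in simp)
  have star: "?h (word_star w) = star B (?h w)" if "w \<in> lists (X \<times> UNIV)" for w
    using that
  proof (induction w)
    case (Cons l w)
    obtain x s where l: "l = (x, s)" by (cases l)
    then have x: "x \<in> X" "w \<in> lists (X \<times> UNIV)" using Cons by auto
    have "?h (word_star (l # w)) = ?h (word_star w) \<otimes>\<^bsub>B\<^esub> ?h [(x, \<not> s)]"
      using app[of "word_star w" "[(x, \<not> s)]"] word_star(1)[OF x(2)] x l by simp
    then show ?case using Cons x l B \<phi> closed by (auto simp: alg_star_mult)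
  qed (use B in simp)
  have "lin_ext B ?h \<in> star_hom (free_star_alg X) B"
    unfolding free_star_alg_def
    by (rule monoid_algebra_star_hom[OF word_monoid]) (use word_star B closed app star in auto)
  moreover have "lin_ext B ?h (ket [(x, False)]) = \<phi> x" if "x \<in> X" for x
    using lin_ext_ket[of B ?h "[(x, False)]"] B \<phi> that by simp
  ultimately show ?thesis by (rule that)
qed

end

subsection \<open>Quotients by *-ideals\<close>

lemma star_ideal_iff:
  assumes A: "star_algebra A"
  shows "star_ideal I A \<longleftrightarrow> I \<subseteq> carrier A \<and> \<zero>\<^bsub>A\<^esub> \<in> I \<and> (\<forall>x\<in>I. \<forall>y\<in>I. x \<oplus>\<^bsub>A\<^esub> y \<in> I) \<and>
    (\<forall>x\<in>I. \<forall>a\<in>carrier A. a \<otimes>\<^bsub>A\<^esub> x \<in> I \<and> x \<otimes>\<^bsub>A\<^esub> a \<in> I) \<and> (\<forall>x\<in>I. star A x \<in> I)" (is "_ \<longleftrightarrow> ?R")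
proof
  assume "star_ideal I A"
  then have I: "ideal I A" and st: "star A ` I \<subseteq> I" by (auto simp: star_ideal_def)
  interpret ideal I A by fact
  show ?R using st by (auto simp: I_l_closed I_r_closed a_subset[THEN subsetD])
next
  assume R: ?R
  have "ideal I A"
  proof (rule idealI)
    show "ring A" by (rule star_algebra_ring[OF A])
    show "subgroup I (add_monoid A)"
    proof (rule group.subgroupI)
      show "group (add_monoid A)"
        using abelian_group.a_group[OF cvec_abelian_group[OF star_algebra_cvec[OF A]]] .
      fix x assume x: "x \<in> I"
      \<comment> \<open>In a unital algebra the negative of \<open>x\<close> is a product with -1
        times the unit, so absorption of products already yields negatives.\<close>
      have "\<ominus>\<^bsub>A\<^esub> x = ((-1) \<odot>\<^bsub>A\<^esub> \<one>\<^bsub>A\<^esub>) \<otimes>\<^bsub>A\<^esub> x"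
        using A R x by (auto simp: cvec_neg alg_smult_mult)
      also have "\<dots> \<in> I" using A R x by auto
      finally show "inv\<^bsub>add_monoid A\<^esub> x \<in> I" by (simp add: a_inv_def)
    qed (use R in auto)
  qed (use R in auto)
  then show "star_ideal I A" using R by (auto simp: star_ideal_def)
qed

text \<open>Ideals are ring ideals, with no mention of scalars; scaling by \<open>c\<close> is
  multiplication by \<open>c\<close> times the unit.\<close>

lemma star_ideal_submodule:
  assumes A: "star_algebra A" and I: "star_ideal I A" shows "submodule I complex_alg A"
proof -
  have R: "I \<subseteq> carrier A" "\<zero>\<^bsub>A\<^esub> \<in> I" "\<And>x y. x \<in> I \<Longrightarrow> y \<in> I \<Longrightarrow> x \<oplus>\<^bsub>A\<^esub> y \<in> I"
    "\<And>x a. x \<in> I \<Longrightarrow> a \<in> carrier A \<Longrightarrow> a \<otimes>\<^bsub>A\<^esub> x \<in> I"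
    using I unfolding star_ideal_iff[OF A] by auto
  have "c \<odot>\<^bsub>A\<^esub> x \<in> I" if x: "x \<in> I" for c x
  proof -
    have "c \<odot>\<^bsub>A\<^esub> x = (c \<odot>\<^bsub>A\<^esub> \<one>\<^bsub>A\<^esub>) \<otimes>\<^bsub>A\<^esub> x" using A R(1) x by (auto simp: alg_smult_mult)
    then show ?thesis using R(4)[OF x, of "c \<odot>\<^bsub>A\<^esub> \<one>\<^bsub>A\<^esub>"] A by simp
  qed
  then show ?thesis using A R by (auto simp: submodule_iff)
qed

lemma gen_star_ideal_star_ideal:
  assumes "star_algebra A" "X \<subseteq> carrier A" shows "star_ideal (gen_star_ideal A X) A"
proof -
  have "star_ideal (carrier A) A" using assms by (simp add: star_ideal_iff)
  then have "gen_star_ideal A X \<subseteq> carrier A" using assms(2) by (auto simp: gen_star_ideal_def)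
  then show ?thesis unfolding star_ideal_iff[OF assms(1)]
    by (auto simp: gen_star_ideal_def star_ideal_iff[OF assms(1)])
qed

lemma gen_star_ideal_superset: "X \<subseteq> gen_star_ideal A X"
  by (auto simp: gen_star_ideal_def)

lemma gen_star_ideal_least: "\<lbrakk>star_ideal I A; X \<subseteq> I\<rbrakk> \<Longrightarrow> gen_star_ideal A X \<subseteq> I"
  by (auto simp: gen_star_ideal_def)

text \<open>Stated for the preimage of an arbitrary *-ideal. Besides kernels this covers the
  comultiplication and the antipode, where the ideal in the target is not zero; conditions on a
  generated ideal thereby reduce to its generators.\<close>

lemma star_hom_kernel:
  assumes A: "star_algebra A" and B: "star_algebra B" and f: "f \<in> star_hom A B" and J: "star_ideal J B"
  shows "star_ideal {x \<in> carrier A. f x \<in> J} A"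
  using J unfolding star_ideal_iff[OF A] star_ideal_iff[OF B]
  using A linear_maps_zero[OF star_hom_linear[OF f]] B
  by (auto simp: star_hom_add[OF f] star_hom_mult[OF f] star_hom_star[OF f] star_hom_closed[OF f])

lemma star_ideal_zero: "star_algebra B \<Longrightarrow> star_ideal {\<zero>\<^bsub>B\<^esub>} B"
  by (simp add: star_ideal_iff)

context
  fixes A :: "('a, 'm) star_alg_scheme" and I
  assumes A [simp]: "star_algebra A" and I: "star_ideal I A"
begin

private abbreviation (input) "QA \<equiv> star_quot A I"

lemma star_quot_proj:
  "(\<lambda>x. I +>\<^bsub>A\<^esub> x) ` carrier A = carrier QA"
  "\<lbrakk>x \<in> carrier A; y \<in> carrier A\<rbrakk> \<Longrightarrow> I +>\<^bsub>A\<^esub> (x \<oplus>\<^bsub>A\<^esub> y) = (I +>\<^bsub>A\<^esub> x) \<oplus>\<^bsub>QA\<^esub> (I +>\<^bsub>A\<^esub> y)"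
  "x \<in> carrier A \<Longrightarrow> I +>\<^bsub>A\<^esub> (c \<odot>\<^bsub>A\<^esub> x) = c \<odot>\<^bsub>QA\<^esub> (I +>\<^bsub>A\<^esub> x)"
  "I +>\<^bsub>A\<^esub> \<zero>\<^bsub>A\<^esub> = \<zero>\<^bsub>QA\<^esub>"
  "\<lbrakk>x \<in> carrier A; y \<in> carrier A\<rbrakk> \<Longrightarrow> I +>\<^bsub>A\<^esub> (x \<otimes>\<^bsub>A\<^esub> y) = (I +>\<^bsub>A\<^esub> x) \<otimes>\<^bsub>QA\<^esub> (I +>\<^bsub>A\<^esub> y)"
  "I +>\<^bsub>A\<^esub> \<one>\<^bsub>A\<^esub> = \<one>\<^bsub>QA\<^esub>"
  "x \<in> carrier A \<Longrightarrow> I +>\<^bsub>A\<^esub> star A x = star QA (I +>\<^bsub>A\<^esub> x)"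
proof -
  note sub = star_ideal_submodule[OF A I]
  have ideal: "ideal I A" using I by (simp add: star_ideal_def)
  show "(\<lambda>x. I +>\<^bsub>A\<^esub> x) ` carrier A = carrier QA"
    by (simp add: star_quot_def a_rcosets_image)
  show "\<lbrakk>x \<in> carrier A; y \<in> carrier A\<rbrakk> \<Longrightarrow> I +>\<^bsub>A\<^esub> (x \<oplus>\<^bsub>A\<^esub> y) = (I +>\<^bsub>A\<^esub> x) \<oplus>\<^bsub>QA\<^esub> (I +>\<^bsub>A\<^esub> y)"
    by (simp add: star_quot_def coset_add[OF _ sub])
  show "x \<in> carrier A \<Longrightarrow> I +>\<^bsub>A\<^esub> (c \<odot>\<^bsub>A\<^esub> x) = c \<odot>\<^bsub>QA\<^esub> (I +>\<^bsub>A\<^esub> x)"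
    by (simp add: star_quot_def coset_smult[OF _ sub])
  show "I +>\<^bsub>A\<^esub> \<zero>\<^bsub>A\<^esub> = \<zero>\<^bsub>QA\<^esub>" by (simp add: star_quot_def coset_zero[OF _ sub])
  show "\<lbrakk>x \<in> carrier A; y \<in> carrier A\<rbrakk> \<Longrightarrow> I +>\<^bsub>A\<^esub> (x \<otimes>\<^bsub>A\<^esub> y) = (I +>\<^bsub>A\<^esub> x) \<otimes>\<^bsub>QA\<^esub> (I +>\<^bsub>A\<^esub> y)"
    by (simp add: star_quot_def ideal.rcoset_mult_add[OF ideal])
  show "I +>\<^bsub>A\<^esub> \<one>\<^bsub>A\<^esub> = \<one>\<^bsub>QA\<^esub>" by (simp add: star_quot_def)
  show "I +>\<^bsub>A\<^esub> star A x = star QA (I +>\<^bsub>A\<^esub> x)" if x: "x \<in> carrier A"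
  proof -
    have "(\<Union>z\<in>I +>\<^bsub>A\<^esub> x. I +>\<^bsub>A\<^esub> star A z) = I +>\<^bsub>A\<^esub> star A x"
    proof (rule coset_Union[OF _ sub x])
      fix z assume z: "z \<in> carrier A" "z \<ominus>\<^bsub>A\<^esub> x \<in> I"
      have "star A z \<ominus>\<^bsub>A\<^esub> star A x \<in> I"
        using z x I unfolding star_ideal_iff[OF A] by (simp add: alg_star_minus[symmetric])
      then show "I +>\<^bsub>A\<^esub> star A z = I +>\<^bsub>A\<^esub> star A x" using z x by (simp add: coset_eq_iff[OF _ sub])
    qed simp
    then show ?thesis by (simp add: star_quot_def)
  qed
qed

lemma star_quot_star_algebra: "star_algebra QA"
  by (rule star_algebra_image[OF A, of "\<lambda>x. I +>\<^bsub>A\<^esub> x"]) (simp_all add: star_quot_proj)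

lemma star_quot_proj_hom: "(\<lambda>x. I +>\<^bsub>A\<^esub> x) \<in> star_hom A QA"
  by (rule star_homI linear_mapsI)+
    (use star_quot_proj(1) in \<open>auto simp: star_quot_proj(2-7)\<close>)

lemma star_quot_eq_iff:
  "\<lbrakk>x \<in> carrier A; y \<in> carrier A\<rbrakk> \<Longrightarrow> I +>\<^bsub>A\<^esub> x = I +>\<^bsub>A\<^esub> y \<longleftrightarrow> x \<ominus>\<^bsub>A\<^esub> y \<in> I"
  by (rule coset_eq_iff[OF _ star_ideal_submodule[OF A I]]) simp_all

lemma star_quot_induced:
  assumes B: "cvec B" and f: "f \<in> linear_maps A B" and ker: "\<And>x. x \<in> I \<Longrightarrow> f x = \<zero>\<^bsub>B\<^esub>"
    and x: "x \<in> carrier A"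
  shows "the_elem (f ` (I +>\<^bsub>A\<^esub> x)) = f x"
  by (rule coset_the_elem_linear[OF _ star_ideal_submodule[OF A I] x B f ker]) simp_all

lemma star_quot_linear:
  assumes B: "cvec B" and f: "f \<in> linear_maps A B" and ker: "\<And>x. x \<in> I \<Longrightarrow> f x = \<zero>\<^bsub>B\<^esub>"
  shows "(\<lambda>X. the_elem (f ` X)) \<in> linear_maps QA B"
proof (rule linear_mapsI)
  note ind = star_quot_induced[OF B f ker]
  fix X Y c assume "X \<in> carrier QA"
  then obtain x where x: "X = I +>\<^bsub>A\<^esub> x" "x \<in> carrier A" using star_quot_proj(1) by blast
  show "the_elem (f ` X) \<in> carrier B" using x by (simp add: ind linear_maps_closed[OF f])
  have "the_elem (f ` (I +>\<^bsub>A\<^esub> (c \<odot>\<^bsub>A\<^esub> x))) = c \<odot>\<^bsub>B\<^esub> the_elem (f ` X)"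
    using x by (simp add: ind linear_maps_smult[OF f])
  then show "the_elem (f ` (c \<odot>\<^bsub>QA\<^esub> X)) = c \<odot>\<^bsub>B\<^esub> the_elem (f ` X)" using x by (simp add: star_quot_proj)
  assume "Y \<in> carrier QA"
  then obtain y where y: "Y = I +>\<^bsub>A\<^esub> y" "y \<in> carrier A" using star_quot_proj(1) by blast
  have "the_elem (f ` (I +>\<^bsub>A\<^esub> (x \<oplus>\<^bsub>A\<^esub> y))) = the_elem (f ` X) \<oplus>\<^bsub>B\<^esub> the_elem (f ` Y)"
    using x y by (simp add: ind linear_maps_add[OF f])
  then show "the_elem (f ` (X \<oplus>\<^bsub>QA\<^esub> Y)) = the_elem (f ` X) \<oplus>\<^bsub>B\<^esub> the_elem (f ` Y)"
    using x y by (simp add: star_quot_proj)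
qed

lemma star_quot_star_hom:
  assumes B: "star_algebra B" and f: "f \<in> star_hom A B" and ker: "\<And>x. x \<in> I \<Longrightarrow> f x = \<zero>\<^bsub>B\<^esub>"
  shows "(\<lambda>X. the_elem (f ` X)) \<in> star_hom QA B"
proof (rule star_homI)
  note ind = star_quot_induced[OF star_algebra_cvec[OF B] star_hom_linear[OF f] ker]
  note p = star_quot_proj_hom
  let ?f = "\<lambda>X. the_elem (f ` X)"
  show "?f \<in> linear_maps QA B"
    by (rule star_quot_linear[OF star_algebra_cvec[OF B] star_hom_linear[OF f] ker])
  fix X Y assume "X \<in> carrier QA"
  then obtain x where x: "X = I +>\<^bsub>A\<^esub> x" "x \<in> carrier A" using star_quot_proj(1) by blast
  have "?f (I +>\<^bsub>A\<^esub> star A x) = star B (?f X)" using x by (simp add: ind star_hom_star[OF f])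
  then show "?f (star QA X) = star B (?f X)" using x by (simp add: star_hom_star[OF p])
  assume "Y \<in> carrier QA"
  then obtain y where y: "Y = I +>\<^bsub>A\<^esub> y" "y \<in> carrier A" using star_quot_proj(1) by blast
  have "?f (I +>\<^bsub>A\<^esub> (x \<otimes>\<^bsub>A\<^esub> y)) = ?f X \<otimes>\<^bsub>B\<^esub> ?f Y" using x y by (simp add: ind star_hom_mult[OF f])
  then show "?f (X \<otimes>\<^bsub>QA\<^esub> Y) = ?f X \<otimes>\<^bsub>B\<^esub> ?f Y" using x y by (simp add: star_hom_mult[OF p])
next
  show "the_elem (f ` \<one>\<^bsub>QA\<^esub>) = \<one>\<^bsub>B\<^esub>"
    using star_quot_induced[OF star_algebra_cvec[OF B] star_hom_linear[OF f] ker, of "\<one>\<^bsub>A\<^esub>"]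
    by (simp add: star_hom_one[OF star_quot_proj_hom] star_hom_one[OF f])
qed

end

subsection \<open>Scalars, opposite algebras and group algebras\<close>

lemma cvec_finsum_swap:
  assumes V: "cvec V" and I: "finite I" and J: "finite J"
    and f: "\<And>i j. \<lbrakk>i \<in> I; j \<in> J\<rbrakk> \<Longrightarrow> f i j \<in> carrier V"
  shows "(\<Oplus>\<^bsub>V\<^esub>i\<in>I. \<Oplus>\<^bsub>V\<^esub>j\<in>J. f i j) = (\<Oplus>\<^bsub>V\<^esub>j\<in>J. \<Oplus>\<^bsub>V\<^esub>i\<in>I. f i j)"
  using I f
proof (induction I)
  case empty
  then show ?case using V by (simp add: cvec_finsum_zero)
next
  case (insert i I)
  have "(\<Oplus>\<^bsub>V\<^esub>i\<in>insert i I. \<Oplus>\<^bsub>V\<^esub>j\<in>J. f i j) =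
      (\<Oplus>\<^bsub>V\<^esub>j\<in>J. f i j) \<oplus>\<^bsub>V\<^esub> (\<Oplus>\<^bsub>V\<^esub>j\<in>J. \<Oplus>\<^bsub>V\<^esub>i\<in>I. f i j)"
    using insert V by (simp add: cvec_finsum_insert)
  also have "\<dots> = (\<Oplus>\<^bsub>V\<^esub>j\<in>J. f i j \<oplus>\<^bsub>V\<^esub> (\<Oplus>\<^bsub>V\<^esub>i\<in>I. f i j))"
    by (rule cvec_finsum_add[symmetric]) (use insert V in auto)
  also have "\<dots> = (\<Oplus>\<^bsub>V\<^esub>j\<in>J. \<Oplus>\<^bsub>V\<^esub>i\<in>insert i I. f i j)"
    by (rule cvec_finsum_cong) (use insert V in \<open>auto simp: cvec_finsum_insert\<close>)
  finally show ?case .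
qed

text \<open>The complex numbers with conjugation. \<open>complex_alg\<close> has no involution, but
  the universal property that produces the counit asks for a *-algebra as target.\<close>

definition complex_star :: "complex star_alg" where
  "complex_star = \<lparr>carrier = UNIV, mult = (*), one = 1, zero = 0, add = (+), smult = (*), star = cnj\<rparr>"

lemma complex_star_sel [simp]:
  "carrier complex_star = UNIV" "mult complex_star = (*)" "one complex_star = 1"
  "zero complex_star = 0" "add complex_star = (+)" "smult complex_star = (*)" "star complex_star = cnj"
  by (simp_all add: complex_star_def)

lemma complex_star_star_algebra: "star_algebra complex_star"
proof (rule star_algebraI)
  show "cvec complex_star"
  proof (rule moduleI)
    show "abelian_group complex_star"
    proof (rule abelian_groupI)
      fix x :: complex
      show "\<exists>y\<in>carrier complex_star. y \<oplus>\<^bsub>complex_star\<^esub> x = \<zero>\<^bsub>complex_star\<^esub>"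
        by (rule bexI[of _ "- x"]) simp_all
    qed simp_all
  qed (simp_all add: cring_complex_alg algebra_simps)
qed (simp_all add: algebra_simps)

lemma alg_hom_complex_star: "alg_hom A complex_star = alg_hom A complex_alg"
  by (simp add: alg_hom_def ring_hom_def linear_maps_def)

text \<open>An antipode reverses products, so it is obtained as a homomorphism into the opposite
  algebra. The involution is kept as it is, so a *-homomorphism into \<open>op_alg\<close> also
  commutes with the involution; for the generators considered here this is consistent, see
  \<open>hn_family_op\<close>.\<close>

definition op_alg :: "('a, 'm) star_alg_scheme \<Rightarrow> ('a, 'm) star_alg_scheme" where
  "op_alg A = A\<lparr>mult := (\<lambda>x y. y \<otimes>\<^bsub>A\<^esub> x)\<rparr>"

lemma op_alg_sel [simp]:
  "carrier (op_alg A) = carrier A" "x \<otimes>\<^bsub>op_alg A\<^esub> y = y \<otimes>\<^bsub>A\<^esub> x" "one (op_alg A) = one A"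
  "zero (op_alg A) = zero A" "add (op_alg A) = add A" "smult (op_alg A) = smult A" "star (op_alg A) = star A"
  by (simp_all add: op_alg_def)

lemma op_alg_star_algebra:
  assumes A: "star_algebra A" shows "star_algebra (op_alg A)"
proof (rule star_algebraI)
  show "cvec (op_alg A)" by (rule cvec_image[of A "\<lambda>x. x"]) (use A in simp_all)
qed (use A in \<open>simp_all add: alg_mult_assoc alg_mult_add alg_add_mult alg_smult_mult alg_mult_smult
      alg_star_add alg_star_smult alg_star_mult\<close>)

text \<open>A Hopf *-algebra record extends the record of its *-algebra, so the two have different
  types and cannot be equated. Comparing the common fields lets results move between them.\<close>

definition same_star_alg :: "('a, 'm) star_alg_scheme \<Rightarrow> ('a, 'n) star_alg_scheme \<Rightarrow> bool" where
  "same_star_alg A B \<longleftrightarrow> carrier A = carrier B \<and> mult A = mult B \<and> one A = one B \<and> zero A = zero B \<and>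
    add A = add B \<and> smult A = smult B \<and> star A = star B"

lemma same_star_alg_extend: "same_star_alg (star_alg.extend A x) A"
  by (simp add: same_star_alg_def star_alg.defs)

lemma same_star_alg_star_algebra: "\<lbrakk>same_star_alg A B; star_algebra B\<rbrakk> \<Longrightarrow> star_algebra A"
  by (rule star_algebra_image[of B "\<lambda>x. x"]) (simp_all add: same_star_alg_def)

lemma same_star_alg_star_hom:
  "\<lbrakk>same_star_alg A A'; same_star_alg B B'\<rbrakk> \<Longrightarrow> star_hom A B = star_hom A' B'"
  by (simp add: star_hom_def alg_hom_def ring_hom_def linear_maps_def same_star_alg_def)

text \<open>Tensor products read only the common fields, so here genuine equality holds and
  rewriting is possible.\<close>

lemma same_star_alg_tensor:
  assumes "same_star_alg A A'" "same_star_alg B B'"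
  shows "tensor_space A B = tensor_space A' B'" "pure A B = pure A' B'" "tensor_alg A B = tensor_alg A' B'"
proof -
  have null: "tensor_null A B = tensor_null A' B'"
    using assms by (simp add: tensor_null_def same_star_alg_def)
  show T: "tensor_space A B = tensor_space A' B'"
    using assms null by (simp add: tensor_space_def same_star_alg_def)
  show P: "pure A B = pure A' B'"
    using assms null by (intro ext) (simp add: pure_def same_star_alg_def)
  show "tensor_alg A B = tensor_alg A' B'"
    using assms by (simp add: tensor_alg_def Let_def T P same_star_alg_def)
qed

lemma group_alg_star_algebra:
  assumes "group G" shows "star_algebra (group_alg G)"
  unfolding group_alg_def
  by (rule monoid_algebra_star_algebra)
    (use assms in \<open>auto simp: group.inv_mult_group group.is_monoid\<close>)

text \<open>Index ranges \<open>{1..N}\<close> have to survive simplification, as the facts about the generators are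
  conditional on membership in them.\<close>

declare One_nat_def [simp del] atLeastAtMost_iff [simp del]

section \<open>The *-algebra generated by the magic matrices over a group\<close>

text \<open>The relations of \<open>hn_relators\<close> read in an arbitrary *-algebra. Each
  structure map on the universal algebra then amounts to exhibiting one such family.\<close>

definition hn_family ::
    "nat \<Rightarrow> ('g, 'm) monoid_scheme \<Rightarrow> ('b, 'n) star_alg_scheme \<Rightarrow> (nat \<Rightarrow> nat \<Rightarrow> 'g \<Rightarrow> 'b) \<Rightarrow> bool" where
  "hn_family N G B b \<longleftrightarrow>
     (\<forall>i\<in>{1..N}. \<forall>j\<in>{1..N}. \<forall>g\<in>carrier G. b i j g \<in> carrier B \<and> star B (b i j g) = b i j (inv\<^bsub>G\<^esub> g)) \<and>
     (\<forall>i\<in>{1..N}. \<forall>j\<in>{1..N}. \<forall>k\<in>{1..N}. \<forall>g\<in>carrier G. \<forall>h\<in>carrier G.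
        b i j g \<otimes>\<^bsub>B\<^esub> b i k h = (if j = k then b i j (g \<otimes>\<^bsub>G\<^esub> h) else \<zero>\<^bsub>B\<^esub>) \<and>
        b j i g \<otimes>\<^bsub>B\<^esub> b k i h = (if j = k then b j i (g \<otimes>\<^bsub>G\<^esub> h) else \<zero>\<^bsub>B\<^esub>)) \<and>
     (\<forall>i\<in>{1..N}. (\<Oplus>\<^bsub>B\<^esub>k\<in>{1..N}. b i k \<one>\<^bsub>G\<^esub>) = \<one>\<^bsub>B\<^esub> \<and> (\<Oplus>\<^bsub>B\<^esub>k\<in>{1..N}. b k i \<one>\<^bsub>G\<^esub>) = \<one>\<^bsub>B\<^esub>)"

lemma hn_familyI:
  assumes "\<And>i j g. \<lbrakk>i \<in> {1..N}; j \<in> {1..N}; g \<in> carrier G\<rbrakk> \<Longrightarrow> b i j g \<in> carrier B"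
    and "\<And>i j g. \<lbrakk>i \<in> {1..N}; j \<in> {1..N}; g \<in> carrier G\<rbrakk> \<Longrightarrow> star B (b i j g) = b i j (inv\<^bsub>G\<^esub> g)"
    and "\<And>i j k g h. \<lbrakk>i \<in> {1..N}; j \<in> {1..N}; k \<in> {1..N}; g \<in> carrier G; h \<in> carrier G\<rbrakk>
      \<Longrightarrow> b i j g \<otimes>\<^bsub>B\<^esub> b i k h = (if j = k then b i j (g \<otimes>\<^bsub>G\<^esub> h) else \<zero>\<^bsub>B\<^esub>)"
    and "\<And>i j k g h. \<lbrakk>i \<in> {1..N}; j \<in> {1..N}; k \<in> {1..N}; g \<in> carrier G; h \<in> carrier G\<rbrakk>
      \<Longrightarrow> b j i g \<otimes>\<^bsub>B\<^esub> b k i h = (if j = k then b j i (g \<otimes>\<^bsub>G\<^esub> h) else \<zero>\<^bsub>B\<^esub>)"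
    and "\<And>i. i \<in> {1..N} \<Longrightarrow> (\<Oplus>\<^bsub>B\<^esub>k\<in>{1..N}. b i k \<one>\<^bsub>G\<^esub>) = \<one>\<^bsub>B\<^esub>"
    and "\<And>i. i \<in> {1..N} \<Longrightarrow> (\<Oplus>\<^bsub>B\<^esub>k\<in>{1..N}. b k i \<one>\<^bsub>G\<^esub>) = \<one>\<^bsub>B\<^esub>"
  shows "hn_family N G B b"
  unfolding hn_family_def by (intro conjI ballI; rule assms; assumption)

lemma
  assumes "hn_family N G B b"
  shows hn_family_closed: "\<lbrakk>i \<in> {1..N}; j \<in> {1..N}; g \<in> carrier G\<rbrakk> \<Longrightarrow> b i j g \<in> carrier B"
    and hn_family_star: "\<lbrakk>i \<in> {1..N}; j \<in> {1..N}; g \<in> carrier G\<rbrakk> \<Longrightarrow> star B (b i j g) = b i j (inv\<^bsub>G\<^esub> g)"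
    and hn_family_row: "\<lbrakk>i \<in> {1..N}; j \<in> {1..N}; k \<in> {1..N}; g \<in> carrier G; h \<in> carrier G\<rbrakk>
      \<Longrightarrow> b i j g \<otimes>\<^bsub>B\<^esub> b i k h = (if j = k then b i j (g \<otimes>\<^bsub>G\<^esub> h) else \<zero>\<^bsub>B\<^esub>)"
    and hn_family_col: "\<lbrakk>i \<in> {1..N}; j \<in> {1..N}; k \<in> {1..N}; g \<in> carrier G; h \<in> carrier G\<rbrakk>
      \<Longrightarrow> b j i g \<otimes>\<^bsub>B\<^esub> b k i h = (if j = k then b j i (g \<otimes>\<^bsub>G\<^esub> h) else \<zero>\<^bsub>B\<^esub>)"
    and hn_family_row_sum: "i \<in> {1..N} \<Longrightarrow> (\<Oplus>\<^bsub>B\<^esub>k\<in>{1..N}. b i k \<one>\<^bsub>G\<^esub>) = \<one>\<^bsub>B\<^esub>"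
    and hn_family_col_sum: "i \<in> {1..N} \<Longrightarrow> (\<Oplus>\<^bsub>B\<^esub>k\<in>{1..N}. b k i \<one>\<^bsub>G\<^esub>) = \<one>\<^bsub>B\<^esub>"
  using assms unfolding hn_family_def by simp_all

lemma hn_family_image:
  assumes f: "f \<in> star_hom A B" and A: "star_algebra A" and B: "star_algebra B"
    and G: "group G" and b: "hn_family N G A b"
  shows "hn_family N G B (\<lambda>i j g. f (b i j g))"
proof -
  interpret group G by fact
  note [simp] = hn_family_closed[OF b]
  have sum: "(\<Oplus>\<^bsub>B\<^esub>k\<in>{1..N}. f (h k)) = f (\<Oplus>\<^bsub>A\<^esub>k\<in>{1..N}. h k)"
    if "\<And>k. k \<in> {1..N} \<Longrightarrow> h k \<in> carrier A" for h
    using linear_maps_finsum[OF star_hom_linear[OF f], of "{1..N}" h] A B that by simp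
  show ?thesis
    using linear_maps_zero[OF star_hom_linear[OF f]] A B
    by (intro hn_familyI)
      (simp_all add: star_hom_closed[OF f] sum hn_family_row_sum[OF b] hn_family_col_sum[OF b]
        star_hom_one[OF f] star_hom_star[OF f, symmetric] star_hom_mult[OF f, symmetric]
        hn_family_star[OF b] hn_family_row[OF b] hn_family_col[OF b])
qed

text \<open>For \<open>B = C\<close> this is the family behind the comultiplication. In a product of
  two entries a double sum appears; for the row relation, orthogonality in \<open>B\<close>
  identifies the two summation indices and orthogonality in \<open>C\<close> settles the rest, and
  for the column relation the roles are exchanged.\<close>

lemma hn_family_tensor:
  assumes B: "star_algebra B" and C: "star_algebra C" and G: "group G"
    and b: "hn_family N G B b" and c: "hn_family N G C c"
  shows "hn_family N G (tensor_alg B C) (\<lambda>i j g. \<Oplus>\<^bsub>tensor_space B C\<^esub>k\<in>{1..N}. pure B C (b i k g) (c k j g))"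
proof -
  interpret group G by fact
  let ?T = "tensor_alg B C" and ?I = "{1..N}" and ?d = "\<lambda>i j g. \<Oplus>\<^bsub>tensor_space B C\<^esub>k\<in>{1..N}. pure B C (b i k g) (c k j g)"
  note [simp] = B C hn_family_closed[OF b] hn_family_closed[OF c]
  have T [simp]: "cvec (tensor_space B C)" "star_algebra ?T" by simp_all
  have mult: "?d i j g \<otimes>\<^bsub>?T\<^esub> ?d i' j' h =
      (\<Oplus>\<^bsub>tensor_space B C\<^esub>k\<in>?I. \<Oplus>\<^bsub>tensor_space B C\<^esub>l\<in>?I. pure B C (b i k g \<otimes>\<^bsub>B\<^esub> b i' l h) (c k j g \<otimes>\<^bsub>C\<^esub> c l j' h))"
    if [simp]: "i \<in> ?I" "j \<in> ?I" "i' \<in> ?I" "j' \<in> ?I" "g \<in> carrier G" "h \<in> carrier G" for i j i' j' g h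
  proof -
    have "?d i j g \<otimes>\<^bsub>?T\<^esub> ?d i' j' h =
        (\<Oplus>\<^bsub>?T\<^esub>k\<in>?I. \<Oplus>\<^bsub>?T\<^esub>l\<in>?I. pure B C (b i k g) (c k j g) \<otimes>\<^bsub>?T\<^esub> pure B C (b i' l h) (c l j' h))"
      unfolding finsum_tensor_alg[symmetric] by (rule alg_finsum_mult_finsum[OF T(2)]) simp_all
    also have "\<dots> = (\<Oplus>\<^bsub>tensor_space B C\<^esub>k\<in>?I. \<Oplus>\<^bsub>tensor_space B C\<^esub>l\<in>?I. pure B C (b i k g \<otimes>\<^bsub>B\<^esub> b i' l h) (c k j g \<otimes>\<^bsub>C\<^esub> c l j' h))"
      unfolding finsum_tensor_alg
      by (intro cvec_finsum_cong) simp_all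
    finally show ?thesis .
  qed
  note pz = pure_zero_left[of B C] pure_zero_right[of B C]
  show ?thesis
  proof (rule hn_familyI)
    fix i j g assume [simp]: "i \<in> ?I" "j \<in> ?I" "g \<in> carrier G"
    show "?d i j g \<in> carrier ?T" by simp
    have "star ?T (?d i j g) = (\<Oplus>\<^bsub>?T\<^esub>k\<in>?I. star ?T (pure B C (b i k g) (c k j g)))"
      using alg_star_finsum[OF T(2), of ?I "\<lambda>k. pure B C (b i k g) (c k j g)"] by simp
    also have "\<dots> = ?d i j (inv\<^bsub>G\<^esub> g)"
      unfolding finsum_tensor_alg
      by (intro cvec_finsum_cong) (simp_all add: hn_family_star[OF b] hn_family_star[OF c])
    finally show "star ?T (?d i j g) = ?d i j (inv\<^bsub>G\<^esub> g)" .
  next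
    fix i j k g h assume [simp]: "i \<in> ?I" "j \<in> ?I" "k \<in> ?I" "g \<in> carrier G" "h \<in> carrier G"
    have "?d i j g \<otimes>\<^bsub>?T\<^esub> ?d i k h =
        (\<Oplus>\<^bsub>tensor_space B C\<^esub>p\<in>?I. pure B C (b i p (g \<otimes>\<^bsub>G\<^esub> h)) (c p j g \<otimes>\<^bsub>C\<^esub> c p k h))"
      unfolding mult[OF \<open>i \<in> ?I\<close> \<open>j \<in> ?I\<close> \<open>i \<in> ?I\<close> \<open>k \<in> ?I\<close> \<open>g \<in> carrier G\<close> \<open>h \<in> carrier G\<close>]
      by (intro cvec_finsum_cong cvec_finsum_delta) (auto simp: hn_family_row[OF b] pz)
    also have "\<dots> = (if j = k then ?d i j (g \<otimes>\<^bsub>G\<^esub> h) else \<zero>\<^bsub>?T\<^esub>)"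
      by (cases "j = k"; simp; intro cvec_finsum_cong cvec_finsum_zero; simp add: hn_family_row[OF c] pz)
    finally show "?d i j g \<otimes>\<^bsub>?T\<^esub> ?d i k h = (if j = k then ?d i j (g \<otimes>\<^bsub>G\<^esub> h) else \<zero>\<^bsub>?T\<^esub>)" .
    have "?d j i g \<otimes>\<^bsub>?T\<^esub> ?d k i h =
        (\<Oplus>\<^bsub>tensor_space B C\<^esub>p\<in>?I. pure B C (b j p g \<otimes>\<^bsub>B\<^esub> b k p h) (c p i (g \<otimes>\<^bsub>G\<^esub> h)))"
      unfolding mult[OF \<open>j \<in> ?I\<close> \<open>i \<in> ?I\<close> \<open>k \<in> ?I\<close> \<open>i \<in> ?I\<close> \<open>g \<in> carrier G\<close> \<open>h \<in> carrier G\<close>]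
      by (intro cvec_finsum_cong cvec_finsum_delta) (auto simp: hn_family_col[OF c] pz)
    also have "\<dots> = (if j = k then ?d j i (g \<otimes>\<^bsub>G\<^esub> h) else \<zero>\<^bsub>?T\<^esub>)"
      by (cases "j = k"; simp; intro cvec_finsum_cong cvec_finsum_zero; simp add: hn_family_col[OF b] pz)
    finally show "?d j i g \<otimes>\<^bsub>?T\<^esub> ?d k i h = (if j = k then ?d j i (g \<otimes>\<^bsub>G\<^esub> h) else \<zero>\<^bsub>?T\<^esub>)" .
  next
    fix i assume [simp]: "i \<in> ?I"
    \<comment> \<open>After interchanging the sums, the inner one is a row sum of \<open>c\<close>
      at the neutral element and equals 1; the outer one is then a row sum of
      \<open>b\<close>.\<close>
    have "(\<Oplus>\<^bsub>tensor_space B C\<^esub>j\<in>?I. ?d i j \<one>\<^bsub>G\<^esub>) =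
        (\<Oplus>\<^bsub>tensor_space B C\<^esub>k\<in>?I. \<Oplus>\<^bsub>tensor_space B C\<^esub>j\<in>?I. pure B C (b i k \<one>\<^bsub>G\<^esub>) (c k j \<one>\<^bsub>G\<^esub>))"
      by (rule cvec_finsum_swap) simp_all
    also have "\<dots> = (\<Oplus>\<^bsub>tensor_space B C\<^esub>k\<in>?I. pure B C (b i k \<one>\<^bsub>G\<^esub>) (\<Oplus>\<^bsub>C\<^esub>j\<in>?I. c k j \<one>\<^bsub>G\<^esub>))"
      by (intro cvec_finsum_cong linear_maps_finsum[OF bilinear_linear_right[OF pure_bilinear], symmetric]) simp_all
    also have "\<dots> = (\<Oplus>\<^bsub>tensor_space B C\<^esub>k\<in>?I. pure B C (b i k \<one>\<^bsub>G\<^esub>) \<one>\<^bsub>C\<^esub>)"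
      by (intro cvec_finsum_cong) (simp_all add: hn_family_row_sum[OF c])
    also have "\<dots> = pure B C (\<Oplus>\<^bsub>B\<^esub>k\<in>?I. b i k \<one>\<^bsub>G\<^esub>) \<one>\<^bsub>C\<^esub>"
      by (intro linear_maps_finsum[OF bilinear_linear_left[OF pure_bilinear], symmetric]) simp_all
    finally show "(\<Oplus>\<^bsub>?T\<^esub>j\<in>?I. ?d i j \<one>\<^bsub>G\<^esub>) = \<one>\<^bsub>?T\<^esub>" by (simp add: hn_family_row_sum[OF b])
    have "(\<Oplus>\<^bsub>tensor_space B C\<^esub>j\<in>?I. ?d j i \<one>\<^bsub>G\<^esub>) =
        (\<Oplus>\<^bsub>tensor_space B C\<^esub>k\<in>?I. \<Oplus>\<^bsub>tensor_space B C\<^esub>j\<in>?I. pure B C (b j k \<one>\<^bsub>G\<^esub>) (c k i \<one>\<^bsub>G\<^esub>))"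
      by (rule cvec_finsum_swap) simp_all
    also have "\<dots> = (\<Oplus>\<^bsub>tensor_space B C\<^esub>k\<in>?I. pure B C (\<Oplus>\<^bsub>B\<^esub>j\<in>?I. b j k \<one>\<^bsub>G\<^esub>) (c k i \<one>\<^bsub>G\<^esub>))"
      by (intro cvec_finsum_cong linear_maps_finsum[OF bilinear_linear_left[OF pure_bilinear], symmetric]) simp_all
    also have "\<dots> = (\<Oplus>\<^bsub>tensor_space B C\<^esub>k\<in>?I. pure B C \<one>\<^bsub>B\<^esub> (c k i \<one>\<^bsub>G\<^esub>))"
      by (intro cvec_finsum_cong) (simp_all add: hn_family_col_sum[OF b])
    also have "\<dots> = pure B C \<one>\<^bsub>B\<^esub> (\<Oplus>\<^bsub>C\<^esub>k\<in>?I. c k i \<one>\<^bsub>G\<^esub>)"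
      by (intro linear_maps_finsum[OF bilinear_linear_right[OF pure_bilinear], symmetric]) simp_all
    finally show "(\<Oplus>\<^bsub>?T\<^esub>j\<in>?I. ?d j i \<one>\<^bsub>G\<^esub>) = \<one>\<^bsub>?T\<^esub>" by (simp add: hn_family_col_sum[OF c])
  qed
qed

text \<open>The family behind the antipode. Transposing exchanges the row and column relations, and
  inversion reverses products in the group, which is compensated by the opposite
  multiplication.\<close>

lemma hn_family_op:
  assumes G: "group G" and b: "hn_family N G B b"
  shows "hn_family N G (op_alg B) (\<lambda>i j g. b j i (inv\<^bsub>G\<^esub> g))"
proof -
  interpret group G by fact
  have sum: "finsum (op_alg B) f I = finsum B f I" for f and I :: "nat set"
    by (rule finsum_structure_cong) simp_all
  show ?thesis
    by (rule hn_familyI)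
      (auto simp: hn_family_closed[OF b] hn_family_star[OF b] hn_family_row[OF b] hn_family_col[OF b] sum
        hn_family_row_sum[OF b] hn_family_col_sum[OF b] inv_mult_group)
qed

lemma hn_family_counit: "hn_family N G complex_star (\<lambda>i j g. if i = j then 1 else 0)"
  using complex_star_star_algebra
  by (intro hn_familyI cvec_finsum_delta) auto

text \<open>As \<open>b\<^sub>j\<^sub>k(g)\<^sup>* = b\<^sub>j\<^sub>k(g\<inverse>)\<close>,
  orthogonality within a column leaves only \<open>i = j\<close>, where the group elements cancel
  and a row sum at the neutral element remains. The second identity is the same with rows and
  columns exchanged.\<close>

lemma hn_family_unitary:
  assumes G: "group G" and b: "hn_family N G B b" and B: "star_algebra B"
    and i: "i \<in> {1..N}" "j \<in> {1..N}" "g \<in> carrier G"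
  shows "(\<Oplus>\<^bsub>B\<^esub>k\<in>{1..N}. b i k g \<otimes>\<^bsub>B\<^esub> star B (b j k g)) = (if i = j then \<one>\<^bsub>B\<^esub> else \<zero>\<^bsub>B\<^esub>)"
    and "(\<Oplus>\<^bsub>B\<^esub>k\<in>{1..N}. star B (b k i g) \<otimes>\<^bsub>B\<^esub> b k j g) = (if i = j then \<one>\<^bsub>B\<^esub> else \<zero>\<^bsub>B\<^esub>)"
proof -
  interpret group G by fact
  have "(\<Oplus>\<^bsub>B\<^esub>k\<in>{1..N}. b i k g \<otimes>\<^bsub>B\<^esub> star B (b j k g)) =
      (\<Oplus>\<^bsub>B\<^esub>k\<in>{1..N}. if i = j then b i k \<one>\<^bsub>G\<^esub> else \<zero>\<^bsub>B\<^esub>)"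
    by (rule cvec_finsum_cong) (use B i in \<open>auto simp: hn_family_star[OF b] hn_family_col[OF b] hn_family_closed[OF b]\<close>)
  also have "\<dots> = (if i = j then \<one>\<^bsub>B\<^esub> else \<zero>\<^bsub>B\<^esub>)"
    using B i by (auto simp: hn_family_row_sum[OF b] cvec_finsum_zero)
  finally show "(\<Oplus>\<^bsub>B\<^esub>k\<in>{1..N}. b i k g \<otimes>\<^bsub>B\<^esub> star B (b j k g)) = (if i = j then \<one>\<^bsub>B\<^esub> else \<zero>\<^bsub>B\<^esub>)" .
  have "(\<Oplus>\<^bsub>B\<^esub>k\<in>{1..N}. star B (b k i g) \<otimes>\<^bsub>B\<^esub> b k j g) =
      (\<Oplus>\<^bsub>B\<^esub>k\<in>{1..N}. if i = j then b k i \<one>\<^bsub>G\<^esub> else \<zero>\<^bsub>B\<^esub>)"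
    by (rule cvec_finsum_cong) (use B i in \<open>auto simp: hn_family_star[OF b] hn_family_row[OF b] hn_family_closed[OF b]\<close>)
  also have "\<dots> = (if i = j then \<one>\<^bsub>B\<^esub> else \<zero>\<^bsub>B\<^esub>)"
    using B i by (auto simp: hn_family_col_sum[OF b] cvec_finsum_zero)
  finally show "(\<Oplus>\<^bsub>B\<^esub>k\<in>{1..N}. star B (b k i g) \<otimes>\<^bsub>B\<^esub> b k j g) = (if i = j then \<one>\<^bsub>B\<^esub> else \<zero>\<^bsub>B\<^esub>)" .
qed

section \<open>The universal algebra: its generators, an induction principle and the universal
  property\<close>

context
  fixes N :: nat and G :: "('g, 'm) monoid_scheme"
  assumes G: "group G"
begin

interpretation group G by fact

private abbreviation (input) "FH \<equiv> hn_free N G"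
private abbreviation (input) "JH \<equiv> hn_ideal N G"
private abbreviation (input) "H \<equiv> hn_star_alg N G"

lemma hn_free_star_algebra [simp]: "star_algebra FH"
  by (simp add: hn_free_def)

lemma hn_var_closed [simp]: "\<lbrakk>i \<in> {1..N}; j \<in> {1..N}; g \<in> carrier G\<rbrakk> \<Longrightarrow> hn_var i j g \<in> carrier FH"
  by (simp add: hn_free_def hn_var_def)

lemma hn_relators_closed: "hn_relators N G \<subseteq> carrier FH"
  unfolding hn_relators_def Let_def
  by (auto)

lemma hn_ideal_star_ideal: "star_ideal JH FH"
  unfolding hn_ideal_def by (rule gen_star_ideal_star_ideal) (simp_all add: hn_relators_closed)

lemma hn_star_alg_star_algebra: "star_algebra H"
  unfolding hn_star_alg_def by (rule star_quot_star_algebra[OF hn_free_star_algebra hn_ideal_star_ideal])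

lemma hn_proj_hom: "(\<lambda>x. JH +>\<^bsub>FH\<^esub> x) \<in> star_hom FH H"
  unfolding hn_star_alg_def by (rule star_quot_proj_hom[OF hn_free_star_algebra hn_ideal_star_ideal])

lemma hn_proj_eq:
  assumes "x \<ominus>\<^bsub>FH\<^esub> y \<in> hn_relators N G" "x \<in> carrier FH" "y \<in> carrier FH"
  shows "JH +>\<^bsub>FH\<^esub> x = JH +>\<^bsub>FH\<^esub> y"
  using star_quot_eq_iff[OF hn_free_star_algebra hn_ideal_star_ideal assms(2,3)]
    subsetD[OF gen_star_ideal_superset assms(1)] by (simp add: hn_ideal_def)

lemma hn_gen_family: "hn_family N G H (hn_gen N G)"
proof -
  note [simp] = hn_star_alg_star_algebra
  note p = hn_proj_hom
  have sum: "(\<Oplus>\<^bsub>H\<^esub>k\<in>{1..N}. JH +>\<^bsub>FH\<^esub> f k) = JH +>\<^bsub>FH\<^esub> (\<Oplus>\<^bsub>FH\<^esub>k\<in>{1..N}. f k)"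
    if "\<And>k. k \<in> {1..N} \<Longrightarrow> f k \<in> carrier FH" for f
    using linear_maps_finsum[OF star_hom_linear[OF p], of "{1..N}" f] that by simp
  have zero: "JH +>\<^bsub>FH\<^esub> \<zero>\<^bsub>FH\<^esub> = \<zero>\<^bsub>H\<^esub>" using linear_maps_zero[OF star_hom_linear[OF p]] by simp
  note one = star_hom_one[OF p]
  show ?thesis
  proof (rule hn_familyI)
    fix i j g assume [simp]: "i \<in> {1..N}" "j \<in> {1..N}" "g \<in> carrier G"
    show "hn_gen N G i j g \<in> carrier H" by (simp add: hn_gen_def star_hom_closed[OF p])
    have "JH +>\<^bsub>FH\<^esub> star FH (hn_var i j g) = JH +>\<^bsub>FH\<^esub> hn_var i j (inv\<^bsub>G\<^esub> g)"
    proof (rule hn_proj_eq)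
      show "star FH (hn_var i j g) \<ominus>\<^bsub>FH\<^esub> hn_var i j (inv\<^bsub>G\<^esub> g) \<in> hn_relators N G"
        unfolding hn_relators_def Let_def Un_iff mem_Collect_eq
        by (intro disjI1 exI conjI) (rule refl | simp)+
    qed simp_all
    then show "star H (hn_gen N G i j g) = hn_gen N G i j (inv\<^bsub>G\<^esub> g)"
      by (simp add: hn_gen_def star_hom_star[OF p])
  next
    fix i j k g h assume [simp]: "i \<in> {1..N}" "j \<in> {1..N}" "k \<in> {1..N}" "g \<in> carrier G" "h \<in> carrier G"
    have "JH +>\<^bsub>FH\<^esub> (hn_var i j g \<otimes>\<^bsub>FH\<^esub> hn_var i k h) =
        JH +>\<^bsub>FH\<^esub> (if j = k then hn_var i j (g \<otimes>\<^bsub>G\<^esub> h) else \<zero>\<^bsub>FH\<^esub>)"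
    proof (rule hn_proj_eq)
      \<comment> \<open>The relators form a union of five families nested to the left; the chain of
        disjunction rules selects the second. The following cases select in the same way.\<close>
      show "hn_var i j g \<otimes>\<^bsub>FH\<^esub> hn_var i k h \<ominus>\<^bsub>FH\<^esub> (if j = k then hn_var i j (g \<otimes>\<^bsub>G\<^esub> h) else \<zero>\<^bsub>FH\<^esub>) \<in> hn_relators N G"
        unfolding hn_relators_def Let_def Un_iff mem_Collect_eq
        by (rule disjI1, rule disjI1, rule disjI1, rule disjI2, intro exI conjI) (rule refl | simp)+
    qed simp_all
    then show "hn_gen N G i j g \<otimes>\<^bsub>H\<^esub> hn_gen N G i k h =
        (if j = k then hn_gen N G i j (g \<otimes>\<^bsub>G\<^esub> h) else \<zero>\<^bsub>H\<^esub>)"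
      by (simp add: hn_gen_def star_hom_mult[OF p] zero split: if_splits)
    have "JH +>\<^bsub>FH\<^esub> (hn_var j i g \<otimes>\<^bsub>FH\<^esub> hn_var k i h) =
        JH +>\<^bsub>FH\<^esub> (if j = k then hn_var j i (g \<otimes>\<^bsub>G\<^esub> h) else \<zero>\<^bsub>FH\<^esub>)"
    proof (rule hn_proj_eq)
      show "hn_var j i g \<otimes>\<^bsub>FH\<^esub> hn_var k i h \<ominus>\<^bsub>FH\<^esub> (if j = k then hn_var j i (g \<otimes>\<^bsub>G\<^esub> h) else \<zero>\<^bsub>FH\<^esub>) \<in> hn_relators N G"
        unfolding hn_relators_def Let_def Un_iff mem_Collect_eq
        by (rule disjI1, rule disjI1, rule disjI2, intro exI conjI) (rule refl | simp)+
    qed simp_all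
    then show "hn_gen N G j i g \<otimes>\<^bsub>H\<^esub> hn_gen N G k i h =
        (if j = k then hn_gen N G j i (g \<otimes>\<^bsub>G\<^esub> h) else \<zero>\<^bsub>H\<^esub>)"
      by (simp add: hn_gen_def star_hom_mult[OF p] zero split: if_splits)
  next
    fix i assume [simp]: "i \<in> {1..N}"
    have "JH +>\<^bsub>FH\<^esub> (\<Oplus>\<^bsub>FH\<^esub>k\<in>{1..N}. hn_var i k \<one>\<^bsub>G\<^esub>) = JH +>\<^bsub>FH\<^esub> \<one>\<^bsub>FH\<^esub>"
    proof (rule hn_proj_eq)
      show "(\<Oplus>\<^bsub>FH\<^esub>k\<in>{1..N}. hn_var i k \<one>\<^bsub>G\<^esub>) \<ominus>\<^bsub>FH\<^esub> \<one>\<^bsub>FH\<^esub> \<in> hn_relators N G"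
        unfolding hn_relators_def Let_def Un_iff mem_Collect_eq
        by (rule disjI1, rule disjI2, intro exI conjI) (rule refl | simp)+
    qed simp_all
    then show "(\<Oplus>\<^bsub>H\<^esub>k\<in>{1..N}. hn_gen N G i k \<one>\<^bsub>G\<^esub>) = \<one>\<^bsub>H\<^esub>"
      by (simp add: hn_gen_def sum one)
    have "JH +>\<^bsub>FH\<^esub> (\<Oplus>\<^bsub>FH\<^esub>k\<in>{1..N}. hn_var k i \<one>\<^bsub>G\<^esub>) = JH +>\<^bsub>FH\<^esub> \<one>\<^bsub>FH\<^esub>"
    proof (rule hn_proj_eq)
      show "(\<Oplus>\<^bsub>FH\<^esub>k\<in>{1..N}. hn_var k i \<one>\<^bsub>G\<^esub>) \<ominus>\<^bsub>FH\<^esub> \<one>\<^bsub>FH\<^esub> \<in> hn_relators N G"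
        unfolding hn_relators_def Let_def Un_iff mem_Collect_eq
        by (rule disjI2, intro exI conjI) (rule refl | simp)+
    qed simp_all
    then show "(\<Oplus>\<^bsub>H\<^esub>k\<in>{1..N}. hn_gen N G k i \<one>\<^bsub>G\<^esub>) = \<one>\<^bsub>H\<^esub>"
      by (simp add: hn_gen_def sum one)
  qed
qed

text \<open>Adjoint letters need no case, because modulo the relations the adjoint of a generator is
  the generator at the inverse group element.\<close>

lemma hn_induct [consumes 1, case_names one gen add smult]:
  assumes x: "x \<in> carrier H"
    and one: "P \<one>\<^bsub>H\<^esub>"
    and gen: "\<And>i j g x. \<lbrakk>i \<in> {1..N}; j \<in> {1..N}; g \<in> carrier G; x \<in> carrier H; P x\<rbrakk>
      \<Longrightarrow> P (hn_gen N G i j g \<otimes>\<^bsub>H\<^esub> x)"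
    and add: "\<And>x y. \<lbrakk>x \<in> carrier H; y \<in> carrier H; P x; P y\<rbrakk> \<Longrightarrow> P (x \<oplus>\<^bsub>H\<^esub> y)"
    and smult: "\<And>c x. \<lbrakk>x \<in> carrier H; P x\<rbrakk> \<Longrightarrow> P (c \<odot>\<^bsub>H\<^esub> x)"
  shows "P x"
proof -
  note p = hn_proj_hom
  have "P (JH +>\<^bsub>FH\<^esub> w)" if "w \<in> carrier FH" for w
    using that unfolding hn_free_def
  proof (induction rule: free_star_alg_induct)
    case one
    then show ?case using assms(2) star_hom_one[OF p] by (simp add: hn_free_def)
  next
    case (letter x s w)
    then obtain i j g where x: "x = (i, j, g)" "i \<in> {1..N}" "j \<in> {1..N}" "g \<in> carrier G" by (cases x) auto
    have l: "ket [(x, False)] \<in> carrier FH" "ket [(x, s)] \<in> carrier FH" and w: "w \<in> carrier FH"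
      using letter by (simp_all add: hn_free_def)
    \<comment> \<open>An adjoint letter is replaced by the generator with the inverse group element;
      from here on both kinds of letters are treated alike.\<close>
    have "JH +>\<^bsub>FH\<^esub> ket [(x, s)] = hn_gen N G i j (if s then inv\<^bsub>G\<^esub> g else g)"
    proof (cases s)
      case True
      then have "ket [(x, s)] = star FH (hn_var i j g)"
        using letter(1) unfolding hn_free_def hn_var_def x(1)[symmetric]
        by (subst free_star_alg_star_letter) auto
      then show ?thesis using True x star_hom_star[OF p, of "hn_var i j g"] hn_family_star[OF hn_gen_family, of i j g]
        by (simp add: hn_gen_def)
    qed (simp add: hn_gen_def hn_var_def x)
    then have "JH +>\<^bsub>FH\<^esub> (ket [(x, s)] \<otimes>\<^bsub>FH\<^esub> w) = hn_gen N G i j (if s then inv\<^bsub>G\<^esub> g else g) \<otimes>\<^bsub>H\<^esub> (JH +>\<^bsub>FH\<^esub> w)"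
      using star_hom_mult[OF p l(2) w] by simp
    then show ?case using gen[of i j "if s then inv\<^bsub>G\<^esub> g else g" "JH +>\<^bsub>FH\<^esub> w"] x
        star_hom_closed[OF p w] letter.IH by (simp add: hn_free_def)
  next
    case (add v w)
    then show ?case using assms(4) star_hom_add[OF p, of v w] star_hom_closed[OF p] by (simp add: hn_free_def)
  next
    case (smult c w)
    then show ?case using assms(5) star_hom_smult[OF p, of w c] star_hom_closed[OF p] by (simp add: hn_free_def)
  qed
  moreover obtain w where "w \<in> carrier FH" "x = JH +>\<^bsub>FH\<^esub> w"
    using x unfolding hn_star_alg_def
      star_quot_proj(1)[OF hn_free_star_algebra hn_ideal_star_ideal, symmetric] by auto
  ultimately show ?thesis by simp
qed

lemma hn_universal:
  assumes B: "star_algebra B" and b: "hn_family N G B b"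
  obtains f where "f \<in> star_hom H B"
    "\<And>i j g. \<lbrakk>i \<in> {1..N}; j \<in> {1..N}; g \<in> carrier G\<rbrakk> \<Longrightarrow> f (hn_gen N G i j g) = b i j g"
proof -
  obtain f where f: "f \<in> star_hom FH B" and v: "\<And>x. x \<in> {1..N} \<times> {1..N} \<times> carrier G \<Longrightarrow>
      f (ket [(x, False)]) = (case x of (i, j, g) \<Rightarrow> b i j g)"
  proof (rule free_star_alg_universal[OF B, of "{1..N} \<times> {1..N} \<times> carrier G" "\<lambda>(i, j, g). b i j g"])
    show "(case x of (i, j, g) \<Rightarrow> b i j g) \<in> carrier B" if "x \<in> {1..N} \<times> {1..N} \<times> carrier G" for x
      using that by (auto simp: hn_family_closed[OF b])
  qed (simp_all add: hn_free_def)
  have var: "f (hn_var i j g) = b i j g" if "i \<in> {1..N}" "j \<in> {1..N}" "g \<in> carrier G" for i j g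
    using v[of "(i, j, g)"] that by (simp add: hn_var_def)
  note lin = star_hom_linear[OF f]
  note [simp] = B linear_maps_zero[OF lin] star_hom_closed[OF f] hn_family_closed[OF b]
  have minus: "f (x \<ominus>\<^bsub>FH\<^esub> y) = \<zero>\<^bsub>B\<^esub> \<longleftrightarrow> f x = f y" if "x \<in> carrier FH" "y \<in> carrier FH" for x y
    using that cvec_minus_eq_zero_iff[of B "f x" "f y"] by (simp add: linear_maps_minus[OF lin])
  have sum: "f (\<Oplus>\<^bsub>FH\<^esub>k\<in>{1..N}. h k) = (\<Oplus>\<^bsub>B\<^esub>k\<in>{1..N}. f (h k))"
    if "\<And>k. k \<in> {1..N} \<Longrightarrow> h k \<in> carrier FH" for h
    by (rule linear_maps_finsum[OF lin]) (use that in simp_all)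
  have sumb: "(\<Oplus>\<^bsub>B\<^esub>k\<in>{1..N}. f (hn_var i k \<one>\<^bsub>G\<^esub>)) = \<one>\<^bsub>B\<^esub>" "(\<Oplus>\<^bsub>B\<^esub>k\<in>{1..N}. f (hn_var k i \<one>\<^bsub>G\<^esub>)) = \<one>\<^bsub>B\<^esub>"
    if "i \<in> {1..N}" for i
    using hn_family_row_sum[OF b that] hn_family_col_sum[OF b that] that
    by (simp_all add: var cong: cvec_finsum_cong[OF star_algebra_cvec[OF B]])
  \<comment> \<open>Each relator is a difference whose two terms get the same image, by the relation
    of \<open>b\<close> that it encodes. The kernel is a *-ideal and so contains the generated
    one.\<close>
  have "hn_relators N G \<subseteq> {x \<in> carrier FH. f x \<in> {\<zero>\<^bsub>B\<^esub>}}"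
  proof
    fix x assume x: "x \<in> hn_relators N G"
    then have "f x = \<zero>\<^bsub>B\<^esub>" unfolding hn_relators_def Let_def Un_iff mem_Collect_eq
      by (elim disjE exE conjE)
        (simp_all add: minus var star_hom_star[OF f] star_hom_mult[OF f] star_hom_one[OF f] hn_family_star[OF b]
          hn_family_row[OF b] hn_family_col[OF b] sum sumb)
    then show "x \<in> {x \<in> carrier FH. f x \<in> {\<zero>\<^bsub>B\<^esub>}}" using x hn_relators_closed by auto
  qed
  then have "JH \<subseteq> {x \<in> carrier FH. f x \<in> {\<zero>\<^bsub>B\<^esub>}}"
    unfolding hn_ideal_def
    by (rule gen_star_ideal_least[OF star_hom_kernel[OF hn_free_star_algebra B f star_ideal_zero[OF B]]])
  then have ker: "f x = \<zero>\<^bsub>B\<^esub>" if "x \<in> JH" for x using that by auto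
  define f' where "f' = (\<lambda>X. the_elem (f ` X))"
  have f': "f' (JH +>\<^bsub>FH\<^esub> x) = f x" if "x \<in> carrier FH" for x
    unfolding f'_def
    by (rule star_quot_induced[OF hn_free_star_algebra hn_ideal_star_ideal _ lin ker that]) simp_all
  have "f' \<in> star_hom H B"
    unfolding f'_def hn_star_alg_def
    by (rule star_quot_star_hom[OF hn_free_star_algebra hn_ideal_star_ideal B f ker])
  moreover have "f' (hn_gen N G i j g) = b i j g" if "i \<in> {1..N}" "j \<in> {1..N}" "g \<in> carrier G" for i j g
    using that by (simp add: hn_gen_def f' var)
  ultimately show ?thesis by (rule that)
qed

end

section \<open>A criterion for CQG-algebras\<close>

text \<open>Unlike \<open>same_star_alg_tensor\<close>, this compares only the vector space fields,
  so that \<open>tensor_alg\<close> may replace \<open>tensor_space\<close> inside iterated tensor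
  products.\<close>

lemma tensor_space_cong:
  assumes "carrier V = carrier V'" "add V = add V'" "smult V = smult V'"
    "carrier W = carrier W'" "add W = add W'" "smult W = smult W'"
  shows "tensor_space V W = tensor_space V' W'" "pure V W = pure V' W'"
proof -
  have null: "tensor_null V W = tensor_null V' W'" using assms by (simp add: tensor_null_def)
  show "tensor_space V W = tensor_space V' W'" using assms null by (simp add: tensor_space_def)
  show "pure V W = pure V' W'" using assms null by (intro ext) (simp add: pure_def)
qed

lemma tensor_tensor_alg [simp]:
  "tensor_space V (tensor_alg A B) = tensor_space V (tensor_space A B)"
  "tensor_space (tensor_alg A B) V = tensor_space (tensor_space A B) V"
  "pure V (tensor_alg A B) = pure V (tensor_space A B)"
  "pure (tensor_alg A B) V = pure (tensor_space A B) V"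
  by (rule tensor_space_cong; simp)+

lemma tensor_map_tensor_alg_right [simp]:
  "tensor_map V (tensor_alg A B) f g = tensor_map V (tensor_space A B) f g"
  by (simp add: tensor_map_def fun_eq_iff)

lemma tensor_map_tensor_alg_left [simp]:
  "tensor_map (tensor_alg A B) V f g = tensor_map (tensor_space A B) V f g"
  by (simp add: tensor_map_def fun_eq_iff)

text \<open>A lift that depends on a parameter \<open>z\<close>, as it occurs in the nested lifts of
  \<open>tensor_assoc\<close>. Linearity in \<open>t\<close> is that of the lift; linearity in
  \<open>z\<close> follows by induction on \<open>t\<close>.\<close>

lemma tensor_lift_bilinear_param:
  assumes V: "cvec V" and W: "cvec W" and X: "cvec X" and U: "cvec U"
    and left: "\<And>z. z \<in> carrier X \<Longrightarrow> bilinear V W U (\<lambda>x y. b x y z)"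
    and right: "\<And>x y. \<lbrakk>x \<in> carrier V; y \<in> carrier W\<rbrakk> \<Longrightarrow> b x y \<in> linear_maps X U"
  shows "bilinear (tensor_space V W) X U (\<lambda>t z. tensor_lift U (\<lambda>x y. b x y z) t)"
proof -
  note [simp] = V W X U
  have 1: "tensor_lift U (\<lambda>x y. b x y z) \<in> linear_maps (tensor_space V W) U" if "z \<in> carrier X" for z
    by (rule tensor_lift_linear) (use left that in simp_all)
  have 2: "tensor_lift U (\<lambda>x y. b x y z) (pure V W x y) = b x y z"
    if "z \<in> carrier X" "x \<in> carrier V" "y \<in> carrier W" for x y z
    by (rule tensor_lift_pure) (use left that in simp_all)
  have "(\<lambda>z. tensor_lift U (\<lambda>x y. b x y z) t) \<in> linear_maps X U" if "t \<in> carrier (tensor_space V W)" for t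
    using that
  proof (induction rule: tensor_induct[OF V W, consumes 1, case_names pure add])
    case (pure x y)
    then show ?case using right[OF pure] by (auto simp: linear_maps_def 2 Pi_def)
  next
    case (add s t)
    show ?case
      by (rule linear_mapsI)
        (use add in \<open>simp_all add: linear_maps_add[OF 1] linear_maps_closed[OF add(3)]
          linear_maps_closed[OF add(4)] linear_maps_add[OF add(3)] linear_maps_add[OF add(4)]
          linear_maps_smult[OF add(3)] linear_maps_smult[OF add(4)] cvec_ac cvec_smult_add\<close>)
  qed
  then show ?thesis using 1 by (auto simp: bilinear_def)
qed

lemma
  assumes A: "cvec A" and B: "cvec B" and C: "cvec C"
  shows tensor_assoc_linear: "tensor_assoc A B C \<in>
      linear_maps (tensor_space (tensor_space A B) C) (tensor_space A (tensor_space B C))"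
    and tensor_assoc_pure: "\<lbrakk>x \<in> carrier A; y \<in> carrier B; z \<in> carrier C\<rbrakk> \<Longrightarrow>
      tensor_assoc A B C (pure (tensor_space A B) C (pure A B x y) z) =
      pure A (tensor_space B C) x (pure B C y z)"
proof -
  let ?T = "tensor_space A (tensor_space B C)"
  note [simp] = A B C
  have 1: "bilinear A B ?T (\<lambda>x y. pure A (tensor_space B C) x (pure B C y z))" if "z \<in> carrier C" for z
    using bilinear_comp[OF pure_bilinear[of A "tensor_space B C"] linear_maps_id
        bilinear_linear_left[OF pure_bilinear that] linear_maps_id] by simp
  have 2: "(\<lambda>z. pure A (tensor_space B C) x (pure B C y z)) \<in> linear_maps C ?T"
    if "x \<in> carrier A" "y \<in> carrier B" for x y
    by (rule linear_maps_comp[OF bilinear_linear_right[OF pure_bilinear[OF B C]]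
          bilinear_linear_right[OF pure_bilinear[OF A tensor_space_cvec[OF B C]]]]) fact+
  have 3: "bilinear (tensor_space A B) C ?T
      (\<lambda>t z. tensor_lift ?T (\<lambda>x y. pure A (tensor_space B C) x (pure B C y z)) t)"
    by (rule tensor_lift_bilinear_param) (use 1 2 in simp_all)
  show "tensor_assoc A B C \<in> linear_maps (tensor_space (tensor_space A B) C) ?T"
    unfolding tensor_assoc_def Let_def by (rule tensor_lift_linear) (use 3 in simp_all)
  assume [simp]: "x \<in> carrier A" "y \<in> carrier B" "z \<in> carrier C"
  show "tensor_assoc A B C (pure (tensor_space A B) C (pure A B x y) z) =
      pure A (tensor_space B C) x (pure B C y z)"
    unfolding tensor_assoc_def Let_def
    by (subst tensor_lift_pure[OF _ _ _ 3]) (simp_all add: tensor_lift_pure[OF _ _ _ 1])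
qed

text \<open>Corepresentations are indexed by natural numbers, so the pair \<open>(i, j)\<close> of a
  tensor product is encoded as \<open>i * m + j\<close> and recovered by division with
  remainder.\<close>

lemma cvec_finsum_div_mod:
  fixes n m :: nat
  assumes V: "cvec V" and f: "\<And>i j. \<lbrakk>i < n; j < m\<rbrakk> \<Longrightarrow> f i j \<in> carrier V"
  shows "(\<Oplus>\<^bsub>V\<^esub>r\<in>{..<n * m}. f (r div m) (r mod m)) = (\<Oplus>\<^bsub>V\<^esub>i\<in>{..<n}. \<Oplus>\<^bsub>V\<^esub>j\<in>{..<m}. f i j)"
  using f
proof (induction n)
  case 0
  then show ?case using V by simp
next
  case (Suc n)
  interpret abelian_monoid V by (rule cvec_abelian_monoid[OF V])
  let ?g = "\<lambda>r. f (r div m) (r mod m)" and ?h = "\<lambda>j. n * m + j"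
  \<comment> \<open>The new block of indices with quotient \<open>n\<close> is a translate of the
    remainders below \<open>m\<close>.\<close>
  have split: "{..<Suc n * m} = {..<n * m} \<union> ?h ` {..<m}"
  proof -
    have "x \<in> ?h ` {..<m}" if "x < m + n * m" "\<not> x < n * m" for x
      using that by (intro image_eqI[of _ _ "x - n * m"]) auto
    then show ?thesis by auto
  qed
  have cl: "?g r \<in> carrier V" if "r < Suc n * m" for r
  proof -
    have "0 < m" using that by (cases m) auto
    moreover have "r div m < Suc n" using that by (simp add: less_mult_imp_div_less)
    ultimately show ?thesis using Suc.prems by simp
  qed
  have "finsum V ?g {..<Suc n * m} = finsum V ?g {..<n * m} \<oplus>\<^bsub>V\<^esub> finsum V ?g (?h ` {..<m})"
    unfolding split by (rule finsum_Un_disjoint) (use cl Suc.prems in \<open>auto simp: Pi_def\<close>)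
  also have "finsum V ?g {..<n * m} = (\<Oplus>\<^bsub>V\<^esub>i\<in>{..<n}. \<Oplus>\<^bsub>V\<^esub>j\<in>{..<m}. f i j)"
    by (rule Suc.IH) (use Suc.prems in simp)
  also have "finsum V ?g (?h ` {..<m}) = (\<Oplus>\<^bsub>V\<^esub>j\<in>{..<m}. ?g (?h j))"
    by (rule cvec_finsum_reindex[OF V]) (use Suc.prems in \<open>auto simp: inj_on_def\<close>)
  also have "\<dots> = (\<Oplus>\<^bsub>V\<^esub>j\<in>{..<m}. f n j)"
    by (rule cvec_finsum_cong[OF V]) (use Suc.prems in auto)
  also have "(\<Oplus>\<^bsub>V\<^esub>i\<in>{..<n}. \<Oplus>\<^bsub>V\<^esub>j\<in>{..<m}. f i j) \<oplus>\<^bsub>V\<^esub> (\<Oplus>\<^bsub>V\<^esub>j\<in>{..<m}. f n j) =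
      (\<Oplus>\<^bsub>V\<^esub>i\<in>{..<Suc n}. \<Oplus>\<^bsub>V\<^esub>j\<in>{..<m}. f i j)"
    unfolding lessThan_Suc
    by (subst cvec_finsum_insert) (use V Suc.prems in \<open>simp_all add: cvec_add_comm\<close>)
  finally show ?case .
qed

lemma unitary_corepD:
  assumes "unitary_corep A n u" "i \<in> {..<n}" "j \<in> {..<n}"
  shows "u i j \<in> carrier A"
    and "comult A (u i j) = (\<Oplus>\<^bsub>tensor_space A A\<^esub>k\<in>{..<n}. pure A A (u i k) (u k j))"
    and "(\<Oplus>\<^bsub>A\<^esub>k\<in>{..<n}. u i k \<otimes>\<^bsub>A\<^esub> star A (u j k)) = (if i = j then \<one>\<^bsub>A\<^esub> else \<zero>\<^bsub>A\<^esub>)"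
    and "(\<Oplus>\<^bsub>A\<^esub>k\<in>{..<n}. star A (u k i) \<otimes>\<^bsub>A\<^esub> u k j) = (if i = j then \<one>\<^bsub>A\<^esub> else \<zero>\<^bsub>A\<^esub>)"
  using assms by (auto simp: unitary_corep_def)

text \<open>The tensor product of two corepresentations, with entries
  \<open>u\<^sub>i\<^sub>j v\<^sub>k\<^sub>l\<close>. It makes the coefficients closed under
  multiplication.\<close>

lemma unitary_corep_product:
  assumes A: "star_algebra A" and \<Delta>: "comult A \<in> star_hom A (tensor_alg A A)"
    and u: "unitary_corep A n u" and v: "unitary_corep A m v"
  shows "unitary_corep A (n * m) (\<lambda>r s. u (r div m) (s div m) \<otimes>\<^bsub>A\<^esub> v (r mod m) (s mod m))"
  unfolding unitary_corep_def
proof (intro allI impI)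
  note [simp] = A unitary_corepD(1)[OF u] unitary_corepD(1)[OF v]
  fix r s assume r: "r < n * m" and s: "s < n * m"
  define i j k l where ijkl: "i = r div m" "j = s div m" "k = r mod m" "l = s mod m"
  have "0 < m" using r by (cases m) auto
  then have [simp]: "i \<in> {..<n}" "j \<in> {..<n}" "k \<in> {..<m}" "l \<in> {..<m}"
    using r s by (simp_all add: ijkl less_mult_imp_div_less)
  have rs: "r = s \<longleftrightarrow> i = j \<and> k = l" unfolding ijkl by (metis mult_div_mod_eq)
  let ?T = "tensor_alg A A" and ?TS = "tensor_space A A"
  have T: "star_algebra ?T" by simp
  note [simp del] = lessThan_iff
  have "comult A (u i j \<otimes>\<^bsub>A\<^esub> v k l) =
      (\<Oplus>\<^bsub>?T\<^esub>p\<in>{..<n}. pure A A (u i p) (u p j)) \<otimes>\<^bsub>?T\<^esub> (\<Oplus>\<^bsub>?T\<^esub>q\<in>{..<m}. pure A A (v k q) (v q l))"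
    by (simp add: star_hom_mult[OF \<Delta>] unitary_corepD(2)[OF u] unitary_corepD(2)[OF v])
  also have "\<dots> = (\<Oplus>\<^bsub>?T\<^esub>p\<in>{..<n}. \<Oplus>\<^bsub>?T\<^esub>q\<in>{..<m}. pure A A (u i p) (u p j) \<otimes>\<^bsub>?T\<^esub> pure A A (v k q) (v q l))"
    by (rule alg_finsum_mult_finsum[OF T]) simp_all
  also have "\<dots> = (\<Oplus>\<^bsub>?TS\<^esub>p\<in>{..<n}. \<Oplus>\<^bsub>?TS\<^esub>q\<in>{..<m}. pure A A (u i p \<otimes>\<^bsub>A\<^esub> v k q) (u p j \<otimes>\<^bsub>A\<^esub> v q l))"
    unfolding finsum_tensor_alg
    by (intro cvec_finsum_cong) simp_all
  finally have 1: "comult A (u i j \<otimes>\<^bsub>A\<^esub> v k l) =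
      (\<Oplus>\<^bsub>?TS\<^esub>p\<in>{..<n}. \<Oplus>\<^bsub>?TS\<^esub>q\<in>{..<m}. pure A A (u i p \<otimes>\<^bsub>A\<^esub> v k q) (u p j \<otimes>\<^bsub>A\<^esub> v q l))" .
  \<comment> \<open>Taking adjoints reverses the factors, so the entries of \<open>v\<close> meet in
    the middle; their sum over \<open>q\<close> is done first and leaves the unitarity of
    \<open>u\<close>.\<close>
  have "(\<Oplus>\<^bsub>A\<^esub>p\<in>{..<n}. \<Oplus>\<^bsub>A\<^esub>q\<in>{..<m}. (u i p \<otimes>\<^bsub>A\<^esub> v k q) \<otimes>\<^bsub>A\<^esub> star A (u j p \<otimes>\<^bsub>A\<^esub> v l q)) =
      (\<Oplus>\<^bsub>A\<^esub>p\<in>{..<n}. \<Oplus>\<^bsub>A\<^esub>q\<in>{..<m}. u i p \<otimes>\<^bsub>A\<^esub> ((v k q \<otimes>\<^bsub>A\<^esub> star A (v l q)) \<otimes>\<^bsub>A\<^esub> star A (u j p)))"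
    by (intro cvec_finsum_cong) (simp_all add: alg_star_mult alg_mult_assoc)
  also have "\<dots> = (\<Oplus>\<^bsub>A\<^esub>p\<in>{..<n}. u i p \<otimes>\<^bsub>A\<^esub> ((\<Oplus>\<^bsub>A\<^esub>q\<in>{..<m}. v k q \<otimes>\<^bsub>A\<^esub> star A (v l q)) \<otimes>\<^bsub>A\<^esub> star A (u j p)))"
    by (intro cvec_finsum_cong) (simp_all add: alg_finsum_mult alg_mult_finsum)
  also have "\<dots> = (\<Oplus>\<^bsub>A\<^esub>p\<in>{..<n}. if k = l then u i p \<otimes>\<^bsub>A\<^esub> star A (u j p) else \<zero>\<^bsub>A\<^esub>)"
    by (intro cvec_finsum_cong) (simp_all add: unitary_corepD(3)[OF v])
  also have "\<dots> = (if i = j \<and> k = l then \<one>\<^bsub>A\<^esub> else \<zero>\<^bsub>A\<^esub>)"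
    by (cases "k = l") (simp_all add: unitary_corepD(3)[OF u] cvec_finsum_zero)
  finally have 2: "(\<Oplus>\<^bsub>A\<^esub>p\<in>{..<n}. \<Oplus>\<^bsub>A\<^esub>q\<in>{..<m}. (u i p \<otimes>\<^bsub>A\<^esub> v k q) \<otimes>\<^bsub>A\<^esub> star A (u j p \<otimes>\<^bsub>A\<^esub> v l q)) =
      (if i = j \<and> k = l then \<one>\<^bsub>A\<^esub> else \<zero>\<^bsub>A\<^esub>)" .
  \<comment> \<open>Here the entries of \<open>u\<close> meet in the middle, so the sum over
    \<open>p\<close> has to become the inner one.\<close>
  have "(\<Oplus>\<^bsub>A\<^esub>p\<in>{..<n}. \<Oplus>\<^bsub>A\<^esub>q\<in>{..<m}. star A (u p i \<otimes>\<^bsub>A\<^esub> v q k) \<otimes>\<^bsub>A\<^esub> (u p j \<otimes>\<^bsub>A\<^esub> v q l)) =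
      (\<Oplus>\<^bsub>A\<^esub>q\<in>{..<m}. \<Oplus>\<^bsub>A\<^esub>p\<in>{..<n}. star A (u p i \<otimes>\<^bsub>A\<^esub> v q k) \<otimes>\<^bsub>A\<^esub> (u p j \<otimes>\<^bsub>A\<^esub> v q l))"
    by (rule cvec_finsum_swap) simp_all
  also have "\<dots> = (\<Oplus>\<^bsub>A\<^esub>q\<in>{..<m}. \<Oplus>\<^bsub>A\<^esub>p\<in>{..<n}. star A (v q k) \<otimes>\<^bsub>A\<^esub> ((star A (u p i) \<otimes>\<^bsub>A\<^esub> u p j) \<otimes>\<^bsub>A\<^esub> v q l))"
    by (intro cvec_finsum_cong) (simp_all add: alg_star_mult alg_mult_assoc)
  also have "\<dots> = (\<Oplus>\<^bsub>A\<^esub>q\<in>{..<m}. star A (v q k) \<otimes>\<^bsub>A\<^esub> ((\<Oplus>\<^bsub>A\<^esub>p\<in>{..<n}. star A (u p i) \<otimes>\<^bsub>A\<^esub> u p j) \<otimes>\<^bsub>A\<^esub> v q l))"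
    by (intro cvec_finsum_cong) (simp_all add: alg_finsum_mult alg_mult_finsum)
  also have "\<dots> = (\<Oplus>\<^bsub>A\<^esub>q\<in>{..<m}. if i = j then star A (v q k) \<otimes>\<^bsub>A\<^esub> v q l else \<zero>\<^bsub>A\<^esub>)"
    by (intro cvec_finsum_cong) (simp_all add: unitary_corepD(4)[OF u])
  also have "\<dots> = (if i = j \<and> k = l then \<one>\<^bsub>A\<^esub> else \<zero>\<^bsub>A\<^esub>)"
    by (cases "i = j") (simp_all add: unitary_corepD(4)[OF v] cvec_finsum_zero)
  finally have 3: "(\<Oplus>\<^bsub>A\<^esub>p\<in>{..<n}. \<Oplus>\<^bsub>A\<^esub>q\<in>{..<m}. star A (u p i \<otimes>\<^bsub>A\<^esub> v q k) \<otimes>\<^bsub>A\<^esub> (u p j \<otimes>\<^bsub>A\<^esub> v q l)) =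
      (if i = j \<and> k = l then \<one>\<^bsub>A\<^esub> else \<zero>\<^bsub>A\<^esub>)" .
  have dm1: "(\<Oplus>\<^bsub>A\<^esub>x\<in>{..<n * m}. f (x div m) (x mod m)) = (\<Oplus>\<^bsub>A\<^esub>p\<in>{..<n}. \<Oplus>\<^bsub>A\<^esub>q\<in>{..<m}. f p q)"
    if "\<And>p q. \<lbrakk>p \<in> {..<n}; q \<in> {..<m}\<rbrakk> \<Longrightarrow> f p q \<in> carrier A" for f
    by (rule cvec_finsum_div_mod) (use that in \<open>simp_all add: lessThan_iff\<close>)
  have dm2: "(\<Oplus>\<^bsub>?TS\<^esub>x\<in>{..<n * m}. f (x div m) (x mod m)) = (\<Oplus>\<^bsub>?TS\<^esub>p\<in>{..<n}. \<Oplus>\<^bsub>?TS\<^esub>q\<in>{..<m}. f p q)"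
    if "\<And>p q. \<lbrakk>p \<in> {..<n}; q \<in> {..<m}\<rbrakk> \<Longrightarrow> f p q \<in> carrier ?TS" for f
    by (rule cvec_finsum_div_mod) (use that in \<open>simp_all add: lessThan_iff\<close>)
  show "u (r div m) (s div m) \<otimes>\<^bsub>A\<^esub> v (r mod m) (s mod m) \<in> carrier A \<and>
      comult A (u (r div m) (s div m) \<otimes>\<^bsub>A\<^esub> v (r mod m) (s mod m)) =
      (\<Oplus>\<^bsub>?T\<^esub>x\<in>{..<n * m}. pure A A (u (r div m) (x div m) \<otimes>\<^bsub>A\<^esub> v (r mod m) (x mod m))
        (u (x div m) (s div m) \<otimes>\<^bsub>A\<^esub> v (x mod m) (s mod m))) \<and>
      (\<Oplus>\<^bsub>A\<^esub>x\<in>{..<n * m}. (u (r div m) (x div m) \<otimes>\<^bsub>A\<^esub> v (r mod m) (x mod m)) \<otimes>\<^bsub>A\<^esub>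
        star A (u (s div m) (x div m) \<otimes>\<^bsub>A\<^esub> v (s mod m) (x mod m))) = (if r = s then \<one>\<^bsub>A\<^esub> else \<zero>\<^bsub>A\<^esub>) \<and>
      (\<Oplus>\<^bsub>A\<^esub>x\<in>{..<n * m}. star A (u (x div m) (r div m) \<otimes>\<^bsub>A\<^esub> v (x mod m) (r mod m)) \<otimes>\<^bsub>A\<^esub>
        (u (x div m) (s div m) \<otimes>\<^bsub>A\<^esub> v (x mod m) (s mod m))) = (if r = s then \<one>\<^bsub>A\<^esub> else \<zero>\<^bsub>A\<^esub>)"
    unfolding ijkl[symmetric] rs finsum_tensor_alg
    using dm1[of "\<lambda>p q. (u i p \<otimes>\<^bsub>A\<^esub> v k q) \<otimes>\<^bsub>A\<^esub> star A (u j p \<otimes>\<^bsub>A\<^esub> v l q)"]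
      dm1[of "\<lambda>p q. star A (u p i \<otimes>\<^bsub>A\<^esub> v q k) \<otimes>\<^bsub>A\<^esub> (u p j \<otimes>\<^bsub>A\<^esub> v q l)"]
      dm2[of "\<lambda>p q. pure A A (u i p \<otimes>\<^bsub>A\<^esub> v k q) (u p j \<otimes>\<^bsub>A\<^esub> v q l)"] 1 2 3
    by simp
qed

text \<open>On coefficients of such corepresentations the axioms of a Hopf *-algebra with counit
  \<open>\<epsilon>\<close> and antipode \<open>S\<close> are immediate, and they are linear.\<close>

definition hopf_corep ::
    "('a, 'm) hopf_star_alg_scheme \<Rightarrow> ('a \<Rightarrow> complex) \<Rightarrow> ('a \<Rightarrow> 'a) \<Rightarrow> nat \<Rightarrow> (nat \<Rightarrow> nat \<Rightarrow> 'a) \<Rightarrow> bool" where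
  "hopf_corep A \<epsilon> S n u \<longleftrightarrow> unitary_corep A n u \<and>
     (\<forall>i<n. \<forall>j<n. \<epsilon> (u i j) = (if i = j then 1 else 0) \<and> S (u i j) = star A (u j i))"

definition hopf_coefs :: "('a, 'm) hopf_star_alg_scheme \<Rightarrow> ('a \<Rightarrow> complex) \<Rightarrow> ('a \<Rightarrow> 'a) \<Rightarrow> 'a set" where
  "hopf_coefs A \<epsilon> S = {u i j | n u i j. hopf_corep A \<epsilon> S n u \<and> i < n \<and> j < n}"

lemma hopf_coefsI: "\<lbrakk>hopf_corep A \<epsilon> S n u; i < n; j < n\<rbrakk> \<Longrightarrow> u i j \<in> hopf_coefs A \<epsilon> S"
  unfolding hopf_coefs_def by blast

text \<open>What has to be verified for a concrete algebra: homomorphism properties and a spanning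
  set of good coefficients. Coassociativity and the laws of counit and antipode are
  consequences.\<close>

locale cqg_data =
  fixes A :: "('a, 'm) hopf_star_alg_scheme" and \<epsilon> :: "'a \<Rightarrow> complex" and S :: "'a \<Rightarrow> 'a"
  assumes star_alg [simp]: "star_algebra A"
    and comult_hom: "comult A \<in> star_hom A (tensor_alg A A)"
    and counit_hom: "\<epsilon> \<in> alg_hom A complex_alg"
    and antipode_linear: "S \<in> linear_maps A A"
    and antipode_one: "S \<one>\<^bsub>A\<^esub> = \<one>\<^bsub>A\<^esub>"
    and antipode_mult: "\<lbrakk>x \<in> carrier A; y \<in> carrier A\<rbrakk> \<Longrightarrow> S (x \<otimes>\<^bsub>A\<^esub> y) = S y \<otimes>\<^bsub>A\<^esub> S x"
    and coefs_span: "carrier A \<subseteq> lin_span A (hopf_coefs A \<epsilon> S)"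
begin

lemma hopf_coefs_closed: "hopf_coefs A \<epsilon> S \<subseteq> carrier A"
  by (auto simp: hopf_coefs_def hopf_corep_def intro: unitary_corepD(1))

lemma linear_eq_on_coefs:
  assumes "cvec V" "f \<in> linear_maps A V" "g \<in> linear_maps A V"
    and "\<And>n u i j. \<lbrakk>hopf_corep A \<epsilon> S n u; i < n; j < n\<rbrakk> \<Longrightarrow> f (u i j) = g (u i j)"
    and "x \<in> carrier A"
  shows "f x = g x"
  by (rule linear_maps_eq_on_span[OF subsetD[OF coefs_span assms(5)] _ hopf_coefs_closed assms(1-3)])
    (use assms(4) in \<open>auto simp: hopf_coefs_def\<close>)

lemma counit_linear: "\<epsilon> \<in> linear_maps A complex_alg"
  by (rule alg_hom_linear[OF counit_hom])

lemma comult_linear: "comult A \<in> linear_maps A (tensor_space A A)"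
  using star_hom_linear[OF comult_hom] by simp

text \<open>On a coefficient the comultiplication is an explicit sum of pure tensors, so every lift
  becomes a finite sum over the middle index. All Hopf axioms are evaluated through this
  formula.\<close>

lemma lift_comult:
  assumes b: "bilinear A A V b" and V: "cvec V" and u: "hopf_corep A \<epsilon> S n u" "i < n" "j < n"
  shows "tensor_lift V b (comult A (u i j)) = (\<Oplus>\<^bsub>V\<^esub>k\<in>{..<n}. b (u i k) (u k j))"
proof -
  have u': "unitary_corep A n u" using u(1) by (simp add: hopf_corep_def)
  have [simp]: "i \<in> {..<n}" "j \<in> {..<n}" using u(2,3) by simp_all
  note [simp] = unitary_corepD(1)[OF u'] V
  note [simp del] = lessThan_iff
  have "tensor_lift V b (comult A (u i j)) =
      (\<Oplus>\<^bsub>V\<^esub>k\<in>{..<n}. tensor_lift V b (pure A A (u i k) (u k j)))"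
    using u by (simp add: unitary_corepD(2)[OF u'] linear_maps_finsum[OF tensor_lift_linear[OF _ _ V b],
          where I = "{..<n}" and g = "\<lambda>k. pure A A (u i k) (u k j)"])
  also have "\<dots> = (\<Oplus>\<^bsub>V\<^esub>k\<in>{..<n}. b (u i k) (u k j))"
    by (intro cvec_finsum_cong) (simp_all add: tensor_lift_pure[OF _ _ V b] bilinear_closed[OF b])
  finally show ?thesis .
qed

lemma is_counit: "is_counit A \<epsilon>"
  unfolding is_counit_def
proof (intro conjI ballI counit_hom)
  have 1: "bilinear A A A (\<lambda>y z. \<epsilon> y \<odot>\<^bsub>A\<^esub> z)" and 2: "bilinear A A A (\<lambda>y z. \<epsilon> z \<odot>\<^bsub>A\<^esub> y)"
    by (rule bilinearI; simp add: linear_maps_add[OF counit_linear] linear_maps_smult[OF counit_linear]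
      cvec_smult_add_left cvec_smult_add cvec_smult_smult mult_ac)+
  fix x assume x: "x \<in> carrier A"
  show "tensor_lift A (\<lambda>y z. \<epsilon> y \<odot>\<^bsub>A\<^esub> z) (comult A x) = x"
  proof (rule linear_eq_on_coefs[OF _ linear_maps_comp[OF comult_linear tensor_lift_linear] linear_maps_id _ x])
    fix n u i j assume u: "hopf_corep A \<epsilon> S n u" "i < n" "j < n"
    show "tensor_lift A (\<lambda>y z. \<epsilon> y \<odot>\<^bsub>A\<^esub> z) (comult A (u i j)) = u i j"
      unfolding lift_comult[OF 1 _ u, simplified]
      by (rule cvec_finsum_delta[of _ _ i]) (use u in \<open>auto simp: hopf_corep_def unitary_corepD(1)\<close>)
  qed (simp_all add: 1)
  show "tensor_lift A (\<lambda>y z. \<epsilon> z \<odot>\<^bsub>A\<^esub> y) (comult A x) = x"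
  proof (rule linear_eq_on_coefs[OF _ linear_maps_comp[OF comult_linear tensor_lift_linear] linear_maps_id _ x])
    fix n u i j assume u: "hopf_corep A \<epsilon> S n u" "i < n" "j < n"
    show "tensor_lift A (\<lambda>y z. \<epsilon> z \<odot>\<^bsub>A\<^esub> y) (comult A (u i j)) = u i j"
      unfolding lift_comult[OF 2 _ u, simplified]
      by (rule cvec_finsum_delta[of _ _ j]) (use u in \<open>auto simp: hopf_corep_def unitary_corepD(1)\<close>)
  qed (simp_all add: 2)
qed

lemma is_antipode: "is_antipode A \<epsilon> S"
  unfolding is_antipode_def
proof (intro conjI ballI antipode_linear)
  note [simp] = linear_maps_closed[OF antipode_linear]
  have 1: "bilinear A A A (\<lambda>y z. S y \<otimes>\<^bsub>A\<^esub> z)" and 2: "bilinear A A A (\<lambda>y z. y \<otimes>\<^bsub>A\<^esub> S z)"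
    by (rule bilinearI; simp add: linear_maps_add[OF antipode_linear] linear_maps_smult[OF antipode_linear]
      alg_add_mult alg_mult_add alg_smult_mult alg_mult_smult)+
  have 3: "(\<lambda>x. \<epsilon> x \<odot>\<^bsub>A\<^esub> \<one>\<^bsub>A\<^esub>) \<in> linear_maps A A"
    by (rule linear_mapsI; simp add: linear_maps_add[OF counit_linear] linear_maps_smult[OF counit_linear]
      cvec_smult_add_left cvec_smult_smult)
  fix x assume x: "x \<in> carrier A"
  show "tensor_lift A (\<lambda>y z. S y \<otimes>\<^bsub>A\<^esub> z) (comult A x) = \<epsilon> x \<odot>\<^bsub>A\<^esub> \<one>\<^bsub>A\<^esub>"
  proof (rule linear_eq_on_coefs[OF _ linear_maps_comp[OF comult_linear tensor_lift_linear] 3 _ x])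
    fix n u i j assume u: "hopf_corep A \<epsilon> S n u" "i < n" "j < n"
    \<comment> \<open>The antipode of \<open>u i k\<close> is the adjoint of \<open>u k i\<close>;
      the law to be shown is then one of the two unitarity relations of \<open>u\<close>, and the
      counit supplies the Kronecker delta.\<close>
    then have "(\<Oplus>\<^bsub>A\<^esub>k\<in>{..<n}. S (u i k) \<otimes>\<^bsub>A\<^esub> u k j) = (\<Oplus>\<^bsub>A\<^esub>k\<in>{..<n}. star A (u k i) \<otimes>\<^bsub>A\<^esub> u k j)"
      by (intro cvec_finsum_cong) (auto simp: hopf_corep_def unitary_corepD(1))
    then show "tensor_lift A (\<lambda>y z. S y \<otimes>\<^bsub>A\<^esub> z) (comult A (u i j)) = \<epsilon> (u i j) \<odot>\<^bsub>A\<^esub> \<one>\<^bsub>A\<^esub>"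
      using u by (auto simp: lift_comult[OF 1 _ u] hopf_corep_def unitary_corepD(4))
  qed (simp_all add: 1)
  show "tensor_lift A (\<lambda>y z. y \<otimes>\<^bsub>A\<^esub> S z) (comult A x) = \<epsilon> x \<odot>\<^bsub>A\<^esub> \<one>\<^bsub>A\<^esub>"
  proof (rule linear_eq_on_coefs[OF _ linear_maps_comp[OF comult_linear tensor_lift_linear] 3 _ x])
    fix n u i j assume u: "hopf_corep A \<epsilon> S n u" "i < n" "j < n"
    then have "(\<Oplus>\<^bsub>A\<^esub>k\<in>{..<n}. u i k \<otimes>\<^bsub>A\<^esub> S (u k j)) = (\<Oplus>\<^bsub>A\<^esub>k\<in>{..<n}. u i k \<otimes>\<^bsub>A\<^esub> star A (u j k))"
      by (intro cvec_finsum_cong) (auto simp: hopf_corep_def unitary_corepD(1))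
    then show "tensor_lift A (\<lambda>y z. y \<otimes>\<^bsub>A\<^esub> S z) (comult A (u i j)) = \<epsilon> (u i j) \<odot>\<^bsub>A\<^esub> \<one>\<^bsub>A\<^esub>"
      using u by (auto simp: lift_comult[OF 2 _ u] hopf_corep_def unitary_corepD(3))
  qed (simp_all add: 2)
qed

lemma coassociative:
  assumes x: "x \<in> carrier A"
  shows "tensor_assoc A A A (tensor_map (tensor_alg A A) A (comult A) (\<lambda>y. y) (comult A x)) =
    tensor_map A (tensor_alg A A) (\<lambda>y. y) (comult A) (comult A x)"
proof -
  let ?T = "tensor_space A A"
  have m1: "tensor_map ?T A (comult A) (\<lambda>y. y) \<in> linear_maps ?T (tensor_space ?T A)"
    by (rule tensor_map_linear) (simp_all add: comult_linear linear_maps_id)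
  have m2: "tensor_map A ?T (\<lambda>y. y) (comult A) \<in> linear_maps ?T (tensor_space A ?T)"
    by (rule tensor_map_linear) (simp_all add: comult_linear linear_maps_id)
  note as = tensor_assoc_linear[of A A A, simplified]
  have "tensor_assoc A A A (tensor_map ?T A (comult A) (\<lambda>y. y) (comult A x)) =
      tensor_map A ?T (\<lambda>y. y) (comult A) (comult A x)"
  proof (rule linear_eq_on_coefs[OF _ linear_maps_comp[OF comult_linear linear_maps_comp[OF m1 as]]
        linear_maps_comp[OF comult_linear m2] _ x])
    fix n u i j assume hu: "hopf_corep A \<epsilon> S n u" and ij: "i < n" "j < n"
    then have u: "unitary_corep A n u" and i [simp]: "i \<in> {..<n}" and j [simp]: "j \<in> {..<n}"
      by (simp_all add: hopf_corep_def)
    note [simp] = unitary_corepD(1)[OF u]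
    note [simp del] = lessThan_iff
    have e: "tensor_map ?T A (comult A) (\<lambda>y. y) (comult A (u i j)) =
        (\<Oplus>\<^bsub>tensor_space ?T A\<^esub>k\<in>{..<n}. pure ?T A (comult A (u i k)) (u k j))"
      unfolding tensor_map_def
      by (rule lift_comult[OF tensor_map_bilinear _ hu ij]) (simp_all add: comult_linear linear_maps_id)
    have "tensor_assoc A A A (tensor_map ?T A (comult A) (\<lambda>y. y) (comult A (u i j))) =
        (\<Oplus>\<^bsub>tensor_space A ?T\<^esub>k\<in>{..<n}. tensor_assoc A A A (pure ?T A (comult A (u i k)) (u k j)))"
      unfolding e
      by (rule linear_maps_finsum[OF as])
        (simp_all add: linear_maps_closed[OF comult_linear])
    also have "\<dots> = (\<Oplus>\<^bsub>tensor_space A ?T\<^esub>k\<in>{..<n}. \<Oplus>\<^bsub>tensor_space A ?T\<^esub>l\<in>{..<n}.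
        pure A ?T (u i l) (pure A A (u l k) (u k j)))"
    proof (rule cvec_finsum_cong)
      fix k assume k [simp]: "k \<in> {..<n}"
      have "pure ?T A (comult A (u i k)) (u k j) =
          (\<Oplus>\<^bsub>tensor_space ?T A\<^esub>l\<in>{..<n}. pure ?T A (pure A A (u i l) (u l k)) (u k j))"
        unfolding unitary_corepD(2)[OF u i k]
        by (rule linear_maps_finsum[OF bilinear_linear_left[OF pure_bilinear]]) simp_all
      then have "tensor_assoc A A A (pure ?T A (comult A (u i k)) (u k j)) =
          (\<Oplus>\<^bsub>tensor_space A ?T\<^esub>l\<in>{..<n}. tensor_assoc A A A (pure ?T A (pure A A (u i l) (u l k)) (u k j)))"
        by (simp add: linear_maps_finsum[OF as])
      also have "\<dots> = (\<Oplus>\<^bsub>tensor_space A ?T\<^esub>l\<in>{..<n}. pure A ?T (u i l) (pure A A (u l k) (u k j)))"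
        by (rule cvec_finsum_cong) (simp_all add: tensor_assoc_pure)
      finally show "tensor_assoc A A A (pure ?T A (comult A (u i k)) (u k j)) =
          (\<Oplus>\<^bsub>tensor_space A ?T\<^esub>l\<in>{..<n}. pure A ?T (u i l) (pure A A (u l k) (u k j)))" .
    qed simp_all
    \<comment> \<open>The left side expands first in \<open>k\<close> and then in \<open>l\<close>,
      the right side in the opposite order; after the interchange the inner sum is a
      comultiplication in the second leg.\<close>
    also have "\<dots> = (\<Oplus>\<^bsub>tensor_space A ?T\<^esub>l\<in>{..<n}. \<Oplus>\<^bsub>tensor_space A ?T\<^esub>k\<in>{..<n}.
        pure A ?T (u i l) (pure A A (u l k) (u k j)))"
      by (rule cvec_finsum_swap) simp_all
    also have "\<dots> = (\<Oplus>\<^bsub>tensor_space A ?T\<^esub>l\<in>{..<n}. pure A ?T (u i l) (comult A (u l j)))"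
    proof (rule cvec_finsum_cong)
      fix l assume l [simp]: "l \<in> {..<n}"
      show "(\<Oplus>\<^bsub>tensor_space A ?T\<^esub>k\<in>{..<n}. pure A ?T (u i l) (pure A A (u l k) (u k j))) =
          pure A ?T (u i l) (comult A (u l j))"
        unfolding unitary_corepD(2)[OF u l j]
        by (rule linear_maps_finsum[OF bilinear_linear_right[OF pure_bilinear], symmetric]) simp_all
    qed (simp_all add: linear_maps_closed[OF comult_linear])
    also have "\<dots> = tensor_map A ?T (\<lambda>y. y) (comult A) (comult A (u i j))"
      unfolding tensor_map_def
      by (rule lift_comult[OF tensor_map_bilinear _ hu ij, symmetric]) (simp_all add: comult_linear linear_maps_id)
    finally show "tensor_assoc A A A (tensor_map ?T A (comult A) (\<lambda>y. y) (comult A (u i j))) =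
        tensor_map A ?T (\<lambda>y. y) (comult A) (comult A (u i j))" .
  qed simp
  then show ?thesis by simp
qed

lemma cqg_algebra: "cqg_algebra A"
  unfolding cqg_algebra_def
proof
  show "hopf_star_algebra A"
    unfolding hopf_star_algebra_def using comult_hom coassociative is_counit is_antipode by auto
  let ?X = "{u i j | n u i j. unitary_corep A n u \<and> i < n \<and> j < n}"
  have X: "?X \<subseteq> carrier A" by (auto intro: unitary_corepD(1))
  have sub: "submodule (lin_span A ?X) complex_alg A" by (rule lin_span_submodule) (use X in simp_all)
  have "hopf_coefs A \<epsilon> S \<subseteq> ?X" by (auto simp: hopf_coefs_def hopf_corep_def)
  then have "hopf_coefs A \<epsilon> S \<subseteq> lin_span A ?X" using lin_span_superset by (rule order_trans)
  then have "lin_span A (hopf_coefs A \<epsilon> S) \<subseteq> lin_span A ?X" by (rule lin_span_least[OF sub])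
  moreover have "lin_span A ?X \<subseteq> carrier A" using sub by (simp add: submodule_iff)
  ultimately show "carrier A = lin_span A ?X" using coefs_span by blast
qed

end

text \<open>The coefficients contain the unit and are closed under products, so their span is a
  subalgebra; if it contains generators it is everything. The hypothesis on all sets
  \<open>K\<close> expresses generation by \<open>U\<close> through left multiplication.\<close>

lemma cqg_dataI:
  assumes A: "star_algebra A" and \<Delta>: "comult A \<in> star_hom A (tensor_alg A A)"
    and \<epsilon>: "\<epsilon> \<in> alg_hom A complex_alg"
    and S: "S \<in> linear_maps A A" "S \<one>\<^bsub>A\<^esub> = \<one>\<^bsub>A\<^esub>"
      "\<And>x y. \<lbrakk>x \<in> carrier A; y \<in> carrier A\<rbrakk> \<Longrightarrow> S (x \<otimes>\<^bsub>A\<^esub> y) = S y \<otimes>\<^bsub>A\<^esub> S x"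
    and U: "U \<subseteq> hopf_coefs A \<epsilon> S"
    and gen: "\<And>K. \<lbrakk>\<one>\<^bsub>A\<^esub> \<in> K; \<And>u x. \<lbrakk>u \<in> U; x \<in> carrier A; x \<in> K\<rbrakk> \<Longrightarrow> u \<otimes>\<^bsub>A\<^esub> x \<in> K;
      \<And>x y. \<lbrakk>x \<in> K; y \<in> K\<rbrakk> \<Longrightarrow> x \<oplus>\<^bsub>A\<^esub> y \<in> K; \<And>c x. x \<in> K \<Longrightarrow> c \<odot>\<^bsub>A\<^esub> x \<in> K\<rbrakk> \<Longrightarrow> carrier A \<subseteq> K"
  shows "cqg_data A \<epsilon> S"
proof (rule cqg_data.intro)
  let ?K = "lin_span A (hopf_coefs A \<epsilon> S)"
  have C: "hopf_coefs A \<epsilon> S \<subseteq> carrier A"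
    by (auto simp: hopf_coefs_def hopf_corep_def intro: unitary_corepD(1))
  have sub: "submodule ?K complex_alg A" by (rule lin_span_submodule) (use A C in simp_all)
  then have K: "?K \<subseteq> carrier A" "\<zero>\<^bsub>A\<^esub> \<in> ?K" "\<And>x y. \<lbrakk>x \<in> ?K; y \<in> ?K\<rbrakk> \<Longrightarrow> x \<oplus>\<^bsub>A\<^esub> y \<in> ?K"
    "\<And>c x. x \<in> ?K \<Longrightarrow> c \<odot>\<^bsub>A\<^esub> x \<in> ?K"
    using A by (auto simp: submodule_iff)
  \<comment> \<open>The trivial corepresentation, a matrix of size 1.\<close>
  have one: "hopf_corep A \<epsilon> S 1 (\<lambda>i j. \<one>\<^bsub>A\<^esub>)"
  proof -
    have fs: "finsum V f {..<1::nat} = f 0" if "cvec V" "f 0 \<in> carrier V" for V :: "(complex, 'v, 'n) module_scheme" and f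
      using that cvec_finsum_insert[of V "{}" 0 f] by (simp add: lessThan_Suc One_nat_def)
    have "comult A \<one>\<^bsub>A\<^esub> = finsum (tensor_space A A) (\<lambda>k. pure A A \<one>\<^bsub>A\<^esub> \<one>\<^bsub>A\<^esub>) {..<1::nat}"
      using A star_hom_one[OF \<Delta>] by (subst fs) simp_all
    then show ?thesis
      using A \<epsilon> S by (auto simp: hopf_corep_def unitary_corep_def fs alg_hom_one One_nat_def[symmetric])
  qed
  have mult: "a \<otimes>\<^bsub>A\<^esub> b \<in> hopf_coefs A \<epsilon> S" if a: "a \<in> hopf_coefs A \<epsilon> S" and b: "b \<in> hopf_coefs A \<epsilon> S" for a b
  proof -
    obtain n u i j where u: "hopf_corep A \<epsilon> S n u" "i < n" "j < n" "a = u i j"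
      using a by (auto simp: hopf_coefs_def)
    obtain m v k l where v: "hopf_corep A \<epsilon> S m v" "k < m" "l < m" "b = v k l"
      using b by (auto simp: hopf_coefs_def)
    let ?w = "\<lambda>r s. u (r div m) (s div m) \<otimes>\<^bsub>A\<^esub> v (r mod m) (s mod m)"
    have uu: "unitary_corep A n u" and vv: "unitary_corep A m v" using u v by (auto simp: hopf_corep_def)
    have w: "hopf_corep A \<epsilon> S (n * m) ?w"
      unfolding hopf_corep_def
    proof (intro conjI allI impI)
      show "unitary_corep A (n * m) ?w" by (rule unitary_corep_product[OF A \<Delta> uu vv])
      fix r s assume "r < n * m" "s < n * m"
      then have d: "r div m < n" "s div m < n" "r mod m < m" "s mod m < m"
        using v by (auto simp: less_mult_imp_div_less)
      have rs: "r = s \<longleftrightarrow> r div m = s div m \<and> r mod m = s mod m" by (metis mult_div_mod_eq)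
      show "\<epsilon> (?w r s) = (if r = s then 1 else 0)"
        using d u(1) v(1) rs by (auto simp: alg_hom_mult[OF \<epsilon>] unitary_corepD(1)[OF uu] unitary_corepD(1)[OF vv] hopf_corep_def)
      show "S (?w r s) = star A (?w s r)"
        using d u(1) v(1) A by (auto simp: S(3) unitary_corepD(1)[OF uu] unitary_corepD(1)[OF vv] hopf_corep_def alg_star_mult)
    qed
    \<comment> \<open>The row index pairs \<open>i\<close> with \<open>k\<close>, the column index
      pairs \<open>j\<close> with \<open>l\<close>; the bounds \<open>k < m\<close> and
      \<open>l < m\<close> make the decoding exact.\<close>
    have ab: "a \<otimes>\<^bsub>A\<^esub> b = ?w (i * m + k) (j * m + l)" using u v by simp
    have "i * m + k < n * m" "j * m + l < n * m"
    proof -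
      have "i * m + k < Suc i * m" "j * m + l < Suc j * m" using v by auto
      moreover have "Suc i * m \<le> n * m" "Suc j * m \<le> n * m" using u by (intro mult_le_mono1; simp)+
      ultimately show "i * m + k < n * m" "j * m + l < n * m" by linarith+
    qed
    then show ?thesis unfolding ab by (rule hopf_coefsI[OF w])
  qed
  show "carrier A \<subseteq> ?K"
  proof (rule gen)
    have "\<one>\<^bsub>A\<^esub> \<in> hopf_coefs A \<epsilon> S" using hopf_coefsI[OF one, of 0 0] by simp
    then show "\<one>\<^bsub>A\<^esub> \<in> ?K" by (rule subsetD[OF lin_span_superset])
    fix u x assume u: "u \<in> U" and x: "x \<in> ?K"
    have uc: "u \<in> hopf_coefs A \<epsilon> S" "u \<in> carrier A" using u U C by auto
    show "u \<otimes>\<^bsub>A\<^esub> x \<in> ?K"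
      using x star_algebra_cvec[OF A] C
    proof (induction rule: lin_span_induct)
      case (base x)
      then show ?case by (intro subsetD[OF lin_span_superset] mult[OF uc(1)])
    qed (use A K uc in \<open>simp_all add: alg_mult_add alg_mult_smult\<close>)
  qed (use K in auto)
qed (use assms in auto)

text \<open>The structure travels along a surjective *-homomorphism intertwining the
  comultiplications. It is used twice: for the quotient by a Hopf ideal, and for the bijection onto
  the smash product.\<close>

lemma cqg_data_image:
  assumes "cqg_data A \<epsilon> S" and B: "star_algebra B"
    and f: "f \<in> star_hom A B" and surj: "f ` carrier A = carrier B"
    and comult: "\<And>x. x \<in> carrier A \<Longrightarrow> comult B (f x) = tensor_map B B f f (comult A x)"
    and \<epsilon>': "\<And>x. x \<in> carrier A \<Longrightarrow> \<epsilon>' (f x) = \<epsilon> x"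
    and S': "\<And>x. x \<in> carrier A \<Longrightarrow> S' (f x) = f (S x)"
  shows "cqg_data B \<epsilon>' S'"
proof -
  interpret cqg_data A \<epsilon> S by fact
  note [simp] = B star_hom_closed[OF f]
  have im: "\<exists>x'\<in>carrier A. x = f x'" if "x \<in> carrier B" for x using that surj by auto
  note hom = star_hom_add[OF f, symmetric] star_hom_mult[OF f, symmetric] star_hom_smult[OF f, symmetric]
    star_hom_star[OF f, symmetric] star_hom_one[OF f, symmetric]
  have ff: "tensor_map B B f f \<in> star_hom (tensor_alg A A) (tensor_alg B B)"
    by (rule tensor_map_star_hom) (use f in simp_all)
  have comp: "(\<lambda>x. tensor_map B B f f (comult A x)) \<in> star_hom A (tensor_alg B B)"
    by (rule star_hom_comp[OF comult_hom ff])
  have 1: "comult B \<in> star_hom B (tensor_alg B B)"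
  proof (rule star_homI linear_mapsI)+
    show "comult B \<one>\<^bsub>B\<^esub> = \<one>\<^bsub>tensor_alg B B\<^esub>"
      unfolding hom using star_hom_one[OF comp] by (subst comult) simp_all
    fix x y c assume "x \<in> carrier B"
    then obtain x' where x: "x = f x'" "x' \<in> carrier A" using im by blast
    show "comult B x \<in> carrier (tensor_alg B B)"
      "comult B (c \<odot>\<^bsub>B\<^esub> x) = c \<odot>\<^bsub>tensor_alg B B\<^esub> comult B x"
      "comult B (star B x) = star (tensor_alg B B) (comult B x)"
      using x star_hom_closed[OF comp, of x'] star_hom_smult[OF comp, of x' c] star_hom_star[OF comp, of x']
      by (simp_all add: hom comult)
    assume "y \<in> carrier B"
    then obtain y' where y: "y = f y'" "y' \<in> carrier A" using im by blast
    show "comult B (x \<oplus>\<^bsub>B\<^esub> y) = comult B x \<oplus>\<^bsub>tensor_alg B B\<^esub> comult B y"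
      "comult B (x \<otimes>\<^bsub>B\<^esub> y) = comult B x \<otimes>\<^bsub>tensor_alg B B\<^esub> comult B y"
      using x y star_hom_add[OF comp, of x' y'] star_hom_mult[OF comp, of x' y']
      by (simp_all add: hom comult)
  qed
  have 2: "\<epsilon>' \<in> alg_hom B complex_alg"
  proof (rule alg_homI linear_mapsI)+
    show "\<epsilon>' \<one>\<^bsub>B\<^esub> = \<one>\<^bsub>complex_alg\<^esub>" unfolding hom by (simp add: \<epsilon>' alg_hom_one[OF counit_hom])
    fix x y c assume "x \<in> carrier B"
    then obtain x' where x: "x = f x'" "x' \<in> carrier A" using im by blast
    show "\<epsilon>' x \<in> carrier complex_alg" "\<epsilon>' (c \<odot>\<^bsub>B\<^esub> x) = c \<odot>\<^bsub>complex_alg\<^esub> \<epsilon>' x"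
      using x by (simp_all add: hom \<epsilon>' linear_maps_smult[OF counit_linear])
    assume "y \<in> carrier B"
    then obtain y' where y: "y = f y'" "y' \<in> carrier A" using im by blast
    show "\<epsilon>' (x \<oplus>\<^bsub>B\<^esub> y) = \<epsilon>' x \<oplus>\<^bsub>complex_alg\<^esub> \<epsilon>' y" "\<epsilon>' (x \<otimes>\<^bsub>B\<^esub> y) = \<epsilon>' x \<otimes>\<^bsub>complex_alg\<^esub> \<epsilon>' y"
      using x y by (simp_all add: hom \<epsilon>' linear_maps_add[OF counit_linear] alg_hom_mult[OF counit_hom])
  qed
  note [simp] = linear_maps_closed[OF antipode_linear]
  have 3: "S' \<in> linear_maps B B"
  proof (rule linear_mapsI)
    fix x y c assume "x \<in> carrier B"
    then obtain x' where x: "x = f x'" "x' \<in> carrier A" using im by blast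
    show "S' x \<in> carrier B" "S' (c \<odot>\<^bsub>B\<^esub> x) = c \<odot>\<^bsub>B\<^esub> S' x"
      using x by (simp_all add: hom S' linear_maps_smult[OF antipode_linear])
    assume "y \<in> carrier B"
    then obtain y' where y: "y = f y'" "y' \<in> carrier A" using im by blast
    show "S' (x \<oplus>\<^bsub>B\<^esub> y) = S' x \<oplus>\<^bsub>B\<^esub> S' y"
      using x y by (simp add: hom S' linear_maps_add[OF antipode_linear])
  qed
  have 4: "S' \<one>\<^bsub>B\<^esub> = \<one>\<^bsub>B\<^esub>" unfolding hom by (simp add: S' antipode_one)
  have 5: "S' (x \<otimes>\<^bsub>B\<^esub> y) = S' y \<otimes>\<^bsub>B\<^esub> S' x" if x: "x \<in> carrier B" and y: "y \<in> carrier B" for x y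
  proof -
    obtain x' where "x = f x'" "x' \<in> carrier A" using im x by blast
    moreover obtain y' where "y = f y'" "y' \<in> carrier A" using im y by blast
    ultimately show ?thesis by (simp add: hom S' antipode_mult)
  qed
  \<comment> \<open>The image of a unitary corepresentation is again one, so the images of the
    spanning coefficients are coefficients downstairs.\<close>
  have corep: "hopf_corep B \<epsilon>' S' n (\<lambda>i j. f (u i j))" if hu: "hopf_corep A \<epsilon> S n u" for n u
    unfolding hopf_corep_def unitary_corep_def
  proof (intro conjI allI impI)
    have u: "unitary_corep A n u" using hu by (simp add: hopf_corep_def)
    note lin = star_hom_linear[OF f]
    note [simp] = unitary_corepD(1)[OF u]
    fix i j assume ij: "i < n" "j < n"
    then have [simp]: "i \<in> {..<n}" "j \<in> {..<n}" by simp_all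
    note [simp del] = lessThan_iff
    show "f (u i j) \<in> carrier B" by simp
    show "\<epsilon>' (f (u i j)) = (if i = j then 1 else 0)" "S' (f (u i j)) = star B (f (u j i))"
      using hu ij by (simp_all add: \<epsilon>' S' hopf_corep_def hom)
    have "comult B (f (u i j)) = (\<Oplus>\<^bsub>tensor_space B B\<^esub>k\<in>{..<n}. tensor_map B B f f (pure A A (u i k) (u k j)))"
      using linear_maps_finsum[OF tensor_map_linear[OF _ _ _ _ lin lin], of "{..<n}" "\<lambda>k. pure A A (u i k) (u k j)"]
      by (simp add: comult unitary_corepD(2)[OF u])
    also have "\<dots> = (\<Oplus>\<^bsub>tensor_space B B\<^esub>k\<in>{..<n}. pure B B (f (u i k)) (f (u k j)))"
      by (rule cvec_finsum_cong) (simp_all add: tensor_map_pure lin)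
    finally show "comult B (f (u i j)) = (\<Oplus>\<^bsub>tensor_alg B B\<^esub>k\<in>{..<n}. pure B B (f (u i k)) (f (u k j)))" by simp
    have zero: "f \<zero>\<^bsub>A\<^esub> = \<zero>\<^bsub>B\<^esub>" using linear_maps_zero[OF lin] by simp
    have "(\<Oplus>\<^bsub>B\<^esub>k\<in>{..<n}. f (u i k) \<otimes>\<^bsub>B\<^esub> star B (f (u j k))) =
        f (\<Oplus>\<^bsub>A\<^esub>k\<in>{..<n}. u i k \<otimes>\<^bsub>A\<^esub> star A (u j k))"
      by (subst linear_maps_finsum[OF lin]) (simp_all add: star_hom_mult[OF f] star_hom_star[OF f] cong: cvec_finsum_cong)
    then show "(\<Oplus>\<^bsub>B\<^esub>k\<in>{..<n}. f (u i k) \<otimes>\<^bsub>B\<^esub> star B (f (u j k))) = (if i = j then \<one>\<^bsub>B\<^esub> else \<zero>\<^bsub>B\<^esub>)"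
      using zero by (simp add: unitary_corepD(3)[OF u] star_hom_one[OF f])
    have "(\<Oplus>\<^bsub>B\<^esub>k\<in>{..<n}. star B (f (u k i)) \<otimes>\<^bsub>B\<^esub> f (u k j)) =
        f (\<Oplus>\<^bsub>A\<^esub>k\<in>{..<n}. star A (u k i) \<otimes>\<^bsub>A\<^esub> u k j)"
      by (subst linear_maps_finsum[OF lin]) (simp_all add: star_hom_mult[OF f] star_hom_star[OF f] cong: cvec_finsum_cong)
    then show "(\<Oplus>\<^bsub>B\<^esub>k\<in>{..<n}. star B (f (u k i)) \<otimes>\<^bsub>B\<^esub> f (u k j)) = (if i = j then \<one>\<^bsub>B\<^esub> else \<zero>\<^bsub>B\<^esub>)"
      using zero by (simp add: unitary_corepD(4)[OF u] star_hom_one[OF f])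
  qed
  let ?K = "lin_span B (hopf_coefs B \<epsilon>' S')"
  have "hopf_coefs B \<epsilon>' S' \<subseteq> carrier B"
    by (auto simp: hopf_coefs_def hopf_corep_def intro: unitary_corepD(1))
  then have "submodule ?K complex_alg B" by (intro lin_span_submodule) simp_all
  then have K: "\<zero>\<^bsub>B\<^esub> \<in> ?K" "\<And>x y. \<lbrakk>x \<in> ?K; y \<in> ?K\<rbrakk> \<Longrightarrow> x \<oplus>\<^bsub>B\<^esub> y \<in> ?K"
    "\<And>c x. x \<in> ?K \<Longrightarrow> c \<odot>\<^bsub>B\<^esub> x \<in> ?K"
    by (simp_all add: submodule_iff)
  have "f x \<in> ?K" if "x \<in> carrier A" for x
    using subsetD[OF coefs_span that] star_algebra_cvec[OF star_alg] hopf_coefs_closed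
  proof (induction rule: lin_span_induct)
    case (base x)
    then have "f x \<in> hopf_coefs B \<epsilon>' S'"
      unfolding hopf_coefs_def[of A] by (auto intro: hopf_coefsI[OF corep])
    then show ?case by (rule subsetD[OF lin_span_superset])
  qed (use K linear_maps_zero[OF star_hom_linear[OF f]] in \<open>simp_all add: star_hom_add[OF f] star_hom_smult[OF f]\<close>)
  then have "carrier B \<subseteq> ?K" unfolding surj[symmetric] by auto
  then show ?thesis by (intro cqg_data.intro B 1 2 3 4 5)
qed

section \<open>The Hopf *-algebra structure\<close>

lemma hn_family_same: "same_star_alg A B \<Longrightarrow> hn_family N G A b \<longleftrightarrow> hn_family N G B b"
  by (simp add: hn_family_def same_star_alg_def finsum_structure_cong[of A B])

lemma comult_extend [simp]: "comult (star_alg.extend A (hopf_star_alg.fields \<Delta>)) = \<Delta>"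
  by (simp add: star_alg.defs hopf_star_alg.defs)

text \<open>Bridges two conventions: matrices of corepresentations are indexed from 0, generators
  from 1.\<close>

lemma finsum_1_N_Suc:
  assumes "cvec V" "\<And>k. k \<in> {1..N} \<Longrightarrow> f k \<in> carrier V"
  shows "(\<Oplus>\<^bsub>V\<^esub>k\<in>{..<N}. f (Suc k)) = (\<Oplus>\<^bsub>V\<^esub>k\<in>{1..N}. f k)"
proof -
  have "Suc ` {..<N} = {1..N}" by (simp add: image_Suc_lessThan One_nat_def)
  then show ?thesis using cvec_finsum_reindex[OF assms(1), of Suc "{..<N}" f] assms(2)
    by (auto simp: One_nat_def atLeastAtMost_iff)
qed

lemma hn_family_hopf_corep:
  assumes G: "group G" and A: "star_algebra A" and a: "hn_family N G A a" and g: "g \<in> carrier G"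
    and \<Delta>: "\<And>i j. \<lbrakk>i \<in> {1..N}; j \<in> {1..N}\<rbrakk> \<Longrightarrow>
      comult A (a i j g) = (\<Oplus>\<^bsub>tensor_space A A\<^esub>k\<in>{1..N}. pure A A (a i k g) (a k j g))"
    and \<epsilon>: "\<And>i j. \<lbrakk>i \<in> {1..N}; j \<in> {1..N}\<rbrakk> \<Longrightarrow> \<epsilon> (a i j g) = (if i = j then 1 else 0)"
    and S: "\<And>i j. \<lbrakk>i \<in> {1..N}; j \<in> {1..N}\<rbrakk> \<Longrightarrow> S (a i j g) = a j i (inv\<^bsub>G\<^esub> g)"
  shows "hopf_corep A \<epsilon> S N (\<lambda>i j. a (Suc i) (Suc j) g)"
proof -
  interpret group G by fact
  note [simp] = A hn_family_closed[OF a] g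
  have T: "cvec (tensor_space A A)" by simp
  have mem: "Suc i \<in> {1..N}" if "i < N" for i using that by (simp add: atLeastAtMost_iff)
  show ?thesis
    unfolding hopf_corep_def unitary_corep_def
    using mem
    by (auto simp: \<epsilon> S \<Delta> hn_family_star[OF a]
      finsum_1_N_Suc[OF T, of N "\<lambda>k. pure A A (a (Suc i) k g) (a k (Suc j) g)" for i j]
      finsum_1_N_Suc[OF star_algebra_cvec[OF A], of N "\<lambda>k. a (Suc i) k g \<otimes>\<^bsub>A\<^esub> star A (a (Suc j) k g)" for i j]
      finsum_1_N_Suc[OF star_algebra_cvec[OF A], of N "\<lambda>k. star A (a k (Suc i) g) \<otimes>\<^bsub>A\<^esub> a k (Suc j) g" for i j]
      hn_family_unitary[OF G a A])
qed

section \<open>Counit, antipode and comultiplication of the universal algebra\<close>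

context
  fixes N :: nat and G :: "('g, 'm) monoid_scheme"
  assumes G: "group G"
begin

private abbreviation (input) "X \<equiv> O_HN N G"
private abbreviation (input) "a \<equiv> hn_gen N G"

lemma O_HN_same: "same_star_alg X (hn_star_alg N G)"
  by (simp add: O_HN_def Let_def same_star_alg_extend)

lemma O_HN_star_algebra [simp]: "star_algebra X"
  by (rule same_star_alg_star_algebra[OF O_HN_same hn_star_alg_star_algebra[OF G]])

lemma O_HN_family: "hn_family N G X a"
  using hn_gen_family[OF G] hn_family_same[OF O_HN_same] by blast

lemma O_HN_induct [consumes 1, case_names one gen add smult]:
  assumes x: "x \<in> carrier X"
    and one: "P \<one>\<^bsub>X\<^esub>"
    and gen: "\<And>i j g x. \<lbrakk>i \<in> {1..N}; j \<in> {1..N}; g \<in> carrier G; x \<in> carrier X; P x\<rbrakk>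
      \<Longrightarrow> P (a i j g \<otimes>\<^bsub>X\<^esub> x)"
    and add: "\<And>x y. \<lbrakk>x \<in> carrier X; y \<in> carrier X; P x; P y\<rbrakk> \<Longrightarrow> P (x \<oplus>\<^bsub>X\<^esub> y)"
    and smult: "\<And>c x. \<lbrakk>x \<in> carrier X; P x\<rbrakk> \<Longrightarrow> P (c \<odot>\<^bsub>X\<^esub> x)"
  shows "P x"
  by (rule hn_induct[OF G, of x N P]) (use O_HN_same assms in \<open>simp_all add: same_star_alg_def\<close>)

lemma O_HN_universal:
  assumes B: "star_algebra B" and b: "hn_family N G B b"
  obtains f where "f \<in> star_hom X B"
    "\<And>i j g. \<lbrakk>i \<in> {1..N}; j \<in> {1..N}; g \<in> carrier G\<rbrakk> \<Longrightarrow> f (a i j g) = b i j g"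
  using hn_universal[OF G B b]
    same_star_alg_star_hom[OF O_HN_same, of B B] by (metis same_star_alg_def)

lemma O_HN_hom_eq:
  assumes B: "star_algebra B" and f: "f \<in> alg_hom X B" and f': "f' \<in> alg_hom X B"
    and eq: "\<And>i j g. \<lbrakk>i \<in> {1..N}; j \<in> {1..N}; g \<in> carrier G\<rbrakk> \<Longrightarrow> f (a i j g) = f' (a i j g)"
    and x: "x \<in> carrier X"
  shows "f x = f' x"
  using x
  by (induction rule: O_HN_induct)
    (use assms in \<open>simp_all add: alg_hom_one alg_hom_mult hn_family_closed[OF O_HN_family]
      linear_maps_add[OF alg_hom_linear] linear_maps_smult[OF alg_hom_linear]\<close>)

lemma O_HN_comult:
  "comult X \<in> carrier X \<rightarrow>\<^sub>E carrier (tensor_alg X X)" (is ?ext)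
  "comult X \<in> star_hom X (tensor_alg X X)" (is ?hom)
  "\<lbrakk>i \<in> {1..N}; j \<in> {1..N}; g \<in> carrier G\<rbrakk> \<Longrightarrow>
    comult X (a i j g) = (\<Oplus>\<^bsub>tensor_space X X\<^esub>k\<in>{1..N}. pure X X (a i k g) (a k j g))"
proof -
  let ?H = "hn_star_alg N G"
  define P where "P \<Delta> \<longleftrightarrow> \<Delta> \<in> carrier X \<rightarrow>\<^sub>E carrier (tensor_alg X X) \<and> \<Delta> \<in> star_hom X (tensor_alg X X) \<and>
    (\<forall>i\<in>{1..N}. \<forall>j\<in>{1..N}. \<forall>g\<in>carrier G.
      \<Delta> (a i j g) = (\<Oplus>\<^bsub>tensor_alg X X\<^esub>k\<in>{1..N}. pure X X (a i k g) (a k j g)))" for \<Delta>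
  \<comment> \<open>The description in \<open>O_HN_def\<close> speaks of \<open>hn_star_alg\<close>;
    its tensor square is literally that of \<open>O_HN\<close>, so the description can be restated
    without the underlying algebra.\<close>
  have T: "tensor_alg X X = tensor_alg ?H ?H" "pure X X = pure ?H ?H"
    by (rule same_star_alg_tensor[OF O_HN_same O_HN_same])+
  have c: "comult X = (THE \<Delta>. P \<Delta>)"
    unfolding P_def T using O_HN_same same_star_alg_star_hom[OF O_HN_same, of "tensor_alg ?H ?H" "tensor_alg ?H ?H"]
    by (simp add: O_HN_def Let_def same_star_alg_def)
  have T': "star_algebra (tensor_alg X X)" by simp
  obtain f where f: "f \<in> star_hom X (tensor_alg X X)"
    and fa: "\<And>i j g. \<lbrakk>i \<in> {1..N}; j \<in> {1..N}; g \<in> carrier G\<rbrakk> \<Longrightarrow>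
      f (a i j g) = (\<Oplus>\<^bsub>tensor_space X X\<^esub>k\<in>{1..N}. pure X X (a i k g) (a k j g))"
    using O_HN_universal[OF T' hn_family_tensor[OF _ _ G O_HN_family O_HN_family]] by auto
  \<comment> \<open>The universal property gives a map on the whole type; cutting it down to the
    carrier makes it extensional, as the description demands.\<close>
  have ex: "P (restrict f (carrier X))"
    unfolding P_def
    using f fa by (auto simp: star_hom_closed[OF f] hn_family_closed[OF O_HN_family] star_hom_def alg_hom_def
      ring_hom_def linear_maps_def Pi_def)
  \<comment> \<open>Two candidates are homomorphisms that agree on generators, hence on the carrier,
    and both are undefined outside.\<close>
  have un: "\<Delta> = \<Delta>'" if d: "P \<Delta>" "P \<Delta>'" for \<Delta> \<Delta>'
  proof (rule PiE_ext)
    show "\<Delta> \<in> carrier X \<rightarrow>\<^sub>E carrier (tensor_alg X X)" "\<Delta>' \<in> carrier X \<rightarrow>\<^sub>E carrier (tensor_alg X X)"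
      using d by (auto simp: P_def)
    show "\<Delta> x = \<Delta>' x" if "x \<in> carrier X" for x
      by (rule O_HN_hom_eq[OF T' _ _ _ that]) (use d in \<open>simp_all add: P_def star_hom_alg_hom\<close>)
  qed
  have "P (comult X)" unfolding c by (rule theI[where P = P, OF ex un[OF _ ex]])
  then show ?ext ?hom
    "\<lbrakk>i \<in> {1..N}; j \<in> {1..N}; g \<in> carrier G\<rbrakk> \<Longrightarrow>
      comult X (a i j g) = (\<Oplus>\<^bsub>tensor_space X X\<^esub>k\<in>{1..N}. pure X X (a i k g) (a k j g))"
    unfolding P_def by simp_all
qed

text \<open>The counit comes from the identity matrix over the complex numbers, the antipode from
  the transposed family in the opposite algebra. The *-homomorphism properties are recorded because
  Hopf ideals are later tested by preimages.\<close>

lemma O_HN_cqg_data: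
  obtains \<epsilon> S where "cqg_data X \<epsilon> S" "\<epsilon> \<in> star_hom X complex_star" "S \<in> star_hom X (op_alg X)"
    "\<And>i j g. \<lbrakk>i \<in> {1..N}; j \<in> {1..N}; g \<in> carrier G\<rbrakk> \<Longrightarrow> \<epsilon> (a i j g) = (if i = j then 1 else 0)"
    "\<And>i j g. \<lbrakk>i \<in> {1..N}; j \<in> {1..N}; g \<in> carrier G\<rbrakk> \<Longrightarrow> S (a i j g) = a j i (inv\<^bsub>G\<^esub> g)"
proof -
  obtain \<epsilon> where \<epsilon>: "\<epsilon> \<in> star_hom X complex_star"
    and \<epsilon>a: "\<And>i j g. \<lbrakk>i \<in> {1..N}; j \<in> {1..N}; g \<in> carrier G\<rbrakk> \<Longrightarrow> \<epsilon> (a i j g) = (if i = j then 1 else 0)"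
    using O_HN_universal[OF complex_star_star_algebra hn_family_counit] by metis
  obtain S where S: "S \<in> star_hom X (op_alg X)"
    and Sa: "\<And>i j g. \<lbrakk>i \<in> {1..N}; j \<in> {1..N}; g \<in> carrier G\<rbrakk> \<Longrightarrow> S (a i j g) = a j i (inv\<^bsub>G\<^esub> g)"
    using O_HN_universal[OF op_alg_star_algebra[OF O_HN_star_algebra] hn_family_op[OF G O_HN_family]] by metis
  have "cqg_data X \<epsilon> S"
  proof (rule cqg_dataI[OF O_HN_star_algebra O_HN_comult(2)])
    show "\<epsilon> \<in> alg_hom X complex_alg" using star_hom_alg_hom[OF \<epsilon>] by (simp add: alg_hom_complex_star)
    show "S \<in> linear_maps X X" using star_hom_linear[OF S] by (simp add: linear_maps_def)
    show "S \<one>\<^bsub>X\<^esub> = \<one>\<^bsub>X\<^esub>" using star_hom_one[OF S] by simp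
    show "S (x \<otimes>\<^bsub>X\<^esub> y) = S y \<otimes>\<^bsub>X\<^esub> S x" if "x \<in> carrier X" "y \<in> carrier X" for x y
      using star_hom_mult[OF S that] by simp
    show "{a i j g | i j g. i \<in> {1..N} \<and> j \<in> {1..N} \<and> g \<in> carrier G} \<subseteq> hopf_coefs X \<epsilon> S"
    proof safe
      fix i j g assume ij: "i \<in> {1..N}" "j \<in> {1..N}" and g: "g \<in> carrier G"
      have "hopf_corep X \<epsilon> S N (\<lambda>i j. a (Suc i) (Suc j) g)"
        by (rule hn_family_hopf_corep[OF G O_HN_star_algebra O_HN_family g]) (use g in \<open>simp_all add: O_HN_comult(3) \<epsilon>a Sa\<close>)
      moreover obtain i' j' where "i = Suc i'" "i' < N" "j = Suc j'" "j' < N"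
        using ij by (cases i; cases j) (auto simp: atLeastAtMost_iff)
      ultimately show "a i j g \<in> hopf_coefs X \<epsilon> S" using hopf_coefsI[of X \<epsilon> S N _ i' j'] by auto
    qed
    fix K
    assume K: "\<one>\<^bsub>X\<^esub> \<in> K" "\<And>u x. \<lbrakk>u \<in> {a i j g | i j g. i \<in> {1..N} \<and> j \<in> {1..N} \<and> g \<in> carrier G}; x \<in> carrier X; x \<in> K\<rbrakk>
        \<Longrightarrow> u \<otimes>\<^bsub>X\<^esub> x \<in> K"
      "\<And>x y. \<lbrakk>x \<in> K; y \<in> K\<rbrakk> \<Longrightarrow> x \<oplus>\<^bsub>X\<^esub> y \<in> K" "\<And>c x. x \<in> K \<Longrightarrow> c \<odot>\<^bsub>X\<^esub> x \<in> K"
    show "carrier X \<subseteq> K"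
    proof
      fix x assume "x \<in> carrier X"
      then show "x \<in> K"
      proof (induction rule: O_HN_induct)
        case (gen i j g x)
        then show ?case by (intro K(2)) auto
      qed (use K in auto)
    qed
  qed
  then show ?thesis using \<epsilon> S \<epsilon>a Sa by (rule that)
qed

end

subsection \<open>Hopf *-ideals\<close>

lemma star_ideal_op: "star_ideal I A \<Longrightarrow> star_algebra A \<Longrightarrow> star_ideal I (op_alg A)"
  unfolding star_ideal_iff[OF op_alg_star_algebra] star_ideal_iff by simp

text \<open>The subspace \<open>I \<otimes> B + A \<otimes> J\<close> from the coideal condition is
  a two-sided *-ideal, so its preimage under the comultiplication is one as well.\<close>

lemma tensor_star_ideal:
  assumes A: "star_algebra A" and B: "star_algebra B" and I: "star_ideal I A" and J: "star_ideal J B"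
  shows "star_ideal (lin_span (tensor_alg A B)
    {pure A B x y | x y. x \<in> I \<and> y \<in> carrier B \<or> x \<in> carrier A \<and> y \<in> J}) (tensor_alg A B)"
proof -
  let ?T = "tensor_alg A B"
  let ?P = "{pure A B x y | x y. x \<in> I \<and> y \<in> carrier B \<or> x \<in> carrier A \<and> y \<in> J}"
  let ?K = "lin_span ?T ?P"
  note I' = I[unfolded star_ideal_iff[OF A]] and J' = J[unfolded star_ideal_iff[OF B]]
  note [simp] = A B
  have IJ: "\<And>x. x \<in> I \<Longrightarrow> x \<in> carrier A" "\<And>x. x \<in> J \<Longrightarrow> x \<in> carrier B" using I' J' by auto
  have T: "star_algebra ?T" by simp
  have P: "?P \<subseteq> carrier ?T" using IJ by auto
  have sub: "submodule ?K complex_alg ?T" by (rule lin_span_submodule[OF star_algebra_cvec[OF T] P])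
  then have K: "?K \<subseteq> carrier ?T" "\<zero>\<^bsub>?T\<^esub> \<in> ?K" "\<And>x y. \<lbrakk>x \<in> ?K; y \<in> ?K\<rbrakk> \<Longrightarrow> x \<oplus>\<^bsub>?T\<^esub> y \<in> ?K"
    "\<And>c x. x \<in> ?K \<Longrightarrow> c \<odot>\<^bsub>?T\<^esub> x \<in> ?K"
    unfolding submodule_iff[OF star_algebra_cvec[OF T]] by blast+
  have pureK: "pure A B x y \<in> ?K" if "x \<in> I \<and> y \<in> carrier B \<or> x \<in> carrier A \<and> y \<in> J" for x y
    using that by (intro subsetD[OF lin_span_superset]) auto
  note ind = tensor_induct[OF star_algebra_cvec[OF A] star_algebra_cvec[OF B], consumes 1, case_names pure add]
  note [simp] = alg_mult_closed[OF T, simplified]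
  have mult: "t \<otimes>\<^bsub>?T\<^esub> s \<in> ?K \<and> s \<otimes>\<^bsub>?T\<^esub> t \<in> ?K" if s: "s \<in> ?K" and t: "t \<in> carrier (tensor_space A B)" for s t
    using s star_algebra_cvec[OF T] P
  proof (induction rule: lin_span_induct)
    case (base s)
    then obtain x y where s: "s = pure A B x y" and xy: "x \<in> I \<and> y \<in> carrier B \<or> x \<in> carrier A \<and> y \<in> J" by blast
    then have [simp]: "x \<in> carrier A" "y \<in> carrier B" using IJ by auto
    show ?case unfolding s using t
    proof (induction rule: ind)
      case (pure x' y')
      have "pure A B (x' \<otimes>\<^bsub>A\<^esub> x) (y' \<otimes>\<^bsub>B\<^esub> y) \<in> ?K" "pure A B (x \<otimes>\<^bsub>A\<^esub> x') (y \<otimes>\<^bsub>B\<^esub> y') \<in> ?K"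
        using xy pure I' J' by (auto intro!: pureK)
      then show ?case using pure by simp
    next
      case (add t t')
      have eq: "(t \<oplus>\<^bsub>?T\<^esub> t') \<otimes>\<^bsub>?T\<^esub> pure A B x y = t \<otimes>\<^bsub>?T\<^esub> pure A B x y \<oplus>\<^bsub>?T\<^esub> t' \<otimes>\<^bsub>?T\<^esub> pure A B x y"
        "pure A B x y \<otimes>\<^bsub>?T\<^esub> (t \<oplus>\<^bsub>?T\<^esub> t') = pure A B x y \<otimes>\<^bsub>?T\<^esub> t \<oplus>\<^bsub>?T\<^esub> pure A B x y \<otimes>\<^bsub>?T\<^esub> t'"
        by (rule alg_add_mult[OF T] alg_mult_add[OF T]; use add(1,2) in simp)+
      show ?case using add(3,4) K(3) eq by (simp only: tensor_alg_sel)
    qed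
  next
    case zero
    have "t \<otimes>\<^bsub>?T\<^esub> \<zero>\<^bsub>?T\<^esub> = \<zero>\<^bsub>?T\<^esub>" "\<zero>\<^bsub>?T\<^esub> \<otimes>\<^bsub>?T\<^esub> t = \<zero>\<^bsub>?T\<^esub>"
      by (rule alg_mult_zero[OF T] alg_zero_mult[OF T]; use t in simp)+
    then show ?case using K(2) by (simp only:)
  next
    case (add s s')
    have "t \<otimes>\<^bsub>?T\<^esub> (s \<oplus>\<^bsub>?T\<^esub> s') = t \<otimes>\<^bsub>?T\<^esub> s \<oplus>\<^bsub>?T\<^esub> t \<otimes>\<^bsub>?T\<^esub> s'" "(s \<oplus>\<^bsub>?T\<^esub> s') \<otimes>\<^bsub>?T\<^esub> t = s \<otimes>\<^bsub>?T\<^esub> t \<oplus>\<^bsub>?T\<^esub> s' \<otimes>\<^bsub>?T\<^esub> t"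
      by (rule alg_add_mult[OF T] alg_mult_add[OF T]; use add(1,2) t in simp)+
    then show ?case using add(3,4) K(3) by (simp only:)
  next
    case (smult c s)
    have "t \<otimes>\<^bsub>?T\<^esub> (c \<odot>\<^bsub>?T\<^esub> s) = c \<odot>\<^bsub>?T\<^esub> (t \<otimes>\<^bsub>?T\<^esub> s)" "(c \<odot>\<^bsub>?T\<^esub> s) \<otimes>\<^bsub>?T\<^esub> t = c \<odot>\<^bsub>?T\<^esub> (s \<otimes>\<^bsub>?T\<^esub> t)"
      by (rule alg_smult_mult[OF T] alg_mult_smult[OF T]; use smult(1) t in simp)+
    then show ?case using smult(2) K(4) by (simp only:)
  qed
  have star: "star ?T s \<in> ?K" if s: "s \<in> ?K" for s
    using s star_algebra_cvec[OF T] P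
  proof (induction rule: lin_span_induct)
    case (base s)
    then obtain x y where s: "s = pure A B x y" and xy: "x \<in> I \<and> y \<in> carrier B \<or> x \<in> carrier A \<and> y \<in> J" by blast
    then have [simp]: "x \<in> carrier A" "y \<in> carrier B" using IJ by auto
    have "pure A B (star A x) (star B y) \<in> ?K" using xy I' J' by (intro pureK) auto
    then show ?case by (simp add: s)
  next
    case zero
    then show ?case using K(2) alg_star_zero[OF T] by simp
  next
    case (add s s')
    then show ?case using K(3) alg_star_add[OF T add(1,2)] by simp
  next
    case (smult c s)
    then show ?case using K(4) alg_star_smult[OF T smult(1)] by simp
  qed
  show ?thesis
    unfolding star_ideal_iff[OF T]
    using K mult star by (auto simp del: tensor_alg_sel(2-5))
qed

text \<open>The coideal condition does not obviously survive intersections. However,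
  comultiplication, counit and antipode are *-homomorphisms, so their conditions define preimages of
  *-ideals and need to be checked only on \<open>R\<close>; the generated *-ideal is then the least
  member of the intersected family.\<close>

lemma gen_hopf_star_ideal_eq:
  assumes "cqg_data A \<epsilon> S" and R: "R \<subseteq> carrier A"
    and \<epsilon>: "\<epsilon> \<in> star_hom A complex_star" and S: "S \<in> star_hom A (op_alg A)"
    and \<epsilon>R: "\<And>r. r \<in> R \<Longrightarrow> \<epsilon> r = 0" and SR: "\<And>r. r \<in> R \<Longrightarrow> S r \<in> gen_star_ideal A R"
    and \<Delta>R: "\<And>r. r \<in> R \<Longrightarrow> comult A r \<in> lin_span (tensor_alg A A) {pure A A x y | x y.
      x \<in> gen_star_ideal A R \<and> y \<in> carrier A \<or> x \<in> carrier A \<and> y \<in> gen_star_ideal A R}"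
  shows "hopf_star_ideal (gen_star_ideal A R) A" "gen_hopf_star_ideal A R = gen_star_ideal A R"
proof -
  interpret cqg_data A \<epsilon> S by fact
  let ?I = "gen_star_ideal A R"
  have I: "star_ideal ?I A" by (rule gen_star_ideal_star_ideal[OF star_alg R])
  let ?K = "lin_span (tensor_alg A A) {pure A A x y | x y. x \<in> ?I \<and> y \<in> carrier A \<or> x \<in> carrier A \<and> y \<in> ?I}"
  have K: "star_ideal ?K (tensor_alg A A)" by (rule tensor_star_ideal[OF star_alg star_alg I I])
  have T: "star_algebra (tensor_alg A A)" by simp
  have "?I \<subseteq> {x \<in> carrier A. comult A x \<in> ?K}"
    by (rule gen_star_ideal_least[OF star_hom_kernel[OF star_alg T comult_hom K]]) (use R \<Delta>R in auto)
  moreover have "?I \<subseteq> {x \<in> carrier A. \<epsilon> x \<in> {\<zero>\<^bsub>complex_star\<^esub>}}"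
    by (rule gen_star_ideal_least[OF star_hom_kernel[OF star_alg complex_star_star_algebra \<epsilon>
        star_ideal_zero[OF complex_star_star_algebra]]]) (use R \<epsilon>R in auto)
  moreover have "?I \<subseteq> {x \<in> carrier A. S x \<in> ?I}"
    by (rule gen_star_ideal_least[OF star_hom_kernel[OF star_alg op_alg_star_algebra[OF star_alg] S
        star_ideal_op[OF I star_alg]]]) (use R SR in auto)
  ultimately show H: "hopf_star_ideal ?I A"
    unfolding hopf_star_ideal_def using I is_counit is_antipode
    by (intro conjI exI[of _ \<epsilon>] exI[of _ S]) auto
  have "?I \<subseteq> J" if "hopf_star_ideal J A" "R \<subseteq> J" for J
    by (rule gen_star_ideal_least) (use that in \<open>auto simp: hopf_star_ideal_def\<close>)
  then show "gen_hopf_star_ideal A R = ?I"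
    using H gen_star_ideal_superset[of R A] unfolding gen_hopf_star_ideal_def by blast
qed

lemma hopf_quot_same: "same_star_alg (hopf_quot A I) (star_quot A I)"
  by (simp add: hopf_quot_def Let_def same_star_alg_extend)

text \<open>Counit, antipode and comultiplication descend because each of them, followed by the
  projection where appropriate, vanishes on \<open>I\<close>; the rest is an instance of
  \<open>cqg_data_image\<close>.\<close>

lemma hopf_quot_cqg_data:
  assumes "cqg_data A \<epsilon> S" and I: "star_ideal I A"
    and \<epsilon>I: "\<And>x. x \<in> I \<Longrightarrow> \<epsilon> x = 0" and SI: "\<And>x. x \<in> I \<Longrightarrow> S x \<in> I"
    and \<Delta>I: "\<And>x. x \<in> I \<Longrightarrow> comult A x \<in> lin_span (tensor_alg A A) {pure A A x y | x y.
      x \<in> I \<and> y \<in> carrier A \<or> x \<in> carrier A \<and> y \<in> I}"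
  defines "\<pi> \<equiv> (\<lambda>x. I +>\<^bsub>A\<^esub> x)" and "Q \<equiv> hopf_quot A I"
  shows "cqg_data Q (\<lambda>X. the_elem (\<epsilon> ` X)) (\<lambda>X. the_elem ((\<lambda>x. \<pi> (S x)) ` X))"
    and "\<pi> \<in> star_hom A Q" and "\<pi> ` carrier A = carrier Q"
    and "x \<in> carrier A \<Longrightarrow> comult Q (\<pi> x) = tensor_map Q Q \<pi> \<pi> (comult A x)"
proof -
  interpret cqg_data A \<epsilon> S by fact
  let ?Q0 = "star_quot A I"
  have same: "same_star_alg Q ?Q0" unfolding Q_def by (rule hopf_quot_same)
  have Q0: "star_algebra ?Q0" by (rule star_quot_star_algebra[OF star_alg I])
  have Q [simp]: "star_algebra Q" by (rule same_star_alg_star_algebra[OF same Q0])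
  show \<pi>: "\<pi> \<in> star_hom A Q"
    using star_quot_proj_hom[OF star_alg I] same_star_alg_star_hom[of A A Q ?Q0] same
    unfolding \<pi>_def by (simp add: same_star_alg_def)
  show surj: "\<pi> ` carrier A = carrier Q"
    using star_quot_proj(1)[OF star_alg I] same unfolding \<pi>_def by (simp add: same_star_alg_def)
  have zeroI: "\<zero>\<^bsub>A\<^esub> \<in> I" "I \<subseteq> carrier A" using I by (simp_all add: star_ideal_iff)
  have \<pi>0: "\<pi> x = \<zero>\<^bsub>Q\<^esub>" if "x \<in> I" for x
  proof -
    have "\<pi> x = \<pi> \<zero>\<^bsub>A\<^esub>" unfolding \<pi>_def
      using that zeroI star_quot_eq_iff[OF star_alg I, of x "\<zero>\<^bsub>A\<^esub>"]
      by (auto simp: cvec_minus)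
    then show ?thesis using linear_maps_zero[OF star_hom_linear[OF \<pi>]] by simp
  qed
  have tm: "tensor_map ?Q0 ?Q0 \<pi> \<pi> = tensor_map Q Q \<pi> \<pi>"
    using same_star_alg_tensor(1,2)[OF same same] by (simp add: tensor_map_def fun_eq_iff)
  have lin: "(\<lambda>x. tensor_map Q Q \<pi> \<pi> (comult A x)) \<in> linear_maps A (tensor_space Q Q)"
    by (rule linear_maps_comp[OF comult_linear tensor_map_linear]) (simp_all add: star_hom_linear[OF \<pi>])
  let ?P = "{pure A A x y | x y. x \<in> I \<and> y \<in> carrier A \<or> x \<in> carrier A \<and> y \<in> I}"
  have P: "?P \<subseteq> carrier (tensor_alg A A)" using zeroI by auto
  have tlin: "tensor_map Q Q \<pi> \<pi> \<in> linear_maps (tensor_space A A) (tensor_space Q Q)"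
    by (rule tensor_map_linear) (simp_all add: star_hom_linear[OF \<pi>])
  have T: "star_algebra (tensor_alg A A)" by simp
  \<comment> \<open>The map \<open>\<pi> \<otimes> \<pi>\<close> annihilates pure tensors with one
    leg in \<open>I\<close>, hence their span; this is why the coideal condition makes the
    comultiplication well defined on cosets.\<close>
  have kill: "tensor_map Q Q \<pi> \<pi> t = \<zero>\<^bsub>tensor_space Q Q\<^esub>" if t: "t \<in> lin_span (tensor_alg A A) ?P" for t
    using t star_algebra_cvec[OF T] P
  proof (induction rule: lin_span_induct)
    case (base t)
    then obtain x y where t: "t = pure A A x y" and xy: "x \<in> I \<and> y \<in> carrier A \<or> x \<in> carrier A \<and> y \<in> I" by blast
    then have "x \<in> carrier A" "y \<in> carrier A" using zeroI by auto
    then show ?case using xy unfolding t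
      by (auto simp: tensor_map_pure star_hom_linear[OF \<pi>] \<pi>0 star_hom_closed[OF \<pi>]
        pure_zero_left[of Q Q] pure_zero_right[of Q Q])
  qed (simp_all add: linear_maps_add[OF tlin] linear_maps_smult[OF tlin] linear_maps_zero[OF tlin])
  show com: "comult Q (\<pi> x) = tensor_map Q Q \<pi> \<pi> (comult A x)" if x: "x \<in> carrier A" for x
  proof -
    have "comult Q (\<pi> x) = the_elem ((\<lambda>x. tensor_map ?Q0 ?Q0 \<pi> \<pi> (comult A x)) ` \<pi> x)"
      by (simp add: Q_def hopf_quot_def Let_def \<pi>_def)
    also have "\<dots> = tensor_map Q Q \<pi> \<pi> (comult A x)"
      unfolding tm[unfolded \<pi>_def] \<pi>_def
      by (rule star_quot_induced[OF star_alg I _ lin[unfolded \<pi>_def] _ x])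
        (use kill[unfolded \<pi>_def] \<Delta>I in simp_all)
    finally show ?thesis .
  qed
  show "cqg_data Q (\<lambda>X. the_elem (\<epsilon> ` X)) (\<lambda>X. the_elem ((\<lambda>x. \<pi> (S x)) ` X))"
  proof (rule cqg_data_image[OF cqg_data_axioms Q \<pi> surj com])
    fix x assume x: "x \<in> carrier A"
    have e: "\<epsilon> \<in> linear_maps A complex_star" using counit_linear by (simp add: linear_maps_def)
    show "the_elem (\<epsilon> ` \<pi> x) = \<epsilon> x" unfolding \<pi>_def
      by (rule star_quot_induced[OF star_alg I star_algebra_cvec[OF complex_star_star_algebra] e _ x]) (simp add: \<epsilon>I)
    show "the_elem ((\<lambda>x. \<pi> (S x)) ` \<pi> x) = \<pi> (S x)"
      unfolding \<pi>_def
      by (rule star_quot_induced[OF star_alg I star_algebra_cvec[OF Q]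
            linear_maps_comp[OF antipode_linear star_hom_linear[OF \<pi>], unfolded \<pi>_def] _ x])
        (use \<pi>0 SI in \<open>simp add: \<pi>_def\<close>)
  qed
qed

section \<open>The quantum group of the pair of a group and a subgroup\<close>

definition hn_balanced ::
    "nat \<Rightarrow> 'g set \<Rightarrow> ('b, 'n) star_alg_scheme \<Rightarrow> (nat \<Rightarrow> nat \<Rightarrow> 'g \<Rightarrow> 'b) \<Rightarrow> bool" where
  "hn_balanced N \<Lambda> B b \<longleftrightarrow>
     (\<forall>i\<in>{1..N}. \<forall>j\<in>{1..N}. \<forall>g\<in>\<Lambda>. (\<Oplus>\<^bsub>B\<^esub>k\<in>{1..N}. b i k g) = (\<Oplus>\<^bsub>B\<^esub>k\<in>{1..N}. b j k g))"

lemma hn_balanced_same: "same_star_alg A B \<Longrightarrow> hn_balanced N \<Lambda> A b \<longleftrightarrow> hn_balanced N \<Lambda> B b"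
  by (simp add: hn_balanced_def same_star_alg_def finsum_structure_cong[of A B])

lemma hn_balancedD:
  "\<lbrakk>hn_balanced N \<Lambda> B b; i \<in> {1..N}; j \<in> {1..N}; g \<in> \<Lambda>\<rbrakk> \<Longrightarrow>
    (\<Oplus>\<^bsub>B\<^esub>k\<in>{1..N}. b i k g) = (\<Oplus>\<^bsub>B\<^esub>k\<in>{1..N}. b j k g)"
  unfolding hn_balanced_def by blast

context
  fixes N :: nat and G :: "('g, 'm) monoid_scheme" and B :: "('b, 'n) star_alg_scheme" and b
  assumes G: "group G" and B [simp]: "star_algebra B" and b: "hn_family N G B b"
begin

interpretation group G by fact

text \<open>Orthogonality within row \<open>i\<close> leaves one summand, so a row sum multiplies
  the entries of its own row as a group element would.\<close>

lemma hn_row_sum_mult: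
  assumes i: "i \<in> {1..N}" "j \<in> {1..N}" "g \<in> carrier G" "h \<in> carrier G"
  shows "(\<Oplus>\<^bsub>B\<^esub>k\<in>{1..N}. b i k g) \<otimes>\<^bsub>B\<^esub> b i j h = b i j (g \<otimes>\<^bsub>G\<^esub> h)"
    and "b i j g \<otimes>\<^bsub>B\<^esub> (\<Oplus>\<^bsub>B\<^esub>k\<in>{1..N}. b i k h) = b i j (g \<otimes>\<^bsub>G\<^esub> h)"
proof -
  note [simp] = hn_family_closed[OF b] i
  have "(\<Oplus>\<^bsub>B\<^esub>k\<in>{1..N}. b i k g) \<otimes>\<^bsub>B\<^esub> b i j h = (\<Oplus>\<^bsub>B\<^esub>k\<in>{1..N}. b i k g \<otimes>\<^bsub>B\<^esub> b i j h)"
    by (rule alg_finsum_mult) simp_all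
  also have "\<dots> = b i j (g \<otimes>\<^bsub>G\<^esub> h)"
    by (rule cvec_finsum_delta[of _ _ j]) (simp_all add: hn_family_row[OF b])
  finally show "(\<Oplus>\<^bsub>B\<^esub>k\<in>{1..N}. b i k g) \<otimes>\<^bsub>B\<^esub> b i j h = b i j (g \<otimes>\<^bsub>G\<^esub> h)" .
  have "b i j g \<otimes>\<^bsub>B\<^esub> (\<Oplus>\<^bsub>B\<^esub>k\<in>{1..N}. b i k h) = (\<Oplus>\<^bsub>B\<^esub>k\<in>{1..N}. b i j g \<otimes>\<^bsub>B\<^esub> b i k h)"
    by (rule alg_mult_finsum) simp_all
  also have "\<dots> = b i j (g \<otimes>\<^bsub>G\<^esub> h)"
    by (rule cvec_finsum_delta[of _ _ j]) (auto simp: hn_family_row[OF b])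
  finally show "b i j g \<otimes>\<^bsub>B\<^esub> (\<Oplus>\<^bsub>B\<^esub>k\<in>{1..N}. b i k h) = b i j (g \<otimes>\<^bsub>G\<^esub> h)" .
qed

text \<open>In a balanced family the column sums agree with the row sums, because multiplying the row sum
  by \<open>1 = \<Sum>\<^sub>k b\<^sub>k\<^sub>j(e)\<close> turns it into a column sum.\<close>

lemma hn_balanced_col_sum:
  assumes bal: "hn_balanced N \<Lambda> B b" and \<Lambda>: "\<Lambda> \<subseteq> carrier G"
    and i: "i \<in> {1..N}" "j \<in> {1..N}" "g \<in> \<Lambda>"
  shows "(\<Oplus>\<^bsub>B\<^esub>k\<in>{1..N}. b k j g) = (\<Oplus>\<^bsub>B\<^esub>k\<in>{1..N}. b i k g)"
proof -
  note [simp] = hn_family_closed[OF b] i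
  have g [simp]: "g \<in> carrier G" using i \<Lambda> by blast
  let ?u = "\<Oplus>\<^bsub>B\<^esub>k\<in>{1..N}. b i k g"
  have "?u = ?u \<otimes>\<^bsub>B\<^esub> (\<Oplus>\<^bsub>B\<^esub>k\<in>{1..N}. b k j \<one>\<^bsub>G\<^esub>)" by (simp add: hn_family_col_sum[OF b])
  also have "\<dots> = (\<Oplus>\<^bsub>B\<^esub>k\<in>{1..N}. ?u \<otimes>\<^bsub>B\<^esub> b k j \<one>\<^bsub>G\<^esub>)" by (rule alg_mult_finsum) simp_all
  also have "\<dots> = (\<Oplus>\<^bsub>B\<^esub>k\<in>{1..N}. b k j g)"
  proof (rule cvec_finsum_cong)
    fix k assume k: "k \<in> {1..N}"
    show "?u \<otimes>\<^bsub>B\<^esub> b k j \<one>\<^bsub>G\<^esub> = b k j g"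
      unfolding hn_balancedD[OF bal i(1) k i(3)] using k by (simp add: hn_row_sum_mult)
  qed simp_all
  finally show ?thesis by simp
qed

text \<open>Balancedness allows the row of the sum to be chosen equal to the row of the factor next
  to it, so that \<open>hn_row_sum_mult\<close> applies to every entry. Thus the row sums represent
  \<Lambda> by unitaries.\<close>

lemma hn_balanced_unit:
  assumes bal: "hn_balanced N \<Lambda> B b" and \<Lambda>: "subgroup \<Lambda> G" and N: "1 \<in> {1..N}"
  defines "u \<equiv> \<lambda>g. \<Oplus>\<^bsub>B\<^esub>k\<in>{1..N}. b 1 k g"
  shows "g \<in> \<Lambda> \<Longrightarrow> u g \<in> carrier B"
    and "\<lbrakk>g \<in> \<Lambda>; i \<in> {1..N}; j \<in> {1..N}; h \<in> carrier G\<rbrakk> \<Longrightarrow> u g \<otimes>\<^bsub>B\<^esub> b i j h = b i j (g \<otimes>\<^bsub>G\<^esub> h)"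
    and "\<lbrakk>g \<in> \<Lambda>; i \<in> {1..N}; j \<in> {1..N}; h \<in> carrier G\<rbrakk> \<Longrightarrow> b i j h \<otimes>\<^bsub>B\<^esub> u g = b i j (h \<otimes>\<^bsub>G\<^esub> g)"
    and "\<lbrakk>g \<in> \<Lambda>; h \<in> \<Lambda>\<rbrakk> \<Longrightarrow> u (g \<otimes>\<^bsub>G\<^esub> h) = u g \<otimes>\<^bsub>B\<^esub> u h"
    and "u \<one>\<^bsub>G\<^esub> = \<one>\<^bsub>B\<^esub>"
    and "g \<in> \<Lambda> \<Longrightarrow> star B (u g) = u (inv\<^bsub>G\<^esub> g)"
proof -
  note [simp] = hn_family_closed[OF b] N subgroup.mem_carrier[OF \<Lambda>]
  show closed: "u g \<in> carrier B" if "g \<in> \<Lambda>" for g using that by (simp add: u_def)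
  have row: "u g = (\<Oplus>\<^bsub>B\<^esub>k\<in>{1..N}. b i k g)" if "g \<in> \<Lambda>" "i \<in> {1..N}" for i g
    unfolding u_def by (rule hn_balancedD[OF bal N that(2,1)])
  show mult: "u g \<otimes>\<^bsub>B\<^esub> b i j h = b i j (g \<otimes>\<^bsub>G\<^esub> h)" if "g \<in> \<Lambda>" "i \<in> {1..N}" "j \<in> {1..N}" "h \<in> carrier G" for g i j h
    unfolding row[OF that(1,2)] using that by (simp add: hn_row_sum_mult)
  show "b i j h \<otimes>\<^bsub>B\<^esub> u g = b i j (h \<otimes>\<^bsub>G\<^esub> g)" if "g \<in> \<Lambda>" "i \<in> {1..N}" "j \<in> {1..N}" "h \<in> carrier G" for g i j h
    unfolding row[OF that(1,2)] using that by (simp add: hn_row_sum_mult)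
  show "u (g \<otimes>\<^bsub>G\<^esub> h) = u g \<otimes>\<^bsub>B\<^esub> u h" if "g \<in> \<Lambda>" "h \<in> \<Lambda>" for g h
  proof -
    have "u g \<otimes>\<^bsub>B\<^esub> u h = u g \<otimes>\<^bsub>B\<^esub> (\<Oplus>\<^bsub>B\<^esub>k\<in>{1..N}. b 1 k h)" by (simp add: u_def)
    also have "\<dots> = (\<Oplus>\<^bsub>B\<^esub>k\<in>{1..N}. u g \<otimes>\<^bsub>B\<^esub> b 1 k h)"
      by (rule alg_mult_finsum) (use that closed in simp_all)
    also have "\<dots> = (\<Oplus>\<^bsub>B\<^esub>k\<in>{1..N}. b 1 k (g \<otimes>\<^bsub>G\<^esub> h))"
      by (rule cvec_finsum_cong) (use that in \<open>simp_all add: mult\<close>)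
    finally show ?thesis by (simp add: u_def)
  qed
  show "u \<one>\<^bsub>G\<^esub> = \<one>\<^bsub>B\<^esub>" by (simp add: u_def hn_family_row_sum[OF b])
  show "star B (u g) = u (inv\<^bsub>G\<^esub> g)" if "g \<in> \<Lambda>" for g
    unfolding u_def
    by (subst alg_star_finsum) (use that in \<open>simp_all add: hn_family_star[OF b] cong: cvec_finsum_cong\<close>)
qed

end

lemma submodule_finsum:
  assumes "cvec V" "submodule K complex_alg V" "\<And>i. i \<in> I \<Longrightarrow> f i \<in> K" "finite I"
  shows "finsum V f I \<in> K"
  using assms(4,3)
proof (induction I)
  case (insert i I)
  then have "f i \<in> K" "finsum V f I \<in> K" by auto
  then show ?case using insert assms(1,2) unfolding submodule_iff[OF assms(1)]
    by (subst cvec_finsum_insert) auto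
qed (use assms(1,2) in \<open>simp add: submodule_iff\<close>)

section \<open>The balancing relations generate a Hopf ideal\<close>

context
  fixes N :: nat and G :: "('g, 'm) monoid_scheme" and \<Lambda>
  assumes G: "group G" and \<Lambda>: "subgroup \<Lambda> G"
begin

interpretation group G by fact

private abbreviation (input) "Y \<equiv> O_HN N G"
private abbreviation (input) "c \<equiv> hn_gen N G"

definition sub_relators :: "'g hn_poly set set" where
  "sub_relators = {(\<Oplus>\<^bsub>Y\<^esub>k\<in>{1..N}. c i k g) \<ominus>\<^bsub>Y\<^esub> (\<Oplus>\<^bsub>Y\<^esub>k\<in>{1..N}. c j k g) | i j g.
     i \<in> {1..N} \<and> j \<in> {1..N} \<and> g \<in> \<Lambda>}"

text \<open>Only the generated *-ideal, which has a usable description; \<open>O_HN_sub_eq\<close>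
  shows that it is the Hopf *-ideal of the definition.\<close>

definition sub_ideal :: "'g hn_poly set set" where
  "sub_ideal = gen_star_ideal Y sub_relators"

definition sub_gen :: "nat \<Rightarrow> nat \<Rightarrow> 'g \<Rightarrow> 'g hn_poly set set" where
  "sub_gen i j g = sub_ideal +>\<^bsub>Y\<^esub> c i j g"

lemma sub_relators_closed: "sub_relators \<subseteq> carrier Y"
  using O_HN_star_algebra[OF G] hn_family_closed[OF O_HN_family[OF G]] subgroup.mem_carrier[OF \<Lambda>]
  by (auto simp: sub_relators_def)

lemma sub_ideal_star_ideal: "star_ideal sub_ideal Y"
  unfolding sub_ideal_def
  by (rule gen_star_ideal_star_ideal[OF O_HN_star_algebra[OF G] sub_relators_closed])

lemma sub_proj:
  "(\<lambda>x. sub_ideal +>\<^bsub>Y\<^esub> x) \<in> star_hom Y (star_quot Y sub_ideal)"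
  "hn_family N G (star_quot Y sub_ideal) sub_gen"
  "hn_balanced N \<Lambda> (star_quot Y sub_ideal) sub_gen"
proof -
  let ?Q = "star_quot Y sub_ideal" and ?\<pi> = "\<lambda>x. sub_ideal +>\<^bsub>Y\<^esub> x"
  note Y = O_HN_star_algebra[OF G]
  note I = sub_ideal_star_ideal
  have Q: "star_algebra ?Q" by (rule star_quot_star_algebra[OF Y I])
  show \<pi>: "?\<pi> \<in> star_hom Y ?Q" by (rule star_quot_proj_hom[OF Y I])
  show "hn_family N G ?Q sub_gen"
    using hn_family_image[OF \<pi> Y Q G O_HN_family[OF G]] unfolding sub_gen_def .
  note [simp] = Y Q hn_family_closed[OF O_HN_family[OF G]] subgroup.mem_carrier[OF \<Lambda>]
  show "hn_balanced N \<Lambda> ?Q sub_gen"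
    unfolding hn_balanced_def
  proof (intro ballI)
    fix i j g assume ij: "i \<in> {1..N}" "j \<in> {1..N}" "g \<in> \<Lambda>"
    let ?t = "\<lambda>i. \<Oplus>\<^bsub>Y\<^esub>k\<in>{1..N}. c i k g"
    have sum: "(\<Oplus>\<^bsub>?Q\<^esub>k\<in>{1..N}. sub_gen i k g) = ?\<pi> (?t i)" if "i \<in> {1..N}" for i
      unfolding sub_gen_def
      by (rule linear_maps_finsum[OF star_hom_linear[OF \<pi>], symmetric]) (use that ij in simp_all)
    have "?t i \<ominus>\<^bsub>Y\<^esub> ?t j \<in> sub_relators" unfolding sub_relators_def using ij by blast
    then have "?t i \<ominus>\<^bsub>Y\<^esub> ?t j \<in> sub_ideal" unfolding sub_ideal_def by (rule subsetD[OF gen_star_ideal_superset])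
    then have "?\<pi> (?t i) = ?\<pi> (?t j)" using ij by (subst star_quot_eq_iff[OF Y I]) simp_all
    then show "(\<Oplus>\<^bsub>?Q\<^esub>k\<in>{1..N}. sub_gen i k g) = (\<Oplus>\<^bsub>?Q\<^esub>k\<in>{1..N}. sub_gen j k g)"
      using ij by (simp add: sum)
  qed
qed

text \<open>The antipode turns a difference of row sums at \<open>g\<close> into a difference of
  column sums at the inverse of \<open>g\<close>. Column sums agree in the quotient by
  \<open>hn_balanced_col_sum\<close>, so the difference lies in the ideal.\<close>

lemma sub_relators_antipode:
  assumes S: "S \<in> star_hom Y (op_alg Y)"
    and Sa: "\<And>i j g. \<lbrakk>i \<in> {1..N}; j \<in> {1..N}; g \<in> carrier G\<rbrakk> \<Longrightarrow> S (c i j g) = c j i (inv\<^bsub>G\<^esub> g)"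
    and r: "r \<in> sub_relators"
  shows "S r \<in> sub_ideal"
proof -
  obtain i j g where r: "r = (\<Oplus>\<^bsub>Y\<^esub>k\<in>{1..N}. c i k g) \<ominus>\<^bsub>Y\<^esub> (\<Oplus>\<^bsub>Y\<^esub>k\<in>{1..N}. c j k g)"
    and ij [simp]: "i \<in> {1..N}" "j \<in> {1..N}" "g \<in> \<Lambda>"
    using r unfolding sub_relators_def by blast
  note Y [simp] = O_HN_star_algebra[OF G]
  note I = sub_ideal_star_ideal
  let ?Q = "star_quot Y sub_ideal" and ?\<pi> = "\<lambda>x. sub_ideal +>\<^bsub>Y\<^esub> x"
  have Q [simp]: "star_algebra ?Q" by (rule star_quot_star_algebra[OF Y I])
  note [simp] = hn_family_closed[OF O_HN_family[OF G]] subgroup.mem_carrier[OF \<Lambda>] subgroup.m_inv_closed[OF \<Lambda>]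
  have lin: "S \<in> linear_maps Y Y" using star_hom_linear[OF S] by (simp add: linear_maps_def)
  let ?cs = "\<lambda>i. \<Oplus>\<^bsub>Y\<^esub>k\<in>{1..N}. c k i (inv\<^bsub>G\<^esub> g)"
  have Ss: "S (\<Oplus>\<^bsub>Y\<^esub>k\<in>{1..N}. c i k g) = ?cs i" if [simp]: "i \<in> {1..N}" for i
    by (subst linear_maps_finsum[OF lin]) (simp_all add: Sa cong: cvec_finsum_cong)
  have \<pi>c: "?\<pi> (?cs i) = (\<Oplus>\<^bsub>?Q\<^esub>k\<in>{1..N}. sub_gen k i (inv\<^bsub>G\<^esub> g))" if [simp]: "i \<in> {1..N}" for i
    unfolding sub_gen_def by (rule linear_maps_finsum[OF star_hom_linear[OF sub_proj(1)]]) simp_all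
  have "?\<pi> (?cs i) = ?\<pi> (?cs j)"
    unfolding \<pi>c[OF ij(1)] \<pi>c[OF ij(2)]
    by (simp add: hn_balanced_col_sum[OF G Q sub_proj(2,3) subgroup.subset[OF \<Lambda>] ij(1)])
  then have "?cs i \<ominus>\<^bsub>Y\<^esub> ?cs j \<in> sub_ideal" by (subst (asm) star_quot_eq_iff[OF Y I]) simp_all
  then show ?thesis unfolding r by (subst linear_maps_minus[OF lin]) (simp_all add: Ss)
qed

text \<open>With \<open>t\<^sub>i\<close> the sum of row i at g, the comultiplication of
  \<open>t\<^sub>i\<close> is
  \<open>\<Sum>\<^sub>l c\<^sub>i\<^sub>l(g) \<otimes> t\<^sub>l\<close>. Modulo the ideal each
  \<open>t\<^sub>l\<close> may be replaced by \<open>t\<^sub>1\<close>, which leaves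
  \<open>t\<^sub>i \<otimes> t\<^sub>1\<close>: row sums become group-like.\<close>

lemma sub_relators_comult:
  assumes N: "1 \<in> {1..N}" and r: "r \<in> sub_relators"
  shows "comult Y r \<in> lin_span (tensor_alg Y Y) {pure Y Y x y | x y.
    x \<in> sub_ideal \<and> y \<in> carrier Y \<or> x \<in> carrier Y \<and> y \<in> sub_ideal}" (is "_ \<in> ?K")
proof -
  obtain i j g where r: "r = (\<Oplus>\<^bsub>Y\<^esub>k\<in>{1..N}. c i k g) \<ominus>\<^bsub>Y\<^esub> (\<Oplus>\<^bsub>Y\<^esub>k\<in>{1..N}. c j k g)"
    and ij [simp]: "i \<in> {1..N}" "j \<in> {1..N}" "g \<in> \<Lambda>"
    using r unfolding sub_relators_def by blast
  note Y [simp] = O_HN_star_algebra[OF G]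
  note I = sub_ideal_star_ideal
  note [simp] = hn_family_closed[OF O_HN_family[OF G]] subgroup.mem_carrier[OF \<Lambda>] N
  let ?T = "tensor_space Y Y" and ?t = "\<lambda>i. \<Oplus>\<^bsub>Y\<^esub>k\<in>{1..N}. c i k g"
  have T: "star_algebra (tensor_alg Y Y)" by simp
  have Kid: "star_ideal ?K (tensor_alg Y Y)" by (rule tensor_star_ideal[OF Y Y I I])
  have Ksub: "submodule ?K complex_alg (tensor_alg Y Y)" by (rule star_ideal_submodule[OF T Kid])
  have K: "?K \<subseteq> carrier ?T" "\<And>x y. \<lbrakk>x \<in> ?K; y \<in> ?K\<rbrakk> \<Longrightarrow> x \<oplus>\<^bsub>?T\<^esub> y \<in> ?K"
    "\<And>r x. x \<in> ?K \<Longrightarrow> r \<odot>\<^bsub>?T\<^esub> x \<in> ?K"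
    using Ksub unfolding submodule_iff[OF star_algebra_cvec[OF T]] by simp_all
  have pureK: "pure Y Y x y \<in> ?K"
    if "x \<in> sub_ideal \<and> y \<in> carrier Y \<or> x \<in> carrier Y \<and> y \<in> sub_ideal" for x y
    using that by (intro subsetD[OF lin_span_superset]) auto
  note lin = star_hom_linear[OF O_HN_comult(2)[OF G], simplified]
  have tI: "?t i \<ominus>\<^bsub>Y\<^esub> ?t j \<in> sub_ideal" if "i \<in> {1..N}" "j \<in> {1..N}" for i j
  proof -
    have "?t i \<ominus>\<^bsub>Y\<^esub> ?t j \<in> sub_relators" unfolding sub_relators_def using that ij(3) by blast
    then show ?thesis unfolding sub_ideal_def by (rule subsetD[OF gen_star_ideal_superset])
  qed
  note pb = pure_bilinear[of Y Y, simplified]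
  have plin: "pure Y Y x (y \<ominus>\<^bsub>Y\<^esub> z) \<oplus>\<^bsub>?T\<^esub> pure Y Y x z = pure Y Y x y"
    if "x \<in> carrier Y" "y \<in> carrier Y" "z \<in> carrier Y" for x y z
  proof -
    have "(y \<ominus>\<^bsub>Y\<^esub> z) \<oplus>\<^bsub>Y\<^esub> z = y"
      using that cvec_smult_add_left[of Y z "-1" 1, symmetric] by (simp add: cvec_minus cvec_add_assoc)
    then show ?thesis using that bilinear_add_right[OF pb, of x "y \<ominus>\<^bsub>Y\<^esub> z" z] by simp
  qed
  have ct: "\<exists>d\<in>?K. comult Y (?t i) = d \<oplus>\<^bsub>?T\<^esub> pure Y Y (?t i) (?t 1)" if [simp]: "i \<in> {1..N}" for i
  proof
    \<comment> \<open>The error made by replacing row \<open>l\<close> by row 1 in the second leg;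
      every summand has its second leg in the ideal.\<close>
    let ?d = "\<Oplus>\<^bsub>?T\<^esub>l\<in>{1..N}. pure Y Y (c i l g) (?t l \<ominus>\<^bsub>Y\<^esub> ?t 1)"
    have "finsum (tensor_alg Y Y) (\<lambda>l. pure Y Y (c i l g) (?t l \<ominus>\<^bsub>Y\<^esub> ?t 1)) {1..N} \<in> ?K"
      by (rule submodule_finsum[OF star_algebra_cvec[OF T] Ksub]) (auto intro!: pureK simp: tI)
    then show "?d \<in> ?K" by simp
    have "comult Y (?t i) = (\<Oplus>\<^bsub>?T\<^esub>k\<in>{1..N}. comult Y (c i k g))"
      by (rule linear_maps_finsum[OF lin]) simp_all
    also have "\<dots> = (\<Oplus>\<^bsub>?T\<^esub>k\<in>{1..N}. \<Oplus>\<^bsub>?T\<^esub>l\<in>{1..N}. pure Y Y (c i l g) (c l k g))"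
      by (rule cvec_finsum_cong) (simp_all add: O_HN_comult(3)[OF G])
    also have "\<dots> = (\<Oplus>\<^bsub>?T\<^esub>l\<in>{1..N}. \<Oplus>\<^bsub>?T\<^esub>k\<in>{1..N}. pure Y Y (c i l g) (c l k g))"
      by (rule cvec_finsum_swap) simp_all
    also have "\<dots> = (\<Oplus>\<^bsub>?T\<^esub>l\<in>{1..N}. pure Y Y (c i l g) (?t l \<ominus>\<^bsub>Y\<^esub> ?t 1) \<oplus>\<^bsub>?T\<^esub> pure Y Y (c i l g) (?t 1))"
    proof (rule cvec_finsum_cong)
      fix l assume [simp]: "l \<in> {1..N}"
      have "(\<Oplus>\<^bsub>?T\<^esub>k\<in>{1..N}. pure Y Y (c i l g) (c l k g)) = pure Y Y (c i l g) (?t l)"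
        by (rule linear_maps_finsum[OF bilinear_linear_right[OF pb], symmetric]) simp_all
      then show "(\<Oplus>\<^bsub>?T\<^esub>k\<in>{1..N}. pure Y Y (c i l g) (c l k g)) =
          pure Y Y (c i l g) (?t l \<ominus>\<^bsub>Y\<^esub> ?t 1) \<oplus>\<^bsub>?T\<^esub> pure Y Y (c i l g) (?t 1)"
        by (simp add: plin)
    qed simp_all
    also have "\<dots> = ?d \<oplus>\<^bsub>?T\<^esub> (\<Oplus>\<^bsub>?T\<^esub>l\<in>{1..N}. pure Y Y (c i l g) (?t 1))"
      by (rule cvec_finsum_add) simp_all
    also have "(\<Oplus>\<^bsub>?T\<^esub>l\<in>{1..N}. pure Y Y (c i l g) (?t 1)) = pure Y Y (?t i) (?t 1)"
      by (rule linear_maps_finsum[OF bilinear_linear_left[OF pb], symmetric]) simp_all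
    finally show "comult Y (?t i) = ?d \<oplus>\<^bsub>?T\<^esub> pure Y Y (?t i) (?t 1)" .
  qed
  obtain d where d: "d \<in> ?K" "comult Y (?t i) = d \<oplus>\<^bsub>?T\<^esub> pure Y Y (?t i) (?t 1)" using ct[OF ij(1)] by blast
  obtain e where e: "e \<in> ?K" "comult Y (?t j) = e \<oplus>\<^bsub>?T\<^esub> pure Y Y (?t j) (?t 1)" using ct[OF ij(2)] by blast
  have [simp]: "d \<in> carrier ?T" "e \<in> carrier ?T" using d e K(1) by blast+
  have "comult Y r = comult Y (?t i) \<ominus>\<^bsub>?T\<^esub> comult Y (?t j)"
    unfolding r by (rule linear_maps_minus[OF lin]) simp_all
  \<comment> \<open>The two errors lie in the ideal, and the main terms combine to a pure tensor
    whose first leg is a relator.\<close>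
  also have "\<dots> = (d \<oplus>\<^bsub>?T\<^esub> (-1) \<odot>\<^bsub>?T\<^esub> e) \<oplus>\<^bsub>?T\<^esub> pure Y Y (?t i \<ominus>\<^bsub>Y\<^esub> ?t j) (?t 1)"
    unfolding d e
    by (simp add: cvec_minus bilinear_add_left[OF pb] bilinear_smult_left[OF pb] cvec_smult_add cvec_ac)
  also have "\<dots> \<in> ?K"
    by (intro K(2,3) d e pureK) (simp add: tI)
  finally show ?thesis .
qed

text \<open>With the Hopf ideal identified, the quotient becomes accessible: all later facts about
  it are drawn from these five statements.\<close>

lemma O_HN_sub_eq:
  assumes N: "1 \<in> {1..N}"
  shows "O_HN_sub N G \<Lambda> = hopf_quot Y sub_ideal"
    and "\<exists>\<epsilon> S. cqg_data (O_HN_sub N G \<Lambda>) \<epsilon> S"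
    and "(\<lambda>x. sub_ideal +>\<^bsub>Y\<^esub> x) \<in> star_hom Y (O_HN_sub N G \<Lambda>)"
    and "(\<lambda>x. sub_ideal +>\<^bsub>Y\<^esub> x) ` carrier Y = carrier (O_HN_sub N G \<Lambda>)"
    and "\<And>x. x \<in> carrier Y \<Longrightarrow> comult (O_HN_sub N G \<Lambda>) (sub_ideal +>\<^bsub>Y\<^esub> x) =
      tensor_map (O_HN_sub N G \<Lambda>) (O_HN_sub N G \<Lambda>) (\<lambda>x. sub_ideal +>\<^bsub>Y\<^esub> x) (\<lambda>x. sub_ideal +>\<^bsub>Y\<^esub> x) (comult Y x)"
proof -
  obtain \<epsilon> S where data: "cqg_data Y \<epsilon> S" and \<epsilon>: "\<epsilon> \<in> star_hom Y complex_star" and S: "S \<in> star_hom Y (op_alg Y)"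
    and \<epsilon>c: "\<And>i j g. \<lbrakk>i \<in> {1..N}; j \<in> {1..N}; g \<in> carrier G\<rbrakk> \<Longrightarrow> \<epsilon> (c i j g) = (if i = j then 1 else 0)"
    and Sa: "\<And>i j g. \<lbrakk>i \<in> {1..N}; j \<in> {1..N}; g \<in> carrier G\<rbrakk> \<Longrightarrow> S (c i j g) = c j i (inv\<^bsub>G\<^esub> g)"
    using O_HN_cqg_data[OF G] by metis
  note Y [simp] = O_HN_star_algebra[OF G]
  note [simp] = hn_family_closed[OF O_HN_family[OF G]] subgroup.mem_carrier[OF \<Lambda>] complex_star_star_algebra
  \<comment> \<open>Among the entries of a row only the diagonal one has counit 1, so every row sum
    has counit 1.\<close>
  have \<epsilon>r: "\<epsilon> r = 0" if r: "r \<in> sub_relators" for r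
  proof -
    obtain i j g where r: "r = (\<Oplus>\<^bsub>Y\<^esub>k\<in>{1..N}. c i k g) \<ominus>\<^bsub>Y\<^esub> (\<Oplus>\<^bsub>Y\<^esub>k\<in>{1..N}. c j k g)"
      and ij [simp]: "i \<in> {1..N}" "j \<in> {1..N}" "g \<in> \<Lambda>"
      using r unfolding sub_relators_def by blast
    have one: "\<epsilon> (\<Oplus>\<^bsub>Y\<^esub>k\<in>{1..N}. c i k g) = 1" if [simp]: "i \<in> {1..N}" for i
      by (subst linear_maps_finsum[OF star_hom_linear[OF \<epsilon>]])
        (simp_all add: cvec_finsum_delta[of complex_star _ i 1] \<epsilon>c)
    show ?thesis unfolding r
      by (subst linear_maps_minus[OF star_hom_linear[OF \<epsilon>]]) (simp_all add: one cvec_minus)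
  qed
  note hyps = data sub_relators_closed \<epsilon> S \<epsilon>r sub_relators_antipode[OF S Sa, unfolded sub_ideal_def]
    sub_relators_comult[OF N, unfolded sub_ideal_def]
  have H: "hopf_star_ideal sub_ideal Y" "gen_hopf_star_ideal Y sub_relators = sub_ideal"
    unfolding sub_ideal_def by (rule gen_hopf_star_ideal_eq[OF hyps]; assumption)+
  show eq: "O_HN_sub N G \<Lambda> = hopf_quot Y sub_ideal"
    unfolding O_HN_sub_def Let_def H(2)[symmetric] sub_relators_def ..
  interpret cqg_data Y \<epsilon> S by fact
  have "sub_ideal \<subseteq> {x \<in> carrier Y. \<epsilon> x \<in> {\<zero>\<^bsub>complex_star\<^esub>}}"
    unfolding sub_ideal_def
    by (rule gen_star_ideal_least[OF star_hom_kernel[OF Y complex_star_star_algebra \<epsilon>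
        star_ideal_zero[OF complex_star_star_algebra]]]) (use sub_relators_closed \<epsilon>r in auto)
  then have 1: "\<epsilon> x = 0" if "x \<in> sub_ideal" for x using that by auto
  have "sub_ideal \<subseteq> {x \<in> carrier Y. S x \<in> sub_ideal}"
    unfolding sub_ideal_def
    by (rule gen_star_ideal_least[OF star_hom_kernel[OF Y op_alg_star_algebra[OF Y] S
        star_ideal_op[OF _ Y]]])
      (use sub_relators_closed sub_relators_antipode[OF S Sa] sub_ideal_star_ideal in \<open>auto simp: sub_ideal_def\<close>)
  then have 2: "S x \<in> sub_ideal" if "x \<in> sub_ideal" for x using that by auto
  have 3: "comult Y x \<in> lin_span (tensor_alg Y Y) {pure Y Y x y | x y.
      x \<in> sub_ideal \<and> y \<in> carrier Y \<or> x \<in> carrier Y \<and> y \<in> sub_ideal}" if "x \<in> sub_ideal" for x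
    using H(1) that unfolding hopf_star_ideal_def by blast
  note Q = hopf_quot_cqg_data[OF data sub_ideal_star_ideal 1 2 3, folded eq]
  show "\<exists>\<epsilon> S. cqg_data (O_HN_sub N G \<Lambda>) \<epsilon> S" using Q(1) by blast
  show "(\<lambda>x. sub_ideal +>\<^bsub>Y\<^esub> x) \<in> star_hom Y (O_HN_sub N G \<Lambda>)"
    "(\<lambda>x. sub_ideal +>\<^bsub>Y\<^esub> x) ` carrier Y = carrier (O_HN_sub N G \<Lambda>)"
    by (rule Q(2,3); assumption)+
  show "comult (O_HN_sub N G \<Lambda>) (sub_ideal +>\<^bsub>Y\<^esub> x) =
      tensor_map (O_HN_sub N G \<Lambda>) (O_HN_sub N G \<Lambda>) (\<lambda>x. sub_ideal +>\<^bsub>Y\<^esub> x) (\<lambda>x. sub_ideal +>\<^bsub>Y\<^esub> x) (comult Y x)"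
    if "x \<in> carrier Y" for x
    by (rule Q(4)[OF _ _ _ that])
qed

section \<open>The quotient algebra: induction, universal property and comultiplication on
  generators\<close>

context
  assumes N: "1 \<in> {1..N}"
begin

private abbreviation (input) "Q \<equiv> O_HN_sub N G \<Lambda>"

lemma O_HN_sub_same: "same_star_alg Q (star_quot Y sub_ideal)"
  unfolding O_HN_sub_eq(1)[OF N] by (rule hopf_quot_same)

lemma O_HN_sub_star_algebra: "star_algebra Q"
  by (rule same_star_alg_star_algebra[OF O_HN_sub_same
      star_quot_star_algebra[OF O_HN_star_algebra[OF G] sub_ideal_star_ideal]])

lemma O_HN_sub_family: "hn_family N G Q sub_gen"
  using sub_proj(2) hn_family_same[OF O_HN_sub_same] by blast

lemma O_HN_sub_balanced: "hn_balanced N \<Lambda> Q sub_gen"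
  using sub_proj(3) hn_balanced_same[OF O_HN_sub_same] by blast

lemma O_HN_sub_induct [consumes 1, case_names one gen add smult]:
  assumes x: "x \<in> carrier Q"
    and one: "P \<one>\<^bsub>Q\<^esub>"
    and gen: "\<And>i j g x. \<lbrakk>i \<in> {1..N}; j \<in> {1..N}; g \<in> carrier G; x \<in> carrier Q; P x\<rbrakk>
      \<Longrightarrow> P (sub_gen i j g \<otimes>\<^bsub>Q\<^esub> x)"
    and add: "\<And>x y. \<lbrakk>x \<in> carrier Q; y \<in> carrier Q; P x; P y\<rbrakk> \<Longrightarrow> P (x \<oplus>\<^bsub>Q\<^esub> y)"
    and smult: "\<And>r x. \<lbrakk>x \<in> carrier Q; P x\<rbrakk> \<Longrightarrow> P (r \<odot>\<^bsub>Q\<^esub> x)"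
  shows "P x"
proof -
  note p = O_HN_sub_eq(3)[OF N]
  have "P (sub_ideal +>\<^bsub>Y\<^esub> x)" if "x \<in> carrier Y" for x
    using that
  proof (induction rule: O_HN_induct[OF G, consumes 1, case_names one gen add smult])
    case (gen i j g x)
    then show ?case using assms(3)[of i j g] star_hom_closed[OF p]
      by (simp add: star_hom_mult[OF p] hn_family_closed[OF O_HN_family[OF G]] sub_gen_def)
  qed (use assms star_hom_closed[OF p] in
    \<open>simp_all add: star_hom_one[OF p] star_hom_add[OF p] star_hom_smult[OF p]\<close>)
  then show ?thesis using x unfolding O_HN_sub_eq(4)[OF N, symmetric] by auto
qed

lemma O_HN_sub_universal:
  assumes B: "star_algebra B" and b: "hn_family N G B b" and bal: "hn_balanced N \<Lambda> B b"
  obtains f where "f \<in> star_hom Q B"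
    "\<And>i j g. \<lbrakk>i \<in> {1..N}; j \<in> {1..N}; g \<in> carrier G\<rbrakk> \<Longrightarrow> f (sub_gen i j g) = b i j g"
proof -
  note Y [simp] = O_HN_star_algebra[OF G]
  note [simp] = hn_family_closed[OF O_HN_family[OF G]] subgroup.mem_carrier[OF \<Lambda>] hn_family_closed[OF b] B
  obtain f where f: "f \<in> star_hom Y B"
    and fa: "\<And>i j g. \<lbrakk>i \<in> {1..N}; j \<in> {1..N}; g \<in> carrier G\<rbrakk> \<Longrightarrow> f (c i j g) = b i j g"
    using O_HN_universal[OF G B b] by metis
  have fr: "f r = \<zero>\<^bsub>B\<^esub>" if r: "r \<in> sub_relators" for r
  proof -
    obtain i j g where r: "r = (\<Oplus>\<^bsub>Y\<^esub>k\<in>{1..N}. c i k g) \<ominus>\<^bsub>Y\<^esub> (\<Oplus>\<^bsub>Y\<^esub>k\<in>{1..N}. c j k g)"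
      and ij [simp]: "i \<in> {1..N}" "j \<in> {1..N}" "g \<in> \<Lambda>"
      using r unfolding sub_relators_def by blast
    have s: "f (\<Oplus>\<^bsub>Y\<^esub>k\<in>{1..N}. c i k g) = (\<Oplus>\<^bsub>B\<^esub>k\<in>{1..N}. b i k g)" if [simp]: "i \<in> {1..N}" for i
      by (subst linear_maps_finsum[OF star_hom_linear[OF f]]) (simp_all add: fa cong: cvec_finsum_cong)
    show ?thesis unfolding r
      by (subst linear_maps_minus[OF star_hom_linear[OF f]])
        (simp_all add: s hn_balancedD[OF bal ij] cvec_minus_eq_zero_iff)
  qed
  have "sub_ideal \<subseteq> {x \<in> carrier Y. f x \<in> {\<zero>\<^bsub>B\<^esub>}}"
    unfolding sub_ideal_def
    by (rule gen_star_ideal_least[OF star_hom_kernel[OF Y B f star_ideal_zero[OF B]]])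
      (use sub_relators_closed fr in auto)
  then have ker: "f x = \<zero>\<^bsub>B\<^esub>" if "x \<in> sub_ideal" for x using that by auto
  have "(\<lambda>Z. the_elem (f ` Z)) \<in> star_hom Q B"
    using star_quot_star_hom[OF Y sub_ideal_star_ideal B f ker]
      same_star_alg_star_hom[OF O_HN_sub_same, of B B] by (simp add: same_star_alg_def)
  moreover have "the_elem (f ` sub_gen i j g) = b i j g" if "i \<in> {1..N}" "j \<in> {1..N}" "g \<in> carrier G" for i j g
    unfolding sub_gen_def
    by (subst star_quot_induced[OF Y sub_ideal_star_ideal star_algebra_cvec[OF B] star_hom_linear[OF f] ker])
      (use that in \<open>simp_all add: fa\<close>)
  ultimately show ?thesis by (rule that)
qed

lemma O_HN_sub_comult:
  "comult Q \<in> star_hom Q (tensor_alg Q Q)"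
  "\<lbrakk>i \<in> {1..N}; j \<in> {1..N}; g \<in> carrier G\<rbrakk> \<Longrightarrow>
    comult Q (sub_gen i j g) = (\<Oplus>\<^bsub>tensor_space Q Q\<^esub>k\<in>{1..N}. pure Q Q (sub_gen i k g) (sub_gen k j g))"
proof -
  obtain \<epsilon> S where "cqg_data Q \<epsilon> S" using O_HN_sub_eq(2)[OF N] by blast
  then show "comult Q \<in> star_hom Q (tensor_alg Q Q)" by (rule cqg_data.comult_hom)
  assume [simp]: "i \<in> {1..N}" "j \<in> {1..N}" "g \<in> carrier G"
  note [simp] = O_HN_star_algebra[OF G] hn_family_closed[OF O_HN_family[OF G]] O_HN_sub_star_algebra
    hn_family_closed[OF O_HN_sub_family]
  note lin = star_hom_linear[OF O_HN_sub_eq(3)[OF N]]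
  let ?\<pi> = "\<lambda>x. sub_ideal +>\<^bsub>Y\<^esub> x"
  have tlin: "tensor_map Q Q ?\<pi> ?\<pi> \<in> linear_maps (tensor_space Y Y) (tensor_space Q Q)"
    by (rule tensor_map_linear) (simp_all add: lin)
  have "comult Q (sub_gen i j g) = tensor_map Q Q ?\<pi> ?\<pi> (comult Y (c i j g))"
    unfolding sub_gen_def by (rule O_HN_sub_eq(5)[OF N]) simp
  also have "\<dots> = (\<Oplus>\<^bsub>tensor_space Q Q\<^esub>k\<in>{1..N}. tensor_map Q Q ?\<pi> ?\<pi> (pure Y Y (c i k g) (c k j g)))"
    unfolding O_HN_comult(3)[OF G \<open>i \<in> {1..N}\<close> \<open>j \<in> {1..N}\<close> \<open>g \<in> carrier G\<close>]
    by (rule linear_maps_finsum[OF tlin]) simp_all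
  also have "\<dots> = (\<Oplus>\<^bsub>tensor_space Q Q\<^esub>k\<in>{1..N}. pure Q Q (sub_gen i k g) (sub_gen k j g))"
    by (rule cvec_finsum_cong) (simp_all add: tensor_map_pure lin sub_gen_def[symmetric])
  finally show "comult Q (sub_gen i j g) =
      (\<Oplus>\<^bsub>tensor_space Q Q\<^esub>k\<in>{1..N}. pure Q Q (sub_gen i k g) (sub_gen k j g))" .
qed

end

end

section \<open>The linear isomorphism with the smash product\<close>

text \<open>Applied to the section \<rho> it produces the map \<theta>; applied to the quotient map
  \<nu> it enters the construction of the left inverse of \<Psi>.\<close>

lemma hn_family_pullback:
  assumes K: "group K" and G: "group G" and \<rho>: "\<rho> \<in> hom K G" and b: "hn_family N G B b"
  shows "hn_family N K B (\<lambda>i j x. b i j (\<rho> x))"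
proof -
  interpret group_hom K G \<rho> using assms by (simp add: group_hom_def group_hom_axioms_def)
  show ?thesis
    by (rule hn_familyI)
      (simp_all add: hn_family_closed[OF b] hn_family_star[OF b] hn_family_row[OF b] hn_family_col[OF b]
        hn_family_row_sum[OF b] hn_family_col_sum[OF b])
qed

lemma group_alg_sel:
  assumes "group G"
  shows "carrier (group_alg G) = carrier (free_space (carrier G))" "\<one>\<^bsub>group_alg G\<^esub> = ket \<one>\<^bsub>G\<^esub>"
    "ket x \<otimes>\<^bsub>group_alg G\<^esub> ket y = ket (x \<otimes>\<^bsub>G\<^esub> y)"
    "x \<in> carrier G \<Longrightarrow> star (group_alg G) (ket x) = ket (inv\<^bsub>G\<^esub> x)"
    "linear_maps (group_alg G) V = linear_maps (free_space (carrier G)) V"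
    "linear_maps V (group_alg G) = linear_maps V (free_space (carrier G))"
proof -
  interpret group G by fact
  show "carrier (group_alg G) = carrier (free_space (carrier G))" "\<one>\<^bsub>group_alg G\<^esub> = ket \<one>\<^bsub>G\<^esub>"
    "ket x \<otimes>\<^bsub>group_alg G\<^esub> ket y = ket (x \<otimes>\<^bsub>G\<^esub> y)"
    "linear_maps (group_alg G) V = linear_maps (free_space (carrier G)) V"
    "linear_maps V (group_alg G) = linear_maps V (free_space (carrier G))"
    unfolding group_alg_def by (simp_all add: is_monoid)
  show "x \<in> carrier G \<Longrightarrow> star (group_alg G) (ket x) = ket (inv\<^bsub>G\<^esub> x)"
    unfolding group_alg_def
    by (rule monoid_algebra_star_ket[OF is_monoid]) (simp_all add: inv_mult_group)
qed

lemma group_alg_ext: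
  assumes G: "group G" and V: "cvec V" and "f \<in> linear_maps (group_alg G) V" "g \<in> linear_maps (group_alg G) V"
    and "\<And>x. x \<in> carrier G \<Longrightarrow> f (ket x) = g (ket x)" and x: "x \<in> carrier (group_alg G)"
  shows "f x = g x"
proof -
  have f: "f \<in> linear_maps (free_space (carrier G)) V" "g \<in> linear_maps (free_space (carrier G)) V"
    and x: "x \<in> carrier (free_space (carrier G))" using assms by (simp_all add: group_alg_sel)
  show ?thesis using x
  proof (induction rule: free_space_induct)
    case zero
    then show ?case using linear_maps_zero[OF f(1)] linear_maps_zero[OF f(2)] V by (simp add: free_space_sel)
  next
    case (add p q)
    then show ?case using linear_maps_add[OF f(1)] linear_maps_add[OF f(2)] by (simp add: free_space_sel)
  next
    case (smult c p)
    then show ?case using linear_maps_smult[OF f(1)] linear_maps_smult[OF f(2)] by (simp add: free_space_sel)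
  qed (use assms in simp)
qed

lemma group_alg_linear:
  assumes "group G" "cvec V" "\<And>x. x \<in> carrier G \<Longrightarrow> h x \<in> carrier V"
  shows "lin_ext V h \<in> linear_maps (group_alg G) V"
  using assms by (simp add: group_alg_sel lin_ext_linear)

text \<open>Each entry is labelled by its own group element. The labels multiply and invert like the
  arguments of \<open>c\<close>, so the relations persist, and the label keeps track of data that is
  lost when \<open>c\<close> is pulled back from a quotient group.\<close>

lemma hn_family_twist:
  assumes G: "group G" and C: "star_algebra C" and c: "hn_family N G C c"
  shows "hn_family N G (tensor_alg (group_alg G) C) (\<lambda>i j g. pure (group_alg G) C (ket g) (c i j g))"
proof -
  interpret group G by fact
  let ?L = "group_alg G"
  have L [simp]: "star_algebra ?L" by (rule group_alg_star_algebra[OF G])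
  have k [simp]: "ket g \<in> carrier ?L" if "g \<in> carrier G" for g using that by (simp add: group_alg_sel[OF G])
  note [simp] = C hn_family_closed[OF c]
  have sum: "(\<Oplus>\<^bsub>tensor_space ?L C\<^esub>k\<in>{1..N}. pure ?L C (ket \<one>\<^bsub>G\<^esub>) (f k)) = pure ?L C (ket \<one>\<^bsub>G\<^esub>) (\<Oplus>\<^bsub>C\<^esub>k\<in>{1..N}. f k)"
    if "\<And>k. k \<in> {1..N} \<Longrightarrow> f k \<in> carrier C" for f
    by (rule linear_maps_finsum[OF bilinear_linear_right[OF pure_bilinear], symmetric]) (use that in simp_all)
  show ?thesis
    by (rule hn_familyI)
      (simp_all add: group_alg_sel[OF G] hn_family_star[OF c] hn_family_row[OF c] hn_family_col[OF c] sum
        hn_family_row_sum[OF c] hn_family_col_sum[OF c] pure_zero_right[of ?L C])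
qed

locale split_extension =
  fixes N :: nat and G :: "('g, 'm) monoid_scheme" and \<Lambda> :: "'g set" and \<rho> :: "'g set \<Rightarrow> 'g"
  assumes N: "N \<ge> 1" and normal: "\<Lambda> \<lhd> G" and \<rho>: "\<rho> \<in> hom (G Mod \<Lambda>) G"
    and sect: "\<And>x. x \<in> carrier (G Mod \<Lambda>) \<Longrightarrow> \<Lambda> #>\<^bsub>G\<^esub> \<rho> x = x"
begin

sublocale normal \<Lambda> G by (rule normal)

text \<open>Keeps products in the quotient group abstract, so that the homomorphism laws of \<rho>
  and \<nu> can fire.\<close>

declare mult_FactGroup [simp del] one_FactGroup [simp del]

abbreviation "GM \<equiv> G Mod \<Lambda>"
abbreviation "GL \<equiv> G\<lparr>carrier := \<Lambda>\<rparr>"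
abbreviation "L \<equiv> group_alg GL"
abbreviation "H \<equiv> O_HN N GM"
abbreviation "Q \<equiv> O_HN_sub N G \<Lambda>"
abbreviation "a \<equiv> hn_gen N GM"
abbreviation "q \<equiv> sub_gen N G \<Lambda>"
abbreviation "T \<equiv> tensor_space L H"
abbreviation "p \<equiv> pure L H"
abbreviation "\<nu> g \<equiv> \<Lambda> #>\<^bsub>G\<^esub> g"

lemma G: "group G" by (rule is_group)
lemma sub: "subgroup \<Lambda> G" by (rule is_subgroup)
lemma GM: "group GM" by (rule factorgroup_is_group)
lemma GL: "group GL" by (rule subgroup_is_group[OF G])

sublocale rho: group_hom GM G \<rho>
  using GM G \<rho> by (simp add: group_hom_def group_hom_axioms_def)

lemma \<nu>_hom: "\<nu> \<in> hom G GM" by (rule r_coset_hom_Mod)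

sublocale nu: group_hom G GM \<nu>
  using GM G \<nu>_hom by (simp add: group_hom_def group_hom_axioms_def)

lemma N1 [simp]: "1 \<in> {1..N}" using N by (simp add: atLeastAtMost_iff)

lemma in_G [simp]: "l \<in> \<Lambda> \<Longrightarrow> l \<in> carrier G" by (rule mem_carrier)

lemma \<nu>_kernel: "l \<in> \<Lambda> \<Longrightarrow> \<nu> l = \<one>\<^bsub>GM\<^esub>"
  using coset_join2[OF _ sub] by (simp add: one_FactGroup)

lemma \<nu>_section: "\<lbrakk>l \<in> \<Lambda>; x \<in> carrier GM\<rbrakk> \<Longrightarrow> \<nu> (l \<otimes>\<^bsub>G\<^esub> \<rho> x) = x"
  using monoid.l_one[OF group.is_monoid[OF GM], of x]
  by (simp add: \<nu>_kernel sect)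

text \<open>The component of \<open>g\<close> in \<Lambda> under the factorization of \<Gamma> into
  \<Lambda> and the image of the section. It is not a homomorphism in general.\<close>

definition \<kappa> :: "'g \<Rightarrow> 'g" where
  "\<kappa> g = g \<otimes>\<^bsub>G\<^esub> inv\<^bsub>G\<^esub> (\<rho> (\<nu> g))"

lemma \<kappa>_closed [simp]: assumes g: "g \<in> carrier G" shows "\<kappa> g \<in> \<Lambda>"
proof (rule coset_join1[OF _ _ sub])
  have "\<nu> (\<kappa> g) = \<nu> g \<otimes>\<^bsub>GM\<^esub> inv\<^bsub>GM\<^esub> \<nu> (\<rho> (\<nu> g))"
    using g nu.hom_mult[of g "inv\<^bsub>G\<^esub> (\<rho> (\<nu> g))"] nu.hom_inv[of "\<rho> (\<nu> g)"]
    by (simp add: \<kappa>_def del: nu.hom_mult nu.hom_inv)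
  also have "\<dots> = \<one>\<^bsub>GM\<^esub>" using g group.r_inv[OF GM, of "\<nu> g"] by (simp add: sect)
  finally show "\<nu> (\<kappa> g) = \<Lambda>" by (simp add: one_FactGroup)
  show "\<kappa> g \<in> carrier G" using g by (simp add: \<kappa>_def)
qed

lemma \<kappa>_decompose: "g \<in> carrier G \<Longrightarrow> \<kappa> g \<otimes>\<^bsub>G\<^esub> \<rho> (\<nu> g) = g"
  by (simp add: \<kappa>_def m_assoc)

lemma \<kappa>_section: "\<lbrakk>l \<in> \<Lambda>; x \<in> carrier GM\<rbrakk> \<Longrightarrow> \<kappa> (l \<otimes>\<^bsub>G\<^esub> \<rho> x) = l"
  by (simp add: \<kappa>_def \<nu>_section m_assoc del: nu.hom_mult)

lemma conj_closed [simp]: "\<lbrakk>l \<in> \<Lambda>; x \<in> carrier GM\<rbrakk> \<Longrightarrow> \<rho> x \<otimes>\<^bsub>G\<^esub> l \<otimes>\<^bsub>G\<^esub> inv\<^bsub>G\<^esub> (\<rho> x) \<in> \<Lambda>"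
  by (rule inv_op_closed2) simp_all

section \<open>The algebras involved and the map \<Psi>\<close>

lemma L_alg [simp]: "star_algebra L" by (rule group_alg_star_algebra[OF GL])
lemma H_alg [simp]: "star_algebra H" by (rule O_HN_star_algebra[OF GM])
lemma Q_alg [simp]: "star_algebra Q" by (rule O_HN_sub_star_algebra[OF G sub N1])
lemma T_cvec [simp]: "cvec T" by simp

lemma ket_L [simp]: "l \<in> \<Lambda> \<Longrightarrow> ket l \<in> carrier L" by (simp add: group_alg_sel[OF GL])
lemma one_L: "\<one>\<^bsub>L\<^esub> = ket \<one>\<^bsub>G\<^esub>" by (simp add: group_alg_sel[OF GL])
lemma mult_L: "ket l \<otimes>\<^bsub>L\<^esub> ket l' = ket (l \<otimes>\<^bsub>G\<^esub> l')" by (simp add: group_alg_sel[OF GL])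

lemma a_closed [simp]: "\<lbrakk>i \<in> {1..N}; j \<in> {1..N}; x \<in> carrier GM\<rbrakk> \<Longrightarrow> a i j x \<in> carrier H"
  by (rule hn_family_closed[OF O_HN_family[OF GM]])

lemma q_family: "hn_family N G Q q" by (rule O_HN_sub_family[OF G sub N1])

lemma q_closed [simp]: "\<lbrakk>i \<in> {1..N}; j \<in> {1..N}; g \<in> carrier G\<rbrakk> \<Longrightarrow> q i j g \<in> carrier Q"
  by (rule hn_family_closed[OF q_family])

text \<open>Row 1 is an arbitrary choice, by balancedness; it exists because \<open>N\<close> is
  positive.\<close>

definition unit_elem :: "'g \<Rightarrow> 'g hn_poly set set" where
  "unit_elem g = (\<Oplus>\<^bsub>Q\<^esub>k\<in>{1..N}. q 1 k g)"

lemmas unit_elem = hn_balanced_unit[OF G Q_alg q_family O_HN_sub_balanced[OF G sub N1] sub N1,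
  folded unit_elem_def]

definition U :: "('g \<Rightarrow> complex) \<Rightarrow> 'g hn_poly set set" where
  "U = lin_ext Q unit_elem"

lemma U_ket [simp]: "l \<in> \<Lambda> \<Longrightarrow> U (ket l) = unit_elem l"
  unfolding U_def by (rule lin_ext_ket) (simp_all add: unit_elem)

lemma U_hom: "U \<in> star_hom L Q"
  unfolding U_def group_alg_def
  by (rule monoid_algebra_star_hom)
    (auto simp: unit_elem group.is_monoid[OF GL] group.inv_mult_group[OF GL] GL
      group.inv_closed[OF GL, simplified] group.inv_inv[OF GL, simplified] m_inv_consistent[OF sub]
      inv_mult_group)

text \<open>The universal property only asserts existence. The choice affects values outside the
  carrier alone, since homomorphisms agreeing on generators agree on the carrier.\<close>

definition \<theta> :: "'g set hn_poly set \<Rightarrow> 'g hn_poly set set" where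
  "\<theta> = (SOME f. f \<in> star_hom H Q \<and> (\<forall>i\<in>{1..N}. \<forall>j\<in>{1..N}. \<forall>x\<in>carrier GM. f (a i j x) = q i j (\<rho> x)))"

lemma \<theta>: "\<theta> \<in> star_hom H Q" "\<lbrakk>i \<in> {1..N}; j \<in> {1..N}; x \<in> carrier GM\<rbrakk> \<Longrightarrow> \<theta> (a i j x) = q i j (\<rho> x)"
proof -
  obtain f where "f \<in> star_hom H Q" "\<And>i j x. \<lbrakk>i \<in> {1..N}; j \<in> {1..N}; x \<in> carrier GM\<rbrakk> \<Longrightarrow> f (a i j x) = q i j (\<rho> x)"
    using O_HN_universal[OF GM Q_alg hn_family_pullback[OF GM G \<rho> q_family]] by metis
  then have "\<exists>f. f \<in> star_hom H Q \<and> (\<forall>i\<in>{1..N}. \<forall>j\<in>{1..N}. \<forall>x\<in>carrier GM. f (a i j x) = q i j (\<rho> x))"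
    by blast
  from someI_ex[OF this]
  show "\<theta> \<in> star_hom H Q" "\<lbrakk>i \<in> {1..N}; j \<in> {1..N}; x \<in> carrier GM\<rbrakk> \<Longrightarrow> \<theta> (a i j x) = q i j (\<rho> x)"
    unfolding \<theta>_def by blast+
qed

lemma U_closed [simp]: "x \<in> carrier L \<Longrightarrow> U x \<in> carrier Q" by (rule star_hom_closed[OF U_hom])
lemma \<theta>_closed [simp]: "y \<in> carrier H \<Longrightarrow> \<theta> y \<in> carrier Q" by (rule star_hom_closed[OF \<theta>(1)])

definition \<Psi> :: "'g smash_elem \<Rightarrow> 'g hn_poly set set" where
  "\<Psi> = tensor_lift Q (\<lambda>x y. U x \<otimes>\<^bsub>Q\<^esub> \<theta> y)"

lemma \<Psi>_bilinear: "bilinear L H Q (\<lambda>x y. U x \<otimes>\<^bsub>Q\<^esub> \<theta> y)"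
  by (rule bilinearI)
    (simp_all add: star_hom_add[OF U_hom] star_hom_add[OF \<theta>(1)] star_hom_smult[OF U_hom] star_hom_smult[OF \<theta>(1)]
      alg_add_mult alg_mult_add alg_smult_mult alg_mult_smult)

lemma \<Psi>_linear: "\<Psi> \<in> linear_maps T Q"
  unfolding \<Psi>_def by (rule tensor_lift_linear[OF _ _ _ \<Psi>_bilinear]) simp_all

lemma \<Psi>_pure [simp]: "\<lbrakk>x \<in> carrier L; y \<in> carrier H\<rbrakk> \<Longrightarrow> \<Psi> (p x y) = U x \<otimes>\<^bsub>Q\<^esub> \<theta> y"
  unfolding \<Psi>_def by (rule tensor_lift_pure[OF _ _ _ \<Psi>_bilinear]) simp_all

lemma \<Psi>_closed [simp]: "t \<in> carrier T \<Longrightarrow> \<Psi> t \<in> carrier Q"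
  by (rule linear_maps_closed[OF \<Psi>_linear])

lemmas T_induct = tensor_induct[of L H, OF star_algebra_cvec[OF L_alg] star_algebra_cvec[OF H_alg],
  consumes 1, case_names pure add]

lemma unit_\<theta>:
  "\<lbrakk>l \<in> \<Lambda>; i \<in> {1..N}; j \<in> {1..N}; x \<in> carrier GM\<rbrakk> \<Longrightarrow> unit_elem l \<otimes>\<^bsub>Q\<^esub> \<theta> (a i j x) = q i j (l \<otimes>\<^bsub>G\<^esub> \<rho> x)"
  by (simp add: \<theta>(2) unit_elem(2))

lemma \<Psi>_gen: "\<lbrakk>g \<in> carrier G; i \<in> {1..N}; j \<in> {1..N}\<rbrakk> \<Longrightarrow> \<Psi> (p (ket (\<kappa> g)) (a i j (\<nu> g))) = q i j g"
  by (simp add: unit_\<theta> \<kappa>_decompose)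

text \<open>The linear extension of the conjugation by which the section acts on \<Lambda>, as in
  the product formula of the smash product.\<close>

definition conj_L :: "'g set \<Rightarrow> ('g \<Rightarrow> complex) \<Rightarrow> 'g \<Rightarrow> complex" where
  "conj_L x = lin_ext L (\<lambda>l. ket (\<rho> x \<otimes>\<^bsub>G\<^esub> l \<otimes>\<^bsub>G\<^esub> inv\<^bsub>G\<^esub> (\<rho> x)))"

lemma conj_L_linear: "x \<in> carrier GM \<Longrightarrow> conj_L x \<in> linear_maps L L"
  unfolding conj_L_def by (rule group_alg_linear[OF GL]) simp_all

lemma conj_L_ket: "\<lbrakk>x \<in> carrier GM; l \<in> \<Lambda>\<rbrakk> \<Longrightarrow> conj_L x (ket l) = ket (\<rho> x \<otimes>\<^bsub>G\<^esub> l \<otimes>\<^bsub>G\<^esub> inv\<^bsub>G\<^esub> (\<rho> x))"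
  unfolding conj_L_def by (rule lin_ext_ket) simp_all

text \<open>For a group element \<open>l\<close> both sides equal
  \<open>q\<^sub>i\<^sub>j(\<rho>(x) l)\<close>: on the left by absorbing \<open>l\<close> from the
  right, on the right because \<open>\<rho>(x)\<inverse> \<rho>(x)\<close> cancels. This is the
  commutation rule of the smash product inside the quotient algebra.\<close>

lemma \<theta>_U_commute:
  assumes [simp]: "i \<in> {1..N}" "j \<in> {1..N}" "x \<in> carrier GM" and l: "l \<in> carrier L"
  shows "\<theta> (a i j x) \<otimes>\<^bsub>Q\<^esub> U l = U (conj_L x l) \<otimes>\<^bsub>Q\<^esub> \<theta> (a i j x)"
proof (rule group_alg_ext[OF GL, of Q "\<lambda>l. \<theta> (a i j x) \<otimes>\<^bsub>Q\<^esub> U l" "\<lambda>l. U (conj_L x l) \<otimes>\<^bsub>Q\<^esub> \<theta> (a i j x)"])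
  show "(\<lambda>l. \<theta> (a i j x) \<otimes>\<^bsub>Q\<^esub> U l) \<in> linear_maps L Q"
    by (rule linear_maps_comp[OF star_hom_linear[OF U_hom] alg_mult_linear_right]) simp_all
  show "(\<lambda>l. U (conj_L x l) \<otimes>\<^bsub>Q\<^esub> \<theta> (a i j x)) \<in> linear_maps L Q"
    by (rule linear_maps_comp[OF linear_maps_comp[OF conj_L_linear star_hom_linear[OF U_hom]] alg_mult_linear_left]) simp_all
  fix l assume "l \<in> carrier GL"
  then have [simp]: "l \<in> \<Lambda>" by simp
  show "\<theta> (a i j x) \<otimes>\<^bsub>Q\<^esub> U (ket l) = U (conj_L x (ket l)) \<otimes>\<^bsub>Q\<^esub> \<theta> (a i j x)"
    by (simp add: conj_L_ket \<theta>(2) unit_elem(2,3)) (simp add: m_assoc)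
qed (use l in simp_all)

text \<open>The image contains the unit and is stable under left multiplication by generators, since
  \<open>q\<^sub>i\<^sub>j(g) = U(\<kappa>(g)) \<theta>(a\<^sub>i\<^sub>j(\<nu>(g)))\<close> and the
  \<theta>-factor can be moved past any value of \<open>U\<close>.\<close>

lemma \<Psi>_surj: "\<Psi> ` carrier T = carrier Q"
proof
  show "carrier Q \<subseteq> \<Psi> ` carrier T"
  proof
    fix z assume "z \<in> carrier Q"
    then show "z \<in> \<Psi> ` carrier T"
    proof (induction rule: O_HN_sub_induct[OF G sub N1, consumes 1, case_names one gen add smult])
      case one
      have "\<Psi> (p \<one>\<^bsub>L\<^esub> \<one>\<^bsub>H\<^esub>) = \<one>\<^bsub>Q\<^esub>"
        by (subst \<Psi>_pure) (simp_all add: star_hom_one[OF U_hom] star_hom_one[OF \<theta>(1)])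
      then show ?case by (intro image_eqI[of _ _ "p \<one>\<^bsub>L\<^esub> \<one>\<^bsub>H\<^esub>"]) simp_all
    next
      case (gen i j g z)
      then obtain t where t: "z = \<Psi> t" "t \<in> carrier T" by blast
      note [simp] = gen(1-3)
      have "\<exists>t'\<in>carrier T. q i j g \<otimes>\<^bsub>Q\<^esub> \<Psi> t = \<Psi> t'" using t(2)
      proof (induction rule: T_induct)
        case (pure x y)
        note [simp] = pure linear_maps_closed[OF conj_L_linear]
        let ?b = "a i j (\<nu> g)" and ?l = "ket (\<kappa> g)"
        have "q i j g \<otimes>\<^bsub>Q\<^esub> \<Psi> (p x y) = (U ?l \<otimes>\<^bsub>Q\<^esub> \<theta> ?b) \<otimes>\<^bsub>Q\<^esub> (U x \<otimes>\<^bsub>Q\<^esub> \<theta> y)"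
          using \<Psi>_gen[of g i j] by simp
        also have "\<dots> = U ?l \<otimes>\<^bsub>Q\<^esub> (\<theta> ?b \<otimes>\<^bsub>Q\<^esub> U x) \<otimes>\<^bsub>Q\<^esub> \<theta> y" by (simp add: alg_mult_assoc del: U_ket)
        also have "\<dots> = (U ?l \<otimes>\<^bsub>Q\<^esub> U (conj_L (\<nu> g) x)) \<otimes>\<^bsub>Q\<^esub> (\<theta> ?b \<otimes>\<^bsub>Q\<^esub> \<theta> y)"
          by (subst \<theta>_U_commute) (simp_all add: alg_mult_assoc del: U_ket)
        also have "\<dots> = \<Psi> (p (?l \<otimes>\<^bsub>L\<^esub> conj_L (\<nu> g) x) (?b \<otimes>\<^bsub>H\<^esub> y))"
          by (simp add: star_hom_mult[OF U_hom] star_hom_mult[OF \<theta>(1)] del: U_ket)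
        finally show ?case by (rule bexI) simp
      next
        case (add s t)
        then obtain s' t' where *: "s' \<in> carrier T" "t' \<in> carrier T" "q i j g \<otimes>\<^bsub>Q\<^esub> \<Psi> s = \<Psi> s'" "q i j g \<otimes>\<^bsub>Q\<^esub> \<Psi> t = \<Psi> t'"
          by blast
        show ?case by (rule bexI[of _ "s' \<oplus>\<^bsub>T\<^esub> t'"]) (use add(1,2) * in \<open>simp_all add: linear_maps_add[OF \<Psi>_linear] alg_mult_add\<close>)
      qed
      then show ?case using t by auto
    next
      case (add x y)
      then obtain s t where "x = \<Psi> s" "y = \<Psi> t" "s \<in> carrier T" "t \<in> carrier T" by blast
      then show ?case by (intro image_eqI[of _ _ "s \<oplus>\<^bsub>T\<^esub> t"]) (simp_all add: linear_maps_add[OF \<Psi>_linear])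
    next
      case (smult c x)
      then obtain s where "x = \<Psi> s" "s \<in> carrier T" by blast
      then show ?case by (intro image_eqI[of _ _ "c \<odot>\<^bsub>T\<^esub> s"]) (simp_all add: linear_maps_smult[OF \<Psi>_linear])
    qed
  qed
qed (use linear_maps_closed[OF \<Psi>_linear] in auto)

text \<open>The inverse remembers the full group element in the first leg, by way of
  \<open>\<complex>[\<Gamma>]\<close>, and only afterwards projects it to \<Lambda>. Mapping
  directly to \<Lambda> would not respect products.\<close>

lemma \<Psi>_left_inverse: "\<exists>\<Xi>. \<forall>t\<in>carrier T. \<Xi> (\<Psi> t) = t"
proof -
  let ?D = "tensor_alg (group_alg G) H" and ?DS = "tensor_space (group_alg G) H" and ?pd = "pure (group_alg G) H"
  have LG [simp]: "star_algebra (group_alg G)" by (rule group_alg_star_algebra[OF G])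
  have kG [simp]: "ket g \<in> carrier (group_alg G)" if "g \<in> carrier G" for g using that by (simp add: group_alg_sel[OF G])
  have oneG: "\<one>\<^bsub>group_alg G\<^esub> = ket \<one>\<^bsub>G\<^esub>" by (simp add: group_alg_sel[OF G])
  have D [simp]: "star_algebra ?D" by simp
  let ?b = "\<lambda>i j g. ?pd (ket g) (a i j (\<nu> g))"
  have fam: "hn_family N G ?D ?b"
    by (rule hn_family_twist[OF G H_alg hn_family_pullback[OF G GM \<nu>_hom O_HN_family[OF GM]]])
  \<comment> \<open>For \<open>l\<close> in \<Lambda> the second leg sits at the neutral element of
    the quotient group, so its row sum is 1 whatever the row; this is what makes the labelled family
    balanced.\<close>
  have bsum: "(\<Oplus>\<^bsub>?DS\<^esub>k\<in>{1..N}. ?b i k l) = ?pd (ket l) \<one>\<^bsub>H\<^esub>" if [simp]: "i \<in> {1..N}" "l \<in> \<Lambda>" for i l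
  proof -
    have "(\<Oplus>\<^bsub>?DS\<^esub>k\<in>{1..N}. ?b i k l) = ?pd (ket l) (\<Oplus>\<^bsub>H\<^esub>k\<in>{1..N}. a i k (\<nu> l))"
      by (rule linear_maps_finsum[OF bilinear_linear_right[OF pure_bilinear], symmetric]) simp_all
    then show ?thesis using hn_family_row_sum[OF O_HN_family[OF GM], of i N] \<nu>_kernel[of l] by simp
  qed
  have bal: "hn_balanced N \<Lambda> ?D ?b" by (simp add: hn_balanced_def bsum)
  obtain \<Phi> where \<Phi>: "\<Phi> \<in> star_hom Q ?D" and \<Phi>q: "\<And>i j g. \<lbrakk>i \<in> {1..N}; j \<in> {1..N}; g \<in> carrier G\<rbrakk> \<Longrightarrow> \<Phi> (q i j g) = ?b i j g"
    using O_HN_sub_universal[OF G sub N1 D fam bal] by metis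
  have \<Phi>u: "\<Phi> (unit_elem l) = ?pd (ket l) \<one>\<^bsub>H\<^esub>" if [simp]: "l \<in> \<Lambda>" for l
  proof -
    have "\<Phi> (unit_elem l) = (\<Oplus>\<^bsub>?D\<^esub>k\<in>{1..N}. \<Phi> (q 1 k l))"
      unfolding unit_elem_def by (rule linear_maps_finsum[OF star_hom_linear[OF \<Phi>]]) simp_all
    also have "\<dots> = (\<Oplus>\<^bsub>?D\<^esub>k\<in>{1..N}. ?b 1 k l)" by (rule cvec_finsum_cong) (simp_all add: \<Phi>q)
    finally show ?thesis by (simp add: bsum)
  qed
  have Dcl [simp]: "\<Phi> z \<in> carrier ?DS" if "z \<in> carrier Q" for z using star_hom_closed[OF \<Phi> that] by simp
  \<comment> \<open>Only a linear map; multiplicativity is lost at this point.\<close>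
  define \<kappa>' where "\<kappa>' = lin_ext L (\<lambda>g. ket (\<kappa> g))"
  have \<kappa>lin: "\<kappa>' \<in> linear_maps (group_alg G) L"
    unfolding \<kappa>'_def by (rule group_alg_linear[OF G]) simp_all
  have \<kappa>ket: "\<kappa>' (ket g) = ket (\<kappa> g)" if "g \<in> carrier G" for g
    unfolding \<kappa>'_def by (rule lin_ext_ket) (use that in simp_all)
  define \<Omega> where "\<Omega> = tensor_map L H \<kappa>' (\<lambda>y. y)"
  have \<Omega>: "\<Omega> \<in> linear_maps ?DS T"
    unfolding \<Omega>_def by (rule tensor_map_linear) (simp_all add: \<kappa>lin linear_maps_id)
  have \<Omega>p: "\<Omega> (?pd x y) = p (\<kappa>' x) y" if "x \<in> carrier (group_alg G)" "y \<in> carrier H" for x y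
    unfolding \<Omega>_def by (rule tensor_map_pure) (use that in \<open>simp_all add: \<kappa>lin linear_maps_id\<close>)
  \<comment> \<open>\<Omega> is not multiplicative, but it acts on the first leg alone and so
    commutes with left multiplication in the second leg.\<close>
  have left: "\<Omega> (?pd \<one>\<^bsub>group_alg G\<^esub> z \<otimes>\<^bsub>?D\<^esub> d) = tensor_map L H (\<lambda>x. x) (\<lambda>y. z \<otimes>\<^bsub>H\<^esub> y) (\<Omega> d)"
    if [simp]: "z \<in> carrier H" "d \<in> carrier ?DS" for z d
  proof (rule tensor_ext[of "group_alg G" H "\<lambda>d. \<Omega> (?pd \<one>\<^bsub>group_alg G\<^esub> z \<otimes>\<^bsub>?D\<^esub> d)" T
        "\<lambda>d. tensor_map L H (\<lambda>x. x) (\<lambda>y. z \<otimes>\<^bsub>H\<^esub> y) (\<Omega> d)"])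
    show "(\<lambda>d. \<Omega> (?pd \<one>\<^bsub>group_alg G\<^esub> z \<otimes>\<^bsub>?D\<^esub> d)) \<in> linear_maps ?DS T"
      by (rule linear_maps_comp[OF bilinear_linear_right[OF tensor_mult_bilinear] \<Omega>]) simp_all
    show "(\<lambda>d. tensor_map L H (\<lambda>x. x) (\<lambda>y. z \<otimes>\<^bsub>H\<^esub> y) (\<Omega> d)) \<in> linear_maps ?DS T"
      by (rule linear_maps_comp[OF \<Omega> tensor_map_linear]) (simp_all add: linear_maps_id alg_mult_linear_right)
    show "\<Omega> (?pd \<one>\<^bsub>group_alg G\<^esub> z \<otimes>\<^bsub>?D\<^esub> ?pd x y) = tensor_map L H (\<lambda>x. x) (\<lambda>y. z \<otimes>\<^bsub>H\<^esub> y) (\<Omega> (?pd x y))"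
      if [simp]: "x \<in> carrier (group_alg G)" "y \<in> carrier H" for x y
      by (simp add: \<Omega>p tensor_map_pure linear_maps_id alg_mult_linear_right linear_maps_closed[OF \<kappa>lin])
  qed simp_all
  have \<Phi>\<theta>: "(\<lambda>y. \<Phi> (\<theta> y)) \<in> star_hom H ?D" by (rule star_hom_comp[OF \<theta>(1) \<Phi>])
  \<comment> \<open>All \<open>l\<close> and \<open>x\<close> are quantified inside the induction,
    because the generator case uses the hypothesis at a different element of the quotient
    group.\<close>
  have key: "\<forall>l\<in>\<Lambda>. \<forall>x\<in>carrier GM. \<Omega> (?pd (ket (l \<otimes>\<^bsub>G\<^esub> \<rho> x)) \<one>\<^bsub>H\<^esub> \<otimes>\<^bsub>?D\<^esub> \<Phi> (\<theta> y)) = p (ket l) y" if "y \<in> carrier H" for y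
    using that
  proof (induction rule: O_HN_induct[OF GM, consumes 1, case_names one gen add smult])
    case one
    have "\<Phi> (\<theta> \<one>\<^bsub>H\<^esub>) = \<one>\<^bsub>?D\<^esub>" by (simp add: star_hom_one[OF \<Phi>\<theta>] del: tensor_alg_sel) 
    then show ?case by (auto simp: \<Omega>p \<kappa>ket \<kappa>_section)
  next
    case (gen i j g y)
    note [simp] = gen(1-4)
    show ?case
    proof (intro ballI)
      fix l x assume [simp]: "l \<in> \<Lambda>" "x \<in> carrier GM"
      have gx: "x \<otimes>\<^bsub>GM\<^esub> g \<in> carrier GM" by (rule monoid.m_closed[OF group.is_monoid[OF GM]]) simp_all
      let ?w = "?pd (ket (l \<otimes>\<^bsub>G\<^esub> \<rho> (x \<otimes>\<^bsub>GM\<^esub> g))) \<one>\<^bsub>H\<^esub> \<otimes>\<^bsub>?D\<^esub> \<Phi> (\<theta> y)"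
      \<comment> \<open>The generator contributes its label \<open>\<rho>(g)\<close>, which merges
        with \<open>\<rho>(x)\<close> since \<rho> is a homomorphism; the remaining second leg can
        be written as a factor on the left, where \<open>left\<close> applies.\<close>
      have "?pd (ket (l \<otimes>\<^bsub>G\<^esub> \<rho> x)) \<one>\<^bsub>H\<^esub> \<otimes>\<^bsub>?D\<^esub> \<Phi> (\<theta> (a i j g)) =
          ?pd \<one>\<^bsub>group_alg G\<^esub> (a i j g) \<otimes>\<^bsub>?D\<^esub> ?pd (ket (l \<otimes>\<^bsub>G\<^esub> \<rho> (x \<otimes>\<^bsub>GM\<^esub> g))) \<one>\<^bsub>H\<^esub>"
        using gx by (simp add: \<theta>(2) \<Phi>q sect group_alg_sel(3)[OF G] oneG m_assoc)
      moreover have "\<Phi> (\<theta> (a i j g \<otimes>\<^bsub>H\<^esub> y)) = \<Phi> (\<theta> (a i j g)) \<otimes>\<^bsub>?D\<^esub> \<Phi> (\<theta> y)"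
        by (rule star_hom_mult[OF \<Phi>\<theta>]) simp_all
      ultimately have e: "?pd (ket (l \<otimes>\<^bsub>G\<^esub> \<rho> x)) \<one>\<^bsub>H\<^esub> \<otimes>\<^bsub>?D\<^esub> \<Phi> (\<theta> (a i j g \<otimes>\<^bsub>H\<^esub> y)) =
          ?pd \<one>\<^bsub>group_alg G\<^esub> (a i j g) \<otimes>\<^bsub>?D\<^esub> ?w"
        using gx by (simp only:, subst (1 2) alg_mult_assoc[OF D, symmetric]) (simp_all del: tensor_mult_pure rho.hom_mult)
      have w: "?w \<in> carrier ?DS"
        using gx alg_mult_closed[OF D, simplified] by (simp del: rho.hom_mult)
      have "\<Omega> (?pd (ket (l \<otimes>\<^bsub>G\<^esub> \<rho> x)) \<one>\<^bsub>H\<^esub> \<otimes>\<^bsub>?D\<^esub> \<Phi> (\<theta> (a i j g \<otimes>\<^bsub>H\<^esub> y))) =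
          tensor_map L H (\<lambda>x. x) (\<lambda>y. a i j g \<otimes>\<^bsub>H\<^esub> y) (\<Omega> ?w)"
        unfolding e by (rule left) (simp, rule w)
      also have "\<Omega> ?w = p (ket l) y"
        by (rule gen(5)[rule_format, OF \<open>l \<in> \<Lambda>\<close> gx])
      also have "tensor_map L H (\<lambda>x. x) (\<lambda>y. a i j g \<otimes>\<^bsub>H\<^esub> y) (p (ket l) y) = p (ket l) (a i j g \<otimes>\<^bsub>H\<^esub> y)"
        by (rule tensor_map_pure) (simp_all add: linear_maps_id alg_mult_linear_right)
      finally show "\<Omega> (?pd (ket (l \<otimes>\<^bsub>G\<^esub> \<rho> x)) \<one>\<^bsub>H\<^esub> \<otimes>\<^bsub>?D\<^esub> \<Phi> (\<theta> (a i j g \<otimes>\<^bsub>H\<^esub> y))) = p (ket l) (a i j g \<otimes>\<^bsub>H\<^esub> y)" .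
    qed
  next
    case (add y z)
    then show ?case
      using alg_mult_add[OF D, simplified] alg_mult_closed[OF D, simplified]
      by (simp add: star_hom_add[OF \<Phi>\<theta>] linear_maps_add[OF \<Omega>] bilinear_add_right[OF pure_bilinear])
  next
    case (smult c y)
    then show ?case
      using alg_mult_smult[OF D, simplified] alg_mult_closed[OF D, simplified]
      by (simp add: star_hom_smult[OF \<Phi>\<theta>] linear_maps_smult[OF \<Omega>] bilinear_smult_right[OF pure_bilinear])
  qed
  have lin: "(\<lambda>t. \<Omega> (\<Phi> (\<Psi> t))) \<in> linear_maps T T"
    using linear_maps_comp[OF linear_maps_comp[OF \<Psi>_linear star_hom_linear[OF \<Phi>, simplified]] \<Omega>] .
  have "\<Omega> (\<Phi> (\<Psi> t)) = t" if t: "t \<in> carrier T" for t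
  proof (rule tensor_ext[OF _ _ lin linear_maps_id _ t])
    fix x y assume x: "x \<in> carrier L" and [simp]: "y \<in> carrier H"
    show "\<Omega> (\<Phi> (\<Psi> (p x y))) = p x y"
    proof (rule group_alg_ext[OF GL T_cvec _ _ _ x, of "\<lambda>x. \<Omega> (\<Phi> (\<Psi> (p x y)))" "\<lambda>x. p x y"])
      show "(\<lambda>x. \<Omega> (\<Phi> (\<Psi> (p x y)))) \<in> linear_maps L T"
        by (rule linear_maps_comp[OF bilinear_linear_left[OF pure_bilinear] lin]) simp_all
      show "(\<lambda>x. p x y) \<in> linear_maps L T"
        by (rule bilinear_linear_left[OF pure_bilinear]) simp_all
      fix l assume "l \<in> carrier GL"
      then have [simp]: "l \<in> \<Lambda>" by simp
      have "\<Phi> (\<Psi> (p (ket l) y)) = ?pd (ket l) \<one>\<^bsub>H\<^esub> \<otimes>\<^bsub>?D\<^esub> \<Phi> (\<theta> y)"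
        by (simp add: star_hom_mult[OF \<Phi>] unit_elem(1) \<Phi>u)
      \<comment> \<open>At the neutral element \<open>\<rho>\<close> gives the unit of \<Gamma>, so
        \<open>key\<close> specializes to the plain identity.\<close>
      then show "\<Omega> (\<Phi> (\<Psi> (p (ket l) y))) = p (ket l) y"
        using key[of y, rule_format, of l "\<one>\<^bsub>GM\<^esub>"] monoid.one_closed[OF group.is_monoid[OF GM]] by simp
    qed
  qed simp_all
  then show ?thesis by (intro exI[of _ "\<lambda>z. \<Omega> (\<Phi> z)"]) blast
qed

lemma \<Psi>_bij: "bij_betw \<Psi> (carrier T) (carrier Q)"
proof -
  obtain \<Xi> where "\<forall>t\<in>carrier T. \<Xi> (\<Psi> t) = t" using \<Psi>_left_inverse by blast
  then have "inj_on \<Psi> (carrier T)" by (intro inj_on_inverseI[of _ \<Xi>]) simp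
  then show ?thesis using \<Psi>_surj by (simp add: bij_betw_def)
qed

end

section \<open>The smash product as a Hopf *-algebra\<close>

context split_extension
begin

definition \<Psi>i :: "'g hn_poly set set \<Rightarrow> 'g smash_elem" where
  "\<Psi>i = inv_into (carrier T) \<Psi>"

lemma \<Psi>_\<Psi>i [simp]: "z \<in> carrier Q \<Longrightarrow> \<Psi> (\<Psi>i z) = z"
  unfolding \<Psi>i_def using \<Psi>_surj by (simp add: f_inv_into_f)

lemma \<Psi>i_closed [simp]: "z \<in> carrier Q \<Longrightarrow> \<Psi>i z \<in> carrier T"
  unfolding \<Psi>i_def by (rule inv_into_into) (simp add: \<Psi>_surj)

lemma \<Psi>i_\<Psi> [simp]: "t \<in> carrier T \<Longrightarrow> \<Psi>i (\<Psi> t) = t"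
  unfolding \<Psi>i_def using \<Psi>_bij by (simp add: bij_betw_def)

lemma \<Psi>_eqI: "\<lbrakk>\<Psi> s = \<Psi> t; s \<in> carrier T; t \<in> carrier T\<rbrakk> \<Longrightarrow> s = t"
  using \<Psi>i_\<Psi> by metis

lemma \<Psi>i_bij: "bij_betw \<Psi>i (carrier Q) (carrier T)"
  unfolding \<Psi>i_def by (rule bij_betw_inv_into[OF \<Psi>_bij])

lemmas \<Psi>_add = linear_maps_add[OF \<Psi>_linear] and \<Psi>_smult = linear_maps_smult[OF \<Psi>_linear]

lemma smash_sel: "smash_space N G \<Lambda> = T" "smash_pure N G \<Lambda> = p"
  by (simp_all add: smash_space_def smash_pure_def)

lemma \<Psi>_pure_one: "x \<in> carrier L \<Longrightarrow> \<Psi> (p x \<one>\<^bsub>H\<^esub>) = U x" "y \<in> carrier H \<Longrightarrow> \<Psi> (p \<one>\<^bsub>L\<^esub> y) = \<theta> y"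
  by (subst \<Psi>_pure; simp add: star_hom_one[OF U_hom] star_hom_one[OF \<theta>(1)])+

text \<open>The product of the smash product is prescribed only on tensors whose second leg is a
  generator. A row sum writes \<open>l \<otimes> 1\<close> through such tensors.\<close>

lemma p_a_one:
  assumes "l \<in> \<Lambda>"
  shows "(\<Oplus>\<^bsub>T\<^esub>j\<in>{1..N}. p (ket l) (a 1 j \<one>\<^bsub>GM\<^esub>)) = p (ket l) \<one>\<^bsub>H\<^esub>"
proof -
  have [simp]: "\<one>\<^bsub>GM\<^esub> \<in> carrier GM" by (rule monoid.one_closed[OF group.is_monoid[OF GM]])
  have "(\<Oplus>\<^bsub>T\<^esub>j\<in>{1..N}. p (ket l) (a 1 j \<one>\<^bsub>GM\<^esub>)) = p (ket l) (\<Oplus>\<^bsub>H\<^esub>j\<in>{1..N}. a 1 j \<one>\<^bsub>GM\<^esub>)"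
    by (rule linear_maps_finsum[OF bilinear_linear_right[OF pure_bilinear], symmetric]) (use assms in simp_all)
  then show ?thesis by (simp add: hn_family_row_sum[OF O_HN_family[OF GM]])
qed

lemma \<theta>_a_U_ket:
  "\<lbrakk>i \<in> {1..N}; j \<in> {1..N}; x \<in> carrier GM; l \<in> \<Lambda>\<rbrakk> \<Longrightarrow> \<theta> (a i j x) \<otimes>\<^bsub>Q\<^esub> U (ket l) =
    U (ket (\<rho> x \<otimes>\<^bsub>G\<^esub> l \<otimes>\<^bsub>G\<^esub> inv\<^bsub>G\<^esub> (\<rho> x))) \<otimes>\<^bsub>Q\<^esub> \<theta> (a i j x)"
  using \<theta>_U_commute[of i j x "ket l"] by (simp add: conj_L_ket del: U_ket)

section \<open>The product of the smash product\<close>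

definition smash_m :: "'g smash_elem \<Rightarrow> 'g smash_elem \<Rightarrow> 'g smash_elem" where
  "smash_m = (\<lambda>s\<in>carrier T. \<lambda>t\<in>carrier T. \<Psi>i (\<Psi> s \<otimes>\<^bsub>Q\<^esub> \<Psi> t))"

lemma smash_m_closed [simp]: "\<lbrakk>s \<in> carrier T; t \<in> carrier T\<rbrakk> \<Longrightarrow> smash_m s t \<in> carrier T"
  by (simp add: smash_m_def)

lemma \<Psi>_smash_m [simp]: "\<lbrakk>s \<in> carrier T; t \<in> carrier T\<rbrakk> \<Longrightarrow> \<Psi> (smash_m s t) = \<Psi> s \<otimes>\<^bsub>Q\<^esub> \<Psi> t"
  by (simp add: smash_m_def)

text \<open>Each requirement is an identity that may be tested after applying the injective \<Psi>,
  where it becomes a statement about \<open>U\<close>, \<theta> and the product of the quotient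
  algebra; the prescribed formula reduces to \<open>\<theta>_a_U_ket\<close>.\<close>

lemma smash_m_smash_mult: "smash_mult N G \<Lambda> \<rho> smash_m"
  unfolding smash_mult_def Let_def smash_sel
proof (intro conjI ballI)
  show "smash_m \<in> carrier T \<rightarrow>\<^sub>E carrier T \<rightarrow>\<^sub>E carrier T"
    unfolding smash_m_def by (intro restrict_PiE_iff[THEN iffD2] ballI) simp
  note lin = \<Psi>_add \<Psi>_smult alg_mult_add alg_add_mult alg_mult_smult alg_smult_mult
  note hom = star_hom_mult[OF U_hom] star_hom_mult[OF \<theta>(1)] star_hom_one[OF U_hom] star_hom_one[OF \<theta>(1)]
  fix s assume [simp]: "s \<in> carrier T"
  show "(\<lambda>t. smash_m s t) \<in> linear_maps T T" "(\<lambda>t. smash_m t s) \<in> linear_maps T T"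
    by (rule linear_mapsI; (simp; fail | rule \<Psi>_eqI; simp add: lin))+
  show "smash_m (p \<one>\<^bsub>L\<^esub> \<one>\<^bsub>H\<^esub>) s = s" "smash_m s (p \<one>\<^bsub>L\<^esub> \<one>\<^bsub>H\<^esub>) = s"
    by (rule \<Psi>_eqI; simp add: hom)+
  fix t u assume [simp]: "t \<in> carrier T" "u \<in> carrier T"
  show "smash_m (smash_m s t) u = smash_m s (smash_m t u)"
    by (rule \<Psi>_eqI) (simp_all add: alg_mult_assoc)
next
  note hom = star_hom_mult[OF U_hom] star_hom_mult[OF \<theta>(1)]
  show "smash_m (p x \<one>\<^bsub>H\<^esub>) (p x' \<one>\<^bsub>H\<^esub>) = p (x \<otimes>\<^bsub>L\<^esub> x') \<one>\<^bsub>H\<^esub>" if "x \<in> carrier L" "x' \<in> carrier L" for x x'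
    by (rule \<Psi>_eqI) (use that in \<open>simp_all add: \<Psi>_pure_one hom del: \<Psi>_pure\<close>)
  show "smash_m (p \<one>\<^bsub>L\<^esub> y) (p \<one>\<^bsub>L\<^esub> y') = p \<one>\<^bsub>L\<^esub> (y \<otimes>\<^bsub>H\<^esub> y')" if "y \<in> carrier H" "y' \<in> carrier H" for y y'
    by (rule \<Psi>_eqI) (use that in \<open>simp_all add: \<Psi>_pure_one hom del: \<Psi>_pure\<close>)
  show "smash_m (p x \<one>\<^bsub>H\<^esub>) (p \<one>\<^bsub>L\<^esub> y) = p x y" if "x \<in> carrier L" "y \<in> carrier H" for x y
    by (rule \<Psi>_eqI) (use that in \<open>simp_all add: star_hom_one[OF U_hom] star_hom_one[OF \<theta>(1)]\<close>)
  fix l l' g h i j i' j'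
  assume [simp]: "l \<in> \<Lambda>" "l' \<in> \<Lambda>" "g \<in> carrier GM" "h \<in> carrier GM"
    "i \<in> {1..N}" "j \<in> {1..N}" "i' \<in> {1..N}" "j' \<in> {1..N}"
  let ?c = "\<rho> g \<otimes>\<^bsub>G\<^esub> l' \<otimes>\<^bsub>G\<^esub> inv\<^bsub>G\<^esub> (\<rho> g)"
  have "U (ket l) \<otimes>\<^bsub>Q\<^esub> \<theta> (a i j g) \<otimes>\<^bsub>Q\<^esub> (U (ket l') \<otimes>\<^bsub>Q\<^esub> \<theta> (a i' j' h)) =
      U (ket l) \<otimes>\<^bsub>Q\<^esub> (\<theta> (a i j g) \<otimes>\<^bsub>Q\<^esub> U (ket l')) \<otimes>\<^bsub>Q\<^esub> \<theta> (a i' j' h)"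
    by (simp add: alg_mult_assoc del: U_ket)
  also have "\<dots> = (U (ket l) \<otimes>\<^bsub>Q\<^esub> U (ket ?c)) \<otimes>\<^bsub>Q\<^esub> (\<theta> (a i j g) \<otimes>\<^bsub>Q\<^esub> \<theta> (a i' j' h))"
    by (simp add: \<theta>_a_U_ket alg_mult_assoc del: U_ket)
  also have "\<dots> = U (ket (l \<otimes>\<^bsub>G\<^esub> ?c)) \<otimes>\<^bsub>Q\<^esub> \<theta> (a i j g \<otimes>\<^bsub>H\<^esub> a i' j' h)"
    by (simp add: hom[symmetric] mult_L del: U_ket)
  finally have e: "U (ket l) \<otimes>\<^bsub>Q\<^esub> \<theta> (a i j g) \<otimes>\<^bsub>Q\<^esub> (U (ket l') \<otimes>\<^bsub>Q\<^esub> \<theta> (a i' j' h)) =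
      U (ket (l \<otimes>\<^bsub>G\<^esub> ?c)) \<otimes>\<^bsub>Q\<^esub> \<theta> (a i j g \<otimes>\<^bsub>H\<^esub> a i' j' h)" .
  have lc: "l \<otimes>\<^bsub>G\<^esub> \<rho> g \<otimes>\<^bsub>G\<^esub> l' \<otimes>\<^bsub>G\<^esub> inv\<^bsub>G\<^esub> (\<rho> g) = l \<otimes>\<^bsub>G\<^esub> ?c" by (simp add: m_assoc)
  have [simp]: "l \<otimes>\<^bsub>G\<^esub> ?c \<in> \<Lambda>" by (rule subgroup.m_closed[OF sub \<open>l \<in> \<Lambda>\<close>]) simp
  show "smash_m (p (ket l) (a i j g)) (p (ket l') (a i' j' h)) =
      p (ket (l \<otimes>\<^bsub>G\<^esub> \<rho> g \<otimes>\<^bsub>G\<^esub> l' \<otimes>\<^bsub>G\<^esub> inv\<^bsub>G\<^esub> (\<rho> g))) (a i j g \<otimes>\<^bsub>H\<^esub> a i' j' h)"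
    unfolding lc by (rule \<Psi>_eqI) (simp_all add: e del: U_ket)
qed

text \<open>Uniqueness of the product: \<Psi> intertwines every admissible \<open>m\<close> with the
  product of the quotient. By associativity and the factorization
  \<open>x \<otimes> y = (x \<otimes> 1)(1 \<otimes> y)\<close>, everything reduces to products of
  the form \<open>(1 \<otimes> y)(x \<otimes> 1)\<close>.\<close>

lemma smash_mult_\<Psi>:
  assumes m: "smash_mult N G \<Lambda> \<rho> m" and s: "s \<in> carrier T" and t: "t \<in> carrier T"
  shows "\<Psi> (m s t) = \<Psi> s \<otimes>\<^bsub>Q\<^esub> \<Psi> t"
proof -
  note M = m[unfolded smash_mult_def Let_def smash_sel]
  have closed [simp]: "m s t \<in> carrier T" if "s \<in> carrier T" "t \<in> carrier T" for s t
    using M that by (auto simp: PiE_iff)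
  have linr: "(\<lambda>t. m s t) \<in> linear_maps T T" and linl: "(\<lambda>t. m t s) \<in> linear_maps T T" if "s \<in> carrier T" for s
    using M that by simp_all
  have assoc: "m (m s t) u = m s (m t u)" if "s \<in> carrier T" "t \<in> carrier T" "u \<in> carrier T" for s t u
    using M that by simp
  have unit: "m (p \<one>\<^bsub>L\<^esub> \<one>\<^bsub>H\<^esub>) t = t" "m t (p \<one>\<^bsub>L\<^esub> \<one>\<^bsub>H\<^esub>) = t" if "t \<in> carrier T" for t
    using M that by simp_all
  have LL: "m (p x \<one>\<^bsub>H\<^esub>) (p x' \<one>\<^bsub>H\<^esub>) = p (x \<otimes>\<^bsub>L\<^esub> x') \<one>\<^bsub>H\<^esub>" if "x \<in> carrier L" "x' \<in> carrier L" for x x'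
    using M that by simp
  have HH: "m (p \<one>\<^bsub>L\<^esub> y) (p \<one>\<^bsub>L\<^esub> y') = p \<one>\<^bsub>L\<^esub> (y \<otimes>\<^bsub>H\<^esub> y')" if "y \<in> carrier H" "y' \<in> carrier H" for y y'
    using M that by simp
  have LH: "m (p x \<one>\<^bsub>H\<^esub>) (p \<one>\<^bsub>L\<^esub> y) = p x y" if "x \<in> carrier L" "y \<in> carrier H" for x y
    using M that by simp
  have gens: "m (p (ket l) (a i j g)) (p (ket l') (a i' j' h)) =
      p (ket (l \<otimes>\<^bsub>G\<^esub> \<rho> g \<otimes>\<^bsub>G\<^esub> l' \<otimes>\<^bsub>G\<^esub> inv\<^bsub>G\<^esub> (\<rho> g))) (a i j g \<otimes>\<^bsub>H\<^esub> a i' j' h)"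
    if "l \<in> \<Lambda>" "l' \<in> \<Lambda>" "g \<in> carrier GM" "h \<in> carrier GM" "i \<in> {1..N}" "j \<in> {1..N}" "i' \<in> {1..N}" "j' \<in> {1..N}"
    for l l' g h i j i' j'
    using M that by simp
  note hom = star_hom_mult[OF U_hom] star_hom_mult[OF \<theta>(1)]
  \<comment> \<open>Right factors of the form \<open>1 \<otimes> y'\<close> and, next, left factors
    of the form \<open>x \<otimes> 1\<close> are controlled by the subalgebra conditions
    alone.\<close>
  have tH: "\<Psi> (m t (p \<one>\<^bsub>L\<^esub> y')) = \<Psi> t \<otimes>\<^bsub>Q\<^esub> \<theta> y'" if t: "t \<in> carrier T" and [simp]: "y' \<in> carrier H" for t y'
    using t
  proof (induction rule: T_induct)
    case (pure x y)
    have "m (p x y) (p \<one>\<^bsub>L\<^esub> y') = m (p x \<one>\<^bsub>H\<^esub>) (m (p \<one>\<^bsub>L\<^esub> y) (p \<one>\<^bsub>L\<^esub> y'))"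
      using pure by (simp add: LH[symmetric, of x y] assoc)
    also have "\<dots> = p x (y \<otimes>\<^bsub>H\<^esub> y')" using pure by (simp add: HH LH)
    finally show ?case using pure by (simp add: hom alg_mult_assoc)
  next
    case (add s t)
    then show ?case by (simp add: linear_maps_add[OF linl] \<Psi>_add alg_add_mult)
  qed
  have Lt: "\<Psi> (m (p x \<one>\<^bsub>H\<^esub>) t) = U x \<otimes>\<^bsub>Q\<^esub> \<Psi> t" if t: "t \<in> carrier T" and [simp]: "x \<in> carrier L" for t x
    using t
  proof (induction rule: T_induct)
    case (pure x' y)
    have "m (p x \<one>\<^bsub>H\<^esub>) (p x' y) = m (m (p x \<one>\<^bsub>H\<^esub>) (p x' \<one>\<^bsub>H\<^esub>)) (p \<one>\<^bsub>L\<^esub> y)"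
      using pure by (simp add: LH[symmetric, of x' y] assoc)
    also have "\<dots> = p (x \<otimes>\<^bsub>L\<^esub> x') y" using pure by (simp add: LL LH)
    finally show ?case using pure by (simp add: hom alg_mult_assoc)
  next
    case (add s t)
    then show ?case by (simp add: linear_maps_add[OF linr] \<Psi>_add alg_mult_add)
  qed
  \<comment> \<open>The only place where the prescribed formula enters.\<close>
  have aL: "\<Psi> (m (p \<one>\<^bsub>L\<^esub> (a i j g)) (p x \<one>\<^bsub>H\<^esub>)) = \<theta> (a i j g) \<otimes>\<^bsub>Q\<^esub> U x"
    if [simp]: "i \<in> {1..N}" "j \<in> {1..N}" "g \<in> carrier GM" and x: "x \<in> carrier L" for i j g x
  proof (rule group_alg_ext[OF GL _ _ _ _ x, of Q "\<lambda>x. \<Psi> (m (p \<one>\<^bsub>L\<^esub> (a i j g)) (p x \<one>\<^bsub>H\<^esub>))" "\<lambda>x. \<theta> (a i j g) \<otimes>\<^bsub>Q\<^esub> U x"])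
    show "(\<lambda>x. \<Psi> (m (p \<one>\<^bsub>L\<^esub> (a i j g)) (p x \<one>\<^bsub>H\<^esub>))) \<in> linear_maps L Q"
      by (rule linear_maps_comp[OF linear_maps_comp[OF bilinear_linear_left[OF pure_bilinear] linr] \<Psi>_linear]) simp_all
    show "(\<lambda>x. \<theta> (a i j g) \<otimes>\<^bsub>Q\<^esub> U x) \<in> linear_maps L Q"
      by (rule linear_maps_comp[OF star_hom_linear[OF U_hom] alg_mult_linear_right]) simp_all
    fix l' assume "l' \<in> carrier GL"
    then have l' [simp]: "l' \<in> \<Lambda>" by simp
    let ?c = "\<rho> g \<otimes>\<^bsub>G\<^esub> l' \<otimes>\<^bsub>G\<^esub> inv\<^bsub>G\<^esub> (\<rho> g)"
    have [simp]: "\<one>\<^bsub>GM\<^esub> \<in> carrier GM" by (rule monoid.one_closed[OF group.is_monoid[OF GM]])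
    \<comment> \<open>The formula does not cover \<open>l' \<otimes> 1\<close> directly, so the unit
      is expanded into the first row of generators at the neutral element and contracted again at
      the end.\<close>
    have "m (p \<one>\<^bsub>L\<^esub> (a i j g)) (p (ket l') \<one>\<^bsub>H\<^esub>) =
        m (p \<one>\<^bsub>L\<^esub> (a i j g)) (\<Oplus>\<^bsub>T\<^esub>k\<in>{1..N}. p (ket l') (a 1 k \<one>\<^bsub>GM\<^esub>))"
      by (simp add: p_a_one)
    also have "\<dots> = (\<Oplus>\<^bsub>T\<^esub>k\<in>{1..N}. m (p \<one>\<^bsub>L\<^esub> (a i j g)) (p (ket l') (a 1 k \<one>\<^bsub>GM\<^esub>)))"
      by (rule linear_maps_finsum[OF linr]) simp_all
    also have "\<dots> = (\<Oplus>\<^bsub>T\<^esub>k\<in>{1..N}. p (ket ?c) (a i j g \<otimes>\<^bsub>H\<^esub> a 1 k \<one>\<^bsub>GM\<^esub>))"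
      by (rule cvec_finsum_cong) (simp_all add: one_L gens)
    also have "\<dots> = p (ket ?c) (\<Oplus>\<^bsub>H\<^esub>k\<in>{1..N}. a i j g \<otimes>\<^bsub>H\<^esub> a 1 k \<one>\<^bsub>GM\<^esub>)"
      by (rule linear_maps_finsum[OF bilinear_linear_right[OF pure_bilinear], symmetric]) simp_all
    also have "(\<Oplus>\<^bsub>H\<^esub>k\<in>{1..N}. a i j g \<otimes>\<^bsub>H\<^esub> a 1 k \<one>\<^bsub>GM\<^esub>) = a i j g \<otimes>\<^bsub>H\<^esub> (\<Oplus>\<^bsub>H\<^esub>k\<in>{1..N}. a 1 k \<one>\<^bsub>GM\<^esub>)"
      by (rule alg_mult_finsum[symmetric]) simp_all
    also have "\<dots> = a i j g" by (simp add: hn_family_row_sum[OF O_HN_family[OF GM]])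
    finally show "\<Psi> (m (p \<one>\<^bsub>L\<^esub> (a i j g)) (p (ket l') \<one>\<^bsub>H\<^esub>)) = \<theta> (a i j g) \<otimes>\<^bsub>Q\<^esub> U (ket l')"
      by (simp add: \<theta>_a_U_ket del: U_ket)
  qed simp_all
  have at: "\<Psi> (m (p \<one>\<^bsub>L\<^esub> (a i j g)) t) = \<theta> (a i j g) \<otimes>\<^bsub>Q\<^esub> \<Psi> t"
    if t: "t \<in> carrier T" and [simp]: "i \<in> {1..N}" "j \<in> {1..N}" "g \<in> carrier GM" for i j g t
    using t
  proof (induction rule: T_induct)
    case (pure x y)
    have "m (p \<one>\<^bsub>L\<^esub> (a i j g)) (p x y) = m (m (p \<one>\<^bsub>L\<^esub> (a i j g)) (p x \<one>\<^bsub>H\<^esub>)) (p \<one>\<^bsub>L\<^esub> y)"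
      using pure by (simp add: LH[symmetric, of x y] assoc)
    then show ?case using pure by (simp add: tH aL alg_mult_assoc)
  next
    case (add s t)
    then show ?case by (simp add: linear_maps_add[OF linr] \<Psi>_add alg_mult_add)
  qed
  \<comment> \<open>From one generator to arbitrary \<open>y\<close>: a word is peeled off from the
    left, and \<open>at\<close> moves the leading generator across the product.\<close>
  have HL: "\<forall>x\<in>carrier L. \<Psi> (m (p \<one>\<^bsub>L\<^esub> y) (p x \<one>\<^bsub>H\<^esub>)) = \<theta> y \<otimes>\<^bsub>Q\<^esub> U x" if "y \<in> carrier H" for y
    using that
  proof (induction rule: O_HN_induct[OF GM, consumes 1, case_names one gen add smult])
    case one
    then show ?case by (simp add: unit \<Psi>_pure_one star_hom_one[OF \<theta>(1)] del: \<Psi>_pure)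
  next
    case (gen i j g y)
    show ?case
    proof
      fix x assume [simp]: "x \<in> carrier L"
      note [simp] = gen(1-4)
      have "m (p \<one>\<^bsub>L\<^esub> (a i j g \<otimes>\<^bsub>H\<^esub> y)) (p x \<one>\<^bsub>H\<^esub>) = m (p \<one>\<^bsub>L\<^esub> (a i j g)) (m (p \<one>\<^bsub>L\<^esub> y) (p x \<one>\<^bsub>H\<^esub>))"
        by (simp add: HH[symmetric] assoc)
      then show "\<Psi> (m (p \<one>\<^bsub>L\<^esub> (a i j g \<otimes>\<^bsub>H\<^esub> y)) (p x \<one>\<^bsub>H\<^esub>)) = \<theta> (a i j g \<otimes>\<^bsub>H\<^esub> y) \<otimes>\<^bsub>Q\<^esub> U x"
        using gen(5) by (simp add: at hom alg_mult_assoc)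
    qed
  next
    case (add y z)
    then show ?case
      by (simp add: bilinear_add_right[OF pure_bilinear] linear_maps_add[OF linl] \<Psi>_add star_hom_add[OF \<theta>(1)] alg_add_mult)
  next
    case (smult c y)
    then show ?case
      by (simp add: bilinear_smult_right[OF pure_bilinear] linear_maps_smult[OF linl] \<Psi>_smult star_hom_smult[OF \<theta>(1)] alg_smult_mult)
  qed
  have st: "\<Psi> (m (p x y) t) = (U x \<otimes>\<^bsub>Q\<^esub> \<theta> y) \<otimes>\<^bsub>Q\<^esub> \<Psi> t" if [simp]: "x \<in> carrier L" "y \<in> carrier H" for x y
    using t
  proof (induction rule: T_induct)
    case (pure x' y')
    \<comment> \<open>The inner product is of the critical type
      \<open>(1 \<otimes> y)(x' \<otimes> 1)\<close> and is evaluated by \<open>HL\<close>; the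
      outer factors are handled by \<open>Lt\<close> and \<open>tH\<close>.\<close>
    have "m (p x y) (p x' y') = m (m (p x \<one>\<^bsub>H\<^esub>) (m (p \<one>\<^bsub>L\<^esub> y) (p x' \<one>\<^bsub>H\<^esub>))) (p \<one>\<^bsub>L\<^esub> y')"
      using pure by (simp add: LH[symmetric, of x y] LH[symmetric, of x' y'] assoc)
    then show ?case using pure HL by (simp add: tH Lt alg_mult_assoc)
  next
    case (add s t)
    then show ?case by (simp add: linear_maps_add[OF linr] \<Psi>_add alg_mult_add)
  qed
  show ?thesis
    using s
  proof (induction rule: T_induct)
    case (pure x y)
    then show ?case by (simp add: st)
  next
    case (add s s')
    then show ?case using t by (simp add: linear_maps_add[OF linl] \<Psi>_add alg_add_mult)
  qed
qed

lemma the_smash_mult: "(THE m. smash_mult N G \<Lambda> \<rho> m) = smash_m"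
proof (rule the_equality[where P = "smash_mult N G \<Lambda> \<rho>", OF smash_m_smash_mult])
  fix m assume m: "smash_mult N G \<Lambda> \<rho> m"
  then have mT: "m \<in> carrier T \<rightarrow>\<^sub>E carrier T \<rightarrow>\<^sub>E carrier T"
    by (simp add: smash_mult_def Let_def smash_sel)
  show "m = smash_m"
  proof (rule PiE_ext[OF mT])
    show mT': "smash_m \<in> carrier T \<rightarrow>\<^sub>E carrier T \<rightarrow>\<^sub>E carrier T"
      using smash_m_smash_mult by (simp add: smash_mult_def Let_def smash_sel)
    fix s assume s: "s \<in> carrier T"
    show "m s = smash_m s"
    proof (rule PiE_ext[OF PiE_mem[OF mT s] PiE_mem[OF mT' s]])
      fix t assume t: "t \<in> carrier T"
      have "m s t \<in> carrier T" using PiE_mem[OF PiE_mem[OF mT s] t] .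
      then show "m s t = smash_m s t"
        by (intro \<Psi>_eqI) (use s t smash_mult_\<Psi>[OF m s t] in simp_all)
    qed
  qed
qed

section \<open>The involution of the smash product\<close>

abbreviation "SA \<equiv> smash_alg N G \<Lambda> \<rho>"

lemma smash_alg_sel: "carrier SA = carrier T" "mult SA = smash_m" "one SA = p \<one>\<^bsub>L\<^esub> \<one>\<^bsub>H\<^esub>" "zero SA = zero T"
  "add SA = add T" "smult SA = smult T"
  by (simp_all add: smash_alg_def the_smash_mult smash_sel)

definition smash_s :: "'g smash_elem \<Rightarrow> 'g smash_elem" where
  "smash_s = (\<lambda>t\<in>carrier T. \<Psi>i (star Q (\<Psi> t)))"

lemma module_extend_sel:
  "carrier (module.extend V (star_alg.fields s)) = carrier V" "mult (module.extend V (star_alg.fields s)) = mult V"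
  "one (module.extend V (star_alg.fields s)) = one V" "zero (module.extend V (star_alg.fields s)) = zero V"
  "add (module.extend V (star_alg.fields s)) = add V" "smult (module.extend V (star_alg.fields s)) = smult V"
  "star (module.extend V (star_alg.fields s)) = s"
  by (simp_all add: module.defs star_alg.defs)

lemma \<Psi>i_ops:
  "\<lbrakk>x \<in> carrier Q; y \<in> carrier Q\<rbrakk> \<Longrightarrow> \<Psi>i (x \<oplus>\<^bsub>Q\<^esub> y) = \<Psi>i x \<oplus>\<^bsub>T\<^esub> \<Psi>i y"
  "x \<in> carrier Q \<Longrightarrow> \<Psi>i (c \<odot>\<^bsub>Q\<^esub> x) = c \<odot>\<^bsub>T\<^esub> \<Psi>i x"
  "\<lbrakk>x \<in> carrier Q; y \<in> carrier Q\<rbrakk> \<Longrightarrow> \<Psi>i (x \<otimes>\<^bsub>Q\<^esub> y) = smash_m (\<Psi>i x) (\<Psi>i y)"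
  "x \<in> carrier Q \<Longrightarrow> \<Psi>i (star Q x) = smash_s (\<Psi>i x)"
  "\<Psi>i \<one>\<^bsub>Q\<^esub> = p \<one>\<^bsub>L\<^esub> \<one>\<^bsub>H\<^esub>"
  "\<Psi>i \<zero>\<^bsub>Q\<^esub> = \<zero>\<^bsub>T\<^esub>"
proof -
  show "\<lbrakk>x \<in> carrier Q; y \<in> carrier Q\<rbrakk> \<Longrightarrow> \<Psi>i (x \<oplus>\<^bsub>Q\<^esub> y) = \<Psi>i x \<oplus>\<^bsub>T\<^esub> \<Psi>i y"
    "x \<in> carrier Q \<Longrightarrow> \<Psi>i (c \<odot>\<^bsub>Q\<^esub> x) = c \<odot>\<^bsub>T\<^esub> \<Psi>i x"
    "\<lbrakk>x \<in> carrier Q; y \<in> carrier Q\<rbrakk> \<Longrightarrow> \<Psi>i (x \<otimes>\<^bsub>Q\<^esub> y) = smash_m (\<Psi>i x) (\<Psi>i y)"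
    by (rule \<Psi>_eqI; simp add: \<Psi>_add \<Psi>_smult)+
  show "x \<in> carrier Q \<Longrightarrow> \<Psi>i (star Q x) = smash_s (\<Psi>i x)" by (simp add: smash_s_def)
  show "\<Psi>i \<one>\<^bsub>Q\<^esub> = p \<one>\<^bsub>L\<^esub> \<one>\<^bsub>H\<^esub>"
    by (rule \<Psi>_eqI) (simp_all add: star_hom_one[OF U_hom] star_hom_one[OF \<theta>(1)])
  show "\<Psi>i \<zero>\<^bsub>Q\<^esub> = \<zero>\<^bsub>T\<^esub>"
    by (rule \<Psi>_eqI) (simp_all add: linear_maps_zero[OF \<Psi>_linear])
qed

lemma smash_s_smash_star: "smash_star N G \<Lambda> \<rho> smash_s"
  unfolding smash_star_def Let_def smash_sel
proof (intro conjI ballI)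
  show "smash_s \<in> carrier SA \<rightarrow>\<^sub>E carrier SA"
    unfolding smash_s_def smash_alg_sel by (rule restrict_PiE_iff[THEN iffD2]) simp
  show "star_algebra (module.extend SA (star_alg.fields smash_s))"
    using \<Psi>i_bij
    by (intro star_algebra_image[OF Q_alg, of \<Psi>i])
      (simp_all add: module_extend_sel smash_alg_sel \<Psi>i_ops bij_betw_def)
  show "smash_s (p x \<one>\<^bsub>H\<^esub>) = p (star L x) \<one>\<^bsub>H\<^esub>" if "x \<in> carrier L" for x
    by (rule \<Psi>_eqI) (use that in \<open>simp_all add: smash_s_def \<Psi>_pure_one star_hom_star[OF U_hom] del: \<Psi>_pure\<close>)
  show "smash_s (p \<one>\<^bsub>L\<^esub> y) = p \<one>\<^bsub>L\<^esub> (star H y)" if "y \<in> carrier H" for y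
    by (rule \<Psi>_eqI) (use that in \<open>simp_all add: smash_s_def \<Psi>_pure_one star_hom_star[OF \<theta>(1)] del: \<Psi>_pure\<close>)
qed

lemma the_smash_star: "(THE s. smash_star N G \<Lambda> \<rho> s) = smash_s"
proof (rule the_equality[where P = "smash_star N G \<Lambda> \<rho>", OF smash_s_smash_star])
  fix s assume s: "smash_star N G \<Lambda> \<rho> s"
  have s_add: "s (t \<oplus>\<^bsub>T\<^esub> u) = s t \<oplus>\<^bsub>T\<^esub> s u"
    if "smash_star N G \<Lambda> \<rho> s" "t \<in> carrier T" "u \<in> carrier T" for s t u
    using that alg_star_add[of "module.extend SA (star_alg.fields s)" t u]
    by (simp add: smash_star_def Let_def module_extend_sel smash_alg_sel)
  \<comment> \<open>An involution reverses
    \<open>x \<otimes> y = (x \<otimes> 1)(1 \<otimes> y)\<close>, and on both factors its value is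
    prescribed; so it is determined on pure tensors.\<close>
  have s_pure: "s (p x y) = smash_m (p \<one>\<^bsub>L\<^esub> (star H y)) (p (star L x) \<one>\<^bsub>H\<^esub>)"
    if s: "smash_star N G \<Lambda> \<rho> s" and [simp]: "x \<in> carrier L" "y \<in> carrier H" for s x y
  proof -
    have "p x y = smash_m (p x \<one>\<^bsub>H\<^esub>) (p \<one>\<^bsub>L\<^esub> y)"
      by (rule \<Psi>_eqI) (simp_all add: star_hom_one[OF U_hom] star_hom_one[OF \<theta>(1)])
    then show ?thesis
      using s alg_star_mult[of "module.extend SA (star_alg.fields s)" "p x \<one>\<^bsub>H\<^esub>" "p \<one>\<^bsub>L\<^esub> y"]
      by (simp add: smash_star_def Let_def smash_sel module_extend_sel smash_alg_sel)
  qed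
  show "s = smash_s"
  proof (rule PiE_ext)
    show "s \<in> carrier T \<rightarrow>\<^sub>E carrier T" "smash_s \<in> carrier T \<rightarrow>\<^sub>E carrier T"
      using s smash_s_smash_star by (simp_all add: smash_star_def Let_def smash_alg_sel)
    fix t assume "t \<in> carrier T"
    then show "s t = smash_s t"
    proof (induction rule: T_induct)
      case (pure x y)
      then show ?case by (simp add: s_pure[OF s] s_pure[OF smash_s_smash_star])
    next
      case (add t u)
      then show ?case by (simp add: s_add[OF s] s_add[OF smash_s_smash_star])
    qed
  qed
qed

abbreviation "SS \<equiv> smash_star_alg N G \<Lambda> \<rho>"

lemma smash_star_alg_sel:
  "carrier SS = carrier T" "mult SS = smash_m" "one SS = p \<one>\<^bsub>L\<^esub> \<one>\<^bsub>H\<^esub>" "zero SS = zero T"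
  "add SS = add T" "smult SS = smult T" "star SS = smash_s"
  by (simp_all add: smash_star_alg_def the_smash_star module_extend_sel smash_alg_sel)

lemma SS_alg [simp]: "star_algebra SS"
  using smash_s_smash_star[unfolded smash_star_def Let_def] by (simp add: smash_star_alg_def the_smash_star)

lemma \<Psi>i_hom: "\<Psi>i \<in> star_hom Q SS"
  by (rule star_homI linear_mapsI)+ (simp_all add: smash_star_alg_sel \<Psi>i_ops)

lemma \<Psi>_hom: "\<Psi> \<in> star_hom SS Q"
  by (rule star_homI linear_mapsI)+
    (simp_all add: smash_star_alg_sel \<Psi>_add \<Psi>_smult smash_s_def star_hom_one[OF U_hom] star_hom_one[OF \<theta>(1)])

lemma \<Psi>i_q:
  assumes "g \<in> carrier G" "i \<in> {1..N}" "j \<in> {1..N}"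
  shows "\<Psi>i (q i j g) = p (ket (\<kappa> g)) (a i j (\<nu> g))"
  by (rule \<Psi>_eqI) (use assms \<Psi>_gen in \<open>simp_all del: \<Psi>_pure\<close>)

section \<open>The comultiplication of the smash product and the isomorphism\<close>

abbreviation "OS \<equiv> O_smash N G \<Lambda> \<rho>"

lemma O_smash_same: "same_star_alg OS SS"
  by (simp add: O_smash_def Let_def same_star_alg_extend)

lemma O_smash_alg [simp]: "star_algebra OS"
  by (rule same_star_alg_star_algebra[OF O_smash_same SS_alg])

text \<open>The definition asks only for an algebra homomorphism with given values; the transported
  comultiplication qualifies and is the only candidate. Compatibility with the involution is then
  inherited from the quotient algebra.\<close>

lemma O_smash_comult:
  assumes z: "z \<in> carrier Q"
  shows "comult OS (\<Psi>i z) = tensor_map OS OS \<Psi>i \<Psi>i (comult Q z)"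
proof -
  let ?TS = "tensor_alg SS SS"
  define P where "P \<Delta> \<longleftrightarrow> \<Delta> \<in> carrier SS \<rightarrow>\<^sub>E carrier ?TS \<and> \<Delta> \<in> alg_hom SS ?TS \<and>
    (\<forall>l\<in>\<Lambda>. \<forall>g\<in>carrier GM. \<forall>i\<in>{1..N}. \<forall>j\<in>{1..N}. \<Delta> (p (ket l) (a i j g)) =
      (\<Oplus>\<^bsub>?TS\<^esub>k\<in>{1..N}. pure SS SS (p (ket l) (a i k g)) (p (ket l) (a k j g))))" for \<Delta>
  have c: "comult OS = (THE \<Delta>. P \<Delta>)"
    unfolding P_def by (simp add: O_smash_def Let_def smash_sel)
  let ?f = "tensor_map SS SS \<Psi>i \<Psi>i"
  have f: "?f \<in> star_hom (tensor_alg Q Q) ?TS"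
    by (rule tensor_map_star_hom) (simp_all add: \<Psi>i_hom)
  have Qc: "comult Q \<in> star_hom Q (tensor_alg Q Q)" by (rule O_HN_sub_comult(1)[OF G sub N1])
  \<comment> \<open>The comultiplication of the quotient algebra carried over by \<Psi> and its
    inverse.\<close>
  let ?\<Delta> = "\<lambda>t. ?f (comult Q (\<Psi> t))"
  have \<Delta>: "?\<Delta> \<in> star_hom SS ?TS" by (rule star_hom_comp[OF star_hom_comp[OF \<Psi>_hom Qc] f])
  have \<Delta>g: "?\<Delta> (p (ket l) (a i j g)) =
      (\<Oplus>\<^bsub>?TS\<^esub>k\<in>{1..N}. pure SS SS (p (ket l) (a i k g)) (p (ket l) (a k j g)))"
    if [simp]: "l \<in> \<Lambda>" "g \<in> carrier GM" "i \<in> {1..N}" "j \<in> {1..N}" for l g i j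
  proof -
    let ?h = "l \<otimes>\<^bsub>G\<^esub> \<rho> g"
    \<comment> \<open>The element \<open>l \<otimes> a\<^sub>i\<^sub>j(g)\<close> corresponds to the
      single generator at \<open>l \<rho>(g)\<close>, so both legs of its comultiplication carry the
      same \<open>l\<close>, as the definition prescribes.\<close>
    have "\<Psi> (p (ket l) (a i j g)) = q i j ?h" by (simp add: unit_\<theta>)
    then have "?\<Delta> (p (ket l) (a i j g)) = ?f (\<Oplus>\<^bsub>tensor_space Q Q\<^esub>k\<in>{1..N}. pure Q Q (q i k ?h) (q k j ?h))"
      by (simp add: O_HN_sub_comult(2)[OF G sub N1])
    also have "\<dots> = (\<Oplus>\<^bsub>?TS\<^esub>k\<in>{1..N}. ?f (pure Q Q (q i k ?h) (q k j ?h)))"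
      unfolding finsum_tensor_alg[symmetric]
      by (rule linear_maps_finsum[OF star_hom_linear[OF f]]) simp_all
    also have "\<dots> = (\<Oplus>\<^bsub>?TS\<^esub>k\<in>{1..N}. pure SS SS (p (ket l) (a i k g)) (p (ket l) (a k j g)))"
    proof (rule cvec_finsum_cong)
      fix k assume [simp]: "k \<in> {1..N}"
      have "?f (pure Q Q (q i k ?h) (q k j ?h)) = pure SS SS (\<Psi>i (q i k ?h)) (\<Psi>i (q k j ?h))"
        by (rule tensor_map_pure) (simp_all add: star_hom_linear[OF \<Psi>i_hom])
      then show "?f (pure Q Q (q i k ?h) (q k j ?h)) = pure SS SS (p (ket l) (a i k g)) (p (ket l) (a k j g))"
        by (simp add: \<Psi>i_q \<kappa>_section \<nu>_section del: nu.hom_mult)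
    next
      show "pure SS SS (p (ket l) (a i k g)) (p (ket l) (a k j g)) \<in> carrier ?TS" if "k \<in> {1..N}" for k
        using that by (simp add: smash_star_alg_sel)
    qed simp
    finally show ?thesis .
  qed
  have ex: "P (restrict ?\<Delta> (carrier SS))"
    unfolding P_def
  proof (intro conjI ballI)
    show "restrict ?\<Delta> (carrier SS) \<in> carrier SS \<rightarrow>\<^sub>E carrier ?TS"
      using star_hom_closed[OF \<Delta>] by (intro restrict_PiE_iff[THEN iffD2]) simp
    show "restrict ?\<Delta> (carrier SS) \<in> alg_hom SS ?TS"
    proof (rule alg_homI linear_mapsI)+
      show "restrict ?\<Delta> (carrier SS) \<one>\<^bsub>SS\<^esub> = \<one>\<^bsub>?TS\<^esub>" using star_hom_one[OF \<Delta>] by simp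
    qed (use star_hom_closed[OF \<Delta>] star_hom_add[OF \<Delta>] star_hom_smult[OF \<Delta>] star_hom_mult[OF \<Delta>] in simp_all)
  qed (use \<Delta>g in \<open>simp add: smash_star_alg_sel\<close>)
  have un: "\<Delta>1 = \<Delta>2" if d: "P \<Delta>1" "P \<Delta>2" for \<Delta>1 \<Delta>2
  proof (rule PiE_ext)
    show d12: "\<Delta>1 \<in> carrier SS \<rightarrow>\<^sub>E carrier ?TS" "\<Delta>2 \<in> carrier SS \<rightarrow>\<^sub>E carrier ?TS"
      using d by (simp_all add: P_def)
    have h1: "\<Delta>1 \<in> alg_hom SS ?TS" and h2: "\<Delta>2 \<in> alg_hom SS ?TS" using d by (simp_all add: P_def)
    note cl = star_hom_closed[OF \<Psi>i_hom]
    \<comment> \<open>Induction takes place in the quotient algebra, where generators are available;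
      their images are exactly of the form on which the comultiplication is prescribed.\<close>
    have "\<Delta>1 (\<Psi>i z) = \<Delta>2 (\<Psi>i z)" if "z \<in> carrier Q" for z
      using that
    proof (induction rule: O_HN_sub_induct[OF G sub N1, consumes 1, case_names one gen add smult])
      case one
      then show ?case by (simp only: star_hom_one[OF \<Psi>i_hom] alg_hom_one[OF h1] alg_hom_one[OF h2])
    next
      case (gen i j g z)
      have "\<Delta>1 (\<Psi>i (q i j g)) = \<Delta>2 (\<Psi>i (q i j g))"
        using d gen(1-3) by (simp add: \<Psi>i_q P_def)
      then show ?case using gen
        by (simp add: star_hom_mult[OF \<Psi>i_hom] alg_hom_mult[OF h1 cl cl] alg_hom_mult[OF h2 cl cl] del: \<Psi>i_closed)
    next
      case (add y z)
      then show ?case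
        by (simp add: star_hom_add[OF \<Psi>i_hom] linear_maps_add[OF alg_hom_linear[OF h1] cl cl]
          linear_maps_add[OF alg_hom_linear[OF h2] cl cl] del: \<Psi>i_closed)
    next
      case (smult c z)
      then show ?case
        by (simp add: star_hom_smult[OF \<Psi>i_hom] linear_maps_smult[OF alg_hom_linear[OF h1] cl]
          linear_maps_smult[OF alg_hom_linear[OF h2] cl] del: \<Psi>i_closed)
    qed
    then show "\<Delta>1 t = \<Delta>2 t" if "t \<in> carrier SS" for t
      using that \<Psi>i_\<Psi>[of t] \<Psi>_closed[of t] by (metis smash_star_alg_sel(1))
  qed
  have "P (comult OS)" unfolding c by (rule theI[where P = P, OF ex un[OF _ ex]])
  then have "comult OS = restrict ?\<Delta> (carrier SS)" using ex by (rule un)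
  then have "comult OS (\<Psi>i z) = ?f (comult Q z)" using z by (simp add: smash_star_alg_sel)
  moreover have "?f = tensor_map OS OS \<Psi>i \<Psi>i"
    using same_star_alg_tensor(1,2)[OF O_smash_same O_smash_same] by (simp add: tensor_map_def fun_eq_iff)
  ultimately show ?thesis by simp
qed

text \<open>The inverse of \<Psi> is the isomorphism. The smash product receives its counit,
  antipode and spanning coefficients through it, so it is a CQG-algebra without a separate
  verification.\<close>

theorem cqg_isomorphic_smash: "cqg_isomorphic Q OS"
proof -
  obtain \<epsilon> S where data: "cqg_data Q \<epsilon> S" using O_HN_sub_eq(2)[OF G sub N1] by blast
  have hom: "\<Psi>i \<in> star_hom Q OS"
    using \<Psi>i_hom same_star_alg_star_hom[of Q Q OS SS] O_smash_same by (simp add: same_star_alg_def)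
  have carr: "carrier OS = carrier T" using O_smash_same by (simp add: same_star_alg_def smash_star_alg_sel)
  have surj: "\<Psi>i ` carrier Q = carrier OS" using \<Psi>i_bij by (simp add: carr bij_betw_def)
  have "cqg_data OS (\<lambda>t. \<epsilon> (\<Psi> t)) (\<lambda>t. \<Psi>i (S (\<Psi> t)))"
    by (rule cqg_data_image[OF data O_smash_alg hom surj O_smash_comult]) simp_all
  then have "cqg_algebra Q" "cqg_algebra OS" using cqg_data.cqg_algebra data by blast+
  moreover have "\<Psi>i \<in> hopf_star_iso Q OS"
    unfolding hopf_star_iso_def using hom \<Psi>i_bij O_smash_comult by (simp add: carr)
  ultimately show ?thesis unfolding cqg_isomorphic_def by blast
qed

end

theorem theorem5p5:
  fixes N :: nat and G :: "('g, 'm) monoid_scheme" and \<Lambda> :: "'g set" and \<rho> :: "'g set \<Rightarrow> 'g"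
  assumes "N \<ge> 1"
    and "\<Lambda> \<lhd> G"
    and "\<rho> \<in> hom (G Mod \<Lambda>) G"
    and "\<forall>x\<in>carrier (G Mod \<Lambda>). \<Lambda> #>\<^bsub>G\<^esub> \<rho> x = x"
  shows "cqg_isomorphic (O_HN_sub N G \<Lambda>) (O_smash N G \<Lambda> \<rho>)"
proof -
  interpret split_extension N G \<Lambda> \<rho>
    using assms by (simp add: split_extension_def)
  show ?thesis by (rule cqg_isomorphic_smash)
qed

end
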